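(* For each $h'\in[-1,1]$, let the transition probability $P(s,h|h')\,ds\,dh$ be the image of the probability measure $\mu$ on $K=\,]0,1[^3\times\mathbf{Z}/2\mathbf{Z}$ given by $$d\mu(A,B,Q,N)=\frac{6}{\pi^2}\,\mathbf{1}_{0<A<1}\,\mathbf{1}_{0<B<1-A}\,\mathbf{1}_{0<Q<\frac{1}{2-A-B}}\,\frac{dA\,dB\,dQ}{1-A}\,(\delta_{N=0}+\delta_{N=1})$$ under the map $K\ni(A,B,Q,N)\mapsto\mathbf{T}_{A,B,Q,N}(h')\in\mathbf{R}_+\times[-1,1]$ (defined in the context). Then for each $\Phi\in C_c(\mathbf{R}_+^*\times[-1,1])$ and each $h'\in[-1,1]$, $$\Phi(T_r(h',\cdot))\to\int_0^\infty\int_{-1}^1\Phi(s,h)P(s,h|h')\,dh\,ds\quad\text{in }L^\infty(\mathbf{S}^1)\text{ weak-}*\text{ as }r\to0^+ ,$$ where $T_r$ is the transfer map defined in the context, regarded as a function of $\omega\in\mathbf{S}^1$; the limit is independent of $\omega$. Moreover, the function $(s,h,h')\mapsto(1+s)P(s,h|h')$ is piecewise continuous and bounded on $\mathbf{R}_+\times[-1,1]\times[-1,1]$, and $P(s,h|h')=P(s,-h|-h')$ for each $h,h'\in[-1,1]$ and $s\ge0$.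
   Context: $\mathbf{R}_+=[0,\infty)$, $\mathbf{R}_+^*=(0,\infty)$. **The billiard table.** For $0<r<\frac12$, let $Z_r=\{x\in\mathbf{R}^2 : \mathrm{dist}(x,\mathbf{Z}^2)>r\}$, the plane minus the closed disks (obstacles) of radius $r$ centered at the points of $\mathbf{Z}^2$. For $x\in\partial Z_r$, $n_x$ is the unit normal at $x$ pointing into $Z_r$. Let $\Gamma_r^+=\{(x,\omega)\in\partial Z_r\times\mathbf{S}^1 : \omega\cdot n_x>0\}$, and $\Gamma_r^+/\mathbf{Z}^2$ its quotient by translations of $x$ by $\mathbf{Z}^2$. **Impact parameter and exit time.** For $(x,\omega)\in\Gamma_r^+$, $h_r(x,\omega)=\sin(\omega,n_x)$ is the sine of the oriented angle from $\omega$ to $n_x$, and $\tau_r(x,\omega)=\inf\{t>0:x+t\omega\in\partial Z_r\}$. **Transfer map.** The map $\Gamma_r^+/\mathbf{Z}^2\ni(x,\omega)\mapsto(h_r(x,\omega),\omega)\in\,]-1,1[\times\mathbf{S}^1$ is a bijection; let $Y_r$ be its inverse. Explicitly, $x=rn$ modulo $\mathbf{Z}^2$, with $n$ the image of $\omega$ under the rotation of angle $\arcsin h'$; for $h'=\pm1$, $Y_r(h',\omega)$ is defined by this same formula. Given $(h',\omega)$, let $(x,\omega)=Y_r(h',\omega)$, let $x^+=x+\tau_r(x,\omega)\omega$ be the next collision point, and let $\omega^+=\omega-2(\omega\cdot n_{x^+})n_{x^+}$ be the velocity after specular reflection. The transfer map is $$T_r(h',\omega)=\big(r\,\tau_r(x,\omega),\;h_r(x^+,\omega^+)\big).$$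 **The limiting map.** For $(A,B,Q,N)\in K$ and $h'\in[-1,1]$, with $Q'=\frac{1-Q(1-B)}{1-A}$: $$\mathbf{T}_{A,B,Q,N}(h')=\left(Q,\;h'-2(-1)^N(1-A)\right)\quad\text{if }(-1)^Nh'\in\,]1-2A,1],$$ $$\mathbf{T}_{A,B,Q,N}(h')=\left(Q',\;h'+2(-1)^N(1-B)\right)\quad\text{if }(-1)^Nh'\in[-1,-1+2B[,$$ $$\mathbf{T}_{A,B,Q,N}(h')=\left(Q'+Q,\;h'+2(-1)^N(A-B)\right)\quad\text{if }(-1)^Nh'\in[-1+2B,1-2A].$$ (The measure $\mu$ is carried by the set $A+B<1$, on which the three cases are disjoint.)
   Formalization: The first component of the transfer map is taken as 2rτ_r instead of rτ_r: the limit law given by μ has mean 1 in s for uniform h', while rτ_r has mean (1−πr²)/2 < 1/2, so the convergence fails with rτ_r. *)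

theory Defs
  imports "HOL-Analysis.Analysis"
begin

text \<open>The Euclidean plane is the type of complex numbers, so that \<^term>\<open>cis \<alpha> * \<omega>\<close> is the
  image of \<open>\<omega>\<close> under the rotation of angle \<open>\<alpha>\<close>, and the unit circle is \<^term>\<open>sphere (0::complex) 1\<close>.\<close>

definition plane_lattice :: "complex set" where
  "plane_lattice = {k. Re k \<in> \<int> \<and> Im k \<in> \<int>}"

definition billiard_table :: "real \<Rightarrow> complex set" where
  "billiard_table r = {x. infdist x plane_lattice > r}"

text \<open>For \<open>0 < r < 1/2\<close> the boundary of the table is the disjoint union of the circles of radius \<open>r\<close>
  centered at the lattice points, so the center is well defined, and the unit normal pointing
  into the table is the outer normal of the obstacle.\<close>

definition obstacle_center :: "real \<Rightarrow> complex \<Rightarrow> complex" where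
  "obstacle_center r x = (THE k. k \<in> plane_lattice \<and> dist x k = r)"

definition inward_normal :: "real \<Rightarrow> complex \<Rightarrow> complex" where
  "inward_normal r x = sgn (x - obstacle_center r x)"

text \<open>\<^term>\<open>Arg (v / \<omega>)\<close> is the oriented angle from \<open>\<omega>\<close> to \<open>v\<close>.\<close>

definition impact_parameter :: "real \<Rightarrow> complex \<times> complex \<Rightarrow> real" where
  "impact_parameter r = (\<lambda>(x, \<omega>). sin (Arg (inward_normal r x / \<omega>)))"

text \<open>For given \<open>r\<close> and impact parameter, there are at most finitely many directions for which the
  particle never meets the boundary again; the exit time should be infinite there, and the value
  of \<^const>\<open>Inf\<close> at the empty set is irrelevant below.\<close>

definition exit_time :: "real \<Rightarrow> complex \<times> complex \<Rightarrow> real" where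
  "exit_time r = (\<lambda>(x, \<omega>). Inf {t. 0 < t \<and> x + t *\<^sub>R \<omega> \<in> frontier (billiard_table r)})"

definition Y_map :: "real \<Rightarrow> real \<Rightarrow> complex \<Rightarrow> complex \<times> complex" where
  "Y_map r h' \<omega> = (r *\<^sub>R (cis (arcsin h') * \<omega>), \<omega>)"

definition specular_reflection :: "complex \<Rightarrow> complex \<Rightarrow> complex" where
  "specular_reflection n \<omega> = \<omega> - (2 * (\<omega> \<bullet> n)) *\<^sub>R n"

text \<open>The first component is the exit time in units of \<open>1/(2r)\<close>, the limiting mean free path.
  This normalization, and not \<open>r\<close> times the exit time, is the one compatible with the measure
  \<open>mu\<close> below: if \<open>h'\<close> is uniform on \<open>[-1,1]\<close>, the three cases of \<open>limit_map\<close> have probabilities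
  \<open>A\<close>, \<open>B\<close>, \<open>1-A-B\<close>, and \<open>A Q + B Q' + (1-A-B) (Q + Q') = 1\<close>, so the limit law has mean \<open>1\<close>.
  On the other hand the mean of the exit time is \<open>(1 - pi r^2) / (2 r)\<close> by Santalo's formula,
  so that \<open>r\<close> times it has mean at most \<open>1/2\<close>.\<close>

definition transfer_map :: "real \<Rightarrow> real \<Rightarrow> complex \<Rightarrow> real \<times> real" where
  "transfer_map r h' \<omega> =
     (let x = fst (Y_map r h' \<omega>);
          \<tau> = exit_time r (x, \<omega>);
          x\<^sub>1 = x + \<tau> *\<^sub>R \<omega>;
          \<omega>\<^sub>1 = specular_reflection (inward_normal r x\<^sub>1) \<omega>
      in (2 * r * \<tau>, impact_parameter r (x\<^sub>1, \<omega>\<^sub>1)))"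

text \<open>\<open>\<int>/2\<int>\<close> is represented by \<open>{0,1}\<close>. The density vanishes off the set \<open>K\<close>.\<close>

definition mu :: "(real \<times> real \<times> real \<times> nat) measure" where
  "mu = density (lborel \<Otimes>\<^sub>M (lborel \<Otimes>\<^sub>M (lborel \<Otimes>\<^sub>M count_space {0, 1})))
     (\<lambda>(A, B, Q, N). ennreal (if 0 < A \<and> A < 1 \<and> 0 < B \<and> B < 1 - A \<and> 0 < Q \<and> Q < 1 / (2 - A - B)
                              then 6 / pi\<^sup>2 * (1 / (1 - A)) else 0))"

definition limit_map :: "real \<times> real \<times> real \<times> nat \<Rightarrow> real \<Rightarrow> real \<times> real" where
  "limit_map = (\<lambda>(A, B, Q, N) h'.
     (let Q' = (1 - Q * (1 - B)) / (1 - A) in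
      if (-1) ^ N * h' \<in> {1 - 2 * A <.. 1} then (Q, h' - 2 * (-1) ^ N * (1 - A))
      else if (-1) ^ N * h' \<in> {-1 ..< -1 + 2 * B} then (Q', h' + 2 * (-1) ^ N * (1 - B))
      else (Q' + Q, h' + 2 * (-1) ^ N * (A - B))))"

text \<open>\<open>P(s,h|h') ds dh\<close> on \<open>[0,\<infinity>) \<times> [-1,1]\<close> is the image of \<open>mu\<close>; here \<open>P\<close> is a pointwise defined
  version of the density.\<close>

definition transition_density :: "(real \<Rightarrow> real \<Rightarrow> real \<Rightarrow> real) \<Rightarrow> bool" where
  "transition_density P \<longleftrightarrow>
     (\<forall>h'\<in>{-1..1}.
        (\<lambda>(s, h). P s h h') \<in> borel_measurable (restrict_space borel ({0..} \<times> {-1..1})) \<and>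
        (\<forall>s\<ge>0. \<forall>h\<in>{-1..1}. 0 \<le> P s h h') \<and>
        distr mu borel (\<lambda>k. limit_map k h') =
          density lborel (\<lambda>(s, h). ennreal (P s h h') * indicator ({0..} \<times> {-1..1}) (s, h)))"

text \<open>Elements of \<open>C\<^sub>c(S)\<close>, extended by zero off \<open>S\<close>.\<close>

definition Cc :: "'a::topological_space set \<Rightarrow> ('a \<Rightarrow> real) set" where
  "Cc S = {\<Phi>. continuous_on S \<Phi> \<and> (\<exists>C. compact C \<and> C \<subseteq> S \<and> (\<forall>x. x \<notin> C \<longrightarrow> \<Phi> x = 0))}"

definition arc_length_measure :: "complex measure" where
  "arc_length_measure =
     distr (restrict_space lborel {0..<2 * pi}) (restrict_space borel (sphere 0 1)) cis"

definition Linfty :: "'a measure \<Rightarrow> ('a \<Rightarrow> real) set" where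
  "Linfty M = {f. f \<in> borel_measurable M \<and> (\<exists>C. AE x in M. \<bar>f x\<bar> \<le> C)}"

definition weak_star_tendsto ::
    "'a measure \<Rightarrow> ('i \<Rightarrow> 'a \<Rightarrow> real) \<Rightarrow> ('a \<Rightarrow> real) \<Rightarrow> 'i filter \<Rightarrow> bool" where
  "weak_star_tendsto M f l F \<longleftrightarrow>
     (\<forall>\<^sub>F i in F. f i \<in> Linfty M) \<and> l \<in> Linfty M \<and>
     (\<forall>g. integrable M g \<longrightarrow>
        ((\<lambda>i. LINT x|M. f i x * g x) \<longlongrightarrow> (LINT x|M. l x * g x)) F)"

text \<open>Finitely many connected full-dimensional pieces with negligible boundary, on each of which the
  function is continuous. No limits are required at points of the closure of a piece which do
  not belong to it: the transition density has none at some points with \<open>h = h'\<close>.\<close>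

definition piecewise_continuous_on :: "'a::euclidean_space set \<Rightarrow> ('a \<Rightarrow> 'b::topological_space) \<Rightarrow> bool"
  where
  "piecewise_continuous_on S f \<longleftrightarrow>
     (\<exists>\<D>. finite \<D> \<and> \<Union>\<D> = S \<and>
        (\<forall>D\<in>\<D>. connected D \<and> D \<subseteq> closure (interior D) \<and> negligible (frontier D) \<and>
               continuous_on D f))"

end

theory Submission
  imports Defs "HOL-Number_Theory.Number_Theory" "HOL-Real_Asymp.Real_Asymp"
begin

text \<open>By symmetry let the direction have slope \<open>t\<close>. A lattice point \<open>(q, a)\<close> met by the strip of width
  \<open>2 r\<close> about the trajectory is the first one iff the two neighbours \<open>(z, a')\<close> and \<open>(q - z, a - a')\<close>
  of the segment from \<open>0\<close> to \<open>(q, a)\<close> miss the strip. With \<open>y = z / q\<close>, where \<open>a z \<equiv> -1\<close> modulo \<open>q\<close>, this is an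
  inequality between the rescaled time \<open>s = 2 r q sqrt (1 + t\<^sup>2)\<close>, the impact parameters \<open>h'\<close> and \<open>h\<close>, and
  \<open>y\<close>. Integration over \<open>t\<close> against a continuous density thus gives a sum over \<open>q \<le> C / r\<close> and over
  the pairs \<open>(a, z)\<close> of inverse residues. The triples \<open>(r q, a / q, z / q)\<close> become equidistributed with
  density \<open>6 u / \<pi>\<^sup>2\<close>: by Stone-Weierstrass it suffices to consider characters, and it is enough
  that \<open>\<bar>K(m, n; q)\<bar> / q\<close> tends to \<open>0\<close> on average over \<open>q\<close> for the Kloosterman sums \<open>K\<close> with \<open>n \<noteq> 0\<close>,
  which follows from Kloosterman's fourth moment. The limit is
  the kernel \<open>3 / \<pi>\<^sup>2\<close> times the measure of the set of admissible \<open>y\<close>. The densities of the three cases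
  of the limiting map add up to the same kernel.\<close>

section \<open>Kloosterman sums\<close>

text \<open>Only an average over q of |K| / q has to vanish, and the elementary fourth moment yields
  this for composite q as well, so no pointwise bound of Weil type enters. The obstacle is the class
  of test functions. Equidistribution is available for continuous periodic functions, whereas the
  conditions for a first hit form an indicator function in y; it is replaced by continuous cutoffs,
  and the error of the cutoff is again an equidistribution limit, which is small. Periodicity in x =
  a / q is obtained by densities that vanish near integer slopes, which also puts a / q inside (0,1)
  once q is large. General integrable densities are then reached by closure under dominated limits,
  possible because the observable is bounded. The 3 / pi^2 is half of 6 / pi^2: with w the rescaled
  transverse variable, s = 2 u sqrt(1 + t^2) and h - h' = w / sqrt(1 + t^2), so du dw = ds dh / 2;
  the direction cancels, which is why the limit does not depend on it.\<close>

definition root_char :: "nat \<Rightarrow> int \<Rightarrow> complex" where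
  "root_char q k = cis (2 * pi * of_int k / real q)"

lemma root_char_add: "root_char q (a + b) = root_char q a * root_char q b"
  by (simp add: root_char_def cis_mult ring_distribs add_divide_distrib)

lemma root_char_0 [simp]: "root_char q 0 = 1"
  by (simp add: root_char_def)

lemma cnj_root_char: "cnj (root_char q a) = root_char q (- a)"
  by (simp add: root_char_def cis_cnj)

lemma norm_root_char [simp]: "norm (root_char q a) = 1"
  by (simp add: root_char_def)

lemma root_char_eq_1_iff:
  assumes "q > 0"
  shows "root_char q a = 1 \<longleftrightarrow> int q dvd a"
proof
  assume "root_char q a = 1"
  hence "cos (2 * pi * of_int a / real q) = 1"
    by (simp add: root_char_def complex_eq_iff)
  then obtain k :: int where "2 * pi * of_int a / real q = of_int k * 2 * pi"
    using cos_one_2pi_int by blast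
  hence "of_int a = real q * of_int k"
    using assms by (simp add: field_simps)
  hence "a = int q * k"
    by (metis of_int_eq_iff of_int_mult of_int_of_nat_eq)
  thus "int q dvd a" by simp
next
  assume "int q dvd a"
  then obtain k where "a = int q * k" by auto
  hence "2 * pi * of_int a / real q = 2 * pi * of_int k"
    using assms by simp
  thus "root_char q a = 1"
    unfolding root_char_def by (simp add: cis_multiple_2pi)
qed

lemma root_char_cong:
  assumes "q > 0" "int q dvd a - b"
  shows "root_char q a = root_char q b"
proof -
  have "root_char q a = root_char q (a - b) * root_char q b"
    by (simp flip: root_char_add)
  thus ?thesis using root_char_eq_1_iff[OF assms(1)] assms(2) by simp
qed

lemma root_char_power: "root_char q (int k * a) = root_char q a ^ k"
  by (induction k) (simp_all add: root_char_add ring_distribs)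

lemma sum_root_char:
  assumes "q > 0"
  shows "(\<Sum>m\<in>{0..<int q}. root_char q (m * y)) = (if int q dvd y then of_nat q else 0)"
proof -
  have "(\<Sum>m\<in>{0..<int q}. root_char q (m * y)) = (\<Sum>k<q. root_char q (int k * y))"
    by (rule sum.reindex_bij_witness[of _ int nat]) auto
  also have "\<dots> = (\<Sum>k<q. root_char q y ^ k)"
    by (simp add: root_char_power)
  also have "\<dots> = (if int q dvd y then of_nat q else 0)"
  proof -
    have "root_char q y ^ q = 1"
      using root_char_eq_1_iff[OF assms, of "int q * y"] by (simp add: root_char_power)
    thus ?thesis
      using root_char_eq_1_iff[OF assms, of y] by (simp add: sum_gp_strict)
  qed
  finally show ?thesis .
qed

text \<open>Parseval on (Z/q)^2: expand the square, and orthogonality in m and in n leaves only the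
  index pairs that agree in both residues. A moment of exponential sums thus becomes a count of
  solutions.\<close>

lemma second_moment_root_char:
  fixes X Z :: "'i \<Rightarrow> int"
  assumes "finite A" "q > 0"
  shows "(\<Sum>m\<in>{0..<int q}. \<Sum>n\<in>{0..<int q}. (norm (\<Sum>i\<in>A. root_char q (m * X i + n * Z i)))\<^sup>2)
         = (real q)\<^sup>2 * card {(i, j) \<in> A \<times> A. int q dvd X i - X j \<and> int q dvd Z i - Z j}"
proof -
  define R where "R = {0..<int q}"
  define s where "s m y = root_char q (m * y)" for m y
  have sq: "complex_of_real ((norm (\<Sum>i\<in>A. root_char q (m * X i + n * Z i)))\<^sup>2)
     = (\<Sum>(i,j)\<in>A\<times>A. s m (X i - X j) * s n (Z i - Z j))" for m n
  proof -
    have "complex_of_real ((norm (\<Sum>i\<in>A. root_char q (m * X i + n * Z i)))\<^sup>2) =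
       (\<Sum>i\<in>A. root_char q (m * X i + n * Z i)) * cnj (\<Sum>i\<in>A. root_char q (m * X i + n * Z i))"
      using complex_norm_square by blast
    also have "\<dots> = (\<Sum>i\<in>A. \<Sum>j\<in>A. root_char q (m * X i + n * Z i) * root_char q (-(m * X j + n * Z j)))"
      by (simp add: sum_product cnj_root_char)
    also have "\<dots> = (\<Sum>i\<in>A. \<Sum>j\<in>A. s m (X i - X j) * s n (Z i - Z j))"
      by (simp add: s_def flip: root_char_add) (simp add: algebra_simps)
    finally show ?thesis by (simp add: sum.cartesian_product)
  qed
  have "complex_of_real (\<Sum>m\<in>R. \<Sum>n\<in>R. (norm (\<Sum>i\<in>A. root_char q (m * X i + n * Z i)))\<^sup>2)
     = (\<Sum>m\<in>R. \<Sum>n\<in>R. \<Sum>(i,j)\<in>A\<times>A. s m (X i - X j) * s n (Z i - Z j))"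
    by (simp only: of_real_sum sq)
  also have "\<dots> = (\<Sum>(m,n)\<in>R\<times>R. \<Sum>(i,j)\<in>A\<times>A. s m (X i - X j) * s n (Z i - Z j))"
    by (rule sum.cartesian_product)
  also have "\<dots> = (\<Sum>p\<in>A\<times>A. \<Sum>t\<in>R\<times>R. s (fst t) (X (fst p) - X (snd p)) * s (snd t) (Z (fst p) - Z (snd p)))"
    unfolding case_prod_unfold by (rule sum.swap)
  also have "\<dots> = (\<Sum>p\<in>A\<times>A. (\<Sum>m\<in>R. s m (X (fst p) - X (snd p))) * (\<Sum>n\<in>R. s n (Z (fst p) - Z (snd p))))"
    by (simp add: sum_product sum.cartesian_product case_prod_unfold)
  also have "\<dots> = (\<Sum>p\<in>A\<times>A. if int q dvd X (fst p) - X (snd p) \<and> int q dvd Z (fst p) - Z (snd p)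
                     then (of_nat q)\<^sup>2 else 0)"
    unfolding s_def R_def sum_root_char[OF assms(2)] by (intro sum.cong) (auto simp: power2_eq_square)
  also have "\<dots> = (\<Sum>p\<in>{(i, j) \<in> A \<times> A. int q dvd X i - X j \<and> int q dvd Z i - Z j}. (of_nat q)\<^sup>2)"
    using assms(1) by (intro sum.mono_neutral_cong_right) auto
  also have "\<dots> = complex_of_real ((real q)\<^sup>2 * card {(i, j) \<in> A \<times> A. int q dvd X i - X j \<and> int q dvd Z i - Z j})"
    by simp
  finally show ?thesis unfolding R_def of_real_eq_iff .
qed

text \<open>The sign -1 comes from the geometry: for a lattice point (q, x) it makes z the abscissa
  of a neighbour (z, a') with q a' - x z = 1. Hence \<open>kloosterman m n q\<close> is the
  classical sum with parameters m and -n.\<close>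

definition unit_pairs :: "nat \<Rightarrow> (int \<times> int) set" where
  "unit_pairs q = {(x, z). x \<in> {0..<int q} \<and> z \<in> {0..<int q} \<and> int q dvd x * z + 1}"

definition kloosterman :: "int \<Rightarrow> int \<Rightarrow> nat \<Rightarrow> complex" where
  "kloosterman m n q = (\<Sum>(x, z)\<in>unit_pairs q. root_char q (m * x + n * z))"

lemma finite_unit_pairs [simp]: "finite (unit_pairs q)"
  by (rule finite_subset[of _ "{0..<int q} \<times> {0..<int q}"]) (auto simp: unit_pairs_def)

lemma unit_pairs_swap: "(x, z) \<in> unit_pairs q \<longleftrightarrow> (z, x) \<in> unit_pairs q"
  by (auto simp: unit_pairs_def mult.commute)

lemma residue_eqI: "a \<in> {0..<int q} \<Longrightarrow> b \<in> {0..<int q} \<Longrightarrow> int q dvd a - b \<Longrightarrow> a = b"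
  by (metis atLeastLessThan_iff mod_eq_dvd_iff mod_pos_pos_trivial)

lemma unit_pairs_unique:
  assumes "(x, z) \<in> unit_pairs q" "(x, z') \<in> unit_pairs q"
  shows "z = z'"
proof (rule residue_eqI)
  have "int q dvd z' * (x * z + 1) - z * (x * z' + 1)"
    using assms by (auto simp: unit_pairs_def)
  hence "int q dvd z' - z" by (simp add: algebra_simps)
  thus "int q dvd z - z'" by (simp add: dvd_diff_commute)
qed (use assms in \<open>auto simp: unit_pairs_def\<close>)

lemma kloosterman_commute: "kloosterman m n q = kloosterman n m q"
  unfolding kloosterman_def
  by (rule sum.reindex_bij_witness[of _ prod.swap prod.swap])
     (auto simp: add.commute unit_pairs_swap)

lemma norm_kloosterman_le: "norm (kloosterman m n q) \<le> card (unit_pairs q)"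
  unfolding kloosterman_def
  by (rule order.trans[OF norm_sum]) (simp add: case_prod_unfold)

lemma kloosterman_mod:
  assumes "q > 0"
  shows "kloosterman (m mod int q) n q = kloosterman m n q"
  unfolding kloosterman_def
proof (intro sum.cong refl, clarify)
  fix x z
  have "int q dvd (m mod int q - m) * x"
    by (intro dvd_mult2) (simp add: dvd_diff_commute[of _ _ m])
  thus "root_char q (m mod int q * x + n * z) = root_char q (m * x + n * z)"
    by (intro root_char_cong assms) (simp add: algebra_simps)
qed

text \<open>Since -w is the inverse of u modulo q, the map (x, z) to (u x, -w z) permutes the unit
  pairs.\<close>

lemma kloosterman_unit_invariant:
  assumes uw: "(u, w) \<in> unit_pairs q" and "q > 0"
  shows "kloosterman (m * u) (- n * w) q = kloosterman m n q"
proof -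
  define g where "g = (\<lambda>(x, z). ((u * x) mod int q, (- w * z) mod int q))"
  have uw1: "int q dvd u * w + 1" using uw by (auto simp: unit_pairs_def)
  have gU: "g p \<in> unit_pairs q" if "p \<in> unit_pairs q" for p
  proof -
    obtain x z where p: "p = (x, z)" by force
    have 1: "int q dvd x * z + 1" using that by (auto simp: p unit_pairs_def)
    have "int q dvd (u * x) * (- w * z) + 1 - ((u * x) mod int q) * ((- w * z) mod int q) - 1"
      by (metis (no_types, lifting) add_diff_cancel_right' diff_diff_eq2 mod_eq_dvd_iff mod_mult_eq diff_add_eq add.commute)
    moreover have "(u * x) * (- w * z) + 1 = x * z + 1 - (u * w + 1) * (x * z)"
      by (simp add: algebra_simps)
    hence "int q dvd (u * x) * (- w * z) + 1" using 1 uw1 by (metis dvd_diff dvd_mult2)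
    ultimately have "int q dvd ((u * x) mod int q) * ((- w * z) mod int q) + 1"
      by (metis (no_types, lifting) diff_diff_eq dvd_diff_right_iff)
    thus ?thesis using \<open>q > 0\<close> by (auto simp: g_def p unit_pairs_def)
  qed
  have inj: "inj_on g (unit_pairs q)"
  proof (rule inj_onI)
    fix p p' assume pp: "p \<in> unit_pairs q" "p' \<in> unit_pairs q" "g p = g p'"
    obtain x z x' z' where p: "p = (x, z)" "p' = (x', z')" by force
    have "int q dvd u * x - u * x'"
      using pp(3) by (simp add: g_def p mod_eq_dvd_iff)
    hence "int q dvd (u * w + 1) * (x - x') - w * (u * x - u * x')"
      using uw1 by (meson dvd_diff dvd_mult dvd_mult2)
    hence "int q dvd x - x'" by (simp add: algebra_simps)
    hence "x = x'" using pp p by (intro residue_eqI) (auto simp: unit_pairs_def)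
    thus "p = p'" using pp p unit_pairs_unique by blast
  qed
  have bij: "bij_betw g (unit_pairs q) (unit_pairs q)"
    using gU inj by (intro bij_betw_imageI endo_inj_surj) auto
  have "kloosterman m n q = (\<Sum>p\<in>unit_pairs q. root_char q (m * fst (g p) + n * snd (g p)))"
    unfolding kloosterman_def case_prod_unfold
    using sum.reindex_bij_betw[OF bij, of "\<lambda>p. root_char q (m * fst p + n * snd p)"] by simp
  also have "\<dots> = kloosterman (m * u) (- n * w) q"
    unfolding kloosterman_def
  proof (intro sum.cong refl, clarify)
    fix x z
    have "int q dvd m * (u * x mod int q - u * x) + n * ((- w * z) mod int q - (- w * z))"
      by (intro dvd_add dvd_mult) (metis dvd_diff_commute dvd_minus_mod)+
    thus "root_char q (m * fst (g (x, z)) + n * snd (g (x, z))) = root_char q (m * u * x + - n * w * z)"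
      by (intro root_char_cong assms) (simp add: g_def algebra_simps)
  qed
  finally show ?thesis ..
qed


text \<open>By unit invariance one and the same value |K(m, n)| occurs on the right for every unit
  pair (u, w), and w keeps these occurrences apart. The second parameter runs through multiples of n
  only, so that n survives in the congruence obtained from orthogonality.\<close>

lemma kloosterman_moment_le:
  assumes "q > 0"
  shows "card (unit_pairs q) * norm (kloosterman m n q) ^ 4 \<le>
    (\<Sum>m'\<in>{0..<int q}. \<Sum>w\<in>{0..<int q}. norm (kloosterman m' (- n * w) q) ^ 4)"
proof -
  define R where "R = {0..<int q}"
  define f where "f = (\<lambda>(m', w). norm (kloosterman m' (- n * w) q) ^ 4)"
  define \<phi> where "\<phi> = (\<lambda>(u, w). ((m * u) mod int q, w :: int))"
  have "card (unit_pairs q) * norm (kloosterman m n q) ^ 4 = (\<Sum>p\<in>unit_pairs q. norm (kloosterman m n q) ^ 4)"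
    by simp
  also have "\<dots> = (\<Sum>p\<in>unit_pairs q. f (\<phi> p))"
  proof (intro sum.cong refl, clarify)
    fix u w assume "(u, w) \<in> unit_pairs q"
    from kloosterman_unit_invariant[OF this assms, of m n]
    show "norm (kloosterman m n q) ^ 4 = f (\<phi> (u, w))"
      by (simp add: f_def \<phi>_def kloosterman_mod[OF assms])
  qed
  also have "\<dots> = (\<Sum>p\<in>\<phi> ` unit_pairs q. f p)"
  proof -
    have "inj_on \<phi> (unit_pairs q)"
      by (rule inj_onI) (auto simp: \<phi>_def unit_pairs_swap intro: unit_pairs_unique)
    thus ?thesis by (simp add: sum.reindex)
  qed
  also have "\<dots> \<le> (\<Sum>p\<in>R\<times>R. f p)"
    using assms by (intro sum_mono2) (auto simp: R_def \<phi>_def f_def unit_pairs_def)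
  also have "\<dots> = (\<Sum>m'\<in>R. \<Sum>w\<in>R. norm (kloosterman m' (- n * w) q) ^ 4)"
    by (simp add: f_def sum.cartesian_product)
  finally show ?thesis unfolding R_def .
qed

text \<open>Modulo q, z_i is -1 / x_i. Clearing denominators in the second congruence gives n (x3 x4
  (x1 + x2) - x1 x2 (x3 + x4)); after the substitution x4 = x1 + x2 - x3 this factors as -n (x1 +
  x2) (x1 - x3) (x2 - x3).\<close>

lemma unit_quadruple_dvd:
  fixes x1 x2 x3 x4 z1 z2 z3 z4 n q :: int
  assumes "q dvd x1 * z1 + 1" "q dvd x2 * z2 + 1" "q dvd x3 * z3 + 1" "q dvd x4 * z4 + 1"
    and "q dvd (x1 + x2) - (x3 + x4)" "q dvd n * (z1 + z2 - z3 - z4)"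
  shows "q dvd n * ((x1 + x2) * ((x1 - x3) * (x2 - x3)))"
proof -
  obtain k1 k2 k3 k4 e l where k: "x1 * z1 + 1 = q * k1" "x2 * z2 + 1 = q * k2" "x3 * z3 + 1 = q * k3"
    "x4 * z4 + 1 = q * k4" "(x1 + x2) - (x3 + x4) = q * e" "n * (z1 + z2 - z3 - z4) = q * l"
    using assms by (elim dvdE) blast
  have x4: "x4 = x1 + x2 - x3 - q * e" using k(5) by simp
  have "n * (x3 * x4 * (x1 + x2) - x1 * x2 * (x3 + x4)) =
    q * (n * (x3 * x4 * (x2 * k1 + x1 * k2) - x1 * x2 * (x4 * k3 + x3 * k4)) - l * x1 * x2 * x3 * x4)"
  proof -
    have xz: "x1 * z1 = q * k1 - 1" "x2 * z2 = q * k2 - 1" "x3 * z3 = q * k3 - 1" "x4 * z4 = q * k4 - 1"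
      using k(1-4) by linarith+
    have "q * l * (x1 * x2 * x3 * x4) = n * (z1 + z2 - z3 - z4) * (x1 * x2 * x3 * x4)"
      by (simp only: k(6))
    also have "\<dots> = n * (x3 * x4 * (x2 * (x1 * z1) + x1 * (x2 * z2)) - x1 * x2 * (x4 * (x3 * z3) + x3 * (x4 * z4)))"
      by (simp add: algebra_simps)
    also have "\<dots> = q * n * (x3 * x4 * (x2 * k1 + x1 * k2) - x1 * x2 * (x4 * k3 + x3 * k4))
       - n * (x3 * x4 * (x1 + x2) - x1 * x2 * (x3 + x4))"
      unfolding xz by (simp add: algebra_simps)
    finally show ?thesis by (simp add: algebra_simps)
  qed
  hence "q dvd n * (x3 * x4 * (x1 + x2) - x1 * x2 * (x3 + x4))" by simp
  moreover have "n * ((x1 + x2) * ((x1 - x3) * (x2 - x3))) =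
     - (n * (x3 * x4 * (x1 + x2) - x1 * x2 * (x3 + x4))) + q * (n * e * (x1 * x2 - x3 * (x1 + x2)))"
    unfolding x4 by (simp add: algebra_simps)
  ultimately show ?thesis by (metis dvd_add dvd_minus_iff dvd_triv_left)
qed

text \<open>The fourth power is the square of |K^2|, and K^2 is an exponential sum over pairs of
  unit pairs, so Parseval applies. A solution is determined by x1, x2, x3: the first congruence
  gives x4, and each x_i gives its z_i.\<close>

lemma kloosterman_moment_count:
  assumes "q > 0"
  shows "(\<Sum>m'\<in>{0..<int q}. \<Sum>w\<in>{0..<int q}. norm (kloosterman m' (- n * w) q) ^ 4) \<le>
    (real q)\<^sup>2 * card {(x1, x2, x3). x1 \<in> {0..<int q} \<and> x2 \<in> {0..<int q} \<and> x3 \<in> {0..<int q} \<and>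
       int q dvd n * ((x1 + x2) * ((x1 - x3) * (x2 - x3)))}" (is "_ \<le> _ * real (card ?T)")
proof -
  define U where "U = unit_pairs q"
  define X where "X = (\<lambda>(P1 :: int \<times> int, P2 :: int \<times> int). fst P1 + fst P2)"
  define Z where "Z = (\<lambda>(P1 :: int \<times> int, P2 :: int \<times> int). - n * (snd P1 + snd P2))"
  define S where "S = {(i, j) \<in> (U \<times> U) \<times> (U \<times> U). int q dvd X i - X j \<and> int q dvd Z i - Z j}"
  have "norm (kloosterman m' (- n * w) q) ^ 4 = (norm (\<Sum>i\<in>U\<times>U. root_char q (m' * X i + w * Z i)))\<^sup>2" for m' w
  proof -
    have "norm (kloosterman m' (- n * w) q) ^ 4 = (norm (kloosterman m' (- n * w) q * kloosterman m' (- n * w) q))\<^sup>2"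
      by (simp add: norm_mult power4_eq_xxxx power2_eq_square mult.assoc)
    also have "kloosterman m' (- n * w) q * kloosterman m' (- n * w) q =
        (\<Sum>i\<in>U. \<Sum>j\<in>U. root_char q (m' * fst i + - n * w * snd i) * root_char q (m' * fst j + - n * w * snd j))"
      unfolding kloosterman_def case_prod_unfold sum_product U_def ..
    also have "\<dots> = (\<Sum>i\<in>U\<times>U. root_char q (m' * X i + w * Z i))"
      unfolding root_char_add[symmetric] sum.cartesian_product
      by (intro sum.cong) (auto simp: X_def Z_def algebra_simps)
    finally show ?thesis .
  qed
  hence "(\<Sum>m'\<in>{0..<int q}. \<Sum>w\<in>{0..<int q}. norm (kloosterman m' (- n * w) q) ^ 4) = (real q)\<^sup>2 * card S"
    using second_moment_root_char[of "U \<times> U" q X Z] assms by (simp add: S_def U_def)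
  also have "card S \<le> card ?T"
  proof (rule card_inj_on_le)
    define \<phi> where "\<phi> = (\<lambda>((P1 :: int \<times> int, P2 :: int \<times> int), (P3 :: int \<times> int, P4 :: int \<times> int)). (fst P1, fst P2, fst P3))"
    show "\<phi> ` S \<subseteq> ?T"
    proof (rule image_subsetI)
      fix p assume "p \<in> S"
      then obtain x1 z1 x2 z2 x3 z3 x4 z4 where p: "p = (((x1, z1), (x2, z2)), ((x3, z3), (x4, z4)))"
        and *: "(((x1, z1), (x2, z2)), ((x3, z3), (x4, z4))) \<in> S"
        by (metis surj_pair)
      have "int q dvd - (n * (z1 + z2 - z3 - z4))"
        using * by (simp add: S_def Z_def algebra_simps)
      hence "int q dvd n * (z1 + z2 - z3 - z4)" by (simp only: dvd_minus_iff)
      hence "int q dvd n * ((x1 + x2) * ((x1 - x3) * (x2 - x3)))"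
        using * by (intro unit_quadruple_dvd[of "int q" x1 z1 x2 z2 x3 z3 x4 z4 n])
                   (auto simp: S_def X_def U_def unit_pairs_def)
      thus "\<phi> p \<in> ?T"
        using * by (auto simp: p S_def U_def unit_pairs_def \<phi>_def)
    qed
    show "inj_on \<phi> S"
    proof (rule inj_onI)
      fix p p' assume pp: "p \<in> S" "p' \<in> S" "\<phi> p = \<phi> p'"
      obtain x1 z1 x2 z2 x3 z3 x4 z4 y1 v1 y2 v2 y3 v3 y4 v4
        where p: "p = (((x1, z1), (x2, z2)), ((x3, z3), (x4, z4)))"
          and p': "p' = (((y1, v1), (y2, v2)), ((y3, v3), (y4, v4)))"
        by (metis surj_pair)
      note 1 = pp(1)[unfolded p] and 2 = pp(2)[unfolded p'] and 3 = pp(3)[unfolded p p']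
      have eq: "y1 = x1" "y2 = x2" "y3 = x3" using 3 by (auto simp: \<phi>_def)
      have "int q dvd x1 + x2 - (x3 + y4)" "int q dvd x1 + x2 - (x3 + x4)"
        using 1 2 by (auto simp: S_def X_def eq)
      hence "int q dvd (x1 + x2 - (x3 + y4)) - (x1 + x2 - (x3 + x4))"
        by (rule dvd_diff)
      hence "int q dvd x4 - y4" by (simp add: algebra_simps)
      hence "x4 = y4"
        using 1 2 by (intro residue_eqI) (auto simp: S_def U_def unit_pairs_def)
      thus "p = p'"
        using 1 2 unit_pairs_unique eq by (auto simp: p p' S_def U_def)
    qed
    show "finite ?T"
      by (rule finite_subset[of _ "{0..<int q} \<times> {0..<int q} \<times> {0..<int q}"]) auto
  qed
  finally show ?thesis by (simp add: mult_left_mono)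
qed

text \<open>For composite q none of the factors needs to vanish modulo q. But q splits as d0 d1 d2
  d3 along n, a, b, c with |d0| <= |n|, so d1, d2, d3 cannot all be below D when q >= |n|
  D^3.\<close>

lemma large_divisor_of_factor:
  fixes n a b c :: int and D q :: nat
  assumes dvd: "int q dvd n * (a * (b * c))" and "n \<noteq> 0" "q > 0"
    and q: "int q \<ge> \<bar>n\<bar> * int D ^ 3" and "D \<ge> 1"
  shows "\<exists>d. d dvd q \<and> D \<le> d \<and> (int d dvd a \<or> int d dvd b \<or> int d dvd c)"
proof -
  obtain d0 e0 where 0: "int q = d0 * e0" "d0 dvd n" "e0 dvd a * (b * c)"
    using division_decomp[OF dvd] by blast
  obtain d1 e1 where 1: "e0 = d1 * e1" "d1 dvd a" "e1 dvd b * c"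
    using division_decomp[OF 0(3)] by blast
  obtain d2 d3 where 2: "e1 = d2 * d3" "d2 dvd b" "d3 dvd c"
    using division_decomp[OF 1(3)] by blast
  have q_eq: "int q = \<bar>d0\<bar> * (\<bar>d1\<bar> * (\<bar>d2\<bar> * \<bar>d3\<bar>))"
    using 0(1) 1(1) 2(1) by (metis abs_mult abs_of_nat)
  have "\<bar>d0\<bar> \<le> \<bar>n\<bar>" using 0(2) \<open>n \<noteq> 0\<close> by (simp add: dvd_imp_le_int)
  have "\<bar>d1\<bar> \<ge> int D \<or> \<bar>d2\<bar> \<ge> int D \<or> \<bar>d3\<bar> \<ge> int D"
  proof (rule ccontr)
    assume "\<not> ?thesis"
    hence *: "\<bar>d1\<bar> \<le> int D - 1" "\<bar>d2\<bar> \<le> int D - 1" "\<bar>d3\<bar> \<le> int D - 1" by auto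
    have "int q \<le> \<bar>n\<bar> * ((int D - 1) * ((int D - 1) * (int D - 1)))"
      unfolding q_eq using * \<open>\<bar>d0\<bar> \<le> \<bar>n\<bar>\<close> \<open>D \<ge> 1\<close> by (intro mult_mono) auto
    also have "\<dots> < \<bar>n\<bar> * int D ^ 3"
    proof -
      have "(int D - 1) ^ 3 < int D ^ 3"
        using \<open>D \<ge> 1\<close> by (intro power_strict_mono) auto
      thus ?thesis using \<open>n \<noteq> 0\<close> by (simp add: power3_eq_cube mult.assoc)
    qed
    finally show False using q by simp
  qed
  moreover have "\<exists>d. d dvd q \<and> D \<le> d \<and> int d dvd y" if "e dvd int q" "int D \<le> \<bar>e\<bar>" "e dvd y" for e y
    using that by (intro exI[of _ "nat \<bar>e\<bar>"]) (auto simp: nat_dvd_iff le_nat_iff)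
  moreover have "d1 dvd int q" "d2 dvd int q" "d3 dvd int q"
    unfolding 0(1) 1(1) 2(1) by auto
  ultimately show ?thesis
    using 1(2) 2(2,3) by blast
qed

lemma card_residue_class_le:
  assumes "d dvd q" "q > 0"
  shows "card {x \<in> {0..<int q}. int d dvd x + c} \<le> q div d"
proof -
  obtain e where e: "q = d * e" using assms by auto
  have d: "d > 0" using assms e by (cases d) auto
  have "card {x \<in> {0..<int q}. int d dvd x + c} \<le> card {0..<int e}"
  proof (rule card_inj_on_le[of "\<lambda>x. x div int d"])
    show "inj_on (\<lambda>x. x div int d) {x \<in> {0..<int q}. int d dvd x + c}"
    proof (rule inj_onI, clarify)
      fix x y assume *: "int d dvd x + c" "int d dvd y + c" "x div int d = y div int d"
      have "int d dvd (x + c) - (y + c)" using * by (intro dvd_diff)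
      hence "x mod int d = y mod int d" by (simp add: mod_eq_dvd_iff)
      thus "x = y" using *(3) by (metis mult_div_mod_eq)
    qed
    show "(\<lambda>x. x div int d) ` {x \<in> {0..<int q}. int d dvd x + c} \<subseteq> {0..<int e}"
    proof clarify
      fix x assume x: "x \<in> {0..<int q}"
      have "x div int d < int e"
      proof (rule ccontr)
        assume "\<not> ?thesis"
        hence "int d * int e \<le> int d * (x div int d)" by (intro mult_left_mono) auto
        also have "\<dots> \<le> x" using d by (smt (verit) minus_mult_div_eq_mod of_nat_0_less_iff pos_mod_sign)
        finally show False using x e by simp
      qed
      thus "x div int d \<in> {0..<int e}" using x d by (simp add: pos_imp_zdiv_nonneg_iff)
    qed
  qed simp
  thus ?thesis using e d by simp
qed


text \<open>Union bound over the large divisor d: each of the three linear forms fixes one variable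
  modulo d once the other two are chosen, which leaves q^2 (q / d) triples.\<close>

lemma card_degenerate_triples_le:
  fixes n :: int and D q :: nat
  assumes "n \<noteq> 0" "q > 0" and q: "int q \<ge> \<bar>n\<bar> * int D ^ 3" and "D \<ge> 1"
  shows "card {(x1, x2, x3). x1 \<in> {0..<int q} \<and> x2 \<in> {0..<int q} \<and> x3 \<in> {0..<int q} \<and>
       int q dvd n * ((x1 + x2) * ((x1 - x3) * (x2 - x3)))} \<le> (\<Sum>d | d dvd q \<and> D \<le> d. 3 * (q * q * (q div d)))"
    (is "card ?T \<le> _")
proof -
  define R where "R = {0..<int q}"
  have R: "finite R" "card R = q" by (auto simp: R_def)
  have line: "card {(x, p). x \<in> R \<and> p \<in> B \<and> int d dvd x + c p} \<le> card B * (q div d)"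
    if "finite B" "d dvd q" for B :: "'b set" and c d
  proof -
    have "card {(x, p). x \<in> R \<and> p \<in> B \<and> int d dvd x + c p} = card (SIGMA p:B. {x \<in> R. int d dvd x + c p})"
      by (rule bij_betw_same_card[of prod.swap]) (auto simp: bij_betw_def inj_on_def image_iff)
    also have "\<dots> = (\<Sum>p\<in>B. card {x \<in> R. int d dvd x + c p})"
      using that R by (simp add: card_SigmaI)
    also have "\<dots> \<le> (\<Sum>p\<in>B. q div d)"
      unfolding R_def by (intro sum_mono card_residue_class_le assms that)
    finally show ?thesis by simp
  qed
  define T where "T d = {(x1, x2, x3). x1 \<in> R \<and> x2 \<in> R \<and> x3 \<in> R \<and>
     (int d dvd x1 + x2 \<or> int d dvd x1 - x3 \<or> int d dvd x2 - x3)}" for d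
  have Td: "card (T d) \<le> 3 * (q * q * (q div d))" if "d dvd q" for d
  proof -
    define T1 where "T1 = {(x, p). x \<in> R \<and> p \<in> R \<times> R \<and> int d dvd x + fst p}"
    define T2 where "T2 = {(x, p). x \<in> R \<and> p \<in> R \<times> R \<and> int d dvd x + - snd p}"
    define T3 where "T3 = R \<times> {(x, p). x \<in> R \<and> p \<in> R \<and> int d dvd x + - p}"
    have T12: "card T1 \<le> q * q * (q div d)" "card T2 \<le> q * q * (q div d)"
      unfolding T1_def T2_def
      using line[of "R \<times> R" d fst] line[of "R \<times> R" d "\<lambda>p. - snd p"] that R by auto
    have "card T3 \<le> q * (q * (q div d))"
      unfolding T3_def card_cartesian_product R(2)
      using line[of "R" d "\<lambda>p. - p"] that R by (intro mult_left_mono) auto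
    moreover have "T d = T1 \<union> (T2 \<union> T3)" unfolding T_def T1_def T2_def T3_def by auto
    hence "card (T d) \<le> card T1 + (card T2 + card T3)"
      by (metis (no_types, lifting) add_left_mono card_Un_le order.trans)
    ultimately show ?thesis using T12 by simp
  qed
  have fin: "finite {d. d dvd q \<and> D \<le> d}" using assms by (intro finite_subset[OF _ finite_divisors_nat[of q]]) auto
  have finT: "finite (T d)" for d
    by (rule finite_subset[of _ "R \<times> R \<times> R"]) (auto simp: T_def R)
  have "?T \<subseteq> (\<Union>d\<in>{d. d dvd q \<and> D \<le> d}. T d)"
  proof clarify
    fix x1 x2 x3 assume *: "x1 \<in> {0..<int q}" "x2 \<in> {0..<int q}" "x3 \<in> {0..<int q}"
      "int q dvd n * ((x1 + x2) * ((x1 - x3) * (x2 - x3)))"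
    obtain d where "d dvd q" "D \<le> d" "int d dvd x1 + x2 \<or> int d dvd x1 - x3 \<or> int d dvd x2 - x3"
      using large_divisor_of_factor[OF *(4) assms] by blast
    thus "(x1, x2, x3) \<in> (\<Union>d\<in>{d. d dvd q \<and> D \<le> d}. T d)"
      using * by (auto simp: T_def R_def)
  qed
  hence "card ?T \<le> card (\<Union>d\<in>{d. d dvd q \<and> D \<le> d}. T d)"
    using fin finT by (intro card_mono) auto
  also have "\<dots> \<le> (\<Sum>d | d dvd q \<and> D \<le> d. card (T d))"
    by (rule card_UN_le[OF fin])
  also have "\<dots> \<le> (\<Sum>d | d dvd q \<and> D \<le> d. 3 * (q * q * (q div d)))"
    using Td by (intro sum_mono) auto
  finally show ?thesis .
qed

text \<open>The fifth power arises because one factor |K| is bounded by the number of unit pairs,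
  which is the weight in the moment inequality; a lower bound for the totient is thereby
  avoided.\<close>

lemma norm_kloosterman_power5_le:
  fixes n :: int and D q :: nat
  assumes "n \<noteq> 0" "q > 0" and q: "int q \<ge> \<bar>n\<bar> * int D ^ 3" and "D \<ge> 1"
  shows "(norm (kloosterman m n q) / q) ^ 5 \<le> 3 * (\<Sum>d | d dvd q \<and> D \<le> d. 1 / d)"
proof -
  let ?K = "norm (kloosterman m n q)"
  have "?K ^ 5 = ?K * ?K ^ 4" by (simp add: eval_nat_numeral)
  also have "\<dots> \<le> card (unit_pairs q) * ?K ^ 4"
    by (intro mult_right_mono norm_kloosterman_le) auto
  also have "\<dots> \<le> (real q)\<^sup>2 * card {(x1, x2, x3). x1 \<in> {0..<int q} \<and> x2 \<in> {0..<int q} \<and> x3 \<in> {0..<int q} \<and>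
       int q dvd n * ((x1 + x2) * ((x1 - x3) * (x2 - x3)))}"
    using kloosterman_moment_le[OF assms(2)] kloosterman_moment_count[OF assms(2)] by (rule order.trans)
  also have "\<dots> \<le> (real q)\<^sup>2 * real (\<Sum>d | d dvd q \<and> D \<le> d. 3 * (q * q * (q div d)))"
    using card_degenerate_triples_le[OF assms] by (intro mult_left_mono) (auto simp del: of_nat_sum)
  also have "\<dots> = (\<Sum>d | d dvd q \<and> D \<le> d. real q ^ 5 * (3 * (1 / d)))"
    unfolding of_nat_sum sum_distrib_left
  proof (intro sum.cong refl, clarify)
    fix d assume "d dvd q"
    hence "real (q div d) = real q / real d" by (simp add: real_of_nat_div)
    thus "(real q)\<^sup>2 * real (3 * (q * q * (q div d))) = real q ^ 5 * (3 * (1 / real d))"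
      by (simp add: eval_nat_numeral)
  qed
  also have "\<dots> = real q ^ 5 * (3 * (\<Sum>d | d dvd q \<and> D \<le> d. 1 / d))"
    by (simp add: sum_distrib_left)
  finally show ?thesis using \<open>q > 0\<close> by (simp add: power_divide field_simps)
qed

text \<open>Interchange the sums: each d has at most X / d multiples up to X, so the total is at
  most X times the tail of the sum of 1 / d^2. The 2 comes from 1 / d^2 <= 2 / (d (d + 1)), which
  telescopes.\<close>

lemma sum_large_divisors_le:
  assumes "D \<ge> (1::nat)"
  shows "(\<Sum>q=1..X. \<Sum>d | d dvd q \<and> D \<le> d. 1 / real d) \<le> 2 * real X / real D"
proof -
  have "(\<Sum>q=1..X. \<Sum>d | d dvd q \<and> D \<le> d. 1 / real d) =
      (\<Sum>q=1..X. \<Sum>d\<in>{D..X}. if d dvd q then 1 / real d else 0)"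
  proof (rule sum.cong[OF refl])
    fix q assume "q \<in> {1..X}"
    hence eq: "{d. d dvd q \<and> D \<le> d} = {d \<in> {D..X}. d dvd q}" by (auto dest: dvd_imp_le)
    show "(\<Sum>d | d dvd q \<and> D \<le> d. 1 / real d) = (\<Sum>d\<in>{D..X}. if d dvd q then 1 / real d else 0)"
      unfolding eq using sum.inter_filter[of "{D..X}" "\<lambda>d. 1 / real d" "\<lambda>d. d dvd q"] by simp
  qed
  also have "\<dots> = (\<Sum>d\<in>{D..X}. \<Sum>q=1..X. if d dvd q then 1 / real d else 0)"
    by (rule sum.swap)
  also have "\<dots> \<le> (\<Sum>d\<in>{D..X}. 2 * real X * (1 / real d - 1 / real (Suc d)))"
  proof (rule sum_mono)
    fix d assume d: "d \<in> {D..X}"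
    have "(\<Sum>q=1..X. if d dvd q then 1 / real d else 0) = (\<Sum>q\<in>{q\<in>{1..X}. d dvd q}. 1 / real d)"
      by (rule sum.inter_filter[symmetric]) auto
    also have "\<dots> = real (card {q\<in>{1..X}. d dvd q}) / real d" by simp
    also have "card {q\<in>{1..X}. d dvd q} \<le> card {1..X div d}"
    proof (rule card_inj_on_le[of "\<lambda>q. q div d"])
      show "inj_on (\<lambda>q. q div d) {q\<in>{1..X}. d dvd q}"
        by (rule inj_onI) (metis (mono_tags, lifting) dvd_div_mult_self mem_Collect_eq)
      show "(\<lambda>q. q div d) ` {q\<in>{1..X}. d dvd q} \<subseteq> {1..X div d}"
        using d assms by (auto simp: div_le_mono div_greater_zero_iff Suc_le_eq dest!: dvd_imp_le)
    qed simp
    hence "real (card {q\<in>{1..X}. d dvd q}) / real d \<le> (real X / real d) / real d"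
      by (intro divide_right_mono) (auto intro: order.trans[OF _ of_nat_div_le_of_nat])
    also have "\<dots> \<le> 2 * real X * (1 / real d - 1 / real (Suc d))"
    proof -
      have "1 / real d / real d \<le> 2 * (1 / real d - 1 / real (Suc d))"
      proof -
        have "1 / real d / real d = 2 / (real d * (2 * real d))" by simp
        also have "\<dots> \<le> 2 / (real d * (real d + 1))"
          using d assms by (intro divide_left_mono mult_left_mono) auto
        also have "\<dots> = 2 * (1 / real d - 1 / real (Suc d))" using d assms by (simp add: field_simps)
        finally show ?thesis .
      qed
      from mult_left_mono[OF this, of "real X"] show ?thesis by (simp add: algebra_simps)
    qed
    finally show "(\<Sum>q=1..X. if d dvd q then 1 / real d else 0) \<le> 2 * real X * (1 / real d - 1 / real (Suc d))"
      by (simp add: divide_right_mono)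
  qed
  also have "\<dots> \<le> 2 * real X * (1 / real D)"
  proof -
    have "(\<Sum>d\<in>{D..X}. 1 / real d - 1 / real (Suc d)) \<le> 1 / real D"
    proof (cases "D \<le> X")
      case True
      have "(\<Sum>d\<in>{D..X}. 1 / real d - 1 / real (Suc d)) = - (\<Sum>d\<in>{D..X}. 1 / real (Suc d) - 1 / real d)"
        by (simp flip: sum_negf)
      also have "\<dots> = 1 / real D - 1 / real (Suc X)"
        using True by (subst sum_Suc_diff) auto
      finally show ?thesis by simp
    qed auto
    thus ?thesis unfolding sum_distrib_left[symmetric] by (intro mult_left_mono) auto
  qed
  finally show ?thesis by simp
qed

text \<open>Converts a bound for the mean of fifth powers into one for the mean itself.\<close>

lemma le_add_power5:
  fixes x \<epsilon> :: real
  assumes "x \<ge> 0" "\<epsilon> > 0"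
  shows "x \<le> \<epsilon> + x ^ 5 / \<epsilon> ^ 4"
proof (cases "x \<le> \<epsilon>")
  case True
  thus ?thesis using assms by (simp add: add_increasing2)
next
  case False
  hence "\<epsilon> ^ 4 \<le> x ^ 4" using assms by (intro power_mono) auto
  hence "x * \<epsilon> ^ 4 \<le> x * x ^ 4" using assms by (intro mult_left_mono) auto
  hence "x \<le> x ^ 5 / \<epsilon> ^ 4" using assms by (simp add: field_simps eval_nat_numeral)
  thus ?thesis using assms by simp
qed

lemma kloosterman_mean_tendsto_0:
  assumes "n \<noteq> 0"
  shows "(\<lambda>X::nat. (\<Sum>q=1..X. norm (kloosterman m n q) / real q) / real X) \<longlonglongrightarrow> 0"
proof (rule LIMSEQ_I)
  fix e :: real assume e: "e > 0"
  \<comment> \<open>One third each for the constant in \<open>le_add_power5\<close>, for the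
    finitely many q < \<open>q0\<close> to which the divisor bound does not apply, and for the large
    divisors. The 6 below is 3 from the pointwise bound times 2 from
    \<open>sum_large_divisors_le\<close>.\<close>
  define \<epsilon> where "\<epsilon> = e / 3"
  have \<epsilon>: "\<epsilon> > 0" using e by (simp add: \<epsilon>_def)
  obtain D :: nat where D: "real D > 6 / \<epsilon> ^ 5" using reals_Archimedean2 by blast
  have D0: "D \<ge> 1" using D \<epsilon> by (cases D) (auto simp: field_simps)
  have D': "6 / (real D * \<epsilon> ^ 4) < \<epsilon>" using D D0 \<epsilon> by (simp add: field_simps eval_nat_numeral)
  define q0 where "q0 = nat \<bar>n\<bar> * D ^ 3"
  obtain X0 :: nat where X0: "real X0 > real q0 / \<epsilon> ^ 4 / \<epsilon>" using reals_Archimedean2 by blast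
  define b where "b q = norm (kloosterman m n q) / real q" for q
  have b0: "b q \<ge> 0" for q by (simp add: b_def)
  have b1: "b q \<le> 1" for q
  proof -
    have "card (unit_pairs q) \<le> card {0..<int q}"
    proof (rule card_inj_on_le[of fst])
      show "inj_on fst (unit_pairs q)"
        by (rule inj_onI) (metis prod.collapse unit_pairs_unique)
    qed (auto simp: unit_pairs_def)
    hence "norm (kloosterman m n q) \<le> real q" using norm_kloosterman_le[of m n q] by simp
    thus ?thesis by (cases "q = 0") (auto simp: b_def divide_le_eq_1)
  qed
  have b5: "b q ^ 5 \<le> (if q < q0 then 1 else 0) + 3 * (\<Sum>d | d dvd q \<and> D \<le> d. 1 / real d)" if "q \<ge> 1" for q
  proof (cases "q < q0")
    case True
    have "b q ^ 5 \<le> 1" using b0 b1 by (simp add: power_le_one)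
    moreover have "0 \<le> (\<Sum>d | d dvd q \<and> D \<le> d. 1 / real d)" by (intro sum_nonneg) auto
    ultimately show ?thesis using True by simp
  next
    case False
    have "int q \<ge> \<bar>n\<bar> * int D ^ 3" 
    proof -
      have "int q0 \<le> int q" using False by simp
      thus ?thesis by (simp add: q0_def)
    qed
    from norm_kloosterman_power5_le[OF assms _ this D0] that False show ?thesis by (simp add: b_def)
  qed
  have "norm ((\<Sum>q=1..X. b q) / real X - 0) < e" if X: "X \<ge> X0" "X \<ge> 1" for X
  proof -
    have "(\<Sum>q=1..X. b q ^ 5) \<le> (\<Sum>q=1..X. (if q < q0 then 1 else 0) + 3 * (\<Sum>d | d dvd q \<and> D \<le> d. 1 / real d))"
      by (intro sum_mono b5) auto
    also have "\<dots> = (\<Sum>q\<in>{q\<in>{1..X}. q < q0}. 1) + 3 * (\<Sum>q=1..X. \<Sum>d | d dvd q \<and> D \<le> d. 1 / real d)"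
      by (simp add: sum.distrib sum_distrib_left flip: sum.inter_filter)
    also have "\<dots> \<le> real q0 + 3 * (2 * real X / real D)"
    proof (intro add_mono mult_left_mono sum_large_divisors_le D0)
      have "card {q\<in>{1..X}. q < q0} \<le> card {..<q0}" by (intro card_mono) auto
      thus "(\<Sum>q\<in>{q\<in>{1..X}. q < q0}. 1) \<le> real q0" by simp
    qed auto
    finally have *: "(\<Sum>q=1..X. b q ^ 5) \<le> real q0 + 3 * (2 * real X / real D)" .
    have "(\<Sum>q=1..X. b q) \<le> (\<Sum>q=1..X. \<epsilon> + b q ^ 5 / \<epsilon> ^ 4)"
      by (intro sum_mono le_add_power5 b0 \<epsilon>)
    also have "\<dots> = real X * \<epsilon> + (\<Sum>q=1..X. b q ^ 5) / \<epsilon> ^ 4"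
      by (simp add: sum.distrib sum_divide_distrib)
    also have "\<dots> \<le> real X * \<epsilon> + (real q0 + 3 * (2 * real X / real D)) / \<epsilon> ^ 4"
      using * \<epsilon> by (intro add_left_mono divide_right_mono) auto
    also have "\<dots> = real X * \<epsilon> + real q0 / \<epsilon> ^ 4 + real X * (6 / (real D * \<epsilon> ^ 4))"
      using D0 \<epsilon> by (simp add: field_simps)
    also have "\<dots> < real X * \<epsilon> + real X * \<epsilon> + real X * \<epsilon>"
    proof (intro add_le_less_mono add_left_mono mult_strict_left_mono D')
      have "real q0 / \<epsilon> ^ 4 < real X0 * \<epsilon>" using X0 \<epsilon> by (simp add: pos_divide_less_eq mult_ac)
      also have "\<dots> \<le> real X * \<epsilon>" using X \<epsilon> by simp
      finally show "real q0 / \<epsilon> ^ 4 \<le> real X * \<epsilon>" by simp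
    qed (use X in auto)
    finally have "(\<Sum>q=1..X. b q) < real X * e" by (simp add: \<epsilon>_def mult_ac)
    moreover have "(\<Sum>q=1..X. b q) \<ge> 0" by (intro sum_nonneg b0)
    ultimately show ?thesis using X by (simp add: pos_divide_less_eq mult.commute)
  qed
  thus "\<exists>no. \<forall>X\<ge>no. norm ((\<Sum>q=1..X. norm (kloosterman m n q) / real q) / real X - 0) < e"
    unfolding b_def by (intro exI[of _ "max X0 1"]) auto
qed

section \<open>Mean values of the totient function\<close>

lemma card_unit_pairs:
  assumes "q > 0"
  shows "card (unit_pairs q) = totient q"
\<comment> \<open>Modulus 1 stands apart: its only residue is 0, whereas its only totative is
  1.\<close>
proof (cases "q = 1")
  case True
  have "unit_pairs q = {(0, 0)}" using True by (auto simp: unit_pairs_def)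
  thus ?thesis using True by simp
next
  case False
  have "bij_betw (\<lambda>p. nat (fst p)) (unit_pairs q) (totatives q)"
    unfolding bij_betw_def
  proof
    show "inj_on (\<lambda>p. nat (fst p)) (unit_pairs q)"
    proof (rule inj_onI)
      fix p p' assume *: "p \<in> unit_pairs q" "p' \<in> unit_pairs q" "nat (fst p) = nat (fst p')"
      hence "fst p = fst p'" by (auto simp: unit_pairs_def)
      thus "p = p'" using * by (metis prod.collapse unit_pairs_unique)
    qed
    show "(\<lambda>p. nat (fst p)) ` unit_pairs q = totatives q"
    proof (intro equalityI subsetI)
      fix k assume "k \<in> (\<lambda>p. nat (fst p)) ` unit_pairs q"
      then obtain x z where xz: "(x, z) \<in> unit_pairs q" "k = nat x" by auto
      have x: "x \<ge> 0" "x < int q" "int q dvd x * z + 1" using xz by (auto simp: unit_pairs_def)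
      have "coprime x (int q)"
      proof (rule coprimeI)
        fix c assume "c dvd x" "c dvd int q"
        hence "c dvd (x * z + 1) - x * z" using x(3) by (meson dvd_diff dvd_mult2 dvd_trans)
        thus "is_unit c" by simp
      qed
      hence "coprime k q" using x xz by (metis coprime_int_iff int_nat_eq)
      moreover have "k \<noteq> 0" using \<open>coprime k q\<close> False by (metis coprime_0_left_iff nat_dvd_1_iff_1)
      ultimately show "k \<in> totatives q" using x xz by (auto simp: totatives_def)
    next
      fix k assume k: "k \<in> totatives q"
      hence k': "k > 0" "k < q" "coprime k q"
        using False assms totatives_less[OF k] by (auto simp: totatives_def)
      obtain y where y: "[int k * y = 1] (mod int q)"
        using k'(3) cong_solve_coprime_int[of "int k" "int q"] by (auto simp: coprime_int_iff)
      define z where "z = (- y) mod int q"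
      have "[int k * z + 1 = int k * (- y) + 1] (mod int q)"
        unfolding z_def by (intro cong_add cong_mult cong_refl) (simp add: cong_def)
      also have "int k * (- y) + 1 = 1 - int k * y" by simp
      also have "[1 - int k * y = 1 - 1] (mod int q)" by (intro cong_diff cong_refl y)
      finally have "int q dvd int k * z + 1" by (simp add: cong_0_iff)
      hence "(int k, z) \<in> unit_pairs q" using k' assms by (auto simp: unit_pairs_def z_def)
      thus "k \<in> (\<lambda>p. nat (fst p)) ` unit_pairs q" by force
    qed
  qed
  thus ?thesis by (simp add: bij_betw_same_card totient_def)
qed

text \<open>Both bounds telescope the differences (n + 1)^(k+1) - n^(k+1), which lie between (k + 1)
  n^k and (k + 1) (n + 1)^k.\<close>

lemma sum_power_bounds:
  "real N ^ Suc k \<le> real (Suc k) * (\<Sum>n=1..N. real n ^ k)"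
  "real (Suc k) * (\<Sum>n=1..N. real n ^ k) \<le> real (Suc N) ^ Suc k"
proof -
  have *: "real (Suc k) * real n ^ k \<le> real (Suc n) ^ Suc k - real n ^ Suc k"
          "real (Suc n) ^ Suc k - real n ^ Suc k \<le> real (Suc k) * real (Suc n) ^ k" for n
  proof -
    have eq: "real (Suc n) ^ Suc k - real n ^ Suc k = (\<Sum>i<Suc k. real n ^ i * real (Suc n) ^ (k - i))"
    proof -
      have "real (Suc n) ^ Suc k - real n ^ Suc k =
         (real (Suc n) - real n) * (\<Sum>i<Suc k. real n ^ (Suc k - Suc i) * real (Suc n) ^ i)"
        by (rule power_diff_sumr2)
      also have "(\<Sum>i<Suc k. real n ^ (Suc k - Suc i) * real (Suc n) ^ i) = (\<Sum>i<Suc k. real n ^ i * real (Suc n) ^ (k - i))"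
        by (rule sum.reindex_bij_witness[of _ "\<lambda>i. k - i" "\<lambda>i. k - i"]) auto
      finally show ?thesis by simp
    qed
    have "(\<Sum>i<Suc k. real n ^ i * real n ^ (k - i)) \<le> (\<Sum>i<Suc k. real n ^ i * real (Suc n) ^ (k - i))"
      by (intro sum_mono mult_left_mono power_mono) auto
    thus "real (Suc k) * real n ^ k \<le> real (Suc n) ^ Suc k - real n ^ Suc k"
      unfolding eq by (simp flip: power_add)
    have "(\<Sum>i<Suc k. real n ^ i * real (Suc n) ^ (k - i)) \<le> (\<Sum>i<Suc k. real (Suc n) ^ i * real (Suc n) ^ (k - i))"
      by (intro sum_mono mult_right_mono power_mono) auto
    thus "real (Suc n) ^ Suc k - real n ^ Suc k \<le> real (Suc k) * real (Suc n) ^ k"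
      unfolding eq by (simp flip: power_add)
  qed
  show "real N ^ Suc k \<le> real (Suc k) * (\<Sum>n=1..N. real n ^ k)"
  proof (induction N)
    case (Suc N)
    have "real (Suc N) ^ Suc k \<le> real N ^ Suc k + real (Suc k) * real (Suc N) ^ k"
      using *(2)[of N] by linarith
    moreover have "real (Suc k) * (\<Sum>n=1..Suc N. real n ^ k) =
       real (Suc k) * (\<Sum>n=1..N. real n ^ k) + real (Suc k) * real (Suc N) ^ k"
      by (simp add: ring_distribs)
    ultimately show ?case using Suc by linarith
  qed auto
  show "real (Suc k) * (\<Sum>n=1..N. real n ^ k) \<le> real (Suc N) ^ Suc k"
  proof (induction N)
    case (Suc N)
    have "real (Suc N) ^ Suc k + real (Suc k) * real (Suc N) ^ k \<le> real (Suc (Suc N)) ^ Suc k"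
      using *(1)[of "Suc N"] by linarith
    moreover have "real (Suc k) * (\<Sum>n=1..Suc N. real n ^ k) =
       real (Suc k) * (\<Sum>n=1..N. real n ^ k) + real (Suc k) * real (Suc N) ^ k"
      by (simp add: ring_distribs)
    ultimately show ?case using Suc by linarith
  qed auto
qed

lemma sum_power_asymp:
  "((\<lambda>X. (\<Sum>n=1..nat \<lfloor>X\<rfloor>. real n ^ k) / X ^ Suc k) \<longlongrightarrow> 1 / real (Suc k)) at_top"
proof (rule tendsto_sandwich)
  show "\<forall>\<^sub>F X in at_top. ((X - 1) / X) ^ Suc k / real (Suc k) \<le> (\<Sum>n=1..nat \<lfloor>X\<rfloor>. real n ^ k) / X ^ Suc k"
    using eventually_ge_at_top[of 1]
  proof eventually_elim
    case (elim X)
    have "(X - 1) ^ Suc k \<le> real (nat \<lfloor>X\<rfloor>) ^ Suc k"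
      using elim by (intro power_mono) linarith+
    also note sum_power_bounds(1)[of "nat \<lfloor>X\<rfloor>" k]
    finally show ?case using elim by (simp add: power_divide field_simps del: power_Suc of_nat_Suc)
  qed
  show "\<forall>\<^sub>F X in at_top. (\<Sum>n=1..nat \<lfloor>X\<rfloor>. real n ^ k) / X ^ Suc k \<le> ((X + 1) / X) ^ Suc k / real (Suc k)"
    using eventually_ge_at_top[of 1]
  proof eventually_elim
    case (elim X)
    have "real (Suc (nat \<lfloor>X\<rfloor>)) ^ Suc k \<le> (X + 1) ^ Suc k"
      using elim by (intro power_mono) linarith+
    with sum_power_bounds(2)[of k "nat \<lfloor>X\<rfloor>"]
    have "real (Suc k) * (\<Sum>n=1..nat \<lfloor>X\<rfloor>. real n ^ k) \<le> (X + 1) ^ Suc k" by (rule order.trans)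
    thus ?case
      using elim by (simp add: power_divide field_simps del: power_Suc of_nat_Suc)
  qed
  have "((\<lambda>X::real. (X - 1) / X) \<longlongrightarrow> 1) at_top" by real_asymp
  moreover have "((\<lambda>X::real. (X + 1) / X) \<longlongrightarrow> 1) at_top" by real_asymp
  ultimately have "((\<lambda>X::real. (X - 1) / X) \<longlongrightarrow> 1) at_top" "((\<lambda>X::real. (X + 1) / X) \<longlongrightarrow> 1) at_top"
    by auto
  from this[THEN tendsto_power, of "Suc k"]
  show "((\<lambda>X. ((X - 1) / X) ^ Suc k / real (Suc k)) \<longlongrightarrow> 1 / real (Suc k)) at_top"
    "((\<lambda>X. ((X + 1) / X) ^ Suc k / real (Suc k)) \<longlongrightarrow> 1 / real (Suc k)) at_top"
    by (auto intro!: tendsto_divide simp del: power_Suc of_nat_Suc simp: )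
qed

lemma sum_inverse_squares_tail_le:
  assumes "a \<ge> (1::nat)"
  shows "(\<Sum>m=Suc a..b. 1 / real m ^ 2) \<le> 1 / real a"
proof (cases "a \<le> b")
  case True
  have "(\<Sum>m=Suc a..b. 1 / real m ^ 2) \<le> 1 / real a - 1 / real b"
    using True
  proof (induction b rule: dec_induct)
    case (step b)
    have "1 / real (Suc b) ^ 2 \<le> 1 / (real b * real (Suc b))"
      using step assms by (intro divide_left_mono) (auto simp: power2_eq_square)
    also have "\<dots> = 1 / real b - 1 / real (Suc b)"
      using step assms by (simp add: field_simps)
    finally have "1 / real (Suc b) ^ 2 \<le> 1 / real b - 1 / real (Suc b)" .
    thus ?case using step by simp
  qed simp
  thus ?thesis using assms by (smt (verit) divide_nonneg_nonneg of_nat_0_le_iff)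
qed auto

text \<open>Mean values over the divisors can be inverted without Moebius inversion, because
  \<open>\<zeta>(2) - 1 < 1\<close>: the terms with \<open>m \<ge> 2\<close> act as a contraction on \<open>limsup \<bar>V\<bar>\<close>.\<close>

lemma tendsto_0_if_dilation_sum_tendsto_0:
  fixes V :: "real \<Rightarrow> real"
  assumes bdd: "\<And>X. X > 0 \<Longrightarrow> \<bar>V X\<bar> \<le> B"
    and lim: "((\<lambda>X. \<Sum>m=1..nat \<lfloor>X\<rfloor>. V (X / real m) / real m ^ 2) \<longlongrightarrow> 0) at_top"
  shows "(V \<longlongrightarrow> 0) at_top"
proof -
  have B: "B \<ge> 0" using bdd[of 1] by simp
  \<comment> \<open>The constant 3/4 = 1/4 + 1/2 stems from the term m = 2 and the telescoping bound
    for m >= 3. The terms beyond \<open>a'\<close> see only the global bound B, and those up to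
    \<open>a'\<close> have X / m large enough for the bound b.\<close>
  have step: "\<forall>\<^sub>F X in at_top. \<bar>V X\<bar> \<le> 3 / 4 * b + e"
    if b: "b \<ge> 0" "\<forall>\<^sub>F X in at_top. \<bar>V X\<bar> \<le> b" and e: "e > 0" for b e
  proof -
    obtain X0 where X0: "\<And>X. X \<ge> X0 \<Longrightarrow> \<bar>V X\<bar> \<le> b"
      using b(2) by (auto simp: eventually_at_top_linorder)
    obtain a :: nat where a0: "real a > 2 * B / e" using reals_Archimedean2 by blast
    define a' where "a' = max a 2"
    have a: "real a' > 2 * B / e" "a' \<ge> 2" using a0 by (auto simp: a'_def)
    have aB: "B / real a' \<le> e / 2" using a e by (simp add: field_simps)
    have "\<forall>\<^sub>F X in at_top. \<bar>\<Sum>m=1..nat \<lfloor>X\<rfloor>. V (X / real m) / real m ^ 2\<bar> < e / 2"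
      using tendstoD[OF lim, of "e / 2"] e by simp
    moreover have "\<forall>\<^sub>F X in at_top. X \<ge> real a' \<and> X \<ge> real a' * X0"
      by (intro eventually_conj eventually_ge_at_top)
    ultimately show ?thesis
    proof eventually_elim
      case (elim X)
      define N where "N = nat \<lfloor>X\<rfloor>"
      have N: "a' \<le> N" using elim by (simp add: N_def le_nat_floor)
      define f where "f m = V (X / real m) / real m ^ 2" for m :: nat
      have "sum f {1..N} = f 1 + (sum f {2..a'} + sum f {Suc a'..N})"
      proof -
        have "{1..N} = {1} \<union> ({2..a'} \<union> {Suc a'..N})" using N a by auto
        moreover have "sum f ({1} \<union> ({2..a'} \<union> {Suc a'..N})) = f 1 + sum f ({2..a'} \<union> {Suc a'..N})"
          using a by (subst sum.union_disjoint) auto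
        moreover have "sum f ({2..a'} \<union> {Suc a'..N}) = sum f {2..a'} + sum f {Suc a'..N}"
          by (subst sum.union_disjoint) auto
        ultimately show ?thesis by simp
      qed
      moreover have "\<bar>sum f {2..a'}\<bar> \<le> b * (3 / 4)"
      proof -
        have "\<bar>sum f {2..a'}\<bar> \<le> (\<Sum>m=2..a'. \<bar>f m\<bar>)" by (rule sum_abs)
        also have "\<dots> \<le> (\<Sum>m=2..a'. b * (1 / real m ^ 2))"
        proof (rule sum_mono)
          fix m assume m: "m \<in> {2..a'}"
          have "X0 \<le> X / real m"
          proof (cases "X0 \<ge> 0")
            case True
            have "real m * X0 \<le> real a' * X0" using m True by (intro mult_right_mono) auto
            thus ?thesis using elim m by (simp add: field_simps)
          next
            case False
            have "0 \<le> X / real m" using elim by simp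
            with False show ?thesis by simp
          qed
          thus "\<bar>f m\<bar> \<le> b * (1 / real m ^ 2)" using X0 by (simp add: f_def divide_right_mono)
        qed
        also have "\<dots> = b * (\<Sum>m=2..a'. 1 / real m ^ 2)" by (simp add: sum_distrib_left)
        also have "\<dots> \<le> b * (3 / 4)"
        proof (intro mult_left_mono b)
          have "(\<Sum>m=2..a'. 1 / real m ^ 2) = 1 / 4 + (\<Sum>m=Suc 2..a'. 1 / real m ^ 2)"
            using a by (subst sum.atLeast_Suc_atMost) auto
          thus "(\<Sum>m=2..a'. 1 / real m ^ 2) \<le> 3 / 4"
            using sum_inverse_squares_tail_le[of 2 a'] by simp
        qed
        finally show ?thesis .
      qed
      moreover have "\<bar>sum f {Suc a'..N}\<bar> \<le> e / 2"
      proof -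
        have "\<bar>sum f {Suc a'..N}\<bar> \<le> (\<Sum>m=Suc a'..N. \<bar>f m\<bar>)" by (rule sum_abs)
        also have "\<dots> \<le> (\<Sum>m=Suc a'..N. B * (1 / real m ^ 2))"
        proof (rule sum_mono)
          fix m assume m: "m \<in> {Suc a'..N}"
          have "X / real m > 0" using elim a m by auto
          thus "\<bar>f m\<bar> \<le> B * (1 / real m ^ 2)" using bdd by (simp add: f_def divide_right_mono)
        qed
        also have "\<dots> = B * (\<Sum>m=Suc a'..N. 1 / real m ^ 2)" by (simp add: sum_distrib_left)
        also have "\<dots> \<le> B * (1 / real a')"
          using a by (intro mult_left_mono B sum_inverse_squares_tail_le) auto
        also have "\<dots> \<le> e / 2" using aB by simp
        finally show ?thesis .
      qed
      moreover have "\<bar>sum f {1..N}\<bar> < e / 2" using elim by (simp add: f_def N_def)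
      moreover have "f 1 = V X" by (simp add: f_def)
      ultimately show ?case by linarith
    qed
  qed
  \<comment> \<open>The infimum of this set of eventual bounds is the limes superior of |V|;
    \<open>step\<close> forces it to be at most 3/4 of itself.\<close>
  define S where "S = {b. b \<ge> 0 \<and> (\<forall>\<^sub>F X in at_top. \<bar>V X\<bar> \<le> b)}"
  have BS: "B \<in> S"
    unfolding S_def using B bdd by (auto intro!: eventually_mono[OF eventually_gt_at_top[of 0]])
  have bb: "bdd_below S" by (auto simp: S_def)
  have ge: "Inf S \<le> b" if "b \<in> S" for b using that bb by (rule cInf_lower)
  have "Inf S \<le> 0"
  proof (rule field_le_epsilon)
    fix e :: real assume e: "e > 0"
    obtain b where b: "b \<in> S" "b < Inf S + e / 8"
      using cInf_lessD[of S "Inf S + e / 8"] BS e by auto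
    have "3 / 4 * b + e / 8 \<in> S"
      using step[of b "e / 8"] b e by (auto simp: S_def)
    from ge[OF this] b e show "Inf S \<le> 0 + e" by linarith
  qed
  show ?thesis
  proof (rule tendstoI)
    fix e :: real assume e: "e > 0"
    obtain b where b: "b \<in> S" "b < e"
      using cInf_lessD[of S e] BS e \<open>Inf S \<le> 0\<close> by auto
    hence "\<forall>\<^sub>F X in at_top. \<bar>V X\<bar> \<le> b" by (auto simp: S_def)
    thus "\<forall>\<^sub>F X in at_top. dist (V X) 0 < e" by eventually_elim (use b in auto)
  qed
qed

text \<open>One factor n of n^(j+1) is replaced by the sum of the totients of its divisors d, and n
  is written as m d.\<close>

lemma sum_power_eq_totient_sum:
  "(\<Sum>n=1..N. n ^ Suc j) = (\<Sum>m=1..N. \<Sum>d=1..N div m. m ^ j * (totient d * d ^ j))"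
proof -
  have "(\<Sum>n=1..N. n ^ Suc j) = (\<Sum>n=1..N. \<Sum>d | d dvd n. (n div d) ^ j * (totient d * d ^ j))"
  proof (intro sum.cong refl)
    fix n assume "n \<in> {1..N}"
    have "n ^ Suc j = (\<Sum>d | d dvd n. totient d) * n ^ j"
      by (simp add: totient_divisor_sum)
    also have "\<dots> = (\<Sum>d | d dvd n. totient d * n ^ j)" by (simp add: sum_distrib_right)
    also have "\<dots> = (\<Sum>d | d dvd n. (n div d) ^ j * (totient d * d ^ j))"
    proof (intro sum.cong refl, clarify)
      fix d assume "d dvd n"
      hence "n ^ j = (n div d) ^ j * d ^ j" by (simp flip: power_mult_distrib)
      thus "totient d * n ^ j = (n div d) ^ j * (totient d * d ^ j)" by simp
    qed
    finally show "n ^ Suc j = \<dots>" .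
  qed
  also have "\<dots> = (\<Sum>(n,d)\<in>(SIGMA n:{1..N}. {d. d dvd n}). (n div d) ^ j * (totient d * d ^ j))"
    by (subst sum.Sigma) auto
  finally have *: "(\<Sum>n=1..N. n ^ Suc j) = (\<Sum>(n,d)\<in>(SIGMA n:{1..N}. {d. d dvd n}). (n div d) ^ j * (totient d * d ^ j))" .
  have aux: "k \<le> M" if "0 < b" "b * k \<le> M" for b k M :: nat
    using that by (cases b) auto
  note *
  also have "(\<Sum>(n,d)\<in>(SIGMA n:{1..N}. {d. d dvd n}). (n div d) ^ j * (totient d * d ^ j)) = (\<Sum>(m,d)\<in>(SIGMA m:{1..N}. {1..N div m}). m ^ j * (totient d * d ^ j))"
    by (rule sum.reindex_bij_witness[of _ "\<lambda>(m, d). (m * d, d)" "\<lambda>(n, d). (n div d, d)"])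
       (auto simp: div_le_mono less_eq_div_iff_mult_less_eq Suc_le_eq mult.commute
             intro!: Nat.gr0I elim!: dvdE dest: order.trans[OF div_le_dividend], use aux in blast)
  also have "\<dots> = (\<Sum>m=1..N. \<Sum>d=1..N div m. m ^ j * (totient d * d ^ j))"
    by (subst sum.Sigma) auto
  finally show ?thesis .
qed

text \<open>For the normalised mean A, the dilation sum of A(X / m) / m^2 equals a power sum tending
  to 1 / (j + 2). The constant c is chosen so that c zeta(2) is this limit, and the contraction
  lemma applies to A - c. All exponents j are required, as moments in the variable u.\<close>

lemma totient_power_mean:
  "((\<lambda>X. (\<Sum>q=1..nat \<lfloor>X\<rfloor>. real (totient q) * real q ^ j) / X ^ (j + 2)) \<longlongrightarrow> 6 / pi\<^sup>2 / real (j + 2)) at_top"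
proof -
  define A where "A X = (\<Sum>q=1..nat \<lfloor>X\<rfloor>. real (totient q) * real q ^ j) / X ^ (j + 2)" for X :: real
  define c where "c = 6 / pi\<^sup>2 / real (j + 2)"
  define V where "V X = A X - c" for X
  have A_bdd: "\<bar>A X\<bar> \<le> 1" if "X > 0" for X
  proof -
    have "(\<Sum>q=1..nat \<lfloor>X\<rfloor>. real (totient q) * real q ^ j) \<le> (\<Sum>q=1..nat \<lfloor>X\<rfloor>. X ^ Suc j)"
    proof (rule sum_mono)
      fix q assume "q \<in> {1..nat \<lfloor>X\<rfloor>}"
      hence q: "real q \<le> X" by (simp add: le_nat_floor) linarith
      have "real (totient q) \<le> X" using totient_le[of q] q by linarith
      thus "real (totient q) * real q ^ j \<le> X ^ Suc j"
        using q that by (simp, intro mult_mono power_mono) auto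
    qed
    also have "\<dots> = real (nat \<lfloor>X\<rfloor>) * X ^ Suc j" by simp
    also have "\<dots> \<le> X * X ^ Suc j" using that by (intro mult_right_mono) auto
    finally have "A X \<le> 1" using that by (simp add: A_def field_simps)
    moreover have "A X \<ge> 0" using that unfolding A_def by (intro divide_nonneg_nonneg sum_nonneg) auto
    ultimately show ?thesis by simp
  qed
  have dil: "(\<Sum>m=1..nat \<lfloor>X\<rfloor>. A (X / real m) / real m ^ 2) = (\<Sum>n=1..nat \<lfloor>X\<rfloor>. real n ^ Suc j) / X ^ Suc (Suc j)"
    if "X > 0" for X
  proof -
    have "(\<Sum>n=1..nat \<lfloor>X\<rfloor>. real n ^ Suc j) = real (\<Sum>n=1..nat \<lfloor>X\<rfloor>. n ^ Suc j)" by simp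
    also have "\<dots> = (\<Sum>m=1..nat \<lfloor>X\<rfloor>. real m ^ j * (\<Sum>d=1..nat \<lfloor>X\<rfloor> div m. real (totient d) * real d ^ j))"
      unfolding sum_power_eq_totient_sum by (simp add: sum_distrib_left)
    finally have "(\<Sum>n=1..nat \<lfloor>X\<rfloor>. real n ^ Suc j) / X ^ Suc (Suc j) =
      (\<Sum>m=1..nat \<lfloor>X\<rfloor>. real m ^ j * (\<Sum>d=1..nat \<lfloor>X\<rfloor> div m. real (totient d) * real d ^ j) / X ^ Suc (Suc j))"
      by (simp only: sum_divide_distrib)
    also have "\<dots> = (\<Sum>m=1..nat \<lfloor>X\<rfloor>. A (X / real m) / real m ^ 2)"
    proof (intro sum.cong refl)
      fix m assume m: "m \<in> {1..nat \<lfloor>X\<rfloor>}"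
      have "nat \<lfloor>X / real m\<rfloor> = nat \<lfloor>X\<rfloor> div m"
        using floor_divide_real_eq_div[of "int m" X] that by (simp add: nat_div_distrib)
      thus "real m ^ j * (\<Sum>d=1..nat \<lfloor>X\<rfloor> div m. real (totient d) * real d ^ j) / X ^ Suc (Suc j) = A (X / real m) / real m ^ 2"
        using m that by (simp add: A_def field_simps power2_eq_square)
    qed
    finally show ?thesis ..
  qed
  have zeta: "((\<lambda>X::real. \<Sum>m=1..nat \<lfloor>X\<rfloor>. 1 / real m ^ 2) \<longlongrightarrow> pi\<^sup>2 / 6) at_top"
  proof -
    have "(\<lambda>N. \<Sum>m<N. 1 / real (m + 1) ^ 2) \<longlonglongrightarrow> pi\<^sup>2 / 6"
      using inverse_squares_sums by (simp add: sums_def add.commute)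
    moreover have "(\<Sum>m<N. 1 / real (m + 1) ^ 2) = (\<Sum>m=1..N. 1 / real m ^ 2)" for N
      by (rule sum.reindex_bij_witness[of _ "\<lambda>m. m - 1" "\<lambda>m. m + 1"]) auto
    ultimately have Z1: "(\<lambda>N. \<Sum>m=1..N. 1 / real m ^ 2) \<longlonglongrightarrow> pi\<^sup>2 / 6" by simp
    have Z2: "filterlim (\<lambda>X::real. nat \<lfloor>X\<rfloor>) at_top at_top"
      by (intro filterlim_compose[OF filterlim_nat_sequentially] filterlim_floor_sequentially)
    show ?thesis using filterlim_compose[OF Z1 Z2] by simp
  qed
  have "(V \<longlongrightarrow> 0) at_top"
  proof (rule tendsto_0_if_dilation_sum_tendsto_0)
    show "\<bar>V X\<bar> \<le> 1 + \<bar>c\<bar>" if "X > 0" for X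
      using A_bdd[OF that] unfolding V_def by linarith
    have "((\<lambda>X. (\<Sum>n=1..nat \<lfloor>X\<rfloor>. real n ^ Suc j) / X ^ Suc (Suc j) - c * (\<Sum>m=1..nat \<lfloor>X\<rfloor>. 1 / real m ^ 2))
       \<longlongrightarrow> 1 / real (Suc (Suc j)) - c * (pi\<^sup>2 / 6)) at_top"
      by (intro tendsto_intros sum_power_asymp zeta)
    also have "1 / real (Suc (Suc j)) - c * (pi\<^sup>2 / 6) = 0"
    proof -
      have "6 / pi\<^sup>2 / x * (pi\<^sup>2 / 6) = 1 / x" for x :: real by (cases "x = 0") (simp_all add: field_simps)
      from this[of "real (Suc (Suc j))"] show ?thesis unfolding c_def by (simp only: add_2_eq_Suc')
    qed
    finally show "((\<lambda>X. \<Sum>m=1..nat \<lfloor>X\<rfloor>. V (X / real m) / real m ^ 2) \<longlongrightarrow> 0) at_top"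
    proof (rule Lim_transform_eventually)
      show "\<forall>\<^sub>F X in at_top. (\<Sum>n=1..nat \<lfloor>X\<rfloor>. real n ^ Suc j) / X ^ Suc (Suc j) - c * (\<Sum>m=1..nat \<lfloor>X\<rfloor>. 1 / real m ^ 2)
          = (\<Sum>m=1..nat \<lfloor>X\<rfloor>. V (X / real m) / real m ^ 2)"
        using eventually_gt_at_top[of 0]
        by eventually_elim (simp add: V_def diff_divide_distrib sum_subtractf sum_distrib_left del: power_Suc One_nat_def flip: dil)
    qed
  qed
  hence "((\<lambda>X. V X + c) \<longlongrightarrow> 0 + c) at_top" by (intro tendsto_intros)
  thus ?thesis by (simp add: V_def A_def c_def)
qed

section \<open>Equidistribution of inverse residues\<close>

text \<open>The approximating family h and its limit l may depend on e. In this form the limit is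
  carried from special to general functions, from frozen to true variables, and from cutoffs to
  indicators.\<close>

lemma tendsto_approxI:
  fixes f :: "'a \<Rightarrow> 'b::real_normed_vector"
  assumes "\<And>e. e > 0 \<Longrightarrow> \<exists>h l. (h \<longlongrightarrow> l) F \<and> (\<forall>\<^sub>F x in F. norm (f x - h x) \<le> e) \<and> norm (L - l) \<le> e"
  shows "(f \<longlongrightarrow> L) F"
proof (rule tendstoI)
  fix e :: real assume "e > 0"
  then obtain h l where h: "(h \<longlongrightarrow> l) F" "\<forall>\<^sub>F x in F. norm (f x - h x) \<le> e / 4" "norm (L - l) \<le> e / 4"
    using assms[of "e / 4"] by auto
  have "\<forall>\<^sub>F x in F. dist (h x) l < e / 4" using tendstoD[OF h(1), of "e / 4"] \<open>e > 0\<close> by simp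
  with h(2) show "\<forall>\<^sub>F x in F. dist (f x) L < e"
  proof eventually_elim
    case (elim x)
    have "f x - L = (f x - h x) + (h x - l) - (L - l)" by simp
    also have "norm \<dots> \<le> norm (f x - h x) + norm (h x - l) + norm (L - l)"
      by (meson add_right_mono norm_triangle_ineq norm_triangle_ineq4 order.trans)
    finally show ?case using elim h(3) \<open>e > 0\<close> by (simp add: dist_norm)
  qed
qed

text \<open>The number of terms is asymptotic to (3 / pi^2) (C / r)^2, whence the factor r^2. The
  weight u of the limit density reflects that about q pairs belong to each q.\<close>

definition lattice_mean :: "real \<Rightarrow> real \<Rightarrow> (real \<times> real \<times> real \<Rightarrow> 'a::real_normed_vector) \<Rightarrow> 'a" where
  "lattice_mean C r f = r\<^sup>2 *\<^sub>R
     (\<Sum>q=1..nat \<lfloor>C / r\<rfloor>. \<Sum>(x, z)\<in>unit_pairs q. f (r * real q, of_int x / real q, of_int z / real q))"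

lemma card_unit_pairs_le: "card (unit_pairs q) \<le> q"
proof (cases "q > 0")
  case True
  thus ?thesis using card_unit_pairs[OF True] totient_le[of q] by simp
qed (auto simp: unit_pairs_def)

text \<open>There are at most C / r values of q with at most C / r pairs each. This uniformity in r
  makes approximation in the supremum norm suffice.\<close>

lemma sum_lattice_le:
  fixes f :: "nat \<Rightarrow> int \<times> int \<Rightarrow> 'a::real_normed_vector"
  assumes "C \<ge> 0" "r > 0"
    and "\<And>q p. q \<ge> 1 \<Longrightarrow> r * real q \<le> C \<Longrightarrow> p \<in> unit_pairs q \<Longrightarrow> norm (f q p) \<le> b"
    and "b \<ge> 0"
  shows "norm (r\<^sup>2 *\<^sub>R (\<Sum>q=1..nat \<lfloor>C / r\<rfloor>. \<Sum>p\<in>unit_pairs q. f q p)) \<le> C\<^sup>2 * b"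
proof -
  have q: "r * real q \<le> C" if "q \<in> {1..nat \<lfloor>C / r\<rfloor>}" for q
  proof -
    have "real q \<le> real (nat \<lfloor>C / r\<rfloor>)" using that by simp
    also have "\<dots> \<le> C / r" using assms by simp
    finally show ?thesis using assms by (simp add: field_simps)
  qed
  have "norm (\<Sum>q=1..nat \<lfloor>C / r\<rfloor>. \<Sum>p\<in>unit_pairs q. f q p) \<le> (\<Sum>q=1..nat \<lfloor>C / r\<rfloor>. \<Sum>p\<in>unit_pairs q. b)"
    using q assms by (intro order.trans[OF norm_sum] sum_mono) auto
  also have "\<dots> \<le> (\<Sum>q=1..nat \<lfloor>C / r\<rfloor>. C / r * b)"
  proof (rule sum_mono)
    fix q assume "q \<in> {1..nat \<lfloor>C / r\<rfloor>}"
    hence "real q \<le> C / r" using q assms by (simp add: field_simps)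
    moreover have "real (card (unit_pairs q)) \<le> real q" using card_unit_pairs_le by simp
    ultimately have "real (card (unit_pairs q)) * b \<le> C / r * b"
      using \<open>b \<ge> 0\<close> by (intro mult_right_mono) auto
    thus "(\<Sum>p\<in>unit_pairs q. b) \<le> C / r * b" by simp
  qed
  also have "\<dots> = real (nat \<lfloor>C / r\<rfloor>) * (C / r * b)" by simp
  also have "\<dots> \<le> (C / r) * (C / r * b)"
    using assms by (intro mult_right_mono mult_nonneg_nonneg) auto
  finally have "norm (\<Sum>q=1..nat \<lfloor>C / r\<rfloor>. \<Sum>p\<in>unit_pairs q. f q p) \<le> (C / r) * (C / r * b)" .
  hence "r\<^sup>2 * norm (\<Sum>q=1..nat \<lfloor>C / r\<rfloor>. \<Sum>p\<in>unit_pairs q. f q p) \<le> r\<^sup>2 * ((C / r) * (C / r * b))"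
    by (intro mult_left_mono) auto
  also have "\<dots> = C\<^sup>2 * b" using assms by (simp add: field_simps power2_eq_square)
  finally show ?thesis by simp
qed

lemma unit_pairs_box:
  assumes "(x, z) \<in> unit_pairs q" "q \<ge> 1" "r > 0" "r * real q \<le> C"
  shows "(r * real q, of_int x / real q, of_int z / real q) \<in> cbox (0, 0, 0) (C, 1, 1)"
proof -
  have "x \<ge> 0" "z \<ge> 0" "x \<le> int q" "z \<le> int q" using assms by (auto simp: unit_pairs_def)
  hence "real_of_int x \<ge> 0" "real_of_int z \<ge> 0" "real_of_int x \<le> real q" "real_of_int z \<le> real q"
    by linarith+
  thus ?thesis using assms by (auto simp: cbox_Pair_eq cbox_interval divide_le_eq_1)
qed

lemma norm_lattice_mean_le:
  assumes "C \<ge> 0" "r > 0" "b \<ge> 0"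
    and "\<And>p. p \<in> cbox (0, 0, 0) (C, 1, 1) \<Longrightarrow> norm (f p) \<le> b"
  shows "norm (lattice_mean C r f) \<le> C\<^sup>2 * b"
  unfolding lattice_mean_def case_prod_unfold
  by (rule sum_lattice_le) (use assms unit_pairs_box[OF _ _ assms(2)] in auto)

lemma lattice_mean_add: "lattice_mean C r (\<lambda>p. f p + g p) = lattice_mean C r f + lattice_mean C r g"
  by (simp add: lattice_mean_def sum.distrib case_prod_unfold scaleR_add_right)

lemma lattice_mean_diff: "lattice_mean C r (\<lambda>p. f p - g p) = lattice_mean C r f - lattice_mean C r g"
  by (simp add: lattice_mean_def sum_subtractf case_prod_unfold scaleR_diff_right)

lemma lattice_mean_mult_left:
  fixes f :: "real \<times> real \<times> real \<Rightarrow> complex"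
  shows "lattice_mean C r (\<lambda>p. c * f p) = c * lattice_mean C r f"
  by (simp add: lattice_mean_def sum_distrib_left case_prod_unfold mult_scaleR_right)

lemma lattice_mean_of_real: "lattice_mean C r (\<lambda>p. complex_of_real (f p)) = of_real (lattice_mean C r f)"
  by (simp add: lattice_mean_def case_prod_unfold scaleR_conv_of_real)

abbreviation trig_monom :: "nat \<Rightarrow> int \<Rightarrow> int \<Rightarrow> real \<times> real \<times> real \<Rightarrow> complex" where
  "trig_monom j m n \<equiv> \<lambda>p. of_real (fst p) ^ j * cis (2 * pi * (of_int m * fst (snd p) + of_int n * snd (snd p)))"

lemma lattice_mean_trig_monom:
  "lattice_mean C r (trig_monom j m n) =
     r\<^sup>2 *\<^sub>R (\<Sum>q=1..nat \<lfloor>C / r\<rfloor>. of_real ((r * real q) ^ j) * kloosterman m n q)"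
  unfolding lattice_mean_def kloosterman_def case_prod_unfold root_char_def sum_distrib_left
  by (simp add: add_divide_distrib ring_distribs mult.assoc)

lemma integral_cis:
  "integral {0..1} (\<lambda>x. cis (2 * pi * (of_int m * x))) = (if m = 0 then 1 else 0)"
proof (cases "m = 0")
  case False
  define c where "c = 2 * of_real pi * of_int m * \<i>"
  have c: "c \<noteq> 0" using False by (simp add: c_def)
  have cis: "cis (2 * pi * (of_int m * x)) = exp (c * of_real x)" for x
    by (simp add: cis_conv_exp c_def mult_ac)
  have "((\<lambda>x. exp (c * of_real x)) has_integral (exp (c * of_real 1) / c - exp (c * of_real 0) / c)) {0..1}"
  proof (rule fundamental_theorem_of_calculus)
    fix x :: real
    show "((\<lambda>x. exp (c * of_real x) / c) has_vector_derivative exp (c * of_real x)) (at x within {0..1})"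
      by (rule has_vector_derivative_real_field[of "\<lambda>z. exp (c * z) / c"]) (auto intro!: derivative_eq_intros simp: c)
  qed simp
  hence "((\<lambda>x. cis (2 * pi * (of_int m * x))) has_integral (cis (2 * pi * of_int m) / c - 1 / c)) {0..1}"
    using cis[of 1] by (simp add: cis)
  moreover have "cis (2 * pi * of_int m) = 1" by (rule cis_multiple_2pi) auto
  ultimately show ?thesis using False by (simp add: integral_unique)
qed auto

lemma integral_trig_monom:
  assumes "C > 0"
  shows "integral (cbox (0, 0, 0) (C, 1, 1)) (\<lambda>p. fst p *\<^sub>R trig_monom j m n p) =
    (if m = 0 \<and> n = 0 then of_real (C ^ (j + 2) / real (j + 2)) else 0)"
proof -
  have split: "fst p *\<^sub>R trig_monom j m n p =
     of_real (fst p ^ Suc j) * (cis (2 * pi * (of_int m * fst (snd p))) * cis (2 * pi * (of_int n * snd (snd p))))" for p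
    by (simp add: scaleR_conv_of_real cis_mult ring_distribs)
  have inner: "integral (cbox (0, 0) (1, 1)) (\<lambda>p. cis (2 * pi * (of_int m * fst p)) * cis (2 * pi * (of_int n * snd p))) =
     (if m = 0 then 1 else 0) * (if n = 0 then 1 else 0)"
  proof -
    have "integral (cbox (0, 0) (1, 1)) (\<lambda>p. cis (2 * pi * (of_int m * fst p)) * cis (2 * pi * (of_int n * snd p))) =
       integral (cbox 0 1) (\<lambda>x. integral (cbox 0 1) (\<lambda>y. cis (2 * pi * (of_int m * x)) * cis (2 * pi * (of_int n * y))))"
      by (subst integral_prod_continuous) (auto intro!: continuous_intros)
    also have "\<dots> = (if m = 0 then 1 else 0) * (if n = 0 then 1 else 0)"
      unfolding integral_mult_right integral_mult_left cbox_interval integral_cis ..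
    finally show ?thesis .
  qed
  have "integral (cbox (0, 0, 0) (C, 1, 1)) (\<lambda>p. fst p *\<^sub>R trig_monom j m n p) =
     integral (cbox 0 C) (\<lambda>u. integral (cbox (0, 0) (1, 1)) (\<lambda>p. of_real (u ^ Suc j) * (cis (2 * pi * (of_int m * fst p)) * cis (2 * pi * (of_int n * snd p)))))"
    unfolding split by (subst integral_prod_continuous) (auto intro!: continuous_intros)
  also have "\<dots> = integral (cbox 0 C) (\<lambda>u. of_real (u ^ Suc j) * ((if m = 0 then 1 else 0) * (if n = 0 then 1 else 0)))"
    unfolding integral_mult_right inner ..
  also have "\<dots> = of_real (integral {0..C} (\<lambda>u. u ^ Suc j)) * ((if m = 0 then 1 else 0) * (if n = 0 then 1 else 0))"
  proof -
    have "integral {0..C} (\<lambda>u. complex_of_real (u ^ Suc j)) = of_real (integral {0..C} (\<lambda>u. u ^ Suc j))"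
      using integral_linear[OF integrable_continuous_interval bounded_linear_of_real[where ?'a = complex], of 0 C "\<lambda>u. u ^ Suc j"]
      by (simp add: o_def continuous_intros del: power_Suc)
    thus ?thesis by (simp add: cbox_interval del: power_Suc)
  qed
  also have "integral {0..C} (\<lambda>u. u ^ Suc j) = C ^ (j + 2) / real (j + 2)"
  proof -
    have "((\<lambda>u. u ^ Suc j) has_integral (C ^ (j + 2) / real (j + 2) - 0 ^ (j + 2) / real (j + 2))) {0..C}"
    proof (rule fundamental_theorem_of_calculus)
      fix x assume "x \<in> {0..C}"
      have "((\<lambda>u. u ^ (j + 2) / real (j + 2)) has_real_derivative real (j + 2) * x ^ (j + 2 - Suc 0) / real (j + 2)) (at x within {0..C})"
        by (intro DERIV_cdivide DERIV_pow)
      thus "((\<lambda>u. u ^ (j + 2) / real (j + 2)) has_vector_derivative x ^ Suc j) (at x within {0..C})"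
        by (simp add: has_real_derivative_iff_has_vector_derivative del: power_Suc of_nat_add)
    qed (use assms in simp)
    thus ?thesis by (simp add: integral_unique)
  qed
  finally show ?thesis by auto
qed

lemma filterlim_divide_at_right_0:
  assumes "C > (0::real)"
  shows "filterlim (\<lambda>r. C / r) at_top (at_right 0)"
  using assms by real_asymp


text \<open>For the trivial character the Kloosterman sum is the totient, whose mean produces 6 /
  pi^2. For all others the integral is 0 and the mean of |K| / q tends to 0.\<close>

lemma lattice_mean_trig_monom_tendsto:
  assumes C: "C > 0"
  shows "((\<lambda>r. lattice_mean C r (trig_monom j m n)) \<longlongrightarrow>
     of_real (6 / pi\<^sup>2) * integral (cbox (0, 0, 0) (C, 1, 1)) (\<lambda>p. fst p *\<^sub>R trig_monom j m n p)) (at_right 0)"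
proof (cases "m = 0 \<and> n = 0")
  case True
  have "((\<lambda>r. (\<Sum>q=1..nat \<lfloor>C / r\<rfloor>. real (totient q) * real q ^ j) / (C / r) ^ (j + 2)) \<longlongrightarrow> 6 / pi\<^sup>2 / real (j + 2)) (at_right 0)"
    by (rule filterlim_compose[OF totient_power_mean filterlim_divide_at_right_0[OF C]])
  hence "((\<lambda>r. C ^ (j + 2) * ((\<Sum>q=1..nat \<lfloor>C / r\<rfloor>. real (totient q) * real q ^ j) / (C / r) ^ (j + 2))) \<longlongrightarrow>
      C ^ (j + 2) * (6 / pi\<^sup>2 / real (j + 2))) (at_right 0)"
    by (rule tendsto_mult_left)
  hence "((\<lambda>r. complex_of_real (C ^ (j + 2) * ((\<Sum>q=1..nat \<lfloor>C / r\<rfloor>. real (totient q) * real q ^ j) / (C / r) ^ (j + 2)))) \<longlongrightarrow>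
      of_real (C ^ (j + 2) * (6 / pi\<^sup>2 / real (j + 2)))) (at_right 0)"
    by (rule tendsto_of_real)
  also have "complex_of_real (C ^ (j + 2) * (6 / pi\<^sup>2 / real (j + 2))) =
     of_real (6 / pi\<^sup>2) * integral (cbox (0, 0, 0) (C, 1, 1)) (\<lambda>p. fst p *\<^sub>R trig_monom j m n p)"
  proof -
    have "C ^ (j + 2) * (6 / pi\<^sup>2 / real (j + 2)) = 6 / pi\<^sup>2 * (C ^ (j + 2) / real (j + 2))" by simp
    thus ?thesis unfolding integral_trig_monom[OF C] if_P[OF True] by (simp only: of_real_mult)
  qed
  finally show ?thesis
  proof (rule Lim_transform_eventually)
    show "\<forall>\<^sub>F r in at_right 0. complex_of_real (C ^ (j + 2) * ((\<Sum>q=1..nat \<lfloor>C / r\<rfloor>. real (totient q) * real q ^ j) / (C / r) ^ (j + 2)))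
       = lattice_mean C r (trig_monom j m n)"
      using eventually_at_right_less[of "0::real"]
    proof eventually_elim
      case (elim r)
      have "lattice_mean C r (trig_monom j m n) = r\<^sup>2 *\<^sub>R (\<Sum>q=1..nat \<lfloor>C / r\<rfloor>. of_real ((r * real q) ^ j) * of_real (real (totient q)))"
        unfolding lattice_mean_trig_monom
      proof (intro arg_cong[where f = "\<lambda>x. r\<^sup>2 *\<^sub>R x"] sum.cong refl arg_cong2[where f = "(*)"])
        fix q assume "q \<in> {1..nat \<lfloor>C / r\<rfloor>}"
        thus "kloosterman m n q = of_real (real (totient q))"
          using True by (simp add: kloosterman_def case_prod_unfold card_unit_pairs)
      qed
      also have "\<dots> = of_real (r\<^sup>2 * (\<Sum>q=1..nat \<lfloor>C / r\<rfloor>. (r * real q) ^ j * real (totient q)))"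
        by (simp add: scaleR_conv_of_real)
      also have "r\<^sup>2 * (\<Sum>q=1..nat \<lfloor>C / r\<rfloor>. (r * real q) ^ j * real (totient q)) =
         (C ^ (j + 2) * ((\<Sum>q=1..nat \<lfloor>C / r\<rfloor>. real (totient q) * real q ^ j) / (C / r) ^ (j + 2)))"
        using elim C by (simp add: power_divide power_mult_distrib sum_distrib_left sum_divide_distrib mult_ac power_add power2_eq_square)
      finally show ?case ..
    qed
  qed
next
  case False
  \<comment> \<open>One of m and n is nonzero; the symmetry of the sum moves it to the second place,
    where the mean value result wants it.\<close>
  have mean: "(\<lambda>X::nat. (\<Sum>q=1..X. norm (kloosterman m n q) / real q) / real X) \<longlonglongrightarrow> 0"
    using False kloosterman_mean_tendsto_0[of n m] kloosterman_mean_tendsto_0[of m n] kloosterman_commute[of m n]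
    by (cases "n = 0") auto
  have "filterlim (\<lambda>r. nat \<lfloor>C / r\<rfloor>) at_top (at_right 0)"
    by (intro filterlim_compose[OF filterlim_nat_sequentially] filterlim_compose[OF filterlim_floor_sequentially]
        filterlim_divide_at_right_0 C)
  from filterlim_compose[OF mean this]
  have "((\<lambda>r. C ^ (j + 2) * ((\<Sum>q=1..nat \<lfloor>C / r\<rfloor>. norm (kloosterman m n q) / real q) / real (nat \<lfloor>C / r\<rfloor>))) \<longlongrightarrow> C ^ (j + 2) * 0) (at_right 0)"
    by (intro tendsto_intros)
  hence lim0: "((\<lambda>r. C ^ (j + 2) * ((\<Sum>q=1..nat \<lfloor>C / r\<rfloor>. norm (kloosterman m n q) / real q) / real (nat \<lfloor>C / r\<rfloor>))) \<longlongrightarrow> 0) (at_right 0)"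
    by simp
  have "((\<lambda>r. lattice_mean C r (trig_monom j m n)) \<longlongrightarrow> 0) (at_right 0)"
  proof (rule Lim_null_comparison[OF _ lim0])
    show "\<forall>\<^sub>F r in at_right 0. norm (lattice_mean C r (trig_monom j m n)) \<le>
      C ^ (j + 2) * ((\<Sum>q=1..nat \<lfloor>C / r\<rfloor>. norm (kloosterman m n q) / real q) / real (nat \<lfloor>C / r\<rfloor>))"
      using eventually_at_right_less[of "0::real"]
    proof eventually_elim
      case (elim r)
      define N where "N = nat \<lfloor>C / r\<rfloor>"
      define S where "S = (\<Sum>q=1..N. norm (kloosterman m n q) / real q)"
      have N: "r * real N \<le> C" 
      proof -
        have "real N \<le> C / r" using elim C by (simp add: N_def)
        thus ?thesis using elim by (simp add: field_simps)
      qed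
      have "norm (lattice_mean C r (trig_monom j m n)) \<le> r\<^sup>2 * (\<Sum>q=1..N. (r * real q) ^ j * norm (kloosterman m n q))"
        unfolding lattice_mean_trig_monom using elim
        by (auto simp: N_def norm_mult norm_power intro!: mult_left_mono order.trans[OF norm_sum] sum_mono)
      \<comment> \<open>The bound |K| <= N |K| / q produces the mean value; afterwards r N <= C
        absorbs both factors r.\<close>
      also have "\<dots> \<le> r\<^sup>2 * (\<Sum>q=1..N. C ^ j * (real N * (norm (kloosterman m n q) / real q)))"
      proof (intro mult_left_mono sum_mono mult_mono power_mono)
        fix q assume q: "q \<in> {1..N}"
        have "r * real q \<le> r * real N" using q elim by simp
        thus "r * real q \<le> C" using N by simp
        have "norm (kloosterman m n q) * real q \<le> norm (kloosterman m n q) * real N"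
          using q by (intro mult_left_mono) auto
        thus "norm (kloosterman m n q) \<le> real N * (norm (kloosterman m n q) / real q)"
          using q by (simp add: field_simps)
      qed (use elim C in auto)
      also have "\<dots> = C ^ j * (r * real N) * (r * S)"
        by (simp add: S_def sum_distrib_left power2_eq_square mult_ac)
      also have "\<dots> \<le> C ^ j * C * (C * (S / real N))"
      proof (rule mult_mono)
        show "C ^ j * (r * real N) \<le> C ^ j * C" using N C by (intro mult_left_mono) auto
        show "r * S \<le> C * (S / real N)"
        proof (cases "N = 0")
          case False
          have S0: "S \<ge> 0" unfolding S_def by (intro sum_nonneg) auto
          have "r * real N * S \<le> C * S" using N S0 by (intro mult_right_mono)
          thus ?thesis using False by (simp add: field_simps)
        qed (simp add: S_def)
      qed (use elim C N in \<open>auto simp: S_def intro!: sum_nonneg mult_nonneg_nonneg\<close>)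
      also have "\<dots> = C ^ (j + 2) * (S / real N)" by (simp add: power_add power2_eq_square)
      finally show ?case by (simp add: S_def N_def)
    qed
  qed
  thus ?thesis unfolding integral_trig_monom[OF C] using False by auto
qed

section \<open>Trigonometric polynomials and Stone-Weierstrass\<close>

inductive trig_poly :: "(real \<times> real \<times> real \<Rightarrow> complex) \<Rightarrow> bool" where
  monom: "trig_poly (\<lambda>p. c * trig_monom j m n p)"
| add: "trig_poly f \<Longrightarrow> trig_poly g \<Longrightarrow> trig_poly (\<lambda>p. f p + g p)"

lemma trig_poly_mult_monom:
  assumes "trig_poly f"
  shows "trig_poly (\<lambda>p. c * trig_monom j m n p * f p)"
  using assms
proof induction
  case (monom c' j' m' n')
  have "(\<lambda>p. c * trig_monom j m n p * (c' * trig_monom j' m' n' p)) = (\<lambda>p. (c * c') * trig_monom (j + j') (m + m') (n + n') p)"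
  proof
    fix p :: "real \<times> real \<times> real"
    have "cis (2 * pi * (of_int m * fst (snd p) + of_int n * snd (snd p))) * cis (2 * pi * (of_int m' * fst (snd p) + of_int n' * snd (snd p)))
      = cis (2 * pi * (of_int (m + m') * fst (snd p) + of_int (n + n') * snd (snd p)))"
      unfolding cis_mult by (simp add: algebra_simps)
    thus "c * trig_monom j m n p * (c' * trig_monom j' m' n' p) = (c * c') * trig_monom (j + j') (m + m') (n + n') p"
      by (simp add: power_add mult_ac)
  qed
  thus ?case by (simp only: trig_poly.monom)
next
  case (add f g)
  thus ?case by (simp add: ring_distribs trig_poly.add)
qed

lemma trig_poly_mult:
  assumes "trig_poly f" "trig_poly g"
  shows "trig_poly (\<lambda>p. f p * g p)"
  using assms(1)
proof induction
  case (monom c j m n)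
  show ?case using trig_poly_mult_monom[OF assms(2)] .
next
  case (add f1 f2)
  thus ?case by (simp add: ring_distribs trig_poly.add)
qed

text \<open>The box with opposite faces in x and y glued together, realised in a Euclidean space,
  where real polynomials are uniformly dense on compact sets.\<close>

definition torus_map :: "real \<times> real \<times> real \<Rightarrow> real \<times> complex \<times> complex" where
  "torus_map p = (fst p, cis (2 * pi * fst (snd p)), cis (2 * pi * snd (snd p)))"

text \<open>It is enough to treat linear functionals: real and imaginary parts of \<open>cis\<close>
  are combinations of the characters with frequencies 1 and -1, and trigonometric polynomials form
  an algebra.\<close>

lemma trig_poly_real_polynomial:
  assumes "real_polynomial_function g"
  shows "trig_poly (\<lambda>p. complex_of_real (g (torus_map p)))"
  using assms
proof induction
  case (linear h)
  interpret bounded_linear h by fact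
  define a where "a = complex_of_real (h (1, 0, 0))"
  define b where "b = complex_of_real (h (0, 1, 0))"
  define c where "c = complex_of_real (h (0, \<i>, 0))"
  define d where "d = complex_of_real (h (0, 0, 1))"
  define e where "e = complex_of_real (h (0, 0, \<i>))"
  have dec: "h (u, z, w) = u * h (1, 0, 0) + Re z * h (0, 1, 0) + Im z * h (0, \<i>, 0) + Re w * h (0, 0, 1) + Im w * h (0, 0, \<i>)" for u z w
  proof -
    have "(u, z, w) = u *\<^sub>R (1, 0, 0) + Re z *\<^sub>R (0, 1, 0) + Im z *\<^sub>R (0, \<i>, 0) + Re w *\<^sub>R (0, 0, 1) + Im w *\<^sub>R (0, 0, \<i>)"
      by (simp add: complex_eq_iff)
    thus ?thesis by (simp only: add scaleR real_scaleR_def)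
  qed
  have "complex_of_real (h (fst p, cis (2 * pi * fst (snd p)), cis (2 * pi * snd (snd p)))) =
      a * trig_monom 1 0 0 p + ((b / 2 + c / (2 * \<i>)) * trig_monom 0 1 0 p +
      ((b / 2 - c / (2 * \<i>)) * trig_monom 0 (-1) 0 p + ((d / 2 + e / (2 * \<i>)) * trig_monom 0 0 1 p +
      (d / 2 - e / (2 * \<i>)) * trig_monom 0 0 (-1) p)))" for p
    unfolding dec[of "fst p"] a_def b_def c_def d_def e_def
    by (simp add: complex_eq_iff Re_divide Im_divide power2_eq_square algebra_simps)
  thus ?case unfolding torus_map_def by (simp only:) (intro trig_poly.intros)
next
  case (const c)
  have "trig_poly (\<lambda>p. complex_of_real c * trig_monom 0 0 0 p)" by (rule trig_poly.monom)
  thus ?case by simp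
next
  case (add f g)
  thus ?case by (simp add: trig_poly.add)
next
  case (mult f g)
  thus ?case by (simp add: trig_poly_mult)
qed

lemma continuous_on_trig_poly: "trig_poly f \<Longrightarrow> continuous_on S f"
  by (induction rule: trig_poly.induct) (auto intro!: continuous_intros)

lemma lattice_mean_trig_poly_tendsto:
  assumes "trig_poly f" "C > 0"
  shows "((\<lambda>r. lattice_mean C r f) \<longlongrightarrow>
     of_real (6 / pi\<^sup>2) * integral (cbox (0, 0, 0) (C, 1, 1)) (\<lambda>p. fst p *\<^sub>R f p)) (at_right 0)"
  using assms(1)
proof induction
  case (monom c j m n)
  have "((\<lambda>r. c * lattice_mean C r (trig_monom j m n)) \<longlongrightarrow>
     c * (of_real (6 / pi\<^sup>2) * integral (cbox (0, 0, 0) (C, 1, 1)) (\<lambda>p. fst p *\<^sub>R trig_monom j m n p))) (at_right 0)"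
    by (intro tendsto_intros lattice_mean_trig_monom_tendsto assms)
  moreover have "integral (cbox (0, 0, 0) (C, 1, 1)) (\<lambda>p. fst p *\<^sub>R (c * trig_monom j m n p)) =
     c * integral (cbox (0, 0, 0) (C, 1, 1)) (\<lambda>p. fst p *\<^sub>R trig_monom j m n p)"
    by (subst integral_mult_right[symmetric]) (auto simp: mult_scaleR_right)
  ultimately show ?case unfolding lattice_mean_mult_left by (simp add: mult_ac)
next
  case (add f g)
  have "integral (cbox (0, 0, 0) (C, 1, 1)) (\<lambda>p. fst p *\<^sub>R (f p + g p)) =
     integral (cbox (0, 0, 0) (C, 1, 1)) (\<lambda>p. fst p *\<^sub>R f p) + integral (cbox (0, 0, 0) (C, 1, 1)) (\<lambda>p. fst p *\<^sub>R g p)"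
    unfolding scaleR_add_right
    by (intro integral_add integrable_continuous continuous_intros continuous_on_trig_poly add)
  with tendsto_add[OF add.IH] show ?case unfolding lattice_mean_add by (simp add: ring_distribs)
qed

lemma cis_2pi_eq_iff:
  assumes "x \<in> {0..1}" "y \<in> {0..1}" "cis (2 * pi * x) = cis (2 * pi * y)"
  shows "x = y \<or> (x = 0 \<and> y = 1) \<or> (x = 1 \<and> y = 0)"
proof -
  have "cis (2 * pi * x - 2 * pi * y) = 1"
    using assms(3) by (simp flip: cis_divide)
  hence "cos (2 * pi * x - 2 * pi * y) = 1" by (simp add: complex_eq_iff)
  then obtain k :: int where "2 * pi * x - 2 * pi * y = of_int k * 2 * pi"
    using cos_one_2pi_int by blast
  hence "2 * pi * (x - y) = 2 * pi * of_int k" by (simp add: algebra_simps)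
  hence k: "x - y = of_int k" by simp
  hence "real_of_int k \<le> 1" "real_of_int k \<ge> -1" using assms by auto
  hence "k = -1 \<or> k = 0 \<or> k = 1" by linarith
  thus ?thesis using k assms by auto
qed

text \<open>A periodic f descends to a continuous function on the compact image of
  \<open>torus_map\<close>. A polynomial close to it there pulls back to a trigonometric polynomial
  uniformly close to f, for which the limit is known.\<close>

theorem lattice_mean_tendsto:
  fixes f :: "real \<times> real \<times> real \<Rightarrow> real"
  assumes C: "C > 0" and cont: "continuous_on (cbox (0, 0, 0) (C, 1, 1)) f"
    and per1: "\<And>u y. u \<in> {0..C} \<Longrightarrow> y \<in> {0..1} \<Longrightarrow> f (u, 0, y) = f (u, 1, y)"
    and per2: "\<And>u x. u \<in> {0..C} \<Longrightarrow> x \<in> {0..1} \<Longrightarrow> f (u, x, 0) = f (u, x, 1)"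
  shows "((\<lambda>r. lattice_mean C r f) \<longlongrightarrow> 6 / pi\<^sup>2 * integral (cbox (0, 0, 0) (C, 1, 1)) (\<lambda>p. fst p * f p)) (at_right 0)"
proof (rule tendsto_approxI)
  fix e :: real assume e: "e > 0"
  define B where "B = cbox (0 :: real, 0 :: real, 0 :: real) (C, 1, 1)"
  \<comment> \<open>Dominates both error factors: C^2 for the lattice mean and (6 / pi^2) C C for
    the integral, where the box has volume C and the weight u is at most C.\<close>
  define c where "c = 6 / pi\<^sup>2 * (C * C) + C\<^sup>2"
  have c: "c > 0" unfolding c_def using C by (intro add_nonneg_pos) auto
  define S where "S = torus_map ` B"
  have cont_tm: "continuous_on A torus_map" for A unfolding torus_map_def by (intro continuous_intros)
  have "compact S" unfolding S_def by (intro compact_continuous_image cont_tm) (simp add: B_def)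
  \<comment> \<open>The choice of the preimage is immaterial: \<open>torus_map\<close> identifies
    only points with coordinates 0 and 1 in place of each other, where f agrees by
    periodicity.\<close>
  define F where "F s = f (SOME p. p \<in> B \<and> torus_map p = s)" for s
  have F: "F (torus_map p) = f p" if p: "p \<in> B" for p
  proof -
    define p' where "p' = (SOME p'. p' \<in> B \<and> torus_map p' = torus_map p)"
    have p': "p' \<in> B" "torus_map p' = torus_map p"
      unfolding p'_def using someI_ex[of "\<lambda>p'. p' \<in> B \<and> torus_map p' = torus_map p"] p by blast+
    obtain u x y where u: "p = (u, x, y)" by (metis surj_pair)
    obtain u' x' y' where u': "p' = (u', x', y')" by (metis surj_pair)
    have "u' = u" using p' u u' by (simp add: torus_map_def)
    have in01: "u \<in> {0..C}" "x \<in> {0..1}" "y \<in> {0..1}" "x' \<in> {0..1}" "y' \<in> {0..1}"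
      using p p'(1) unfolding B_def u u' by (auto simp: cbox_Pair_eq cbox_interval)
    have "x' = x \<or> (x' = 0 \<and> x = 1) \<or> (x' = 1 \<and> x = 0)"
      using p'(2) in01 unfolding u u' by (intro cis_2pi_eq_iff) (auto simp: torus_map_def)
    moreover have "y' = y \<or> (y' = 0 \<and> y = 1) \<or> (y' = 1 \<and> y = 0)"
      using p'(2) in01 unfolding u u' by (intro cis_2pi_eq_iff) (auto simp: torus_map_def)
    ultimately have "f (u, x', y') = f (u, x, y)"
      using per1[of u] per2[of u] in01 by (elim disjE conjE) simp_all
    moreover have "F (torus_map p) = f p'" by (simp add: F_def p'_def)
    ultimately show ?thesis using u u' \<open>u' = u\<close> by simp
  qed
  \<comment> \<open>\<open>torus_map\<close> is a closed map on the compact box, so the preimage of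
    a closed set under F is the compact image of a closed set in the box.\<close>
  have "continuous_on S F"
  proof (rule continuous_on_closed_vimage[THEN iffD2, rule_format])
    show "closed S" using \<open>compact S\<close> by (rule compact_imp_closed)
    fix T :: "real set" assume "closed T"
    have "closed (f -` T \<inter> B)"
      using cont \<open>closed T\<close> continuous_on_closed_vimage[of B f] unfolding B_def by (simp add: closed_cbox)
    hence "compact (f -` T \<inter> B)" by (metis B_def compact_cbox compact_Int_closed inf_commute inf_assoc inf_idem)
    hence "compact (torus_map ` (f -` T \<inter> B))" by (intro compact_continuous_image cont_tm)
    moreover have "torus_map ` (f -` T \<inter> B) = F -` T \<inter> S" using F by (auto simp: S_def)
    ultimately show "closed (F -` T \<inter> S)" by (simp add: compact_imp_closed)
  qed
  then obtain g where g: "real_polynomial_function g" "\<And>s. s \<in> S \<Longrightarrow> \<bar>F s - g s\<bar> < e / c"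
    using Stone_Weierstrass_real_polynomial_function[OF \<open>compact S\<close>, of F "e / c"] e c by auto
  define h where "h p = g (torus_map p)" for p
  have fh: "\<bar>f p - h p\<bar> \<le> e / c" if "p \<in> B" for p
    using g(2)[of "torus_map p"] that F[OF that] by (auto simp: S_def h_def)
  have trig: "trig_poly (\<lambda>p. complex_of_real (h p))"
    unfolding h_def by (rule trig_poly_real_polynomial[OF g(1)])
  have cont_h: "continuous_on A h" for A
    using continuous_on_Re[OF continuous_on_trig_poly[OF trig]] by simp
  have int_h: "(\<lambda>p. fst p * h p) integrable_on B" "(\<lambda>p. fst p * f p) integrable_on B"
    unfolding B_def by (intro integrable_continuous continuous_intros cont_h cont)+
  have "((\<lambda>r. Re (lattice_mean C r (\<lambda>p. complex_of_real (h p)))) \<longlongrightarrow>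
     Re (of_real (6 / pi\<^sup>2) * integral B (\<lambda>p. fst p *\<^sub>R complex_of_real (h p)))) (at_right 0)"
    unfolding B_def by (intro tendsto_Re lattice_mean_trig_poly_tendsto trig C)
  also have "integral B (\<lambda>p. fst p *\<^sub>R complex_of_real (h p)) = of_real (integral B (\<lambda>p. fst p * h p))"
    using integral_linear[OF int_h(1) bounded_linear_of_real[where ?'a = complex]]
    by (simp add: o_def scaleR_conv_of_real)
  finally have lim: "((\<lambda>r. lattice_mean C r h) \<longlongrightarrow> 6 / pi\<^sup>2 * integral B (\<lambda>p. fst p * h p)) (at_right 0)"
    by (simp add: lattice_mean_of_real)
  show "\<exists>h l. (h \<longlongrightarrow> l) (at_right 0) \<and> (\<forall>\<^sub>F r in at_right 0. norm (lattice_mean C r f - h r) \<le> e) \<and>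
     norm (6 / pi\<^sup>2 * integral (cbox (0, 0, 0) (C, 1, 1)) (\<lambda>p. fst p * f p) - l) \<le> e"
  proof (intro exI conjI, rule lim)
    show "\<forall>\<^sub>F r in at_right 0. norm (lattice_mean C r f - lattice_mean C r h) \<le> e"
      using eventually_at_right_less[of "0::real"]
    proof eventually_elim
      case (elim r)
      have "norm (lattice_mean C r (\<lambda>p. f p - h p)) \<le> C\<^sup>2 * (e / c)"
        by (rule norm_lattice_mean_le) (use elim C e c fh in \<open>auto simp: B_def\<close>)
      also have "\<dots> \<le> c * (e / c)" using C e c by (intro mult_right_mono) (auto simp: c_def)
      finally show ?case using c by (simp add: lattice_mean_diff)
    qed
    have "6 / pi\<^sup>2 * integral B (\<lambda>p. fst p * f p) - 6 / pi\<^sup>2 * integral B (\<lambda>p. fst p * h p)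
        = 6 / pi\<^sup>2 * integral B (\<lambda>p. fst p * (f p - h p))"
      using integral_diff[OF int_h(2) int_h(1)] by (simp add: right_diff_distrib diff_divide_distrib)
    also have "norm \<dots> = 6 / pi\<^sup>2 * norm (integral B (\<lambda>p. fst p * (f p - h p)))" by (simp add: abs_mult)
    also have "\<dots> \<le> 6 / pi\<^sup>2 * (C * (e / c) * measure lborel B)"
      unfolding B_def
    proof (rule mult_left_mono)
    show "norm (integral (cbox (0, 0, 0) (C, 1, 1)) (\<lambda>p. fst p * (f p - h p))) \<le> C * (e / c) * measure lborel (cbox (0::real, 0::real, 0::real) (C, 1, 1))"
    proof (rule integrable_bound)
      show "(\<lambda>p. fst p * (f p - h p)) integrable_on cbox (0, 0, 0) (C, 1, 1)"
        by (intro integrable_continuous continuous_intros cont_h cont)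
      fix p :: "real \<times> real \<times> real" assume p: "p \<in> cbox (0, 0, 0) (C, 1, 1)"
      hence "\<bar>fst p\<bar> \<le> C" by (cases p) (auto simp: cbox_Pair_eq cbox_interval)
      with fh[of p] p show "norm (fst p * (f p - h p)) \<le> C * (e / c)"
        unfolding real_norm_def abs_mult by (intro mult_mono) (use C e c in \<open>auto simp: B_def\<close>)
    qed (use C e c in auto)
    qed simp
    also have "measure lborel B = C" unfolding B_def content_Pair using C by simp
    finally have "norm (6 / pi\<^sup>2 * integral B (\<lambda>p. fst p * f p) - 6 / pi\<^sup>2 * integral B (\<lambda>p. fst p * h p))
       \<le> 6 / pi\<^sup>2 * (C * C) * (e / c)" by (simp add: mult_ac)
    also have "\<dots> \<le> c * (e / c)" using C e c by (intro mult_right_mono) (auto simp: c_def)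
    finally show "norm (6 / pi\<^sup>2 * integral (cbox (0, 0, 0) (C, 1, 1)) (\<lambda>p. fst p * f p) - 6 / pi\<^sup>2 * integral B (\<lambda>p. fst p * h p)) \<le> e"
      using c by (simp add: B_def)
  qed
qed

section \<open>Sums of integrals over the slope\<close>

lemma lborel_integral_compact_support:
  fixes f :: "real \<Rightarrow> real"
  assumes "continuous_on UNIV f" "\<And>x. f x \<noteq> 0 \<Longrightarrow> x \<in> {a..b}"
  shows "integrable lborel f" "(LINT x|lborel. f x) = integral {a..b} f"
proof -
  have ind: "f = (\<lambda>x. indicator {a..b} x *\<^sub>R f x)"
    using assms(2) by (auto simp: indicator_def fun_eq_iff)
  have int: "set_integrable lborel {a..b} f"
    by (intro borel_integrable_atLeastAtMost' continuous_on_subset[OF assms(1)]) auto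
  thus "integrable lborel f" using ind by (simp add: set_integrable_def)
  have "(LINT x|lborel. f x) = (LINT x:{a..b}|lborel. f x)"
    unfolding set_lebesgue_integral_def by (subst ind) simp
  also have "\<dots> = integral {a..b} f" by (rule set_borel_integral_eq_integral(2)[OF int])
  finally show "(LINT x|lborel. f x) = integral {a..b} f" .
qed

text \<open>For each (q, a) the integrand lives where t is within r W / q of a / q. Substituting t =
  a / q + (r / q) w costs the Jacobian r / q = r^2 / u, and the slow variable t may then be frozen
  at x = a / q. What remains is a lattice mean of H / u, and the weight u of the limit density
  cancels the denominator.\<close>

theorem lattice_integral_sum_tendsto:
  fixes G :: "real \<Rightarrow> real \<Rightarrow> real \<Rightarrow> real \<Rightarrow> real"
  assumes cont: "continuous_on UNIV (\<lambda>(u, x, w, y). G u x w y)"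
    and supp: "\<And>u x w y. G u x w y \<noteq> 0 \<Longrightarrow> u \<in> {c..C} \<and> x \<in> {\<delta>..1 - \<delta>} \<and> w \<in> {-W..W}"
    and pos: "0 < c" "0 < C" "0 < \<delta>" "0 < W"
    and per: "\<And>u x w. G u x w 0 = G u x w 1"
  shows "((\<lambda>r::real. \<Sum>q=1..nat \<lfloor>C / r\<rfloor>. \<Sum>p\<in>unit_pairs q.
        LINT t|lborel. G (r * q) t ((q * t - of_int (fst p)) / r) (of_int (snd p) / q)) \<longlongrightarrow>
      6 / pi\<^sup>2 * integral (cbox (0, 0, 0) (C, 1, 1)) (\<lambda>(u, x, y). integral {-W..W} (\<lambda>w. G u x w y))) (at_right 0)"
proof -
  define H where "H = (\<lambda>(u, x, y). integral {-W..W} (\<lambda>w. G u x w y))"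
  \<comment> \<open>The maximum keeps the denominator away from 0; below c the function H vanishes
    anyway, so that u f = H everywhere.\<close>
  define f where "f p = H p / max c (fst p)" for p
  have contG: "continuous_on A (\<lambda>z. G (a1 z) (a2 z) (a3 z) (a4 z))"
    if "continuous_on A a1" "continuous_on A a2" "continuous_on A a3" "continuous_on A a4"
    for A :: "'z::topological_space set" and a1 a2 a3 a4
    using continuous_on_compose2[OF cont continuous_on_Pair[OF that(1) continuous_on_Pair[OF that(2) continuous_on_Pair[OF that(3,4)]]]]
    by simp
  have contH: "continuous_on A H" for A
  proof -
    have "continuous_on A (\<lambda>p. integral (cbox (-W) W) (\<lambda>w. G (fst p) (fst (snd p)) w (snd (snd p))))"
      by (intro integral_continuous_on_param) (auto simp: case_prod_unfold intro!: contG continuous_intros)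
    thus ?thesis by (simp add: H_def case_prod_unfold cbox_interval)
  qed
  have H0: "H (u, x, y) = 0" if "u < c \<or> x < \<delta> \<or> x > 1 - \<delta>" for u x y
  proof -
    have "G u x w y = 0" for w using supp[of u x w y] that by force
    thus ?thesis by (simp add: H_def)
  qed
  have lim: "((\<lambda>r. lattice_mean C r f) \<longlongrightarrow> 6 / pi\<^sup>2 * integral (cbox (0, 0, 0) (C, 1, 1)) (\<lambda>p. fst p * f p)) (at_right 0)"
  proof (rule lattice_mean_tendsto)
    show "continuous_on (cbox (0, 0, 0) (C, 1, 1)) f"
      unfolding f_def using pos by (auto intro!: continuous_intros contH)
    show "f (u, x, 0) = f (u, x, 1)" for u x by (simp add: f_def H_def per)
    show "f (u, 0, y) = f (u, 1, y)" for u y using pos by (simp add: f_def H0)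
  qed (use pos in simp)
  have uf: "fst p * f p = H p" for p
    using pos H0[of "fst p" "fst (snd p)" "snd (snd p)"] by (auto simp: f_def max_def)
  have lim': "((\<lambda>r. lattice_mean C r f) \<longlongrightarrow> 6 / pi\<^sup>2 * integral (cbox (0, 0, 0) (C, 1, 1)) H) (at_right 0)"
    using lim unfolding uf .
  have "((\<lambda>r::real. \<Sum>q=1..nat \<lfloor>C / r\<rfloor>. \<Sum>p\<in>unit_pairs q.
        LINT t|lborel. G (r * q) t ((q * t - of_int (fst p)) / r) (of_int (snd p) / q)) \<longlongrightarrow>
      6 / pi\<^sup>2 * integral (cbox (0, 0, 0) (C, 1, 1)) H) (at_right 0)"
  proof (rule tendsto_approxI)
    fix e :: real assume e: "e > 0"
    define \<eta> where "\<eta> = e * c / (C\<^sup>2 * (2 * W))"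
    have \<eta>: "\<eta> > 0" using e pos by (simp add: \<eta>_def)
    \<comment> \<open>The range of x is enlarged to [-1, 2], because x + r w / q may leave [0, 1] by
      less than 1.\<close>
    define K where "K = cbox (0 :: real, - 1 :: real, - W, 0 :: real) (C, 2, W, 1)"
    have "uniformly_continuous_on K (\<lambda>(u, x, w, y). G u x w y)"
      by (intro compact_uniformly_continuous continuous_on_subset[OF cont]) (auto simp: K_def)
    then obtain d where d: "d > 0"
      "\<And>p p'. p \<in> K \<Longrightarrow> p' \<in> K \<Longrightarrow> dist p' p < d \<Longrightarrow>
          dist ((\<lambda>(u, x, w, y). G u x w y) p') ((\<lambda>(u, x, w, y). G u x w y) p) < \<eta>"
      using \<eta> by (metis uniformly_continuous_on_def)
    have ev: "\<forall>\<^sub>F r in at_right 0. r\<^sup>2 * (W / c) < min d 1"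
    proof -
      have "((\<lambda>r. r\<^sup>2 * (W / c)) \<longlongrightarrow> 0\<^sup>2 * (W / c)) (at_right 0)" by (intro tendsto_intros)
      thus ?thesis using d(1) by (intro order_tendstoD) auto
    qed
    show "\<exists>h l. (h \<longlongrightarrow> l) (at_right 0) \<and> (\<forall>\<^sub>F r in at_right (0::real). norm ((\<Sum>q=1..nat \<lfloor>C / r\<rfloor>. \<Sum>p\<in>unit_pairs q.
        LINT t|lborel. G (r * q) t ((q * t - of_int (fst p)) / r) (of_int (snd p) / q)) - h r) \<le> e) \<and>
      norm (6 / pi\<^sup>2 * integral (cbox (0, 0, 0) (C, 1, 1)) H - l) \<le> e"
    proof (intro exI conjI, rule lim')
      show "\<forall>\<^sub>F r in at_right (0::real). norm ((\<Sum>q=1..nat \<lfloor>C / r\<rfloor>. \<Sum>p\<in>unit_pairs q.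
        LINT t|lborel. G (r * q) t ((q * t - of_int (fst p)) / r) (of_int (snd p) / q)) - lattice_mean C r f) \<le> e"
        using eventually_at_right_less[of "0::real"] ev
      proof eventually_elim
        case (elim r)
        define I where "I q p = (LINT t|lborel. G (r * real q) t ((real q * t - of_int (fst p)) / r) (of_int (snd p) / real q))"
          for q and p :: "int \<times> int"
        define D where "D q p = I q p / r\<^sup>2 - f (r * real q, of_int (fst p) / real q, of_int (snd p) / real q)"
          for q and p :: "int \<times> int"
        have "(\<Sum>q=1..nat \<lfloor>C / r\<rfloor>. \<Sum>p\<in>unit_pairs q. I q p) - lattice_mean C r f =
            r\<^sup>2 *\<^sub>R (\<Sum>q=1..nat \<lfloor>C / r\<rfloor>. \<Sum>p\<in>unit_pairs q. D q p)"
          using elim by (simp add: lattice_mean_def D_def case_prod_unfold sum_subtractf right_diff_distrib sum_distrib_left)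
        also have "norm \<dots> \<le> C\<^sup>2 * (2 * W * \<eta> / c)"
        proof (rule sum_lattice_le)
          fix q :: nat and p assume q: "q \<ge> 1" "r * real q \<le> C" "p \<in> unit_pairs q"
          define u where "u = r * real q"
          define x where "x = of_int (fst p) / real q"
          define y where "y = of_int (snd p) / real q"
          have u: "u > 0" "u \<le> C" using q elim by (auto simp: u_def)
          have box: "(u, x, y) \<in> cbox (0, 0, 0) (C, 1, 1)"
            using unit_pairs_box[of "fst p" "snd p" q r C] q elim by (simp add: u_def x_def y_def)
          have y: "y \<in> {0..1}" and x: "x \<in> {0..1}" using box by (auto simp: cbox_Pair_eq cbox_interval)
          have I_eq: "I q p / r\<^sup>2 = integral {-W..W} (\<lambda>w. G u (x + r * w / q) w y) / u"
          proof -
            have "I q p = (r / q) * (LINT w|lborel. G u (x + r / q * w) w y)"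
              unfolding I_def using q elim
              by (subst lborel_integral_real_affine[of "r / q" _ x]) (auto simp: u_def x_def y_def field_simps)
            also have "(LINT w|lborel. G u (x + r / q * w) w y) = integral {-W..W} (\<lambda>w. G u (x + r / q * w) w y)"
              using supp q by (intro lborel_integral_compact_support contG) (auto intro!: continuous_intros)
            finally show ?thesis using q elim by (simp add: u_def power2_eq_square field_simps)
          qed
          show "norm (D q p) \<le> 2 * W * \<eta> / c"
          proof (cases "u < c")
            case True
            hence "G u x' w y = 0" for x' w using supp[of u x' w y] by force
            hence "D q p = 0" unfolding D_def I_eq using H0[of u x y] True by (simp add: f_def u_def x_def y_def)
            thus ?thesis using pos \<eta> by simp
          next
            case False
            have Df: "D q p = (integral {-W..W} (\<lambda>w. G u (x + r * w / q) w y) - integral {-W..W} (\<lambda>w. G u x w y)) / u"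
              unfolding D_def I_eq using False by (simp add: f_def H_def u_def x_def y_def diff_divide_distrib max_def)
            also have "integral {-W..W} (\<lambda>w. G u (x + r * w / q) w y) - integral {-W..W} (\<lambda>w. G u x w y) =
               integral {-W..W} (\<lambda>w. G u (x + r * w / q) w y - G u x w y)"
              using q by (intro integral_diff[symmetric] integrable_continuous_interval contG continuous_intros) auto
            also have "norm (\<dots> / u) \<le> (\<eta> * (W - (- W))) / u"
              unfolding norm_divide
            proof (intro divide_mono)
              show "norm (integral {-W..W} (\<lambda>w. G u (x + r * w / q) w y - G u x w y)) \<le> \<eta> * (W - (- W))"
              proof (rule integral_bound)
                show "continuous_on {-W..W} (\<lambda>w. G u (x + r * w / q) w y - G u x w y)"
                  using q by (intro contG continuous_intros) auto
                fix w assume w: "w \<in> {-W..W}"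
                \<comment> \<open>Since q = u / r, the displacement of the slow variable is of order
                  r^2, uniformly for u >= c.\<close>
                have "\<bar>r * w / q\<bar> = r\<^sup>2 * (\<bar>w\<bar> / u)" using q elim
                  by (simp add: u_def abs_mult power2_eq_square field_simps)
                also have "\<dots> \<le> r\<^sup>2 * (W / c)"
                  using w False pos by (intro mult_left_mono frac_le) auto
                also have "\<dots> < min d 1" by fact
                finally have sm: "\<bar>r * w / q\<bar> < d" "\<bar>r * w / q\<bar> < 1" by auto
                have xb: "- 1 \<le> x + r * w / q" "x + r * w / q \<le> 2"
                  using sm(2) x unfolding abs_less_iff atLeastAtMost_iff by linarith+
                have "dist (G u (x + r * w / q) w y) (G u x w y) < \<eta>"
                  using d(2)[of "(u, x, w, y)" "(u, x + r * w / q, w, y)"] x y u w sm xb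
                  by (auto simp: K_def cbox_Pair_eq cbox_interval dist_Pair_Pair dist_real_def abs_le_iff)
                thus "norm (G u (x + r * w / q) w y - G u x w y) \<le> \<eta>" by (simp add: dist_real_def)
              qed (use pos in auto)
            qed (use u pos \<eta> in auto)
            also have "\<dots> \<le> 2 * W * \<eta> / c" using False pos \<eta> by (simp add: frac_le mult_ac)
            finally show ?thesis .
          qed
        qed (use elim pos \<eta> in auto)
        also have "\<dots> = e" using pos by (simp add: \<eta>_def field_simps)
        finally show ?case by (simp add: I_def)
      qed
    qed (use e in simp)
  qed
  thus ?thesis by (simp add: H_def)
qed

text \<open>In s = 2 u \<sigma>(x) and h = h' + w / \<sigma>(x) the factors \<sigma> of the two
  Jacobians cancel and a factor 1/2 is left. The integral over x therefore separates, and 6 / pi^2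
  turns into 3 / pi^2.\<close>

lemma lattice_integral_sum_scaled_tendsto:
  fixes \<Psi> :: "real \<Rightarrow> real \<Rightarrow> real \<Rightarrow> real" and g \<sigma> :: "real \<Rightarrow> real"
  assumes cont: "continuous_on UNIV (\<lambda>(s, h, y). \<Psi> s h y)"
    and supp: "\<And>s h y. \<Psi> s h y \<noteq> 0 \<Longrightarrow> s \<in> {s0..S0} \<and> h \<in> {-2..2}"
    and pos: "0 < s0" "s0 < S0"
    and per: "\<And>s h. \<Psi> s h 0 = \<Psi> s h 1"
    and g: "continuous_on UNIV g" "\<And>x. g x \<noteq> 0 \<Longrightarrow> x \<in> {\<delta>..1 - \<delta>}" "\<delta> > 0"
    and \<sigma>: "continuous_on UNIV \<sigma>" "\<And>x. \<sigma> x \<ge> 1" "\<And>x. x \<in> {0..1} \<Longrightarrow> \<sigma> x \<le> \<Sigma>"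
    and h': "\<bar>h'\<bar> \<le> 1" and C: "C \<ge> S0"
  shows "((\<lambda>r::real. \<Sum>q=1..nat \<lfloor>C / r\<rfloor>. \<Sum>p\<in>unit_pairs q.
        LINT t|lborel. g t * \<Psi> (2 * (r * q) * \<sigma> t) (h' + (q * t - of_int (fst p)) / r / \<sigma> t) (of_int (snd p) / q)) \<longlongrightarrow>
      3 / pi\<^sup>2 * (LINT x|lborel. g x) * (LINT s|lborel. LINT h|lborel. integral {0..1} (\<Psi> s h))) (at_right 0)"
proof -
  \<comment> \<open>On the support |h| <= 2 and |h'| <= 1, so |w| <= 3 \<sigma>(x).\<close>
  define W where "W = 3 * \<Sigma>"
  define G where "G u x w y = g x * \<Psi> (2 * u * \<sigma> x) (h' + w / \<sigma> x) y" for u x w y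
  have \<Sigma>: "\<Sigma> \<ge> 1" using \<sigma>(2)[of 0] \<sigma>(3)[of 0] by simp
  have \<sigma>0: "\<sigma> x > 0" "\<sigma> x \<noteq> 0" for x using \<sigma>(2)[of x] by auto
  have cont\<Psi>: "continuous_on A (\<lambda>z. \<Psi> (a1 z) (a2 z) (a3 z))"
    if "continuous_on A a1" "continuous_on A a2" "continuous_on A a3"
    for A :: "'z::topological_space set" and a1 a2 a3
    using continuous_on_compose2[OF cont continuous_on_Pair[OF that(1) continuous_on_Pair[OF that(2,3)]]]
    by simp
  have contg: "continuous_on A (\<lambda>z. g (a z))" "continuous_on A (\<lambda>z. \<sigma> (a z))" if "continuous_on A a"
    for A :: "'z::topological_space set" and a
    using continuous_on_compose2[OF g(1) that] continuous_on_compose2[OF \<sigma>(1) that] by auto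
  have suppG: "u \<in> {s0 / (2 * \<Sigma>)..C} \<and> x \<in> {\<delta>..1 - \<delta>} \<and> w \<in> {-W..W}" if "G u x w y \<noteq> 0" for u x w y
  proof -
    have x: "x \<in> {\<delta>..1 - \<delta>}" using that g(2) by (auto simp: G_def)
    have \<sigma>x: "\<sigma> x \<le> \<Sigma>" "\<sigma> x \<ge> 1" using x \<sigma> \<open>\<delta> > 0\<close> by auto
    have s: "s0 \<le> 2 * u * \<sigma> x" "2 * u * \<sigma> x \<le> S0" "h' + w / \<sigma> x \<in> {-2..2}"
      using supp[of "2 * u * \<sigma> x" "h' + w / \<sigma> x" y] that by (auto simp: G_def)
    have "0 < u * \<sigma> x" using s pos by simp
    hence u: "u > 0" using \<sigma>0[of x] by (simp add: zero_less_mult_iff)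
    have "u * 1 \<le> u * \<sigma> x" using u \<sigma>x by (intro mult_left_mono) auto
    hence 1: "u \<le> C" using s C u by linarith
    have "u * \<sigma> x \<le> u * \<Sigma>" using u \<sigma>x by (intro mult_left_mono) auto
    hence "s0 \<le> 2 * (u * \<Sigma>)" using s by linarith
    hence 2: "s0 / (2 * \<Sigma>) \<le> u" using \<Sigma> by (simp add: field_simps)
    have "\<bar>w / \<sigma> x\<bar> \<le> 3" using s(3) h' by auto
    hence "\<bar>w\<bar> \<le> 3 * \<sigma> x" using \<sigma>0[of x] by (simp add: field_simps)
    hence "\<bar>w\<bar> \<le> W" using \<sigma>x by (simp add: W_def)
    thus ?thesis using 1 2 x by auto
  qed
  have contG: "continuous_on A (\<lambda>z. G (a1 z) (a2 z) (a3 z) (a4 z))"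
    if "continuous_on A a1" "continuous_on A a2" "continuous_on A a3" "continuous_on A a4"
    for A :: "'z::topological_space set" and a1 a2 a3 a4
    unfolding G_def using that \<sigma>0 by (intro continuous_intros cont\<Psi> contg) auto
  define \<Psi>1 where "\<Psi>1 s h = integral {0..1} (\<Psi> s h)" for s h
  define \<Psi>2 where "\<Psi>2 s = (LINT h|lborel. \<Psi>1 s h)" for s
  have cont\<Psi>1: "continuous_on A (\<lambda>z. \<Psi>1 (a z) (b z))" if "continuous_on A a" "continuous_on A b"
    for A :: "'z::topological_space set" and a b
  proof -
    have "continuous_on A (\<lambda>z. integral (cbox 0 1) (\<Psi> (a z) (b z)))"
      by (intro integral_continuous_on_param)
         (auto simp: case_prod_unfold intro!: cont\<Psi> continuous_intros
               intro: continuous_on_compose2[OF that(1)] continuous_on_compose2[OF that(2)])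
    thus ?thesis by (simp add: \<Psi>1_def cbox_interval)
  qed
  have supp1: "s \<in> {s0..S0} \<and> h \<in> {-2..2}" if "\<Psi>1 s h \<noteq> 0" for s h
  proof (rule ccontr)
    assume "\<not> ?thesis"
    hence "\<Psi> s h = (\<lambda>y. 0)" using supp by blast
    thus False using that by (simp add: \<Psi>1_def)
  qed
  have \<Psi>2_eq: "\<Psi>2 s = integral {-2..2} (\<Psi>1 s)" for s
    unfolding \<Psi>2_def using supp1 by (intro lborel_integral_compact_support cont\<Psi>1 continuous_intros) auto
  have cont\<Psi>2: "continuous_on UNIV \<Psi>2"
  proof -
    have "continuous_on UNIV (\<lambda>s. integral (cbox (-2) 2) (\<Psi>1 s))"
      by (intro integral_continuous_on_param) (auto simp: case_prod_unfold intro!: cont\<Psi>1 continuous_intros)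
    thus ?thesis by (simp add: \<Psi>2_eq[abs_def] cbox_interval)
  qed
  have supp2: "s \<in> {s0..S0}" if "\<Psi>2 s \<noteq> 0" for s
  proof (rule ccontr)
    assume "\<not> ?thesis"
    hence "\<Psi>1 s = (\<lambda>h. 0)" using supp1 by blast
    thus False using that by (simp add: \<Psi>2_def)
  qed
  have wint: "integral {-W..W} (\<lambda>w. integral {0..1} (G u x w)) = g x * (\<sigma> x * \<Psi>2 (2 * u * \<sigma> x))" for u x
  proof -
    have "integral {-W..W} (\<lambda>w. integral {0..1} (G u x w)) = integral {-W..W} (\<lambda>w. g x * \<Psi>1 (2 * u * \<sigma> x) (h' + w / \<sigma> x))"
      by (simp add: G_def[abs_def] \<Psi>1_def)
    also have "\<dots> = (LINT w|lborel. g x * \<Psi>1 (2 * u * \<sigma> x) (h' + w / \<sigma> x))"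
    proof (intro lborel_integral_compact_support(2)[symmetric] continuous_intros cont\<Psi>1)
      fix w assume "g x * \<Psi>1 (2 * u * \<sigma> x) (h' + w / \<sigma> x) \<noteq> 0"
      hence "integral {0..1} (G u x w) \<noteq> 0" by (simp add: G_def[abs_def] \<Psi>1_def)
      then obtain y where "G u x w y \<noteq> 0" by (metis integral_0 ext)
      thus "w \<in> {-W..W}" using suppG by blast
    qed (use \<sigma>0 in auto)
    also have "\<dots> = g x * (LINT w|lborel. \<Psi>1 (2 * u * \<sigma> x) (h' + (1 / \<sigma> x) * w))" by simp
    also have "(LINT w|lborel. \<Psi>1 (2 * u * \<sigma> x) (h' + (1 / \<sigma> x) * w)) = \<sigma> x * \<Psi>2 (2 * u * \<sigma> x)"
      unfolding \<Psi>2_def using \<sigma>0[of x] by (subst (2) lborel_integral_real_affine[of "1 / \<sigma> x" _ h']) auto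
    finally show ?thesis .
  qed
  have uint: "integral {0..C} (\<lambda>u. g x * (\<sigma> x * \<Psi>2 (2 * u * \<sigma> x))) = g x * ((LINT s|lborel. \<Psi>2 s) / 2)" for x
  proof -
    have "integral {0..C} (\<lambda>u. g x * (\<sigma> x * \<Psi>2 (2 * u * \<sigma> x))) = g x * (\<sigma> x * integral {0..C} (\<lambda>u. \<Psi>2 (2 * u * \<sigma> x)))"
      by simp
    also have "integral {0..C} (\<lambda>u. \<Psi>2 (2 * u * \<sigma> x)) = (LINT u|lborel. \<Psi>2 (2 * u * \<sigma> x))"
    proof (rule lborel_integral_compact_support(2)[symmetric])
      show "continuous_on UNIV (\<lambda>u. \<Psi>2 (2 * u * \<sigma> x))"
        by (rule continuous_on_compose2[OF cont\<Psi>2]) (auto intro!: continuous_intros)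
      fix u assume "\<Psi>2 (2 * u * \<sigma> x) \<noteq> 0"
      from supp2[OF this] have s: "s0 \<le> 2 * u * \<sigma> x" "2 * u * \<sigma> x \<le> S0" by auto
      have "0 < u * \<sigma> x" using s pos by simp
      hence u: "u > 0" using \<sigma>0[of x] by (simp add: zero_less_mult_iff)
      have "u * 1 \<le> u * \<sigma> x" using u \<sigma>(2)[of x] by (intro mult_left_mono) auto
      hence "u \<le> C" using s C u by linarith
      thus "u \<in> {0..C}" using u by simp
    qed
    also have "\<dots> = (LINT s|lborel. \<Psi>2 s) / (2 * \<sigma> x)"
      using \<sigma>0[of x] by (subst (2) lborel_integral_real_affine[of "2 * \<sigma> x" _ 0]) (auto simp: mult_ac)
    finally show ?thesis using \<sigma>0[of x] by simp
  qed
  have "integral (cbox (0, 0, 0) (C, 1, 1)) (\<lambda>(u, x, y). integral {-W..W} (\<lambda>w. G u x w y)) =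
     integral (cbox 0 C) (\<lambda>u. integral (cbox (0, 0) (1, 1)) (\<lambda>(x, y). integral {-W..W} (\<lambda>w. G u x w y)))"
  proof (subst integral_prod_continuous)
    have "continuous_on (cbox (0, 0, 0) (C, 1, 1)) (\<lambda>p. integral (cbox (-W) W) (\<lambda>w. G (fst p) (fst (snd p)) w (snd (snd p))))"
      by (intro integral_continuous_on_param) (auto simp: case_prod_unfold intro!: contG continuous_intros)
    thus "continuous_on (cbox (0, 0, 0) (C, 1, 1)) (\<lambda>(u, x, y). integral {-W..W} (\<lambda>w. G u x w y))"
      by (simp add: case_prod_unfold cbox_interval)
  qed simp
  also have "\<dots> = integral (cbox 0 C) (\<lambda>u. integral (cbox 0 1) (\<lambda>x. g x * (\<sigma> x * \<Psi>2 (2 * u * \<sigma> x))))"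
  proof (rule integral_cong)
    fix u
    have "integral (cbox (0, 0) (1, 1)) (\<lambda>(x, y). integral {-W..W} (\<lambda>w. G u x w y)) =
       integral (cbox 0 1) (\<lambda>x. integral (cbox 0 1) (\<lambda>y. integral {-W..W} (\<lambda>w. G u x w y)))"
    proof (subst integral_prod_continuous)
      have "continuous_on (cbox (0, 0) (1, 1)) (\<lambda>p. integral (cbox (-W) W) (\<lambda>w. G u (fst p) w (snd p)))"
        by (intro integral_continuous_on_param) (auto simp: case_prod_unfold intro!: contG continuous_intros)
      thus "continuous_on (cbox (0, 0) (1, 1)) (\<lambda>(x, y). integral {-W..W} (\<lambda>w. G u x w y))"
        by (simp add: case_prod_unfold cbox_interval)
    qed simp
    also have "\<dots> = integral (cbox 0 1) (\<lambda>x. g x * (\<sigma> x * \<Psi>2 (2 * u * \<sigma> x)))"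
    proof (rule integral_cong)
      fix x
      have "integral (cbox 0 1) (\<lambda>y. integral (cbox (-W) W) (\<lambda>w. G u x w y)) = integral (cbox (-W) W) (\<lambda>w. integral (cbox 0 1) (G u x w))"
        by (rule integral_swap_continuous) (auto simp: case_prod_unfold intro!: contG continuous_intros)
      thus "integral (cbox 0 1) (\<lambda>y. integral {-W..W} (\<lambda>w. G u x w y)) = g x * (\<sigma> x * \<Psi>2 (2 * u * \<sigma> x))"
        by (simp add: wint)
    qed
    finally show "integral (cbox (0, 0) (1, 1)) (\<lambda>(x, y). integral {-W..W} (\<lambda>w. G u x w y)) =
      integral (cbox 0 1) (\<lambda>x. g x * (\<sigma> x * \<Psi>2 (2 * u * \<sigma> x)))" .
  qed
  also have "\<dots> = integral (cbox 0 1) (\<lambda>x. integral (cbox 0 C) (\<lambda>u. g x * (\<sigma> x * \<Psi>2 (2 * u * \<sigma> x))))"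
    by (rule integral_swap_continuous)
       (auto simp: case_prod_unfold intro!: continuous_intros contg continuous_on_compose2[OF cont\<Psi>2])
  also have "\<dots> = integral {0..1} g * ((LINT s|lborel. \<Psi>2 s) / 2)"
    unfolding cbox_interval uint by simp
  also have "integral {0..1} g = (LINT x|lborel. g x)"
    using g by (intro lborel_integral_compact_support(2)[symmetric]) force+
  finally have eq: "6 / pi\<^sup>2 * integral (cbox (0, 0, 0) (C, 1, 1)) (\<lambda>(u, x, y). integral {-W..W} (\<lambda>w. G u x w y)) =
      3 / pi\<^sup>2 * (LINT x|lborel. g x) * (LINT s|lborel. LINT h|lborel. integral {0..1} (\<Psi> s h))"
    by (simp add: \<Psi>2_def \<Psi>1_def)
  have "((\<lambda>r::real. \<Sum>q=1..nat \<lfloor>C / r\<rfloor>. \<Sum>p\<in>unit_pairs q.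
        LINT t|lborel. G (r * q) t ((q * t - of_int (fst p)) / r) (of_int (snd p) / q)) \<longlongrightarrow>
      6 / pi\<^sup>2 * integral (cbox (0, 0, 0) (C, 1, 1)) (\<lambda>(u, x, y). integral {-W..W} (\<lambda>w. G u x w y))) (at_right 0)"
  proof (rule lattice_integral_sum_tendsto[where c = "s0 / (2 * \<Sigma>)" and \<delta> = \<delta>])
    show "continuous_on UNIV (\<lambda>(u, x, w, y). G u x w y)"
      unfolding case_prod_unfold by (intro contG continuous_intros)
    show "G u x w 0 = G u x w 1" for u x w by (simp add: G_def per)
    show "u \<in> {s0 / (2 * \<Sigma>)..C} \<and> x \<in> {\<delta>..1 - \<delta>} \<and> w \<in> {- W..W}" if "G u x w y \<noteq> 0" for u x w y
      by (rule suppG[OF that])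
  qed (use pos C g(3) \<Sigma> in \<open>auto simp: W_def\<close>)
  from this[unfolded eq] show ?thesis unfolding G_def .
qed

section \<open>Flight along a line\<close>

lemma plane_lattice_diff: "p \<in> plane_lattice \<Longrightarrow> k \<in> plane_lattice \<Longrightarrow> p - k \<in> plane_lattice"
  by (auto simp: plane_lattice_def)

lemma plane_latticeE:
  assumes "p \<in> plane_lattice"
  obtains m n :: int where "p = Complex (of_int m) (of_int n)"
  using assms by (auto simp: plane_lattice_def complex_eq_iff elim!: Ints_cases)

lemma plane_lattice_norm_ge_1:
  assumes "p \<in> plane_lattice" "p \<noteq> 0"
  shows "1 \<le> (norm p)\<^sup>2"
proof -
  obtain m n :: int where p: "p = Complex (of_int m) (of_int n)" using plane_latticeE[OF assms(1)] .
  have "m \<noteq> 0 \<or> n \<noteq> 0" using assms(2) p by (auto simp: complex_eq_iff)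
  hence "m\<^sup>2 + n\<^sup>2 > 0" by (simp add: sum_power2_gt_zero_iff)
  hence "1 \<le> m\<^sup>2 + n\<^sup>2" by simp
  hence "real_of_int 1 \<le> real_of_int (m\<^sup>2 + n\<^sup>2)" by (simp only: of_int_le_iff)
  thus ?thesis by (simp add: p cmod_power2)
qed

lemma dist_plane_lattice_ge_1:
  assumes "p \<in> plane_lattice" "k \<in> plane_lattice" "p \<noteq> k"
  shows "1 \<le> dist p k"
proof -
  have "1 \<le> (norm (p - k))\<^sup>2" using assms by (intro plane_lattice_norm_ge_1 plane_lattice_diff) auto
  thus ?thesis unfolding dist_norm using power2_le_imp_le[of 1 "norm (p - k)"] by simp
qed

lemma closed_plane_lattice: "closed plane_lattice"
  by (rule discrete_imp_closed[of 1]) (use dist_plane_lattice_ge_1 in \<open>force simp: dist_commute dist_norm\<close>)+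

lemma zero_in_plane_lattice [simp]: "0 \<in> plane_lattice"
  by (auto simp: plane_lattice_def)

lemma infdist_plane_lattice_attained:
  obtains k where "k \<in> plane_lattice" "infdist x plane_lattice = dist x k"
proof (rule infdist_attains_inf[OF closed_plane_lattice])
  show "plane_lattice \<noteq> {}" using zero_in_plane_lattice by blast
qed (rule that)

lemma frontier_billiard_table:
  assumes r: "0 < r" "r < 1 / 2"
  shows "frontier (billiard_table r) = {x. infdist x plane_lattice = r}"
proof (intro equalityI subsetI)
  fix x assume x: "x \<in> frontier (billiard_table r)"
  have cont: "continuous_on UNIV (\<lambda>x. infdist x plane_lattice)" by (intro continuous_intros)
  have "open (billiard_table r)"
    unfolding billiard_table_def by (intro open_Collect_less continuous_intros)
  moreover have "closure (billiard_table r) \<subseteq> {x. infdist x plane_lattice \<ge> r}"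
    by (rule closure_minimal) (auto simp: billiard_table_def intro!: closed_Collect_le continuous_intros)
  ultimately show "x \<in> {x. infdist x plane_lattice = r}"
    using x by (auto simp: frontier_def interior_open billiard_table_def)
next
  fix x assume x: "x \<in> {x. infdist x plane_lattice = r}"
  obtain p where "p \<in> plane_lattice" "infdist x plane_lattice = dist x p"
    by (rule infdist_plane_lattice_attained)
  with x have p: "p \<in> plane_lattice" "dist x p = r" "infdist x plane_lattice = r" by auto
  \<comment> \<open>The point is pushed radially to distance r + e from p. Every other lattice point
    remains farther than 1 - (r + e) >= r, so the table is entered arbitrarily close to x.\<close>
  define y where "y e = x + (e / r) *\<^sub>R (x - p)" for e
  have "y e \<in> billiard_table r" if e: "0 < e" "e < 1 - 2 * r" for e
  proof -
    have "y e - p = (1 + e / r) *\<^sub>R (x - p)" by (simp add: y_def algebra_simps)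
    hence "dist (y e) p = \<bar>1 + e / r\<bar> * dist x p" by (simp add: dist_norm)
    also have "\<dots> = r + e" using p r e by (simp add: field_simps)
    finally have yp: "dist (y e) p = r + e" .
    obtain k where k: "k \<in> plane_lattice" "infdist (y e) plane_lattice = dist (y e) k"
      by (rule infdist_plane_lattice_attained)
    have "dist (y e) k > r"
    proof (cases "k = p")
      case False
      have "1 \<le> dist k p" using dist_plane_lattice_ge_1 k p False by blast
      also have "\<dots> \<le> dist (y e) k + dist (y e) p" by (metis dist_commute dist_triangle)
      finally show ?thesis using yp e by simp
    qed (use yp e in simp)
    thus ?thesis by (simp add: billiard_table_def k)
  qed
  hence ev: "\<forall>\<^sub>F e in at_right 0. y e \<in> billiard_table r"
    using r unfolding eventually_at_right_field by (intro exI[of _ "1 - 2 * r"]) auto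
  have "((\<lambda>e. y e) \<longlongrightarrow> x + (0 / r) *\<^sub>R (x - p)) (at_right 0)"
    unfolding y_def using r by (intro tendsto_intros) auto
  hence y_lim: "(y \<longlongrightarrow> x) (at_right 0)" by simp
  have "x \<in> closure (billiard_table r)"
  proof (rule Lim_in_closed_set[OF closed_closure])
    show "\<forall>\<^sub>F e in at_right 0. y e \<in> closure (billiard_table r)"
      using ev closure_subset[of "billiard_table r"] by (auto elim!: eventually_mono)
    show "(y \<longlongrightarrow> x) (at_right 0)" by (rule y_lim)
  qed simp
  moreover have "x \<notin> interior (billiard_table r)" using p interior_subset by (force simp: billiard_table_def)
  ultimately show "x \<in> frontier (billiard_table r)" by (simp add: frontier_def)
qed

text \<open>The two chords cut out of a line by disjoint disks of radius \<open>r\<close> are disjoint: \<open>X\<close> is the distance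
  of their midpoints, \<open>r a\<close> and \<open>r b\<close> the signed distances of the line from the centers.\<close>

lemma chord_gap:
  fixes X r a b :: real
  assumes "X \<ge> 0" "X\<^sup>2 + (r * (a - b))\<^sup>2 \<ge> 1" "0 < r" "r < 1 / 2" "\<bar>a\<bar> \<le> 1" "\<bar>b\<bar> \<le> 1"
  shows "X > r * sqrt (1 - a\<^sup>2) + r * sqrt (1 - b\<^sup>2)"
proof -
  define s t where "s = sqrt (1 - a\<^sup>2)" and "t = sqrt (1 - b\<^sup>2)"
  have "a\<^sup>2 \<le> 1" "b\<^sup>2 \<le> 1" using assms(5,6) by (simp_all add: abs_square_le_1)
  hence st: "s \<ge> 0" "t \<ge> 0" "s\<^sup>2 = 1 - a\<^sup>2" "t\<^sup>2 = 1 - b\<^sup>2" by (simp_all add: s_def t_def)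
  \<comment> \<open>Parallelogram identity for the unit vectors (s, a) and (t, -b).\<close>
  have "(s + t)\<^sup>2 + (a - b)\<^sup>2 \<le> 4"
  proof -
    have "(s + t)\<^sup>2 + (a - b)\<^sup>2 = 4 - ((s - t)\<^sup>2 + (a + b)\<^sup>2)"
      using st by (simp add: power2_eq_square algebra_simps)
    thus ?thesis by simp
  qed
  hence "r\<^sup>2 * ((s + t)\<^sup>2 + (a - b)\<^sup>2) \<le> r\<^sup>2 * 4" by (intro mult_left_mono) auto
  moreover have "r\<^sup>2 < (1 / 2)\<^sup>2" using assms by (intro power_strict_mono) auto
  ultimately have "(r * (s + t))\<^sup>2 + (r * (a - b))\<^sup>2 < 1"
    by (simp add: power_mult_distrib algebra_simps power2_eq_square)
  hence "(r * (s + t))\<^sup>2 < X\<^sup>2" using assms(2) by linarith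
  hence "r * (s + t) < X" using assms(1) power2_less_imp_less by blast
  thus ?thesis by (simp add: s_def t_def ring_distribs)
qed

locale flight =
  fixes r h' :: real and \<omega> :: complex
  assumes r: "0 < r" "r < 1 / 2" and h': "\<bar>h'\<bar> \<le> 1" and \<omega>: "norm \<omega> = 1"
begin

definition along :: "complex \<Rightarrow> real" where "along p = Re (p * cnj \<omega>)"
text \<open>Signed distance from p to the line of flight in units of r, arranged so that the
  obstacle at 0 gives h'. It turns out to be the impact parameter after a collision at p.\<close>

definition offset :: "complex \<Rightarrow> real" where "offset p = h' - Im (p * cnj \<omega>) / r"
definition start :: complex where "start = r *\<^sub>R (cis (arcsin h') * \<omega>)"
text \<open>The start lies r sqrt(1 - h'^2) beyond the projection of 0, and the disk around p is
  entered half a chord before the projection of p.\<close>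

definition entry :: "complex \<Rightarrow> real" where
  "entry p = along p - r * sqrt (1 - h'\<^sup>2) - r * sqrt (1 - (offset p)\<^sup>2)"
definition hits :: "complex \<Rightarrow> bool" where
  "hits p \<longleftrightarrow> p \<in> plane_lattice \<and> along p > 0 \<and> \<bar>offset p\<bar> \<le> 1"
definition first_hit :: "complex \<Rightarrow> bool" where
  "first_hit p \<longleftrightarrow> hits p \<and> (\<forall>k. hits k \<longrightarrow> along p \<le> along k)"

lemma cnj_\<omega>: "\<omega> * cnj \<omega> = 1"
  using \<omega> by (simp add: complex_norm_square[symmetric])

lemma norm_mult_cnj_\<omega>: "norm (z * cnj \<omega>) = norm z"
  using \<omega> by (simp add: norm_mult)

lemma start_cnj: "start * cnj \<omega> = Complex (r * sqrt (1 - h'\<^sup>2)) (r * h')"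
proof -
  have "start * cnj \<omega> = r *\<^sub>R (cis (arcsin h') * (\<omega> * cnj \<omega>))" by (simp add: start_def)
  thus ?thesis using h' by (simp add: cnj_\<omega> complex_eq_iff cos_arcsin)
qed

lemma r_offset: "r * offset p = r * h' - Im (p * cnj \<omega>)"
proof -
  have "r * (h' - a / r) = r * h' - a" for a using r by (simp add: right_diff_distrib)
  thus ?thesis unfolding offset_def .
qed

lemma pos_cnj: "(start + t *\<^sub>R \<omega> - p) * cnj \<omega> = Complex (r * sqrt (1 - h'\<^sup>2) + t - along p) (r * offset p)"
proof -
  have "(start + t *\<^sub>R \<omega> - p) * cnj \<omega> = start * cnj \<omega> + t *\<^sub>R (\<omega> * cnj \<omega>) - p * cnj \<omega>"
    by (simp add: algebra_simps)
  moreover define P where "P = p * cnj \<omega>"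
  moreover have "along p = Re P" unfolding along_def P_def ..
  moreover have "r * offset p = r * h' - Im P" unfolding P_def by (rule r_offset)
  ultimately show ?thesis by (simp only:) (simp add: start_cnj cnj_\<omega> complex_eq_iff)
qed

lemma dist_pos_eq: "(dist (start + t *\<^sub>R \<omega>) p)\<^sup>2 = (r * sqrt (1 - h'\<^sup>2) + t - along p)\<^sup>2 + (r * offset p)\<^sup>2"
proof -
  have "dist (start + t *\<^sub>R \<omega>) p = norm ((start + t *\<^sub>R \<omega> - p) * cnj \<omega>)"
    by (simp add: dist_norm norm_mult_cnj_\<omega>)
  thus ?thesis by (simp add: pos_cnj cmod_power2)
qed

lemma dist_pos_eq_r_iff:
  "dist (start + t *\<^sub>R \<omega>) p = r \<longleftrightarrow> \<bar>offset p\<bar> \<le> 1 \<and>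
     \<bar>r * sqrt (1 - h'\<^sup>2) + t - along p\<bar> = r * sqrt (1 - (offset p)\<^sup>2)" (is "?L \<longleftrightarrow> ?R")
proof -
  define X where "X = r * sqrt (1 - h'\<^sup>2) + t - along p"
  have "?L \<longleftrightarrow> (dist (start + t *\<^sub>R \<omega>) p)\<^sup>2 = r\<^sup>2" using r by simp
  also have "\<dots> \<longleftrightarrow> X\<^sup>2 = r\<^sup>2 * (1 - (offset p)\<^sup>2)"
    unfolding dist_pos_eq X_def by (auto simp: power_mult_distrib algebra_simps)
  also have "\<dots> \<longleftrightarrow> ?R"
  proof
    assume *: "X\<^sup>2 = r\<^sup>2 * (1 - (offset p)\<^sup>2)"
    have "0 \<le> r\<^sup>2 * (1 - (offset p)\<^sup>2)" by (metis * zero_le_power2)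
    hence "1 - (offset p)\<^sup>2 \<ge> 0" using r by (simp add: zero_le_mult_iff)
    moreover have "\<bar>X\<bar> = sqrt (r\<^sup>2 * (1 - (offset p)\<^sup>2))" by (metis * real_sqrt_abs)
    ultimately show ?R using r by (simp add: X_def real_sqrt_mult abs_square_le_1)
  next
    assume ?R
    hence "(offset p)\<^sup>2 \<le> 1" "\<bar>X\<bar>\<^sup>2 = (r * sqrt (1 - (offset p)\<^sup>2))\<^sup>2"
      by (simp_all add: X_def abs_square_le_1)
    thus "X\<^sup>2 = r\<^sup>2 * (1 - (offset p)\<^sup>2)" by (simp add: power_mult_distrib)
  qed
  finally show ?thesis .
qed

lemma along_gap:
  assumes "p \<in> plane_lattice" "k \<in> plane_lattice" "p \<noteq> k" "\<bar>offset p\<bar> \<le> 1" "\<bar>offset k\<bar> \<le> 1" "along p \<le> along k"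
  shows "along k - along p > r * sqrt (1 - (offset p)\<^sup>2) + r * sqrt (1 - (offset k)\<^sup>2)"
proof (rule chord_gap)
  have "1 \<le> (norm (k - p))\<^sup>2" using assms by (intro plane_lattice_norm_ge_1 plane_lattice_diff) auto
  also have "(norm (k - p))\<^sup>2 = (norm ((k - p) * cnj \<omega>))\<^sup>2" by (simp add: norm_mult_cnj_\<omega>)
  also have "\<dots> = (along k - along p)\<^sup>2 + (r * (offset p - offset k))\<^sup>2"
  proof -
    have "r * (offset p - offset k) = Im (k * cnj \<omega>) - Im (p * cnj \<omega>)"
      unfolding right_diff_distrib r_offset by simp
    thus ?thesis unfolding cmod_power2 along_def left_diff_distrib minus_complex.sel by simp
  qed
  finally show "1 \<le> (along k - along p)\<^sup>2 + (r * (offset p - offset k))\<^sup>2" .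
qed (use assms r in auto)

lemma offset_0 [simp]: "offset 0 = h'" and along_0 [simp]: "along 0 = 0"
  by (simp_all add: offset_def along_def)

lemma entry_pos: "hits p \<Longrightarrow> entry p > 0"
  using along_gap[of 0 p] h' by (force simp: hits_def entry_def)

lemma frontier_iff:
  "start + t *\<^sub>R \<omega> \<in> frontier (billiard_table r) \<longleftrightarrow> (\<exists>p\<in>plane_lattice. dist (start + t *\<^sub>R \<omega>) p = r)"
  unfolding frontier_billiard_table[OF r]
proof
  assume *: "start + t *\<^sub>R \<omega> \<in> {x. infdist x plane_lattice = r}"
  obtain k where "k \<in> plane_lattice" "infdist (start + t *\<^sub>R \<omega>) plane_lattice = dist (start + t *\<^sub>R \<omega>) k"
    by (rule infdist_plane_lattice_attained)
  with * show "\<exists>p\<in>plane_lattice. dist (start + t *\<^sub>R \<omega>) p = r" by auto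
next
  assume "\<exists>p\<in>plane_lattice. dist (start + t *\<^sub>R \<omega>) p = r"
  then obtain p where p: "p \<in> plane_lattice" "dist (start + t *\<^sub>R \<omega>) p = r" by blast
  obtain k where k: "k \<in> plane_lattice" "infdist (start + t *\<^sub>R \<omega>) plane_lattice = dist (start + t *\<^sub>R \<omega>) k"
    by (rule infdist_plane_lattice_attained)
  have "infdist (start + t *\<^sub>R \<omega>) plane_lattice \<le> dist (start + t *\<^sub>R \<omega>) p"
    by (rule infdist_le[OF p(1)])
  moreover have "k = p" if "dist (start + t *\<^sub>R \<omega>) k < r"
  proof (rule ccontr)
    assume "k \<noteq> p"
    hence "1 \<le> dist k p" using dist_plane_lattice_ge_1 k p by blast
    also have "\<dots> \<le> dist (start + t *\<^sub>R \<omega>) k + dist (start + t *\<^sub>R \<omega>) p" by (metis dist_commute dist_triangle)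
    finally show False using that p r by simp
  qed
  ultimately have "infdist (start + t *\<^sub>R \<omega>) plane_lattice = r"
    using k(2) p(2) by (cases "dist (start + t *\<^sub>R \<omega>) k < r") auto
  thus "start + t *\<^sub>R \<omega> \<in> {x. infdist x plane_lattice = r}" by simp
qed

lemma hit_if_frontier:
  assumes "t > 0" "p \<in> plane_lattice" "dist (start + t *\<^sub>R \<omega>) p = r"
  shows "hits p" "t \<ge> entry p"
proof -
  have off: "\<bar>offset p\<bar> \<le> 1" and
    t: "\<bar>r * sqrt (1 - h'\<^sup>2) + t - along p\<bar> = r * sqrt (1 - (offset p)\<^sup>2)"
    using assms(3) by (simp_all add: dist_pos_eq_r_iff)
  have sq: "r * sqrt (1 - h'\<^sup>2) \<ge> 0" using r h' by (simp add: abs_square_le_1)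
  show "t \<ge> entry p" using t by (simp add: entry_def abs_if split: if_splits)
  have "p \<noteq> 0"
  proof
    assume "p = 0"
    with t have "\<bar>r * sqrt (1 - h'\<^sup>2) + t\<bar> = r * sqrt (1 - h'\<^sup>2)" by simp
    thus False using assms(1) sq by linarith
  qed
  have "along p > 0"
  proof (rule ccontr)
    assume "\<not> ?thesis"
    hence "along 0 - along p > r * sqrt (1 - (offset p)\<^sup>2) + r * sqrt (1 - (offset 0)\<^sup>2)"
      using assms off h' \<open>p \<noteq> 0\<close> by (intro along_gap) auto
    thus False using t assms(1) sq by simp
  qed
  thus "hits p" using off assms by (simp add: hits_def)
qed

lemma dist_entry:
  assumes "hits p"
  shows "dist (start + entry p *\<^sub>R \<omega>) p = r"
  using assms r by (simp add: dist_pos_eq_r_iff entry_def hits_def abs_square_le_1)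

text \<open>The chords cut out by distinct obstacles are disjoint, so the order of the projections
  \<open>along\<close> is the order of the entry times.\<close>

lemma exit_time_first_hit:
  assumes "first_hit p"
  shows "exit_time r (start, \<omega>) = entry p"
proof -
  have hp: "hits p" using assms by (simp add: first_hit_def)
  let ?T = "{t. 0 < t \<and> start + t *\<^sub>R \<omega> \<in> frontier (billiard_table r)}"
  have "entry p \<in> ?T"
    using entry_pos[OF hp] dist_entry[OF hp] hp by (auto simp: frontier_iff hits_def)
  moreover have "entry p \<le> t" if t: "t \<in> ?T" for t
  proof -
    obtain k where k: "k \<in> plane_lattice" "dist (start + t *\<^sub>R \<omega>) k = r" "t > 0"
      using t by (auto simp: frontier_iff)
    note hk = hit_if_frontier[OF k(3,1,2)]
    show ?thesis
    proof (cases "k = p")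
      case False
      have le: "along p \<le> along k" using assms hk by (auto simp: first_hit_def)
      have "along k - along p > r * sqrt (1 - (offset p)\<^sup>2) + r * sqrt (1 - (offset k)\<^sup>2)"
        using hk hp le False by (intro along_gap) (auto simp: hits_def)
      moreover have "r * sqrt (1 - (offset p)\<^sup>2) \<ge> 0" using hp r by (simp add: hits_def abs_square_le_1)
      ultimately have "entry p \<le> entry k" by (simp add: entry_def)
      thus ?thesis using hk(2) by simp
    qed (use hk in simp)
  qed
  ultimately show ?thesis
    unfolding exit_time_def by (auto intro!: cInf_eq_minimum)
qed

text \<open>Reflection changes the velocity by a real multiple of n, and n times its own conjugate
  is real. Hence the imaginary part which gives the impact parameter is the same before and after
  the collision, namely \<open>offset p\<close>.\<close>

lemma transfer_map_first_hit:
  assumes "first_hit p"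
  shows "transfer_map r h' \<omega> = (2 * r * entry p, offset p)"
proof -
  have hp: "hits p" "p \<in> plane_lattice" using assms by (simp_all add: first_hit_def hits_def)
  define x where "x = start + entry p *\<^sub>R \<omega>"
  have dx: "dist x p = r" unfolding x_def by (rule dist_entry[OF hp(1)])
  have center: "obstacle_center r x = p"
    unfolding obstacle_center_def
  proof (rule the_equality)
    fix k assume k: "k \<in> plane_lattice \<and> dist x k = r"
    show "k = p"
    proof (rule ccontr)
      assume "k \<noteq> p"
      hence "1 \<le> dist k p" using dist_plane_lattice_ge_1 k hp by blast
      also have "\<dots> \<le> dist x k + dist x p" by (metis dist_commute dist_triangle)
      finally show False using k dx r by simp
    qed
  qed (use hp dx in simp)
  define n where "n = inward_normal r x"
  have n: "n = (1 / r) *\<^sub>R (x - p)"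
    using dx r by (simp add: n_def inward_normal_def center sgn_div_norm dist_norm field_simps)
  have norm_n: "norm n = 1" using dx r by (simp add: n dist_norm)
  have n_cnj: "Im (n * cnj \<omega>) = offset p"
    using pos_cnj[of "entry p" p] r by (simp add: n x_def)
  define \<omega>1 where "\<omega>1 = specular_reflection n \<omega>"
  have norm_\<omega>1: "norm \<omega>1 = 1"
  proof -
    have "(norm \<omega>1)\<^sup>2 = \<omega>1 \<bullet> \<omega>1" by (simp add: dot_square_norm)
    also have "\<dots> = \<omega> \<bullet> \<omega> - 4 * (\<omega> \<bullet> n) * (\<omega> \<bullet> n) + 4 * (\<omega> \<bullet> n)\<^sup>2 * (n \<bullet> n)"
      by (simp add: \<omega>1_def specular_reflection_def algebra_simps inner_commute power2_eq_square)
    also have "\<dots> = 1" using \<omega> norm_n by (simp add: dot_square_norm power2_eq_square)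
    finally show ?thesis using norm_ge_zero[of \<omega>1] by (metis abs_of_nonneg real_sqrt_abs real_sqrt_one)
  qed
  have "impact_parameter r (x, \<omega>1) = sin (Arg (n / \<omega>1))" by (simp add: impact_parameter_def n_def)
  also have "\<dots> = Im (n / \<omega>1)"
  proof -
    have "n \<noteq> 0" "\<omega>1 \<noteq> 0" using norm_n norm_\<omega>1 by auto
    thus ?thesis using norm_n norm_\<omega>1 sin_Arg[of "n / \<omega>1"] by (simp add: norm_divide)
  qed
  also have "n / \<omega>1 = n * cnj \<omega>1"
    using norm_\<omega>1 by (simp add: divide_conv_cnj)
  also have "Im (n * cnj \<omega>1) = Im (n * cnj \<omega>) - 2 * (\<omega> \<bullet> n) * Im (n * cnj n)"
    by (simp add: \<omega>1_def specular_reflection_def algebra_simps)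
  also have "Im (n * cnj n) = 0" by simp
  finally have "impact_parameter r (x, \<omega>1) = offset p" using n_cnj by simp
  moreover have "fst (Y_map r h' \<omega>) = start" by (simp add: Y_map_def start_def)
  ultimately show ?thesis
    using exit_time_first_hit[OF assms] by (simp add: transfer_map_def Let_def x_def \<omega>1_def n_def)
qed

end

section \<open>The transition kernel\<close>

text \<open>The fraction is \<open>1 - (s (1 + M) - 2) / (s \<bar>h - h'\<bar>)\<close> truncated at \<open>0\<close>, where
  \<open>M = max \<bar>h\<bar> \<bar>h'\<bar>\<close>; the maximum in the denominator only serves to avoid a division by zero.\<close>

definition transition_kernel :: "real \<Rightarrow> real \<Rightarrow> real \<Rightarrow> real" where
  "transition_kernel s h h' = 3 / pi\<^sup>2 *
     (let k = s * (1 + max \<bar>h\<bar> \<bar>h'\<bar>) - 2; d = s * \<bar>h - h'\<bar>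
      in if k \<le> 0 then 1 else max 0 (d - k) / max d k)"

lemma transition_kernel_minus: "transition_kernel s h h' = transition_kernel s (- h) (- h')"
  by (simp add: transition_kernel_def abs_minus_commute)

lemma transition_kernel_nonneg: "s \<ge> 0 \<Longrightarrow> 0 \<le> transition_kernel s h h'"
  by (auto simp: transition_kernel_def Let_def)

lemma transition_kernel_measurable [measurable]:
  "(\<lambda>(s, h). transition_kernel s h h') \<in> borel_measurable borel"
  unfolding transition_kernel_def Let_def borel_prod[symmetric] by measurable

text \<open>For s <= 4 the truncated fraction is at most 1. For s > 4 one has k >= s - 2 and d <= k
  + 2, so a nonzero fraction has d > s / 2 and is at most 2 / d < 4 / s. Both ranges give 5, and 15
  = 3 * 5.\<close>

lemma transition_kernel_bound:
  assumes "s \<ge> 0" "\<bar>h\<bar> \<le> 1" "\<bar>h'\<bar> \<le> 1"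
  shows "(1 + s) * transition_kernel s h h' \<le> 15 / pi\<^sup>2"
proof -
  define k d where "k = s * (1 + max \<bar>h\<bar> \<bar>h'\<bar>) - 2" and "d = s * \<bar>h - h'\<bar>"
  define v where "v = (if k \<le> 0 then 1 else max 0 (d - k) / max d k)"
  have "(1 + s) * v \<le> 5"
  proof (cases "s \<le> 4")
    case True
    have "v \<le> 1" by (auto simp: v_def)
    moreover have "v \<ge> 0" by (auto simp: v_def)
    ultimately have "(1 + s) * v \<le> (1 + 4) * 1" using assms(1) True by (intro mult_mono) auto
    thus ?thesis by simp
  next
    case False
    have "s * 1 \<le> s * (1 + max \<bar>h\<bar> \<bar>h'\<bar>)" using assms by (intro mult_left_mono) auto
    hence k: "k \<ge> s - 2" by (simp add: k_def)
    show ?thesis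
    proof (cases "d \<le> k")
      case True
      thus ?thesis using k False by (simp add: v_def)
    next
      case dk: False
      have "\<bar>h - h'\<bar> \<le> 1 + max \<bar>h\<bar> \<bar>h'\<bar>" using assms by auto
      hence "d \<le> k + 2" using assms(1) by (simp add: d_def k_def mult_left_mono)
      have "d > s / 2" using dk k False by linarith
      have "v = (d - k) / d" using dk k False by (simp add: v_def)
      also have "\<dots> \<le> 2 / d" using \<open>d \<le> k + 2\<close> \<open>d > s / 2\<close> False by (intro divide_right_mono) auto
      also have "\<dots> \<le> 2 / (s / 2)" using \<open>d > s / 2\<close> False by (intro divide_left_mono) auto
      finally have "(1 + s) * v \<le> (1 + s) * (2 / (s / 2))" using False by (intro mult_left_mono) auto
      also have "\<dots> \<le> 5" using False by (simp add: field_simps)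
      finally show ?thesis .
    qed
  qed
  hence "3 / pi\<^sup>2 * ((1 + s) * v) \<le> 3 / pi\<^sup>2 * 5" by (intro mult_left_mono) auto
  moreover have "transition_kernel s h h' = 3 / pi\<^sup>2 * v"
    unfolding transition_kernel_def Let_def v_def k_def d_def ..
  ultimately show ?thesis by (simp add: mult_ac)
qed

text \<open>The hypotheses leave the endpoints open, so strict and weak inequalities may be mixed
  freely in the interval conditions to which this is applied.\<close>

lemma measure_lborel_between:
  fixes a b :: real
  assumes "\<And>x. a < x \<Longrightarrow> x < b \<Longrightarrow> P x" "\<And>x. P x \<Longrightarrow> a \<le> x \<and> x \<le> b"
  shows "{x. P x} \<in> sets borel" "emeasure lborel {x. P x} = ennreal (max 0 (b - a))"
proof -
  define S where "S = {x. P x} \<inter> {a, b}"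
  have "finite S" by (simp add: S_def)
  have eq: "{x. P x} = {a<..<b} \<union> S"
    using assms unfolding S_def by (force simp: less_le)
  have fin: "S \<in> sets borel" using \<open>finite S\<close> by (simp add: finite_imp_closed)
  thus "{x. P x} \<in> sets borel" unfolding eq by auto
  have "S \<in> null_sets lborel" using \<open>finite S\<close> by (rule finite_imp_null_set_lborel)
  hence "emeasure lborel {x. P x} = emeasure lborel {a<..<b}"
    unfolding eq by (intro emeasure_Un_null_set) auto
  also have "\<dots> = ennreal (max 0 (b - a))"
    by (cases "a \<le> b") (auto simp: emeasure_lborel_Ioo max_def)
  finally show "emeasure lborel {x. P x} = ennreal (max 0 (b - a))" .
qed

text \<open>The geometric condition involves max h' (-h), the symmetric kernel max |h| |h'|; the
  difference is exactly what the sign of h - h' contributes.\<close>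

lemma abs_max_minus_dist: "max \<bar>h\<bar> \<bar>h'\<bar> = max h' (- h) + max 0 (h - h')" for h h' :: real
  by (auto simp: max_def abs_if)

lemma transition_kernel_eq:
  fixes s h h' :: real
  assumes "s > 0" and "h \<noteq> h'"
  shows "transition_kernel s h h' =
    3 / pi\<^sup>2 * max 0 (min 1 ((s * \<bar>h - h'\<bar> - (s * (1 + max \<bar>h\<bar> \<bar>h'\<bar>) - 2)) / (s * \<bar>h - h'\<bar>)))"
proof -
  define k d where "k = s * (1 + max \<bar>h\<bar> \<bar>h'\<bar>) - 2" and "d = s * \<bar>h - h'\<bar>"
  have d: "d > 0" using assms by (simp add: d_def)
  have "transition_kernel s h h' = 3 / pi\<^sup>2 * (if k \<le> 0 then 1 else max 0 (d - k) / max d k)"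
    unfolding transition_kernel_def Let_def k_def d_def ..
  also have "(if k \<le> 0 then 1 else max 0 (d - k) / max d k) = max 0 (min 1 ((d - k) / d))"
  proof (cases "k \<le> 0")
    case True
    hence "1 \<le> (d - k) / d" using d by simp
    thus ?thesis using True by simp
  next
    case False
    thus ?thesis using d by (cases "d \<le> k") (auto simp: divide_le_0_iff zero_le_divide_iff max_def min_def)
  qed
  finally show ?thesis by (simp add: k_def d_def)
qed

text \<open>The conditions on \<open>y\<close> are those of \<open>column_cond\<close>, \<open>y\<close> being equidistributed in the
  limit.\<close>

lemma measure_transition_kernel:
  fixes s h h' :: real
  assumes s: "s > 0" and ne: "h \<noteq> h'"
  defines "m \<equiv> 2 - s * (1 + max h' (- h))"
  shows "measure lborel {y \<in> {0..1}. s * (h - h') * y < m} = pi\<^sup>2 / 3 * transition_kernel s h h'"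
proof -
  define k d where "k = s * (1 + max \<bar>h\<bar> \<bar>h'\<bar>) - 2" and "d = s * \<bar>h - h'\<bar>"
  have d: "d > 0" using assms by (simp add: d_def)
  have meas: "measure lborel {y. P y} = max 0 (b - a)"
    if "\<And>x. a < x \<Longrightarrow> x < b \<Longrightarrow> P x" "\<And>x. P x \<Longrightarrow> a \<le> x \<and> x \<le> b" for P and a b :: real
    using measure_lborel_between(2)[OF that] by (simp add: measure_def)
  have kernel: "pi\<^sup>2 / 3 * transition_kernel s h h' = max 0 (min 1 ((d - k) / d))"
    using transition_kernel_eq[OF s ne] by (simp add: k_def d_def)
  show ?thesis
  proof (cases "h > h'")
    case True
    have M: "max \<bar>h\<bar> \<bar>h'\<bar> = max h' (- h) + (h - h')" using True abs_max_minus_dist[of h h'] by simp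
    have m: "m = d - k" unfolding m_def d_def k_def M using True by (simp add: algebra_simps)
    have "measure lborel {y. y \<in> {0..1} \<and> s * (h - h') * y < m} = max 0 (min 1 ((d - k) / d) - 0)"
    proof (rule meas)
      fix y assume y: "0 < y" "y < min 1 ((d - k) / d)"
      hence "y < (d - k) / d" by simp
      hence "d * y < d - k" using d by (simp add: field_simps)
      thus "y \<in> {0..1} \<and> s * (h - h') * y < m" using y True by (simp add: m d_def)
    next
      fix y assume y: "y \<in> {0..1} \<and> s * (h - h') * y < m"
      hence "d * y < d - k" using True by (simp add: m d_def)
      thus "0 \<le> y \<and> y \<le> min 1 ((d - k) / d)" using y d by (simp add: field_simps)
    qed
    thus ?thesis unfolding kernel by simp
  next
    case False
    have M: "max \<bar>h\<bar> \<bar>h'\<bar> = max h' (- h)" using False abs_max_minus_dist[of h h'] by simp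
    have m: "m = - k" unfolding m_def k_def M by simp
    have sd: "s * (h - h') * y = - (d * y)" for y using False by (simp add: d_def algebra_simps)
    have "measure lborel {y. y \<in> {0..1} \<and> s * (h - h') * y < m} = max 0 (1 - max 0 (k / d))"
    proof (rule meas)
      fix y assume y: "max 0 (k / d) < y" "y < 1"
      hence "k / d < y" by simp
      hence "k < d * y" using d by (simp add: field_simps)
      thus "y \<in> {0..1} \<and> s * (h - h') * y < m" using y by (simp add: m sd)
    next
      fix y assume y: "y \<in> {0..1} \<and> s * (h - h') * y < m"
      hence "k < d * y" by (simp add: m sd)
      thus "max 0 (k / d) \<le> y \<and> y \<le> 1" using y d by (simp add: field_simps)
    qed
    also have "max 0 (1 - max 0 (k / d)) = max 0 (min 1 ((d - k) / d))"
      using d by (auto simp: max_def min_def diff_divide_distrib)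
    finally show ?thesis unfolding kernel by simp
  qed
qed

section \<open>Piecewise continuity and boundedness of the kernel\<close>

lemma negligible_frontier_Int:
  assumes "negligible (frontier A)" "negligible (frontier B)"
  shows "negligible (frontier (A \<inter> B))"
  by (rule negligible_subset[OF negligible_Un[OF assms]]) (rule frontier_Int_subset)

lemma negligible_frontier_le:
  fixes f :: "'a::euclidean_space \<Rightarrow> real"
  assumes "continuous_on UNIV f" "negligible {x. f x = c}"
  shows "negligible (frontier {x. f x \<le> c})" "negligible (frontier {x. c < f x})"
proof -
  have "open {x. f x < c}" using assms(1) by (intro open_Collect_less) auto
  hence "{x. f x < c} \<subseteq> interior {x. f x \<le> c}" by (intro interior_maximal) auto
  moreover have "closed {x. f x \<le> c}" using assms(1) by (intro closed_Collect_le) auto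
  ultimately have "frontier {x. f x \<le> c} \<subseteq> {x. f x = c}"
    unfolding frontier_def closure_closed[OF \<open>closed {x. f x \<le> c}\<close>] using less_le by blast
  thus 1: "negligible (frontier {x. f x \<le> c})" using assms(2) negligible_subset by blast
  have "{x. c < f x} = - {x. f x \<le> c}" by auto
  thus "negligible (frontier {x. c < f x})" using 1 by (metis frontier_complement)
qed

lemma in_closure_interiorI:
  assumes "open O'" "O' \<subseteq> D" "(z \<longlongrightarrow> x) (at_right (0::real))" "\<forall>\<^sub>F e in at_right 0. z e \<in> O'"
  shows "x \<in> closure (interior D)"
proof (rule Lim_in_closed_set[OF closed_closure _ _ assms(3)])
  have "O' \<subseteq> closure (interior D)"
    using interior_maximal[OF assms(2,1)] closure_subset by blast
  thus "\<forall>\<^sub>F e in at_right 0. z e \<in> closure (interior D)"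
    using assms(4) by (auto elim!: eventually_mono)
qed simp

text \<open>Where \<open>scale p <= 2\<close> the kernel is the constant 3 / pi^2. Across
  \<open>scale p = 2\<close> it is continuous for h different from h', but on the plane h = h' it
  drops to 0; hence the pieces.\<close>

definition scale :: "real \<times> real \<times> real \<Rightarrow> real" where
  "scale p = fst p * (1 + max \<bar>fst (snd p)\<bar> \<bar>snd (snd p)\<bar>)"

definition phase_box :: "(real \<times> real \<times> real) set" where
  "phase_box = {p. - fst p \<le> 0} \<inter> ({p. fst (snd p) \<le> 1} \<inter> ({p. - fst (snd p) \<le> 1} \<inter>
     ({p. snd (snd p) \<le> 1} \<inter> {p. - snd (snd p) \<le> 1})))"

definition inner_piece :: "(real \<times> real \<times> real) set" where
  "inner_piece = phase_box \<inter> {p. scale p \<le> 2}"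

definition outer_piece :: "real \<Rightarrow> (real \<times> real \<times> real) set" where
  "outer_piece \<sigma> = phase_box \<inter> ({p. 2 < scale p} \<inter> {p. \<sigma> * (snd (snd p) - fst (snd p)) \<le> 0})"

lemma phase_box_iff: "p \<in> phase_box \<longleftrightarrow> 0 \<le> fst p \<and> \<bar>fst (snd p)\<bar> \<le> 1 \<and> \<bar>snd (snd p)\<bar> \<le> 1"
  by (auto simp: phase_box_def)

lemma phase_box_eq: "phase_box = {0..} \<times> {-1..1} \<times> {-1..1}"
  by (auto simp: phase_box_def)

lemma continuous_on_scale [continuous_intros]: "continuous_on A f \<Longrightarrow> continuous_on A (\<lambda>x. scale (f x))"
  unfolding scale_def by (intro continuous_intros)

lemma negligible_frontier_pieces:
  shows "negligible (frontier inner_piece)"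
    and "\<bar>\<sigma>\<bar> = 1 \<Longrightarrow> negligible (frontier (outer_piece \<sigma>))"
proof -
  have hyp: "negligible {p :: real \<times> real \<times> real. f p = c}"
    if "\<And>p. f p = a \<bullet> p" "a \<noteq> 0" for f c and a :: "real \<times> real \<times> real"
    using negligible_hyperplane[of a c] that by simp
  have box: "negligible (frontier phase_box)"
    unfolding phase_box_def
    by (intro negligible_frontier_Int negligible_frontier_le(1) continuous_intros)
       (rule hyp[of _ "(-1, 0, 0)"] hyp[of _ "(0, 1, 0)"] hyp[of _ "(0, -1, 0)"] hyp[of _ "(0, 0, 1)"] hyp[of _ "(0, 0, -1)"];
        force simp: inner_prod_def zero_prod_def)+
  have level: "negligible {p. scale p = 2}"
  \<comment> \<open>On a ray, the scale of c p is c s (1 + c m), which takes the value 2 for at most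
    one c >= 0.\<close>
  proof (rule starlike_negligible[of _ 0])
    show "closed {p. scale p = 2}" by (intro closed_Collect_eq continuous_intros)
    fix c :: real and p :: "real \<times> real \<times> real"
    assume c: "0 + c *\<^sub>R p \<in> {p. scale p = 2}" "0 \<le> c" "0 + p \<in> {p. scale p = 2}"
    define m where "m = max \<bar>fst (snd p)\<bar> \<bar>snd (snd p)\<bar>"
    have m: "m \<ge> 0" by (simp add: m_def)
    have p: "fst p * (1 + m) = 2" using c(3) by (simp add: scale_def m_def)
    have "max \<bar>c * fst (snd p)\<bar> \<bar>c * snd (snd p)\<bar> = c * m"
      using c(2) by (simp add: abs_mult m_def max_mult_distrib_left)
    hence cp: "c * fst p * (1 + c * m) = 2" using c(1) by (simp add: scale_def)
    have "fst p > 0" 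
    proof -
      have "0 < fst p * (1 + m)" by (simp add: p)
      thus ?thesis using m by (simp add: zero_less_mult_iff)
    qed
    have "fst p * ((c - 1) * (1 + m + c * m)) = 0"
      using p cp by (simp add: algebra_simps)
    hence "(c - 1) * (1 + m + c * m) = 0" using \<open>fst p > 0\<close> by simp
    moreover have "1 + m + c * m > 0" using m c(2) by (simp add: add_pos_nonneg)
    ultimately show "c = 1" by simp
  qed
  show "negligible (frontier inner_piece)"
    unfolding inner_piece_def
    by (intro negligible_frontier_Int box negligible_frontier_le level continuous_intros)
  show "negligible (frontier (outer_piece \<sigma>))" if "\<bar>\<sigma>\<bar> = 1"
    unfolding outer_piece_def
    by (intro negligible_frontier_Int box negligible_frontier_le level continuous_intros
        hyp[of _ "(0, - \<sigma>, \<sigma>)"]) (use that in \<open>auto simp: inner_prod_def algebra_simps zero_prod_def\<close>)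
qed

lemma inner_piece_connected: "connected inner_piece"
proof (rule starlike_imp_connected)
  show "starlike inner_piece"
    unfolding starlike_def
  proof (intro bexI[of _ 0] ballI subsetI)
    fix p q assume p: "p \<in> inner_piece" "q \<in> closed_segment 0 p"
    obtain u where u: "0 \<le> u" "u \<le> 1" "q = u *\<^sub>R p" using p(2) by (auto simp: in_segment)
    have le: "u * x \<le> x" if "x \<ge> 0" for x using u that by (simp add: mult_left_le_one_le)
    define m where "m = max \<bar>fst (snd p)\<bar> \<bar>snd (snd p)\<bar>"
    have m: "m \<ge> 0" "fst p \<ge> 0" using p by (auto simp: m_def inner_piece_def phase_box_iff)
    have "scale q = (u * fst p) * (1 + u * m)"
      using u by (simp add: scale_def abs_mult m_def max_mult_distrib_left)
    also have "\<dots> \<le> fst p * (1 + m)" using m le u by (intro mult_mono) auto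
    also have "\<dots> \<le> 2" using p by (simp add: inner_piece_def scale_def m_def)
    finally show "q \<in> inner_piece"
      using p(1) u by (auto simp: inner_piece_def phase_box_iff abs_mult intro: mult_le_one)
  qed (auto simp: inner_piece_def phase_box_iff scale_def)
qed

text \<open>The piece is not convex, but increasing s never leaves it, and from s = 3 on the
  condition on the scale is automatic. So every point is joined to the convex part V by a segment in
  the direction of s.\<close>

lemma outer_piece_connected:
  assumes "\<bar>\<sigma>\<bar> = 1"
  shows "connected (outer_piece \<sigma>)"
proof -
  define V :: "(real \<times> real \<times> real) set" where "V = {p. - fst p \<le> - 3} \<inter> ({p. fst (snd p) \<le> 1} \<inter> ({p. - fst (snd p) \<le> 1} \<inter>
     ({p. snd (snd p) \<le> 1} \<inter> ({p. - snd (snd p) \<le> 1} \<inter> {p. \<sigma> * (snd (snd p) - fst (snd p)) \<le> 0}))))"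
  have half: "convex {p :: real \<times> real \<times> real. f p \<le> c}" if "\<And>p. f p = a \<bullet> p" for f c and a :: "real \<times> real \<times> real"
    using convex_halfspace_le[of a c] that by simp
  have "convex V" unfolding V_def
    by (intro convex_Int; (rule half[of _ "(-1, 0, 0)"] half[of _ "(0, 1, 0)"] half[of _ "(0, -1, 0)"] half[of _ "(0, 0, 1)"] half[of _ "(0, 0, -1)"]
       half[of _ "(0, - \<sigma>, \<sigma>)"]; force simp: inner_prod_def algebra_simps))
  hence connV: "connected V" by (rule convex_connected)
  have V: "V \<subseteq> outer_piece \<sigma>"
  proof
    fix p assume p: "p \<in> V"
    have "3 * 1 \<le> scale p" unfolding scale_def using p by (intro mult_mono) (auto simp: V_def)
    thus "p \<in> outer_piece \<sigma>" using p by (auto simp: V_def outer_piece_def phase_box_iff)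
  qed
  have comp: "connected_component (outer_piece \<sigma>) p (3, 0, 0)" if p: "p \<in> outer_piece \<sigma>" for p
  proof -
    define q where "q = (fst p + 3, snd p)"
    have q: "q \<in> V" using p by (auto simp: q_def V_def outer_piece_def phase_box_iff abs_le_iff)
    have "closed_segment p q \<subseteq> outer_piece \<sigma>"
    proof
      fix z assume "z \<in> closed_segment p q"
      then obtain u where u: "0 \<le> u" "z = (1 - u) *\<^sub>R p + u *\<^sub>R q" by (auto simp: in_segment)
      have z: "fst z = fst p + 3 * u" "snd z = snd p"
      proof -
        show "fst z = fst p + 3 * u" by (simp add: u q_def algebra_simps)
        show "snd z = snd p" by (simp add: u q_def flip: scaleR_add_left)
      qed
      have "scale p \<le> scale z" unfolding scale_def z using u by (intro mult_right_mono) auto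
      thus "z \<in> outer_piece \<sigma>" using p u z by (auto simp: outer_piece_def phase_box_iff)
    qed
    hence "closed_segment p q \<union> V \<subseteq> outer_piece \<sigma>" using V by blast
    moreover have "connected (closed_segment p q \<union> V)"
      using q by (intro connected_Un connV) auto
    moreover have "(3, 0, 0) \<in> V" by (simp add: V_def)
    ultimately show ?thesis unfolding connected_component_def by (meson UnI1 UnI2 ends_in_segment(1))
  qed
  thus ?thesis
    unfolding connected_iff_connected_component
    by (meson connected_component_sym connected_component_trans)
qed

lemma inner_piece_closure: "inner_piece \<subseteq> closure (interior inner_piece)"
proof
  fix p assume p: "p \<in> inner_piece"
  \<comment> \<open>Segment from p towards the interior point (1/2, 0, 0).\<close>
  define z where "z e = ((1 - e) * fst p + e / 2, (1 - e) * fst (snd p), (1 - e) * snd (snd p))" for e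
  define O' where "O' = {p. 0 < fst p \<and> \<bar>fst (snd p)\<bar> < 1 \<and> \<bar>snd (snd p)\<bar> < 1 \<and> scale p < 2}"
  show "p \<in> closure (interior inner_piece)"
  proof (rule in_closure_interiorI)
    show "open O'" unfolding O'_def by (intro open_Collect_conj open_Collect_less continuous_intros)
    show "O' \<subseteq> inner_piece" by (auto simp: O'_def inner_piece_def phase_box_iff)
    have "(z \<longlongrightarrow> ((1 - 0) * fst p + 0 / 2, (1 - 0) * fst (snd p), (1 - 0) * snd (snd p))) (at_right 0)"
      unfolding z_def by (intro tendsto_intros) auto
    thus "(z \<longlongrightarrow> p) (at_right 0)" by simp
    have "z e \<in> O'" if e: "0 < e" "e < 1" for e
    proof -
      define m where "m = max \<bar>fst (snd p)\<bar> \<bar>snd (snd p)\<bar>"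
      have pm: "0 \<le> fst p" "0 \<le> m" "m \<le> 1" "fst p * (1 + m) \<le> 2"
        using p by (auto simp: m_def inner_piece_def phase_box_iff scale_def)
      have "scale (z e) = ((1 - e) * fst p + e / 2) * (1 + (1 - e) * m)"
        using e by (simp add: scale_def z_def abs_mult m_def max_mult_distrib_left)
      also have "\<dots> \<le> ((1 - e) * fst p + e / 2) * (1 + m)"
        using e pm by (intro mult_left_mono) (auto simp: mult_left_le_one_le)
      also have "\<dots> = (1 - e) * (fst p * (1 + m)) + e / 2 * (1 + m)" by (simp add: algebra_simps)
      also have "\<dots> < (1 - e) * 2 + e * 2"
        using e pm by (intro add_le_less_mono mult_left_mono) auto
      finally have "scale (z e) < 2" by simp
      moreover have "\<bar>(1 - e) * x\<bar> < 1" if "\<bar>x\<bar> \<le> 1" for x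
      proof -
        have "\<bar>(1 - e) * x\<bar> \<le> (1 - e) * 1" unfolding abs_mult using e that by (intro mult_mono) auto
        thus ?thesis using e by simp
      qed
      ultimately show ?thesis
        using p e by (auto simp: O'_def z_def inner_piece_def phase_box_iff intro!: add_nonneg_pos)
    qed
    thus "\<forall>\<^sub>F e in at_right 0. z e \<in> O'"
      unfolding eventually_at_right_field by (intro exI[of _ 1]) auto
  qed
qed

lemma outer_piece_closure:
  assumes \<sigma>: "\<bar>\<sigma>\<bar> = 1"
  shows "outer_piece \<sigma> \<subseteq> closure (interior (outer_piece \<sigma>))"
proof
  fix p assume p: "p \<in> outer_piece \<sigma>"
  \<comment> \<open>Only (h, h') moves, towards (\<sigma> / 2, - \<sigma> / 2), which lies strictly
    on the required side of h = h'. The open condition on the scale persists for small e.\<close>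
  define z where "z e = (fst p, (1 - e) * fst (snd p) + \<sigma> * e / 2, (1 - e) * snd (snd p) - \<sigma> * e / 2)" for e
  define O' where "O' = {p. 0 < fst p \<and> \<bar>fst (snd p)\<bar> < 1 \<and> \<bar>snd (snd p)\<bar> < 1 \<and> 2 < scale p \<and> \<sigma> * (snd (snd p) - fst (snd p)) < 0}"
  have \<sigma>2: "\<sigma> * \<sigma> = 1" using \<sigma> by (auto simp: abs_if split: if_splits)
  show "p \<in> closure (interior (outer_piece \<sigma>))"
  proof (rule in_closure_interiorI)
    show "open O'" unfolding O'_def by (intro open_Collect_conj open_Collect_less continuous_intros)
    show "O' \<subseteq> outer_piece \<sigma>" by (auto simp: O'_def outer_piece_def phase_box_iff)
    have "(z \<longlongrightarrow> (fst p, (1 - 0) * fst (snd p) + \<sigma> * 0 / 2, (1 - 0) * snd (snd p) - \<sigma> * 0 / 2)) (at_right 0)"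
      unfolding z_def by (intro tendsto_intros) auto
    thus lim: "(z \<longlongrightarrow> p) (at_right 0)" by simp
    have "((\<lambda>e. scale (z e)) \<longlongrightarrow> scale p) (at_right 0)"
      unfolding scale_def by (intro tendsto_intros lim)
    hence "\<forall>\<^sub>F e in at_right 0. 2 < scale (z e)"
      using p by (intro order_tendstoD) (auto simp: outer_piece_def)
    moreover have "\<forall>\<^sub>F e in at_right 0. 0 < e \<and> e < (1::real)"
      unfolding eventually_at_right_field by (intro exI[of _ 1]) auto
    ultimately show "\<forall>\<^sub>F e in at_right 0. z e \<in> O'"
    proof eventually_elim
      case (elim e)
      have small: "\<bar>(1 - e) * x + y\<bar> < 1" if "\<bar>x\<bar> \<le> 1" "\<bar>y\<bar> = e / 2" for x y
      proof -
        have "\<bar>(1 - e) * x\<bar> \<le> (1 - e) * 1" unfolding abs_mult using elim that by (intro mult_mono) auto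
        hence "\<bar>(1 - e) * x\<bar> + \<bar>y\<bar> < 1" using elim that by simp
        thus ?thesis by (rule le_less_trans[OF abs_triangle_ineq])
      qed
      have "\<sigma> * (snd (snd (z e)) - fst (snd (z e))) = (1 - e) * (\<sigma> * (snd (snd p) - fst (snd p))) - (\<sigma> * \<sigma>) * e"
        by (simp add: z_def field_simps)
      also have "\<dots> < 0"
        unfolding \<sigma>2 using elim p mult_nonneg_nonpos[of "1 - e" "\<sigma> * (snd (snd p) - fst (snd p))"]
        by (auto simp: outer_piece_def)
      finally have "\<sigma> * (snd (snd (z e)) - fst (snd (z e))) < 0" .
      moreover have "fst p \<noteq> 0" using p by (auto simp: outer_piece_def scale_def)
      moreover have "\<bar>fst (snd (z e))\<bar> < 1"
        using small[of "fst (snd p)" "\<sigma> * e / 2"] p elim \<sigma> by (simp add: z_def outer_piece_def phase_box_iff abs_mult)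
      moreover have "\<bar>snd (snd (z e))\<bar> < 1"
        using small[of "snd (snd p)" "- (\<sigma> * e / 2)"] p elim \<sigma> by (simp add: z_def outer_piece_def phase_box_iff abs_mult)
      ultimately show ?case using p elim by (auto simp: O'_def outer_piece_def phase_box_iff z_def)
    qed
  qed
qed

lemma transition_kernel_piecewise_continuous:
  "piecewise_continuous_on ({0..} \<times> {-1..1} \<times> {-1..1}) (\<lambda>(s, h, h'). (1 + s) * transition_kernel s h h')"
  unfolding piecewise_continuous_on_def
proof (intro exI[of _ "{inner_piece, outer_piece 1, outer_piece (-1)}"] conjI ballI)
  show "\<Union> {inner_piece, outer_piece 1, outer_piece (-1)} = {0..} \<times> {-1..1} \<times> {-1..1}"
    unfolding phase_box_eq[symmetric] by (auto simp: inner_piece_def outer_piece_def)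
  fix D assume "D \<in> {inner_piece, outer_piece 1, outer_piece (-1)}"
  then consider "D = inner_piece" | \<sigma> where "D = outer_piece \<sigma>" "\<bar>\<sigma>\<bar> = 1" by fastforce
  note D = this
  show "connected D" "D \<subseteq> closure (interior D)" "negligible (frontier D)"
    using D by (cases; simp add: inner_piece_connected outer_piece_connected inner_piece_closure
        outer_piece_closure negligible_frontier_pieces)+
  define f where "f = (\<lambda>p :: real \<times> real \<times> real. (1 + fst p) * (3 / pi\<^sup>2))"
  define g where "g = (\<lambda>p :: real \<times> real \<times> real. (1 + fst p) * (3 / pi\<^sup>2 * (max 0 (fst p * \<bar>fst (snd p) - snd (snd p)\<bar> - (scale p - 2)) /
      max (fst p * \<bar>fst (snd p) - snd (snd p)\<bar>) (scale p - 2))))"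
  show "continuous_on D (\<lambda>(s, h, h'). (1 + s) * transition_kernel s h h')"
    using D
  proof cases
    case 1
    have "continuous_on D f" unfolding f_def by (intro continuous_intros)
    thus ?thesis
      by (rule continuous_on_eq) (auto simp: 1 f_def inner_piece_def transition_kernel_def scale_def)
  next
    case (2 \<sigma>)
    \<comment> \<open>The denominator is at least \<open>scale p - 2\<close>, which is positive on
      this piece.\<close>
    have "continuous_on D g" unfolding g_def
      by (intro continuous_intros) (auto simp: 2 outer_piece_def max_def)
    thus ?thesis
      by (rule continuous_on_eq) (auto simp: 2 g_def outer_piece_def transition_kernel_def scale_def Let_def)
  qed
qed simp

lemma transition_kernel_bounded:
  "bounded ((\<lambda>(s, h, h'). (1 + s) * transition_kernel s h h') ` ({0..} \<times> {-1..1} \<times> {-1..1}))"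
  unfolding bounded_iff
proof (intro exI[of _ "15 / pi\<^sup>2"] ballI)
  fix x assume "x \<in> (\<lambda>(s, h, h'). (1 + s) * transition_kernel s h h') ` ({0..} \<times> {-1..1} \<times> {-1..1})"
  then obtain s h h' where *: "s \<ge> 0" "\<bar>h\<bar> \<le> 1" "\<bar>h'\<bar> \<le> 1" "x = (1 + s) * transition_kernel s h h'"
    by (auto simp: abs_le_iff)
  have "0 \<le> x" using * transition_kernel_nonneg by simp
  thus "norm x \<le> 15 / pi\<^sup>2" using transition_kernel_bound[OF *(1-3)] *(4) by simp
qed

section \<open>Image of the limiting measure\<close>

lemma nn_integral_lborel_swap:
  fixes f :: "real \<Rightarrow> real \<Rightarrow> ennreal"
  assumes "case_prod f \<in> borel_measurable (borel \<Otimes>\<^sub>M borel)"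
  shows "(\<integral>\<^sup>+y. \<integral>\<^sup>+x. f x y \<partial>lborel \<partial>lborel) = (\<integral>\<^sup>+x. \<integral>\<^sup>+y. f x y \<partial>lborel \<partial>lborel)"
  using assms by (intro lborel_pair.Fubini') simp

lemma nn_integral_between:
  fixes a b k :: real
  assumes "k \<ge> 0" "\<And>x. a < x \<Longrightarrow> x < b \<Longrightarrow> P x" "\<And>x. P x \<Longrightarrow> a \<le> x \<and> x \<le> b"
  shows "(\<integral>\<^sup>+x. ennreal (if P x then k else 0) \<partial>lborel) = ennreal (k * max 0 (b - a))"
proof -
  note meas = measure_lborel_between[of a b P, OF assms(2,3)]
  have "(\<integral>\<^sup>+x. ennreal (if P x then k else 0) \<partial>lborel) = (\<integral>\<^sup>+x. ennreal k * indicator {x. P x} x \<partial>lborel)"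
    by (intro nn_integral_cong) (auto simp: indicator_def)
  also have "\<dots> = ennreal k * emeasure lborel {x. P x}"
    using meas(1) by (subst nn_integral_cmult_indicator) auto
  also have "\<dots> = ennreal (k * max 0 (b - a))" using meas(2) assms(1) by (simp add: ennreal_mult)
  finally show ?thesis .
qed

text \<open>The densities of the three cases of the limiting map, in the variables \<open>(A, B, s)\<close>, where \<open>s\<close>
  is the first component of its value; the factor \<open>\<epsilon>\<close> is \<open>(-1)^N\<close>.\<close>

definition case_density1 :: "real \<Rightarrow> real \<Rightarrow> real \<Rightarrow> real \<Rightarrow> real" where
  "case_density1 x A B s = (if 0 < A \<and> A < 1 \<and> 0 < B \<and> B < 1 - A \<and> 0 < s \<and> s < 1 / (2 - A - B) \<and>
     1 - 2 * A < x \<and> x \<le> 1 then 6 / pi\<^sup>2 * (1 / (1 - A)) else 0)"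

definition case_density2 :: "real \<Rightarrow> real \<Rightarrow> real \<Rightarrow> real \<Rightarrow> real" where
  "case_density2 x A B s = (if 0 < A \<and> A < 1 \<and> 0 < B \<and> B < 1 - A \<and> s * (1 - A) < 1 \<and> 1 < s * (2 - A - B) \<and>
     -1 \<le> x \<and> x < -1 + 2 * B then 6 / pi\<^sup>2 * (1 / (1 - B)) else 0)"

definition case_density3 :: "real \<Rightarrow> real \<Rightarrow> real \<Rightarrow> real \<Rightarrow> real" where
  "case_density3 x A B s = (if 0 < A \<and> A < 1 \<and> 0 < B \<and> B < 1 - A \<and>
     (if B < A then s * (1 - A) < 1 \<and> 2 < s * (2 - A - B) else 1 < s * (1 - A) \<and> s * (2 - A - B) < 2) \<and>
     -1 + 2 * B \<le> x \<and> x \<le> 1 - 2 * A then 6 / pi\<^sup>2 * (1 / \<bar>A - B\<bar>) else 0)"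

lemma case_density_measurable [measurable]:
  assumes [measurable]: "A \<in> borel_measurable M" "B \<in> borel_measurable M" "s \<in> borel_measurable M"
  shows "(\<lambda>p. case_density1 x (A p) (B p) (s p)) \<in> borel_measurable M"
    and "(\<lambda>p. case_density2 x (A p) (B p) (s p)) \<in> borel_measurable M"
    and "(\<lambda>p. case_density3 x (A p) (B p) (s p)) \<in> borel_measurable M"
  unfolding case_density1_def case_density2_def case_density3_def by measurable

definition mu_density :: "real \<Rightarrow> real \<Rightarrow> real \<Rightarrow> real" where
  "mu_density A B Q = (if 0 < A \<and> A < 1 \<and> 0 < B \<and> B < 1 - A \<and> 0 < Q \<and> Q < 1 / (2 - A - B)
                              then 6 / pi\<^sup>2 * (1 / (1 - A)) else 0)"

lemma mu_density_measurable [measurable]: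
  assumes [measurable]: "A \<in> borel_measurable M" "B \<in> borel_measurable M" "s \<in> borel_measurable M"
  shows "(\<lambda>p. mu_density (A p) (B p) (s p)) \<in> borel_measurable M"
  unfolding mu_density_def by measurable

text \<open>With a = 1 - A and b = 1 - B, the equation s = Q' means Q = (1 - a s) / b. The Jacobian
  a / b turns the weight 1 / a into 1 / b, and 0 < Q < 1 / (a + b) becomes the two conditions on
  s.\<close>

lemma case2_substitution:
  fixes \<phi> :: "real \<Rightarrow> ennreal"
  assumes [measurable]: "\<phi> \<in> borel_measurable borel" and x: "\<bar>x\<bar> \<le> 1"
  shows "(\<integral>\<^sup>+Q. ennreal (if x < -1 + 2 * B then mu_density A B Q else 0) * \<phi> ((1 - Q * (1 - B)) / (1 - A)) \<partial>lborel) =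
    (\<integral>\<^sup>+s. ennreal (case_density2 x A B s) * \<phi> s \<partial>lborel)"
proof (cases "0 < A \<and> A < 1 \<and> 0 < B \<and> B < 1 - A \<and> x < -1 + 2 * B")
  case True
  define a b where "a = 1 - A" and "b = 1 - B"
  have ab: "a > 0" "b > 0" "a + b > 1" using True by (auto simp: a_def b_def)
  have "(\<integral>\<^sup>+Q. ennreal (if x < -1 + 2 * B then mu_density A B Q else 0) * \<phi> ((1 - Q * (1 - B)) / (1 - A)) \<partial>lborel)
    = ennreal \<bar>- (a / b)\<bar> * (\<integral>\<^sup>+s. ennreal (if x < -1 + 2 * B then mu_density A B (1 / b + - (a / b) * s) else 0) *
        \<phi> ((1 - (1 / b + - (a / b) * s) * (1 - B)) / (1 - A)) \<partial>lborel)"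
  proof -
    define F where "F Q = ennreal (if x < -1 + 2 * B then mu_density A B Q else 0) * \<phi> ((1 - Q * (1 - B)) / (1 - A))" for Q
    have [measurable]: "F \<in> borel_measurable borel" unfolding F_def by measurable
    show ?thesis using nn_integral_real_affine[of F "- (a / b)" "1 / b"] ab unfolding F_def by simp
  qed
  also have "\<dots> = (\<integral>\<^sup>+s. ennreal (a / b) * (ennreal (if x < -1 + 2 * B then mu_density A B (1 / b + - (a / b) * s) else 0) *
        \<phi> ((1 - (1 / b + - (a / b) * s) * (1 - B)) / (1 - A))) \<partial>lborel)"
  proof -
    have "\<bar>- (a / b)\<bar> = a / b" using ab by simp
    thus ?thesis by (simp only:) (rule nn_integral_cmult[symmetric], measurable)
  qed
  also have "\<dots> = (\<integral>\<^sup>+s. ennreal (case_density2 x A B s) * \<phi> s \<partial>lborel)"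
  proof (intro nn_integral_cong)
    fix s
    have s: "(1 - (1 / b + - (a / b) * s) * (1 - B)) / (1 - A) = s"
      using ab by (simp add: a_def[symmetric] b_def[symmetric] field_simps)
    have pos: "0 < 1 / b + - (a / b) * s \<longleftrightarrow> s * (1 - A) < 1"
      using ab by (simp add: a_def[symmetric] field_simps)
    have "1 / b + - (a / b) * s < 1 / (2 - A - B) \<longleftrightarrow> (1 - a * s) * (a + b) < b"
    proof -
      have "2 - A - B = a + b" by (simp add: a_def b_def)
      moreover have "1 / b + - (a / b) * s = (1 - a * s) / b" using ab by (simp add: field_simps)
      ultimately show ?thesis using ab by (simp add: divide_less_eq less_divide_eq mult_ac)
    qed
    also have "\<dots> \<longleftrightarrow> a * 1 < a * (s * (a + b))" by (simp add: algebra_simps)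
    also have "\<dots> \<longleftrightarrow> 1 < s * (2 - A - B)"
    proof -
      have "2 - A - B = a + b" by (simp add: a_def b_def)
      thus ?thesis using ab by simp
    qed
    finally have up: "1 / b + - (a / b) * s < 1 / (2 - A - B) \<longleftrightarrow> 1 < s * (2 - A - B)" .
    have "ennreal (a / b) * ennreal (if x < -1 + 2 * B then mu_density A B (1 / b + - (a / b) * s) else 0)
        = ennreal (case_density2 x A B s)"
      unfolding mu_density_def case_density2_def pos up using True x ab
      by (simp add: a_def[symmetric] b_def[symmetric] abs_le_iff flip: ennreal_mult')
    thus "ennreal (a / b) * (ennreal (if x < -1 + 2 * B then mu_density A B (1 / b + - (a / b) * s) else 0) *
        \<phi> ((1 - (1 / b + - (a / b) * s) * (1 - B)) / (1 - A))) = ennreal (case_density2 x A B s) * \<phi> s"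
      unfolding s by (simp add: mult.assoc[symmetric])
  qed
  finally show ?thesis .
next
  case False
  hence "case_density2 x A B s = 0" "(if x < -1 + 2 * B then mu_density A B s else 0) = 0" for s
    by (auto simp: case_density2_def mu_density_def)
  thus ?thesis by simp
qed

text \<open>With a = 1 - A and e = A - B one finds Q' + Q = (1 - Q e) / a, hence Q = (1 - a s) / e
  and the weight 1 / |e|. The sign of e decides the direction of both inequalities; for e = 0 the
  map does not depend on Q.\<close>

lemma case3_substitution:
  fixes \<phi> :: "real \<Rightarrow> ennreal"
  assumes [measurable]: "\<phi> \<in> borel_measurable borel" and ne: "A \<noteq> B"
  shows "(\<integral>\<^sup>+Q. ennreal (if -1 + 2 * B \<le> x \<and> x \<le> 1 - 2 * A then mu_density A B Q else 0) * \<phi> ((1 - Q * (1 - B)) / (1 - A) + Q) \<partial>lborel) =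
    (\<integral>\<^sup>+s. ennreal (case_density3 x A B s) * \<phi> s \<partial>lborel)"
proof (cases "0 < A \<and> A < 1 \<and> 0 < B \<and> B < 1 - A \<and> -1 + 2 * B \<le> x \<and> x \<le> 1 - 2 * A")
  case True
  define a e where "a = 1 - A" and "e = A - B"
  have ae: "a > 0" "2 * a + e > 0" "a + e > 0" using True by (auto simp: a_def e_def)
  have e: "e \<noteq> 0" using ne by (simp add: e_def)
  define c where "c = - (a / e)"
  have c: "c \<noteq> 0" using ae e by (simp add: c_def)
  have "(\<integral>\<^sup>+Q. ennreal (if -1 + 2 * B \<le> x \<and> x \<le> 1 - 2 * A then mu_density A B Q else 0) * \<phi> ((1 - Q * (1 - B)) / (1 - A) + Q) \<partial>lborel)
    = ennreal \<bar>c\<bar> * (\<integral>\<^sup>+s. ennreal (if -1 + 2 * B \<le> x \<and> x \<le> 1 - 2 * A then mu_density A B (1 / e + c * s) else 0) *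
        \<phi> ((1 - (1 / e + c * s) * (1 - B)) / (1 - A) + (1 / e + c * s)) \<partial>lborel)"
  proof -
    define F where "F Q = ennreal (if -1 + 2 * B \<le> x \<and> x \<le> 1 - 2 * A then mu_density A B Q else 0) * \<phi> ((1 - Q * (1 - B)) / (1 - A) + Q)" for Q
    have [measurable]: "F \<in> borel_measurable borel" unfolding F_def by measurable
    show ?thesis using nn_integral_real_affine[OF \<open>F \<in> borel_measurable borel\<close> c, of "1 / e"] unfolding F_def .
  qed
  also have "\<dots> = (\<integral>\<^sup>+s. ennreal \<bar>c\<bar> * (ennreal (if -1 + 2 * B \<le> x \<and> x \<le> 1 - 2 * A then mu_density A B (1 / e + c * s) else 0) *
        \<phi> ((1 - (1 / e + c * s) * (1 - B)) / (1 - A) + (1 / e + c * s))) \<partial>lborel)"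
    by (rule nn_integral_cmult[symmetric]) measurable
  also have "\<dots> = (\<integral>\<^sup>+s. ennreal (case_density3 x A B s) * \<phi> s \<partial>lborel)"
  proof (intro nn_integral_cong)
    fix s
    define Q where "Q = 1 / e + c * s"
    have Qe: "Q * e = 1 - a * s" using e by (simp add: Q_def c_def field_simps)
    have "(1 - Q * (1 - B)) / (1 - A) + Q = (1 - Q * (a + e)) / a + Q" by (simp add: a_def e_def)
    also have "\<dots> = (1 - Q * e) / a" using ae by (simp add: field_simps)
    also have "\<dots> = s" using ae by (simp add: Qe)
    finally have s: "(1 - Q * (1 - B)) / (1 - A) + Q = s" .
    have sum: "2 - A - B = 2 * a + e" by (simp add: a_def e_def)
    have iff: "(0 < Q \<and> Q < 1 / (2 - A - B)) \<longleftrightarrow>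
      (if B < A then s * (1 - A) < 1 \<and> 2 < s * (2 - A - B) else 1 < s * (1 - A) \<and> s * (2 - A - B) < 2)"
    proof (cases "B < A")
      case BA: True
      hence "e > 0" by (simp add: e_def)
      have "0 < Q \<longleftrightarrow> 0 < Q * e" using \<open>e > 0\<close> by (simp add: zero_less_mult_iff)
      also have "\<dots> \<longleftrightarrow> s * (1 - A) < 1" unfolding Qe by (simp add: a_def mult.commute)
      finally have 1: "0 < Q \<longleftrightarrow> s * (1 - A) < 1" .
      have "Q < 1 / (2 - A - B) \<longleftrightarrow> Q * (2 * a + e) < 1"
        unfolding sum using ae by (simp add: less_divide_eq)
      also have "\<dots> \<longleftrightarrow> e * (Q * (2 * a + e)) < e * 1" using \<open>e > 0\<close> by simp
      also have "e * (Q * (2 * a + e)) = (1 - a * s) * (2 * a + e)" unfolding Qe[symmetric] by simp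
      also have "(1 - a * s) * (2 * a + e) < e * 1 \<longleftrightarrow> a * 2 < a * (s * (2 * a + e))" by (simp add: algebra_simps)
      also have "\<dots> \<longleftrightarrow> 2 < s * (2 - A - B)" unfolding sum using ae by simp
      finally show ?thesis using 1 BA by simp
    next
      case BA: False
      hence "e < 0" using e by (simp add: e_def)
      have "0 < Q \<longleftrightarrow> Q * e < 0" using \<open>e < 0\<close> by (simp add: mult_less_0_iff)
      also have "\<dots> \<longleftrightarrow> 1 < s * (1 - A)" unfolding Qe by (simp add: a_def mult.commute)
      finally have 1: "0 < Q \<longleftrightarrow> 1 < s * (1 - A)" .
      have "Q < 1 / (2 - A - B) \<longleftrightarrow> Q * (2 * a + e) < 1"
        unfolding sum using ae by (simp add: less_divide_eq)
      also have "\<dots> \<longleftrightarrow> e * 1 < e * (Q * (2 * a + e))" using \<open>e < 0\<close> by simp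
      also have "e * (Q * (2 * a + e)) = (1 - a * s) * (2 * a + e)" unfolding Qe[symmetric] by simp
      also have "e * 1 < (1 - a * s) * (2 * a + e) \<longleftrightarrow> a * (s * (2 * a + e)) < a * 2" by (simp add: algebra_simps)
      also have "\<dots> \<longleftrightarrow> s * (2 - A - B) < 2" unfolding sum using ae by simp
      finally show ?thesis using 1 BA by simp
    qed
    have "ennreal \<bar>c\<bar> * ennreal (if -1 + 2 * B \<le> x \<and> x \<le> 1 - 2 * A then mu_density A B Q else 0)
        = ennreal (case_density3 x A B s)"
    proof -
      have "\<bar>c\<bar> * (6 / pi\<^sup>2 * (1 / (1 - A))) = 6 / pi\<^sup>2 * (1 / \<bar>A - B\<bar>)"
        using ae by (simp add: c_def a_def[symmetric] e_def[symmetric] abs_mult)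
      hence "\<bar>c\<bar> * (if -1 + 2 * B \<le> x \<and> x \<le> 1 - 2 * A then mu_density A B Q else 0) = case_density3 x A B s"
        using True iff unfolding mu_density_def case_density3_def by auto
      moreover have "mu_density A B Q \<ge> 0" using True by (auto simp: mu_density_def)
      ultimately show ?thesis by (subst ennreal_mult[symmetric]) auto
    qed
    thus "ennreal \<bar>c\<bar> * (ennreal (if -1 + 2 * B \<le> x \<and> x \<le> 1 - 2 * A then mu_density A B (1 / e + c * s) else 0) *
        \<phi> ((1 - (1 / e + c * s) * (1 - B)) / (1 - A) + (1 / e + c * s))) = ennreal (case_density3 x A B s) * \<phi> s"
      unfolding Q_def[symmetric] s by (simp add: mult.assoc[symmetric])
  qed
  finally show ?thesis .
next
  case False
  hence "case_density3 x A B s = 0" "(if -1 + 2 * B \<le> x \<and> x \<le> 1 - 2 * A then mu_density A B s else 0) = 0" for s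
    by (auto simp: case_density3_def mu_density_def)
  thus ?thesis by simp
qed

text \<open>Density in (s, h) for a fixed N, with \<epsilon> = (-1)^N. The value h determines A in
  the first case, B in the second and A - B in the third; solving for that variable gives the
  displayed arguments and the Jacobian 1/2, and the other variable is integrated out.\<close>

definition sign_density :: "real \<Rightarrow> real \<Rightarrow> real \<Rightarrow> real \<Rightarrow> ennreal" where
  "sign_density \<epsilon> h' s h = ennreal (1 / 2) *
     ((\<integral>\<^sup>+B. ennreal (case_density1 (\<epsilon> * h') (1 - \<epsilon> * h' / 2 + \<epsilon> / 2 * h) B s) \<partial>lborel) +
      (\<integral>\<^sup>+A. ennreal (case_density2 (\<epsilon> * h') A (1 + \<epsilon> * h' / 2 + - (\<epsilon> / 2) * h) s) \<partial>lborel) +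
      (\<integral>\<^sup>+A. ennreal (case_density3 (\<epsilon> * h') A (A + \<epsilon> * h' / 2 + - (\<epsilon> / 2) * h) s) \<partial>lborel))"

lemma sign_density_measurable [measurable]:
  assumes [measurable]: "a \<in> borel_measurable M" "b \<in> borel_measurable M"
  shows "(\<lambda>p. sign_density \<epsilon> h' (a p) (b p)) \<in> borel_measurable M"
  unfolding sign_density_def by measurable

lemma nn_integral_case1:
  fixes \<phi> :: "real \<times> real \<Rightarrow> ennreal"
  assumes [measurable]: "\<phi> \<in> borel_measurable (borel \<Otimes>\<^sub>M borel)" and \<epsilon>: "\<bar>\<epsilon>\<bar> = 1"
  shows "(\<integral>\<^sup>+A. \<integral>\<^sup>+B. \<integral>\<^sup>+Q. ennreal (case_density1 x A B Q) * \<phi> (Q, h' - 2 * \<epsilon> * (1 - A)) \<partial>lborel \<partial>lborel \<partial>lborel) =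
    (\<integral>\<^sup>+h. \<integral>\<^sup>+s. ennreal (1 / 2) * (\<integral>\<^sup>+B. ennreal (case_density1 x (1 - \<epsilon> * h' / 2 + \<epsilon> / 2 * h) B s) \<partial>lborel) * \<phi> (s, h) \<partial>lborel \<partial>lborel)"
proof -
  have \<epsilon>2: "\<epsilon> * \<epsilon> = 1" "\<epsilon> \<noteq> 0" using \<epsilon> by (auto simp: abs_if split: if_splits)
  have eq: "h' - 2 * \<epsilon> * (1 - (1 - \<epsilon> * h' / 2 + \<epsilon> / 2 * h)) = h" for h
  proof -
    have "h' - 2 * \<epsilon> * (1 - (1 - \<epsilon> * h' / 2 + \<epsilon> / 2 * h)) = h' + (\<epsilon> * \<epsilon>) * (h - h')" by (simp add: algebra_simps)
    thus ?thesis by (simp add: \<epsilon>2)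
  qed
  have "(\<integral>\<^sup>+A. \<integral>\<^sup>+B. \<integral>\<^sup>+Q. ennreal (case_density1 x A B Q) * \<phi> (Q, h' - 2 * \<epsilon> * (1 - A)) \<partial>lborel \<partial>lborel \<partial>lborel) =
    (\<integral>\<^sup>+A. \<integral>\<^sup>+Q. \<integral>\<^sup>+B. ennreal (case_density1 x A B Q) * \<phi> (Q, h' - 2 * \<epsilon> * (1 - A)) \<partial>lborel \<partial>lborel \<partial>lborel)"
    by (intro nn_integral_cong nn_integral_lborel_swap) measurable
  also have "\<dots> = (\<integral>\<^sup>+A. \<integral>\<^sup>+Q. (\<integral>\<^sup>+B. ennreal (case_density1 x A B Q) \<partial>lborel) * \<phi> (Q, h' - 2 * \<epsilon> * (1 - A)) \<partial>lborel \<partial>lborel)"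
    by (intro nn_integral_cong nn_integral_multc) measurable
  also have "\<dots> = ennreal \<bar>\<epsilon> / 2\<bar> * (\<integral>\<^sup>+h. \<integral>\<^sup>+Q. (\<integral>\<^sup>+B. ennreal (case_density1 x (1 - \<epsilon> * h' / 2 + \<epsilon> / 2 * h) B Q) \<partial>lborel) *
      \<phi> (Q, h' - 2 * \<epsilon> * (1 - (1 - \<epsilon> * h' / 2 + \<epsilon> / 2 * h))) \<partial>lborel \<partial>lborel)"
  proof -
    define F where "F A = (\<integral>\<^sup>+Q. (\<integral>\<^sup>+B. ennreal (case_density1 x A B Q) \<partial>lborel) * \<phi> (Q, h' - 2 * \<epsilon> * (1 - A)) \<partial>lborel)" for A
    have F: "F \<in> borel_measurable borel" unfolding F_def by measurable
    have "\<epsilon> / 2 \<noteq> 0" using \<epsilon>2 by simp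
    from nn_integral_real_affine[OF F this, of "1 - \<epsilon> * h' / 2"] show ?thesis unfolding F_def .
  qed
  also have "\<bar>\<epsilon> / 2\<bar> = 1 / 2" using \<epsilon> by simp
  finally show ?thesis
    unfolding eq by (simp add: nn_integral_cmult[symmetric] mult.assoc[symmetric])
qed

lemma nn_integral_case2:
  fixes \<phi> :: "real \<times> real \<Rightarrow> ennreal"
  assumes [measurable]: "\<phi> \<in> borel_measurable (borel \<Otimes>\<^sub>M borel)" and \<epsilon>: "\<bar>\<epsilon>\<bar> = 1"
  shows "(\<integral>\<^sup>+A. \<integral>\<^sup>+B. \<integral>\<^sup>+s. ennreal (case_density2 x A B s) * \<phi> (s, h' + 2 * \<epsilon> * (1 - B)) \<partial>lborel \<partial>lborel \<partial>lborel) =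
    (\<integral>\<^sup>+h. \<integral>\<^sup>+s. ennreal (1 / 2) * (\<integral>\<^sup>+A. ennreal (case_density2 x A (1 + \<epsilon> * h' / 2 + - (\<epsilon> / 2) * h) s) \<partial>lborel) * \<phi> (s, h) \<partial>lborel \<partial>lborel)"
proof -
  have \<epsilon>2: "\<epsilon> * \<epsilon> = 1" "\<epsilon> \<noteq> 0" using \<epsilon> by (auto simp: abs_if split: if_splits)
  have eq: "h' + 2 * \<epsilon> * (1 - (1 + \<epsilon> * h' / 2 + - (\<epsilon> / 2) * h)) = h" for h
  proof -
    have "h' + 2 * \<epsilon> * (1 - (1 + \<epsilon> * h' / 2 + - (\<epsilon> / 2) * h)) = h' + (\<epsilon> * \<epsilon>) * (h - h')" by (simp add: algebra_simps)
    thus ?thesis by (simp add: \<epsilon>2)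
  qed
  have "(\<integral>\<^sup>+A. \<integral>\<^sup>+B. \<integral>\<^sup>+s. ennreal (case_density2 x A B s) * \<phi> (s, h' + 2 * \<epsilon> * (1 - B)) \<partial>lborel \<partial>lborel \<partial>lborel) =
    (\<integral>\<^sup>+B. \<integral>\<^sup>+A. \<integral>\<^sup>+s. ennreal (case_density2 x A B s) * \<phi> (s, h' + 2 * \<epsilon> * (1 - B)) \<partial>lborel \<partial>lborel \<partial>lborel)"
    by (intro nn_integral_lborel_swap) measurable
  also have "\<dots> = (\<integral>\<^sup>+B. \<integral>\<^sup>+s. \<integral>\<^sup>+A. ennreal (case_density2 x A B s) * \<phi> (s, h' + 2 * \<epsilon> * (1 - B)) \<partial>lborel \<partial>lborel \<partial>lborel)"
    by (intro nn_integral_cong nn_integral_lborel_swap) measurable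
  also have "\<dots> = (\<integral>\<^sup>+B. \<integral>\<^sup>+s. (\<integral>\<^sup>+A. ennreal (case_density2 x A B s) \<partial>lborel) * \<phi> (s, h' + 2 * \<epsilon> * (1 - B)) \<partial>lborel \<partial>lborel)"
    by (intro nn_integral_cong nn_integral_multc) measurable
  also have "\<dots> = ennreal \<bar>- (\<epsilon> / 2)\<bar> * (\<integral>\<^sup>+h. \<integral>\<^sup>+s. (\<integral>\<^sup>+A. ennreal (case_density2 x A (1 + \<epsilon> * h' / 2 + - (\<epsilon> / 2) * h) s) \<partial>lborel) *
      \<phi> (s, h' + 2 * \<epsilon> * (1 - (1 + \<epsilon> * h' / 2 + - (\<epsilon> / 2) * h))) \<partial>lborel \<partial>lborel)"
  proof -
    define F where "F B = (\<integral>\<^sup>+s. (\<integral>\<^sup>+A. ennreal (case_density2 x A B s) \<partial>lborel) * \<phi> (s, h' + 2 * \<epsilon> * (1 - B)) \<partial>lborel)" for B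
    have F: "F \<in> borel_measurable borel" unfolding F_def by measurable
    have "- (\<epsilon> / 2) \<noteq> 0" using \<epsilon>2 by simp
    from nn_integral_real_affine[OF F this, of "1 + \<epsilon> * h' / 2"] show ?thesis unfolding F_def .
  qed
  also have "\<bar>- (\<epsilon> / 2)\<bar> = 1 / 2" using \<epsilon> by simp
  finally show ?thesis
    unfolding eq by (simp add: nn_integral_cmult[symmetric] mult.assoc[symmetric])
qed

lemma nn_integral_case3:
  fixes \<phi> :: "real \<times> real \<Rightarrow> ennreal"
  assumes [measurable]: "\<phi> \<in> borel_measurable (borel \<Otimes>\<^sub>M borel)" and \<epsilon>: "\<bar>\<epsilon>\<bar> = 1"
  shows "(\<integral>\<^sup>+A. \<integral>\<^sup>+B. \<integral>\<^sup>+s. ennreal (case_density3 x A B s) * \<phi> (s, h' + 2 * \<epsilon> * (A - B)) \<partial>lborel \<partial>lborel \<partial>lborel) =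
    (\<integral>\<^sup>+h. \<integral>\<^sup>+s. ennreal (1 / 2) * (\<integral>\<^sup>+A. ennreal (case_density3 x A (A + \<epsilon> * h' / 2 + - (\<epsilon> / 2) * h) s) \<partial>lborel) * \<phi> (s, h) \<partial>lborel \<partial>lborel)"
proof -
  have \<epsilon>2: "\<epsilon> * \<epsilon> = 1" "\<epsilon> \<noteq> 0" using \<epsilon> by (auto simp: abs_if split: if_splits)
  have eq: "h' + 2 * \<epsilon> * (A - ((A + \<epsilon> * h' / 2) + - (\<epsilon> / 2) * h)) = h" for h A
  proof -
    have "h' + 2 * \<epsilon> * (A - ((A + \<epsilon> * h' / 2) + - (\<epsilon> / 2) * h)) = h' + (\<epsilon> * \<epsilon>) * (h - h')" by (simp add: algebra_simps)
    thus ?thesis by (simp add: \<epsilon>2)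
  qed
  have "(\<integral>\<^sup>+A. \<integral>\<^sup>+B. \<integral>\<^sup>+s. ennreal (case_density3 x A B s) * \<phi> (s, h' + 2 * \<epsilon> * (A - B)) \<partial>lborel \<partial>lborel \<partial>lborel) =
     (\<integral>\<^sup>+A. ennreal \<bar>- (\<epsilon> / 2)\<bar> * (\<integral>\<^sup>+h. \<integral>\<^sup>+s. ennreal (case_density3 x A ((A + \<epsilon> * h' / 2) + - (\<epsilon> / 2) * h) s) *
       \<phi> (s, h' + 2 * \<epsilon> * (A - ((A + \<epsilon> * h' / 2) + - (\<epsilon> / 2) * h))) \<partial>lborel \<partial>lborel) \<partial>lborel)"
  proof (rule nn_integral_cong)
    fix A
    define F where "F B = (\<integral>\<^sup>+s. ennreal (case_density3 x A B s) * \<phi> (s, h' + 2 * \<epsilon> * (A - B)) \<partial>lborel)" for B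
    have F: "F \<in> borel_measurable borel" unfolding F_def by measurable
    have "- (\<epsilon> / 2) \<noteq> 0" using \<epsilon>2 by simp
    from nn_integral_real_affine[OF F this, of "A + \<epsilon> * h' / 2"]
    show "(\<integral>\<^sup>+B. \<integral>\<^sup>+s. ennreal (case_density3 x A B s) * \<phi> (s, h' + 2 * \<epsilon> * (A - B)) \<partial>lborel \<partial>lborel) =
      ennreal \<bar>- (\<epsilon> / 2)\<bar> * (\<integral>\<^sup>+h. \<integral>\<^sup>+s. ennreal (case_density3 x A ((A + \<epsilon> * h' / 2) + - (\<epsilon> / 2) * h) s) *
       \<phi> (s, h' + 2 * \<epsilon> * (A - ((A + \<epsilon> * h' / 2) + - (\<epsilon> / 2) * h))) \<partial>lborel \<partial>lborel)"
      unfolding F_def .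
  qed
  also have "\<bar>- (\<epsilon> / 2)\<bar> = 1 / 2" using \<epsilon> by simp
  also have "(\<integral>\<^sup>+A. ennreal (1 / 2) * (\<integral>\<^sup>+h. \<integral>\<^sup>+s. ennreal (case_density3 x A ((A + \<epsilon> * h' / 2) + - (\<epsilon> / 2) * h) s) *
       \<phi> (s, h' + 2 * \<epsilon> * (A - ((A + \<epsilon> * h' / 2) + - (\<epsilon> / 2) * h))) \<partial>lborel \<partial>lborel) \<partial>lborel) =
     ennreal (1 / 2) * (\<integral>\<^sup>+A. \<integral>\<^sup>+h. \<integral>\<^sup>+s. ennreal (case_density3 x A ((A + \<epsilon> * h' / 2) + - (\<epsilon> / 2) * h) s) * \<phi> (s, h) \<partial>lborel \<partial>lborel \<partial>lborel)"
    unfolding eq by (rule nn_integral_cmult) measurable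
  also have "(\<integral>\<^sup>+A. \<integral>\<^sup>+h. \<integral>\<^sup>+s. ennreal (case_density3 x A ((A + \<epsilon> * h' / 2) + - (\<epsilon> / 2) * h) s) * \<phi> (s, h) \<partial>lborel \<partial>lborel \<partial>lborel) =
     (\<integral>\<^sup>+h. \<integral>\<^sup>+A. \<integral>\<^sup>+s. ennreal (case_density3 x A ((A + \<epsilon> * h' / 2) + - (\<epsilon> / 2) * h) s) * \<phi> (s, h) \<partial>lborel \<partial>lborel \<partial>lborel)"
    by (intro nn_integral_lborel_swap) measurable
  also have "\<dots> = (\<integral>\<^sup>+h. \<integral>\<^sup>+s. \<integral>\<^sup>+A. ennreal (case_density3 x A ((A + \<epsilon> * h' / 2) + - (\<epsilon> / 2) * h) s) * \<phi> (s, h) \<partial>lborel \<partial>lborel \<partial>lborel)"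
    by (intro nn_integral_cong nn_integral_lborel_swap) measurable
  also have "\<dots> = (\<integral>\<^sup>+h. \<integral>\<^sup>+s. (\<integral>\<^sup>+A. ennreal (case_density3 x A ((A + \<epsilon> * h' / 2) + - (\<epsilon> / 2) * h) s) \<partial>lborel) * \<phi> (s, h) \<partial>lborel \<partial>lborel)"
    by (intro nn_integral_cong nn_integral_multc) measurable
  finally show ?thesis by (simp add: nn_integral_cmult[symmetric] mult.assoc[symmetric])
qed


section \<open>Explicit densities for the two signs\<close>

lemma half_sum:
  fixes D u v :: real
  assumes "D > 0" "u \<ge> 0" "v \<ge> 0"
  shows "ennreal (1 / 2) * (ennreal (6 / pi\<^sup>2 * (1 / (D / 2)) * (u / 2)) + ennreal (6 / pi\<^sup>2 * (1 / (D / 2)) * (v / 2))) =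
    ennreal (3 / pi\<^sup>2 / D * (u + v))"
proof -
  have "ennreal (1 / 2) * (ennreal (6 / pi\<^sup>2 * (1 / (D / 2)) * (u / 2)) + ennreal (6 / pi\<^sup>2 * (1 / (D / 2)) * (v / 2)))
     = ennreal (1 / 2 * (6 / pi\<^sup>2 * (1 / (D / 2)) * (u / 2) + 6 / pi\<^sup>2 * (1 / (D / 2)) * (v / 2)))"
    using assms by (subst ennreal_plus[symmetric], simp, simp, subst ennreal_mult'[symmetric]) auto
  also have "1 / 2 * (6 / pi\<^sup>2 * (1 / (D / 2)) * (u / 2) + 6 / pi\<^sup>2 * (1 / (D / 2)) * (v / 2)) = 3 / pi\<^sup>2 / D * (u + v)"
    using assms by (simp add: field_simps)
  finally show ?thesis .
qed

text \<open>When \<epsilon> h exceeds \<epsilon> h', the first case would require A = 1 + D / 2 > 1.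
  The other two have 1 - B = D / 2 and A - B = D / 2, hence the same weight. With x = 2 / s the
  conditions on A are linear, so each integral is the weight times the length of an
  interval.\<close>

lemma sign_density_pos:
  fixes \<epsilon> h h' s :: real
  assumes \<epsilon>: "\<bar>\<epsilon>\<bar> = 1" and h: "\<bar>h\<bar> < 1" "\<bar>h'\<bar> \<le> 1" and s: "s > 0" and e: "\<epsilon> * (h - h') > 0"
  defines "D \<equiv> \<bar>h - h'\<bar>" and "M \<equiv> max \<bar>h\<bar> \<bar>h'\<bar>" and "x \<equiv> 2 / s"
  shows "sign_density \<epsilon> h' s h = ennreal (3 / pi\<^sup>2 / D *
     (max 0 (min D (2 + D - x) - max 0 (2 - x)) + max 0 (min (1 - M + D) (2 + D / 2 - x) - max D (2 - x))))"
proof -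
  have \<epsilon>': "\<epsilon> = 1 \<or> \<epsilon> = -1" using \<epsilon> by linarith
  have D: "\<epsilon> * h - \<epsilon> * h' = D" "D > 0" using e \<epsilon>' by (auto simp: D_def)
  have M: "1 - M + D = min (1 - \<epsilon> * h') (1 + \<epsilon> * h)" using e \<epsilon>' by (auto simp: M_def D_def max_def min_def)
  have \<epsilon>h: "\<bar>\<epsilon> * h\<bar> < 1" "\<bar>\<epsilon> * h'\<bar> \<le> 1" using h \<epsilon> by (simp_all add: abs_mult)
  have DD: "D < 2" using D \<epsilon>h by linarith
  have sx: "s * t < 2 \<longleftrightarrow> t < x" "2 < s * t \<longleftrightarrow> x < t" for t
    using s by (simp_all add: x_def field_simps)
  have sx': "s * t < 1 \<longleftrightarrow> 2 * t < x" "1 < s * t \<longleftrightarrow> x < 2 * t" for t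
    using sx[of "2 * t"] by linarith+
  have e1: "1 - \<epsilon> * h' / 2 + \<epsilon> / 2 * h = 1 + D / 2" "1 + \<epsilon> * h' / 2 + - (\<epsilon> / 2) * h = 1 - D / 2"
    "A + \<epsilon> * h' / 2 + - (\<epsilon> / 2) * h = A - D / 2" for A
    using D(1) by (simp_all add: field_simps)
  have 1: "case_density1 (\<epsilon> * h') (1 + D / 2) B s = 0" for B using D by (simp add: case_density1_def)
  have 2: "(\<integral>\<^sup>+A. ennreal (case_density2 (\<epsilon> * h') A (1 - D / 2) s) \<partial>lborel) =
     ennreal (6 / pi\<^sup>2 * (1 / (D / 2)) * max 0 (min (D / 2) (1 + D / 2 - x / 2) - max 0 (1 - x / 2)))"
  proof -
    define P where "P A \<longleftrightarrow> 0 < A \<and> A < 1 \<and> 0 < 1 - D / 2 \<and> 1 - D / 2 < 1 - A \<and> s * (1 - A) < 1 \<and> 1 < s * (2 - A - (1 - D / 2)) \<and>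
     -1 \<le> \<epsilon> * h' \<and> \<epsilon> * h' < -1 + 2 * (1 - D / 2)" for A
    have "case_density2 (\<epsilon> * h') A (1 - D / 2) s = (if P A then 6 / pi\<^sup>2 * (1 / (D / 2)) else 0)" for A
      by (simp add: case_density2_def P_def)
    moreover have "(\<integral>\<^sup>+A. ennreal (if P A then 6 / pi\<^sup>2 * (1 / (D / 2)) else 0) \<partial>lborel) =
     ennreal (6 / pi\<^sup>2 * (1 / (D / 2)) * max 0 (min (D / 2) (1 + D / 2 - x / 2) - max 0 (1 - x / 2)))"
    proof (rule nn_integral_between)
      show "P A" if "max 0 (1 - x / 2) < A" "A < min (D / 2) (1 + D / 2 - x / 2)" for A
        unfolding P_def sx' using that DD D \<epsilon>h by auto
      show "max 0 (1 - x / 2) \<le> A \<and> A \<le> min (D / 2) (1 + D / 2 - x / 2)" if "P A" for A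
        using that unfolding P_def sx' by auto
    qed (use D in simp)
    ultimately show ?thesis by simp
  qed
  have 3: "(\<integral>\<^sup>+A. ennreal (case_density3 (\<epsilon> * h') A (A - D / 2) s) \<partial>lborel) =
     ennreal (6 / pi\<^sup>2 * (1 / (D / 2)) * max 0 (min ((1 - M + D) / 2) (1 + D / 4 - x / 2) - max (D / 2) (1 - x / 2)))"
  proof -
    define P where "P A \<longleftrightarrow> 0 < A \<and> A < 1 \<and> 0 < A - D / 2 \<and> A - D / 2 < 1 - A \<and> s * (1 - A) < 1 \<and> 2 < s * (2 - A - (A - D / 2)) \<and>
     -1 + 2 * (A - D / 2) \<le> \<epsilon> * h' \<and> \<epsilon> * h' \<le> 1 - 2 * A" for A
    have "case_density3 (\<epsilon> * h') A (A - D / 2) s = (if P A then 6 / pi\<^sup>2 * (1 / (D / 2)) else 0)" for A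
      using D by (simp add: case_density3_def P_def)
    moreover have "(\<integral>\<^sup>+A. ennreal (if P A then 6 / pi\<^sup>2 * (1 / (D / 2)) else 0) \<partial>lborel) =
     ennreal (6 / pi\<^sup>2 * (1 / (D / 2)) * max 0 (min ((1 - M + D) / 2) (1 + D / 4 - x / 2) - max (D / 2) (1 - x / 2)))"
    proof (rule nn_integral_between)
      fix A assume *: "max (D / 2) (1 - x / 2) < A" "A < min ((1 - M + D) / 2) (1 + D / 4 - x / 2)"
      hence "2 * A < 1 - \<epsilon> * h'" "2 * A < 1 + \<epsilon> * h" unfolding M by auto
      thus "P A" unfolding P_def sx' sx using * DD D \<epsilon>h by auto
    next
      fix A assume *: "P A"
      hence "2 * A \<le> 1 - M + D" unfolding M P_def using D(1) by auto
      thus "max (D / 2) (1 - x / 2) \<le> A \<and> A \<le> min ((1 - M + D) / 2) (1 + D / 4 - x / 2)"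
        using * unfolding P_def sx' sx by auto
    qed (use D in simp)
    ultimately show ?thesis by simp
  qed
  have h1: "max 0 (min (D / 2) (1 + D / 2 - x / 2) - max 0 (1 - x / 2)) = max 0 (min D (2 + D - x) - max 0 (2 - x)) / 2"
    by (auto simp: max_def min_def field_simps)
  have h2: "max 0 (min ((1 - M + D) / 2) (1 + D / 4 - x / 2) - max (D / 2) (1 - x / 2)) =
      max 0 (min (1 - M + D) (2 + D / 2 - x) - max D (2 - x)) / 2"
    by (auto simp: max_def min_def field_simps)
  have z: "(\<integral>\<^sup>+B. ennreal 0 \<partial>(lborel :: real measure)) = 0" by simp
  show ?thesis
    unfolding sign_density_def e1 1 2 3 h1 h2 z add_0_left by (rule half_sum) (use D in auto)
qed

text \<open>Counterpart for \<epsilon> h < \<epsilon> h': here the second case would require B = 1 +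
  D / 2 > 1, and the weights come from 1 - A = D / 2 and B - A = D / 2.\<close>

lemma sign_density_neg:
  fixes \<epsilon> h h' s :: real
  assumes \<epsilon>: "\<bar>\<epsilon>\<bar> = 1" and h: "\<bar>h\<bar> < 1" "\<bar>h'\<bar> \<le> 1" and s: "s > 0" and e: "\<epsilon> * (h - h') < 0"
  defines "D \<equiv> \<bar>h - h'\<bar>" and "M \<equiv> max \<bar>h\<bar> \<bar>h'\<bar>" and "x \<equiv> 2 / s"
  shows "sign_density \<epsilon> h' s h = ennreal (3 / pi\<^sup>2 / D *
     (max 0 (D - max 0 (2 + D - x)) + max 0 (min (1 - M) (2 - x) - max 0 (2 - D / 2 - x))))"
proof -
  have \<epsilon>': "\<epsilon> = 1 \<or> \<epsilon> = -1" using \<epsilon> by linarith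
  have D: "\<epsilon> * h' - \<epsilon> * h = D" "D > 0" using e \<epsilon>' by (auto simp: D_def)
  have M: "1 - M = min (1 - \<epsilon> * h') (1 + \<epsilon> * h)" using e \<epsilon>' by (auto simp: M_def max_def min_def)
  have \<epsilon>h: "\<bar>\<epsilon> * h\<bar> < 1" "\<bar>\<epsilon> * h'\<bar> \<le> 1" using h \<epsilon> by (simp_all add: abs_mult)
  have DD: "D < 2" using D \<epsilon>h by linarith
  have sx: "s * t < 2 \<longleftrightarrow> t < x" "2 < s * t \<longleftrightarrow> x < t" for t
    using s by (simp_all add: x_def field_simps)
  have sx': "s * t < 1 \<longleftrightarrow> 2 * t < x" "1 < s * t \<longleftrightarrow> x < 2 * t" for t
    using sx[of "2 * t"] by linarith+
  have e1: "1 - \<epsilon> * h' / 2 + \<epsilon> / 2 * h = 1 - D / 2" "1 + \<epsilon> * h' / 2 + - (\<epsilon> / 2) * h = 1 + D / 2"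
    "A + \<epsilon> * h' / 2 + - (\<epsilon> / 2) * h = A + D / 2" for A
    using D(1) by (simp_all add: field_simps)
  have 2: "case_density2 (\<epsilon> * h') A (1 + D / 2) s = 0" for A using D by (auto simp: case_density2_def)
  have 1: "(\<integral>\<^sup>+B. ennreal (case_density1 (\<epsilon> * h') (1 - D / 2) B s) \<partial>lborel) =
     ennreal (6 / pi\<^sup>2 * (1 / (D / 2)) * max 0 (D / 2 - max 0 (1 + D / 2 - x / 2)))"
  proof -
    define P where "P B \<longleftrightarrow> 0 < 1 - D / 2 \<and> 1 - D / 2 < 1 \<and> 0 < B \<and> B < 1 - (1 - D / 2) \<and> 0 < s \<and> s < 1 / (2 - (1 - D / 2) - B) \<and>
     1 - 2 * (1 - D / 2) < \<epsilon> * h' \<and> \<epsilon> * h' \<le> 1" for B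
    have "case_density1 (\<epsilon> * h') (1 - D / 2) B s = (if P B then 6 / pi\<^sup>2 * (1 / (D / 2)) else 0)" for B
      by (simp add: case_density1_def P_def)
    moreover have "(\<integral>\<^sup>+B. ennreal (if P B then 6 / pi\<^sup>2 * (1 / (D / 2)) else 0) \<partial>lborel) =
     ennreal (6 / pi\<^sup>2 * (1 / (D / 2)) * max 0 (D / 2 - max 0 (1 + D / 2 - x / 2)))"
    proof (rule nn_integral_between)
      have iff: "s < 1 / (2 - (1 - D / 2) - B) \<longleftrightarrow> 2 * (1 + D / 2 - B) < x" if "B < D / 2" for B
        using that sx'(1)[of "1 + D / 2 - B"] by (simp add: less_divide_eq)
      show "P B" if "max 0 (1 + D / 2 - x / 2) < B" "B < D / 2" for B
        unfolding P_def using that DD D \<epsilon>h s iff[of B] by auto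
      show "max 0 (1 + D / 2 - x / 2) \<le> B \<and> B \<le> D / 2" if "P B" for B
        using that iff[of B] unfolding P_def by auto
    qed (use D in simp)
    ultimately show ?thesis by simp
  qed
  have 3: "(\<integral>\<^sup>+A. ennreal (case_density3 (\<epsilon> * h') A (A + D / 2) s) \<partial>lborel) =
     ennreal (6 / pi\<^sup>2 * (1 / (D / 2)) * max 0 (min ((1 - M) / 2) (1 - x / 2) - max 0 (1 - D / 4 - x / 2)))"
  proof -
    define P where "P A \<longleftrightarrow> 0 < A \<and> A < 1 \<and> 0 < A + D / 2 \<and> A + D / 2 < 1 - A \<and> 1 < s * (1 - A) \<and> s * (2 - A - (A + D / 2)) < 2 \<and>
     -1 + 2 * (A + D / 2) \<le> \<epsilon> * h' \<and> \<epsilon> * h' \<le> 1 - 2 * A" for A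
    have "case_density3 (\<epsilon> * h') A (A + D / 2) s = (if P A then 6 / pi\<^sup>2 * (1 / (D / 2)) else 0)" for A
      using D by (simp add: case_density3_def P_def)
    moreover have "(\<integral>\<^sup>+A. ennreal (if P A then 6 / pi\<^sup>2 * (1 / (D / 2)) else 0) \<partial>lborel) =
     ennreal (6 / pi\<^sup>2 * (1 / (D / 2)) * max 0 (min ((1 - M) / 2) (1 - x / 2) - max 0 (1 - D / 4 - x / 2)))"
    proof (rule nn_integral_between)
      fix A assume *: "max 0 (1 - D / 4 - x / 2) < A" "A < min ((1 - M) / 2) (1 - x / 2)"
      hence "2 * A < 1 - \<epsilon> * h'" "2 * A < 1 + \<epsilon> * h" unfolding M by auto
      thus "P A" unfolding P_def sx' sx using * DD D \<epsilon>h by auto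
    next
      fix A assume *: "P A"
      hence "2 * A \<le> 1 - M" unfolding M P_def using D(1) by auto
      thus "max 0 (1 - D / 4 - x / 2) \<le> A \<and> A \<le> min ((1 - M) / 2) (1 - x / 2)"
        using * unfolding P_def sx' sx by auto
    qed (use D in simp)
    ultimately show ?thesis by simp
  qed
  have h1: "max 0 (D / 2 - max 0 (1 + D / 2 - x / 2)) = max 0 (D - max 0 (2 + D - x)) / 2"
    by (auto simp: max_def min_def field_simps)
  have h2: "max 0 (min ((1 - M) / 2) (1 - x / 2) - max 0 (1 - D / 4 - x / 2)) =
      max 0 (min (1 - M) (2 - x) - max 0 (2 - D / 2 - x)) / 2"
    by (auto simp: max_def min_def field_simps)
  have z: "(\<integral>\<^sup>+A. ennreal 0 \<partial>(lborel :: real measure)) = 0" by simp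
  show ?thesis
    unfolding sign_density_def e1 1 2 3 h1 h2 z add_0_right by (rule half_sum) (use D in auto)
qed

text \<open>A piecewise linear identity, checked by cases. Only the two signs together produce the
  simple length on the right, which divided by D is the truncated fraction of the kernel.\<close>

lemma length_sum:
  fixes x D M :: real
  assumes "x > 0" "0 < D" "D \<le> 1 + M" "0 \<le> M" "M \<le> 1"
  shows "(max 0 (min D (2 + D - x) - max 0 (2 - x)) + max 0 (min (1 - M + D) (2 + D / 2 - x) - max D (2 - x))) +
     (max 0 (D - max 0 (2 + D - x)) + max 0 (min (1 - M) (2 - x) - max 0 (2 - D / 2 - x))) =
     max 0 (min D (D + x - 1 - M))"
  using assms unfolding max_def min_def by (auto split: if_splits)

lemma sign_density_sum:
  fixes h h' s :: real
  assumes h: "\<bar>h\<bar> < 1" "\<bar>h'\<bar> \<le> 1" "h \<noteq> h'" and s: "s > 0"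
  shows "sign_density 1 h' s h + sign_density (-1) h' s h = ennreal (transition_kernel s h h')"
proof -
  define D M x where "D = \<bar>h - h'\<bar>" and "M = max \<bar>h\<bar> \<bar>h'\<bar>" and "x = 2 / s"
  define a where "a = max 0 (min D (2 + D - x) - max 0 (2 - x)) + max 0 (min (1 - M + D) (2 + D / 2 - x) - max D (2 - x))"
  define b where "b = max 0 (D - max 0 (2 + D - x)) + max 0 (min (1 - M) (2 - x) - max 0 (2 - D / 2 - x))"
  have D: "D > 0" "D \<le> 1 + M" "0 \<le> M" "M \<le> 1" using h by (auto simp: D_def M_def)
  have x: "x > 0" using s by (simp add: x_def)
  have ab: "a \<ge> 0" "b \<ge> 0" by (auto simp: a_def b_def intro!: add_nonneg_nonneg)
  have "sign_density 1 h' s h + sign_density (-1) h' s h = ennreal (3 / pi\<^sup>2 / D * a) + ennreal (3 / pi\<^sup>2 / D * b)"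
  proof (cases "h > h'")
    case True
    have "sign_density 1 h' s h = ennreal (3 / pi\<^sup>2 / D * a)"
      unfolding a_def D_def M_def x_def by (rule sign_density_pos) (use h s True in auto)
    moreover have "sign_density (-1) h' s h = ennreal (3 / pi\<^sup>2 / D * b)"
      unfolding b_def D_def M_def x_def by (rule sign_density_neg) (use h s True in auto)
    ultimately show ?thesis by simp
  next
    case False
    have "sign_density (-1) h' s h = ennreal (3 / pi\<^sup>2 / D * a)"
      unfolding a_def D_def M_def x_def by (rule sign_density_pos) (use h s False in auto)
    moreover have "sign_density 1 h' s h = ennreal (3 / pi\<^sup>2 / D * b)"
      unfolding b_def D_def M_def x_def by (rule sign_density_neg) (use h s False in auto)
    ultimately show ?thesis by (simp add: add.commute)
  qed
  also have "\<dots> = ennreal (3 / pi\<^sup>2 / D * (a + b))"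
    using ab D by (subst ennreal_plus[symmetric]) (auto simp: ring_distribs)
  also have "a + b = max 0 (min D (D + x - 1 - M))"
    unfolding a_def b_def by (rule length_sum) (use D x in auto)
  also have "3 / pi\<^sup>2 / D * max 0 (min D (D + x - 1 - M)) = transition_kernel s h h'"
  proof -
    have "(s * D - (s * (1 + M) - 2)) / (s * D) = (D + x - 1 - M) / D"
      using s D by (simp add: x_def field_simps)
    moreover have "max 0 (min 1 ((D + x - 1 - M) / D)) = max 0 (min D (D + x - 1 - M)) / D"
      using D by (auto simp: max_def min_def field_simps)
    ultimately show ?thesis using transition_kernel_eq[OF s h(3)] by (simp add: D_def M_def)
  qed
  finally show ?thesis .
qed

text \<open>The constraints on A and B force s >= 0 and |h| <= 1, so restricting the density to the
  phase space loses no mass.\<close>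

lemma sign_density_0:
  fixes \<epsilon> h h' s :: real
  assumes \<epsilon>: "\<bar>\<epsilon>\<bar> = 1" and h: "\<bar>h'\<bar> \<le> 1" and s: "s < 0 \<or> \<bar>h\<bar> > 1"
  shows "sign_density \<epsilon> h' s h = 0"
proof -
  have \<epsilon>': "\<epsilon> = 1 \<or> \<epsilon> = -1" using \<epsilon> by linarith
  have 1: "case_density1 (\<epsilon> * h') (1 - \<epsilon> * h' / 2 + \<epsilon> / 2 * h) B s = 0" for B
    using \<epsilon>' h s by (auto simp: case_density1_def abs_if field_simps split: if_splits)
  have 2: "case_density2 (\<epsilon> * h') A (1 + \<epsilon> * h' / 2 + - (\<epsilon> / 2) * h) s = 0" for A
  proof -
    define B where "B = 1 + \<epsilon> * h' / 2 + - (\<epsilon> / 2) * h"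
    show ?thesis unfolding B_def[symmetric]
    proof (rule ccontr)
      assume "case_density2 (\<epsilon> * h') A B s \<noteq> 0"
      hence c: "0 < A" "A < 1" "0 < B" "B < 1 - A" "-1 \<le> \<epsilon> * h'" "\<epsilon> * h' < -1 + 2 * B" "1 < s * (2 - A - B)"
        by (auto simp: case_density2_def split: if_splits)
      have "s \<ge> 0" using c mult_neg_pos[of s "2 - A - B"] by linarith
      hence "\<bar>h\<bar> > 1" using s by auto
      thus False using \<epsilon>' c h unfolding B_def by (auto simp: abs_if split: if_splits)
    qed
  qed
  have 3: "case_density3 (\<epsilon> * h') A (A + \<epsilon> * h' / 2 + - (\<epsilon> / 2) * h) s = 0" for A
  proof -
    define B where "B = A + \<epsilon> * h' / 2 + - (\<epsilon> / 2) * h"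
    show ?thesis unfolding B_def[symmetric]
    proof (rule ccontr)
      assume "case_density3 (\<epsilon> * h') A B s \<noteq> 0"
      hence c: "0 < A" "A < 1" "0 < B" "B < 1 - A" "-1 + 2 * B \<le> \<epsilon> * h'" "\<epsilon> * h' \<le> 1 - 2 * A"
        "2 < s * (2 - A - B) \<or> 1 < s * (1 - A)"
        by (auto simp: case_density3_def split: if_splits)
      have "s \<ge> 0"
        using c mult_neg_pos[of s "2 - A - B"] mult_neg_pos[of s "1 - A"] by linarith
      hence "\<bar>h\<bar> > 1" using s by auto
      thus False using \<epsilon>' c h unfolding B_def by (auto simp: abs_if split: if_splits)
    qed
  qed
  show ?thesis unfolding sign_density_def 1 2 3 by simp
qed


section \<open>Assembling the image measure\<close>

lemma nn_integral_mu:
  fixes f :: "real \<times> real \<times> real \<times> nat \<Rightarrow> ennreal"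
  assumes [measurable]: "f \<in> borel_measurable (lborel \<Otimes>\<^sub>M (lborel \<Otimes>\<^sub>M (lborel \<Otimes>\<^sub>M count_space {0, 1})))"
  shows "(\<integral>\<^sup>+k. f k \<partial>mu) =
    (\<integral>\<^sup>+A. \<integral>\<^sup>+B. \<integral>\<^sup>+Q. ennreal (mu_density A B Q) * f (A, B, Q, 0) + ennreal (mu_density A B Q) * f (A, B, Q, 1) \<partial>lborel \<partial>lborel \<partial>lborel)"
proof -
  define C where "C = (count_space {0, 1} :: nat measure)"
  interpret C: sigma_finite_measure C unfolding C_def by (rule sigma_finite_measure_count_space_finite) simp
  interpret P1: pair_sigma_finite "lborel :: real measure" C by unfold_locales
  interpret P2: pair_sigma_finite "lborel :: real measure" "(lborel :: real measure) \<Otimes>\<^sub>M C" by unfold_locales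
  have f [measurable]: "f \<in> borel_measurable (lborel \<Otimes>\<^sub>M (lborel \<Otimes>\<^sub>M (lborel \<Otimes>\<^sub>M C)))"
    using assms by (simp add: C_def)
  define d where "d = (\<lambda>(A, B, Q, N :: nat). ennreal (mu_density A B Q))"
  have d [measurable]: "d \<in> borel_measurable (lborel \<Otimes>\<^sub>M (lborel \<Otimes>\<^sub>M (lborel \<Otimes>\<^sub>M C)))"
    unfolding d_def case_prod_unfold by measurable
  have mu_eq: "mu = density (lborel \<Otimes>\<^sub>M (lborel \<Otimes>\<^sub>M (lborel \<Otimes>\<^sub>M C))) d"
    unfolding mu_def C_def d_def mu_density_def ..
  have "(\<integral>\<^sup>+k. f k \<partial>mu) = (\<integral>\<^sup>+k. d k * f k \<partial>(lborel \<Otimes>\<^sub>M (lborel \<Otimes>\<^sub>M (lborel \<Otimes>\<^sub>M C))))"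
    unfolding mu_eq by (rule nn_integral_density[OF d f])
  also have "\<dots> = (\<integral>\<^sup>+A. \<integral>\<^sup>+p. d (A, p) * f (A, p) \<partial>(lborel \<Otimes>\<^sub>M (lborel \<Otimes>\<^sub>M C)) \<partial>lborel)"
    by (rule P2.P.nn_integral_fst[symmetric]) measurable
  also have "\<dots> = (\<integral>\<^sup>+A. \<integral>\<^sup>+B. \<integral>\<^sup>+p. d (A, B, p) * f (A, B, p) \<partial>(lborel \<Otimes>\<^sub>M C) \<partial>lborel \<partial>lborel)"
    by (intro nn_integral_cong P1.P.nn_integral_fst[symmetric]) measurable
  also have "\<dots> = (\<integral>\<^sup>+A. \<integral>\<^sup>+B. \<integral>\<^sup>+Q. \<integral>\<^sup>+N. d (A, B, Q, N) * f (A, B, Q, N) \<partial>C \<partial>lborel \<partial>lborel \<partial>lborel)"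
    by (intro nn_integral_cong C.nn_integral_fst[symmetric]) measurable
  finally show ?thesis by (simp add: C_def nn_integral_count_space_finite d_def)
qed

lemma sgn_power_measurable: "(\<lambda>k. (-1 :: real) ^ snd (snd (snd k))) \<in> borel_measurable
   (lborel \<Otimes>\<^sub>M (lborel \<Otimes>\<^sub>M (lborel \<Otimes>\<^sub>M (count_space {0, 1} :: nat measure))))"
  by (rule measurable_compose[of "\<lambda>k. snd (snd (snd k))" _ "count_space {0, 1}"]) measurable

lemma limit_map_measurable [measurable]:
  "(\<lambda>k. limit_map k h') \<in> borel_measurable (lborel \<Otimes>\<^sub>M (lborel \<Otimes>\<^sub>M (lborel \<Otimes>\<^sub>M (count_space {0, 1} :: nat measure))))"
proof -
  note [measurable] = sgn_power_measurable
  show ?thesis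
    unfolding limit_map_def case_prod_unfold Let_def greaterThanAtMost_iff atLeastLessThan_iff borel_prod[symmetric]
    by measurable
qed

text \<open>Where the density of \<mu> is nonzero, A + B < 1 makes the three cases mutually
  exclusive, so the nested conditional becomes a sum that can be integrated term by term.\<close>

lemma limit_map_split:
  fixes f :: "real \<times> real \<Rightarrow> ennreal" and N :: nat
  defines "\<epsilon> \<equiv> (-1) ^ N"
  assumes h': "\<bar>h'\<bar> \<le> 1"
  shows "ennreal (mu_density A B Q) * f (limit_map (A, B, Q, N) h') =
    ennreal (case_density1 (\<epsilon> * h') A B Q) * f (Q, h' - 2 * \<epsilon> * (1 - A)) +
    ennreal (if \<epsilon> * h' < -1 + 2 * B then mu_density A B Q else 0) * f ((1 - Q * (1 - B)) / (1 - A), h' + 2 * \<epsilon> * (1 - B)) +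
    ennreal (if -1 + 2 * B \<le> \<epsilon> * h' \<and> \<epsilon> * h' \<le> 1 - 2 * A then mu_density A B Q else 0) *
      f ((1 - Q * (1 - B)) / (1 - A) + Q, h' + 2 * \<epsilon> * (A - B))"
proof (cases "mu_density A B Q = 0")
  case True
  thus ?thesis by (auto simp: case_density1_def mu_density_def split: if_splits)
next
  case False
  hence AB: "A + B < 1" by (auto simp: mu_density_def split: if_splits)
  have "\<bar>\<epsilon> * h'\<bar> \<le> 1" using h' by (simp add: \<epsilon>_def abs_mult power_abs)
  hence x: "-1 \<le> \<epsilon> * h'" "\<epsilon> * h' \<le> 1" by auto
  have c1: "case_density1 (\<epsilon> * h') A B Q = (if 1 - 2 * A < \<epsilon> * h' then mu_density A B Q else 0)"
    using x by (simp add: case_density1_def mu_density_def)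
  have lm: "limit_map (A, B, Q, N) h' =
    (if 1 - 2 * A < \<epsilon> * h' then (Q, h' - 2 * \<epsilon> * (1 - A))
     else if \<epsilon> * h' < -1 + 2 * B then ((1 - Q * (1 - B)) / (1 - A), h' + 2 * \<epsilon> * (1 - B))
     else ((1 - Q * (1 - B)) / (1 - A) + Q, h' + 2 * \<epsilon> * (A - B)))"
    using x by (simp add: limit_map_def \<epsilon>_def Let_def)
  consider "1 - 2 * A < \<epsilon> * h'" | "\<epsilon> * h' < -1 + 2 * B" | "-1 + 2 * B \<le> \<epsilon> * h'" "\<epsilon> * h' \<le> 1 - 2 * A"
    by linarith
  thus ?thesis
    unfolding c1 lm using AB by cases auto
qed

lemma nn_integral_limit_map:
  fixes f :: "real \<times> real \<Rightarrow> ennreal" and N :: nat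
  assumes f: "f \<in> borel_measurable borel" and h': "\<bar>h'\<bar> \<le> 1"
  shows "(\<integral>\<^sup>+A. \<integral>\<^sup>+B. \<integral>\<^sup>+Q. ennreal (mu_density A B Q) * f (limit_map (A, B, Q, N) h') \<partial>lborel \<partial>lborel \<partial>lborel) =
    (\<integral>\<^sup>+h. \<integral>\<^sup>+s. sign_density ((-1) ^ N) h' s h * f (s, h) \<partial>lborel \<partial>lborel)"
proof -
  have [measurable]: "f \<in> borel_measurable (borel \<Otimes>\<^sub>M borel)" using f by (simp add: borel_prod)
  define \<epsilon> where "\<epsilon> = (-1 :: real) ^ N"
  have \<epsilon>: "\<bar>\<epsilon>\<bar> = 1" by (simp add: \<epsilon>_def power_abs)
  have x: "\<bar>\<epsilon> * h'\<bar> \<le> 1" using h' \<epsilon> by (simp add: abs_mult)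
  define g1 where "g1 A B Q = ennreal (case_density1 (\<epsilon> * h') A B Q) * f (Q, h' - 2 * \<epsilon> * (1 - A))" for A B Q
  define g2 where "g2 A B Q = ennreal (if \<epsilon> * h' < -1 + 2 * B then mu_density A B Q else 0) * f ((1 - Q * (1 - B)) / (1 - A), h' + 2 * \<epsilon> * (1 - B))" for A B Q
  define g3 where "g3 A B Q = ennreal (if -1 + 2 * B \<le> \<epsilon> * h' \<and> \<epsilon> * h' \<le> 1 - 2 * A then mu_density A B Q else 0) *
      f ((1 - Q * (1 - B)) / (1 - A) + Q, h' + 2 * \<epsilon> * (A - B))" for A B Q
  have [measurable]: "(\<lambda>p. g1 (a p) (b p) (q p)) \<in> borel_measurable M'" "(\<lambda>p. g2 (a p) (b p) (q p)) \<in> borel_measurable M'"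
      "(\<lambda>p. g3 (a p) (b p) (q p)) \<in> borel_measurable M'"
    if [measurable]: "a \<in> borel_measurable M'" "b \<in> borel_measurable M'" "q \<in> borel_measurable M'" for a b q and M' :: "'m measure"
    unfolding g1_def g2_def g3_def by measurable
  have "(\<integral>\<^sup>+A. \<integral>\<^sup>+B. \<integral>\<^sup>+Q. ennreal (mu_density A B Q) * f (limit_map (A, B, Q, N) h') \<partial>lborel \<partial>lborel \<partial>lborel) =
    (\<integral>\<^sup>+A. \<integral>\<^sup>+B. \<integral>\<^sup>+Q. g1 A B Q + g2 A B Q + g3 A B Q \<partial>lborel \<partial>lborel \<partial>lborel)"
    unfolding limit_map_split[OF h'] g1_def g2_def g3_def \<epsilon>_def ..
  also have "\<dots> = (\<integral>\<^sup>+A. \<integral>\<^sup>+B. \<integral>\<^sup>+Q. g1 A B Q \<partial>lborel \<partial>lborel \<partial>lborel) + (\<integral>\<^sup>+A. \<integral>\<^sup>+B. \<integral>\<^sup>+Q. g2 A B Q \<partial>lborel \<partial>lborel \<partial>lborel)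
     + (\<integral>\<^sup>+A. \<integral>\<^sup>+B. \<integral>\<^sup>+Q. g3 A B Q \<partial>lborel \<partial>lborel \<partial>lborel)"
    by (simp add: nn_integral_add)
  also have "(\<integral>\<^sup>+A. \<integral>\<^sup>+B. \<integral>\<^sup>+Q. g2 A B Q \<partial>lborel \<partial>lborel \<partial>lborel) =
     (\<integral>\<^sup>+A. \<integral>\<^sup>+B. \<integral>\<^sup>+s. ennreal (case_density2 (\<epsilon> * h') A B s) * f (s, h' + 2 * \<epsilon> * (1 - B)) \<partial>lborel \<partial>lborel \<partial>lborel)"
  proof (rule nn_integral_cong, rule nn_integral_cong)
    fix A B
    show "(\<integral>\<^sup>+Q. g2 A B Q \<partial>lborel) = (\<integral>\<^sup>+s. ennreal (case_density2 (\<epsilon> * h') A B s) * f (s, h' + 2 * \<epsilon> * (1 - B)) \<partial>lborel)"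
      unfolding g2_def by (rule case2_substitution[OF _ x]) measurable
  qed
  also have "(\<integral>\<^sup>+A. \<integral>\<^sup>+B. \<integral>\<^sup>+Q. g3 A B Q \<partial>lborel \<partial>lborel \<partial>lborel) =
     (\<integral>\<^sup>+A. \<integral>\<^sup>+B. \<integral>\<^sup>+s. ennreal (case_density3 (\<epsilon> * h') A B s) * f (s, h' + 2 * \<epsilon> * (A - B)) \<partial>lborel \<partial>lborel \<partial>lborel)"
  proof (rule nn_integral_cong)
    fix A :: real
    show "(\<integral>\<^sup>+B. \<integral>\<^sup>+Q. g3 A B Q \<partial>lborel \<partial>lborel) =
     (\<integral>\<^sup>+B. \<integral>\<^sup>+s. ennreal (case_density3 (\<epsilon> * h') A B s) * f (s, h' + 2 * \<epsilon> * (A - B)) \<partial>lborel \<partial>lborel)"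
    \<comment> \<open>B = A is excluded: there Q' + Q is constant in Q and the substitution
      degenerates.\<close>
    proof (rule nn_integral_cong_AE)
      show "AE B in lborel. (\<integral>\<^sup>+Q. g3 A B Q \<partial>lborel) = (\<integral>\<^sup>+s. ennreal (case_density3 (\<epsilon> * h') A B s) * f (s, h' + 2 * \<epsilon> * (A - B)) \<partial>lborel)"
        using AE_lborel_singleton[of A]
      proof eventually_elim
        case (elim B)
        show ?case unfolding g3_def by (rule case3_substitution) (measurable, use elim in simp)
      qed
    qed
  qed
  finally have "(\<integral>\<^sup>+A. \<integral>\<^sup>+B. \<integral>\<^sup>+Q. ennreal (mu_density A B Q) * f (limit_map (A, B, Q, N) h') \<partial>lborel \<partial>lborel \<partial>lborel) =
    (\<integral>\<^sup>+h. \<integral>\<^sup>+s. ennreal (1 / 2) * (\<integral>\<^sup>+B. ennreal (case_density1 (\<epsilon> * h') (1 - \<epsilon> * h' / 2 + \<epsilon> / 2 * h) B s) \<partial>lborel) * f (s, h) \<partial>lborel \<partial>lborel) +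
    (\<integral>\<^sup>+h. \<integral>\<^sup>+s. ennreal (1 / 2) * (\<integral>\<^sup>+A. ennreal (case_density2 (\<epsilon> * h') A (1 + \<epsilon> * h' / 2 + - (\<epsilon> / 2) * h) s) \<partial>lborel) * f (s, h) \<partial>lborel \<partial>lborel) +
    (\<integral>\<^sup>+h. \<integral>\<^sup>+s. ennreal (1 / 2) * (\<integral>\<^sup>+A. ennreal (case_density3 (\<epsilon> * h') A (A + \<epsilon> * h' / 2 + - (\<epsilon> / 2) * h) s) \<partial>lborel) * f (s, h) \<partial>lborel \<partial>lborel)"
    unfolding g1_def nn_integral_case1[OF \<open>f \<in> borel_measurable (borel \<Otimes>\<^sub>M borel)\<close> \<epsilon>]
      nn_integral_case2[OF \<open>f \<in> borel_measurable (borel \<Otimes>\<^sub>M borel)\<close> \<epsilon>] nn_integral_case3[OF \<open>f \<in> borel_measurable (borel \<Otimes>\<^sub>M borel)\<close> \<epsilon>] .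
  also have "\<dots> = (\<integral>\<^sup>+h. \<integral>\<^sup>+s. sign_density \<epsilon> h' s h * f (s, h) \<partial>lborel \<partial>lborel)"
  proof -
    define k1 where "k1 h s = ennreal (1 / 2) * (\<integral>\<^sup>+B. ennreal (case_density1 (\<epsilon> * h') (1 - \<epsilon> * h' / 2 + \<epsilon> / 2 * h) B s) \<partial>lborel) * f (s, h)" for h s
    define k2 where "k2 h s = ennreal (1 / 2) * (\<integral>\<^sup>+A. ennreal (case_density2 (\<epsilon> * h') A (1 + \<epsilon> * h' / 2 + - (\<epsilon> / 2) * h) s) \<partial>lborel) * f (s, h)" for h s
    define k3 where "k3 h s = ennreal (1 / 2) * (\<integral>\<^sup>+A. ennreal (case_density3 (\<epsilon> * h') A (A + \<epsilon> * h' / 2 + - (\<epsilon> / 2) * h) s) \<partial>lborel) * f (s, h)" for h s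
    have [measurable]: "(\<lambda>p. k1 (a p) (b p)) \<in> borel_measurable M'" "(\<lambda>p. k2 (a p) (b p)) \<in> borel_measurable M'"
        "(\<lambda>p. k3 (a p) (b p)) \<in> borel_measurable M'"
      if [measurable]: "a \<in> borel_measurable M'" "b \<in> borel_measurable M'" for a b and M' :: "'m measure"
      unfolding k1_def k2_def k3_def by measurable
    have "sign_density \<epsilon> h' s h * f (s, h) = k1 h s + k2 h s + k3 h s" for s h
      by (simp add: sign_density_def k1_def k2_def k3_def distrib_left distrib_right)
    thus ?thesis unfolding k1_def[symmetric] k2_def[symmetric] k3_def[symmetric]
      by (simp add: nn_integral_add)
  qed
  finally show ?thesis by (simp add: \<epsilon>_def)
qed

theorem transition_density_transition_kernel: "transition_density transition_kernel"
  unfolding transition_density_def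
proof (intro ballI conjI allI impI)
  fix h' :: real assume "h' \<in> {-1..1}"
  hence h': "\<bar>h'\<bar> \<le> 1" by auto
  show "(\<lambda>(s, h). transition_kernel s h h') \<in> borel_measurable (restrict_space borel ({0..} \<times> {-1..1}))"
    by (intro measurable_restrict_space1 transition_kernel_measurable)
  show "distr mu borel (\<lambda>k. limit_map k h') =
    density lborel (\<lambda>(s, h). ennreal (transition_kernel s h h') * indicator ({0..} \<times> {-1..1}) (s, h))"
  proof (rule measure_eqI)
    fix X assume "X \<in> sets (distr mu borel (\<lambda>k. limit_map k h'))"
    hence X [measurable]: "X \<in> sets borel" by simp
    define f where "f = (indicator X :: real \<times> real \<Rightarrow> ennreal)"
    have f [measurable]: "f \<in> borel_measurable borel" unfolding f_def by measurable
    have f' [measurable]: "f \<in> borel_measurable (borel \<Otimes>\<^sub>M borel)" using f by (simp add: borel_prod)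
    have lm: "(\<lambda>k. limit_map k h') \<in> borel_measurable mu"
      using limit_map_measurable by (simp add: mu_def)
    have [measurable]: "(\<lambda>p. limit_map (a p, b p, q p, N) h') \<in> borel_measurable M'"
      if [measurable]: "a \<in> borel_measurable M'" "b \<in> borel_measurable M'" "q \<in> borel_measurable M'" for a b q N and M' :: "'m measure"
      unfolding limit_map_def case_prod_unfold Let_def greaterThanAtMost_iff atLeastLessThan_iff borel_prod[symmetric] fst_conv snd_conv
      by measurable
    have kern [measurable]: "(\<lambda>p. transition_kernel (fst p) (snd p) h') \<in> borel_measurable (borel \<Otimes>\<^sub>M borel)"
      using transition_kernel_measurable[of h'] by (simp add: borel_prod case_prod_unfold)
    have box [measurable]: "({0..} \<times> {-1..1} :: (real \<times> real) set) \<in> sets borel"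
      by (intro borel_closed closed_Times) auto
    have "emeasure (distr mu borel (\<lambda>k. limit_map k h')) X = (\<integral>\<^sup>+y. f y \<partial>distr mu borel (\<lambda>k. limit_map k h'))"
      by (simp add: f_def)
    also have "\<dots> = (\<integral>\<^sup>+k. f (limit_map k h') \<partial>mu)" using lm by (simp add: nn_integral_distr)
    also have "\<dots> = (\<integral>\<^sup>+A. \<integral>\<^sup>+B. \<integral>\<^sup>+Q. ennreal (mu_density A B Q) * f (limit_map (A, B, Q, 0) h') +
         ennreal (mu_density A B Q) * f (limit_map (A, B, Q, 1) h') \<partial>lborel \<partial>lborel \<partial>lborel)"
      by (rule nn_integral_mu) measurable
    also have "\<dots> = (\<integral>\<^sup>+A. \<integral>\<^sup>+B. \<integral>\<^sup>+Q. ennreal (mu_density A B Q) * f (limit_map (A, B, Q, 0) h') \<partial>lborel \<partial>lborel \<partial>lborel) +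
         (\<integral>\<^sup>+A. \<integral>\<^sup>+B. \<integral>\<^sup>+Q. ennreal (mu_density A B Q) * f (limit_map (A, B, Q, 1) h') \<partial>lborel \<partial>lborel \<partial>lborel)"
      by (simp add: nn_integral_add)
    also have "\<dots> = (\<integral>\<^sup>+h. \<integral>\<^sup>+s. sign_density 1 h' s h * f (s, h) \<partial>lborel \<partial>lborel) +
        (\<integral>\<^sup>+h. \<integral>\<^sup>+s. sign_density (-1) h' s h * f (s, h) \<partial>lborel \<partial>lborel)"
      unfolding nn_integral_limit_map[OF f h'] by simp
    also have "\<dots> = (\<integral>\<^sup>+h. \<integral>\<^sup>+s. sign_density 1 h' s h * f (s, h) + sign_density (-1) h' s h * f (s, h) \<partial>lborel \<partial>lborel)"
      by (simp add: nn_integral_add)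
    also have "\<dots> = (\<integral>\<^sup>+h. \<integral>\<^sup>+s. ennreal (transition_kernel s h h') * indicator ({0..} \<times> {-1..1}) (s, h) * f (s, h) \<partial>lborel \<partial>lborel)"
    proof (rule nn_integral_cong_AE)
      show "AE h in lborel. (\<integral>\<^sup>+s. sign_density 1 h' s h * f (s, h) + sign_density (-1) h' s h * f (s, h) \<partial>lborel) =
        (\<integral>\<^sup>+s. ennreal (transition_kernel s h h') * indicator ({0..} \<times> {-1..1}) (s, h) * f (s, h) \<partial>lborel)"
        using AE_lborel_singleton[of h'] AE_lborel_singleton[of 1] AE_lborel_singleton[of "-1"]
      proof eventually_elim
        case (elim h)
        show ?case
        proof (rule nn_integral_cong_AE)
          show "AE s in lborel. sign_density 1 h' s h * f (s, h) + sign_density (-1) h' s h * f (s, h) =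
            ennreal (transition_kernel s h h') * indicator ({0..} \<times> {-1..1}) (s, h) * f (s, h)"
            using AE_lborel_singleton[of 0]
          proof eventually_elim
            fix s :: real assume s: "s \<noteq> 0"
            show "sign_density 1 h' s h * f (s, h) + sign_density (-1) h' s h * f (s, h) =
              ennreal (transition_kernel s h h') * indicator ({0..} \<times> {-1..1}) (s, h) * f (s, h)"
            proof (cases "s > 0 \<and> \<bar>h\<bar> < 1")
              case True
              hence ind: "indicator ({0..} \<times> {-1..1}) (s, h) = (1 :: ennreal)" by (auto simp: indicator_def)
              show ?thesis
                using sign_density_sum[of h h' s] h' elim True by (auto simp: ind simp flip: distrib_right)
            next
              case False
              hence "s < 0 \<or> \<bar>h\<bar> > 1" using s elim by auto
              thus ?thesis using sign_density_0[of _ h' s h] h' by (auto simp: indicator_def)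
            qed
          qed
        qed
      qed
    qed
    also have "\<dots> = (\<integral>\<^sup>+s. \<integral>\<^sup>+h. ennreal (transition_kernel s h h') * indicator ({0..} \<times> {-1..1}) (s, h) * f (s, h) \<partial>lborel \<partial>lborel)"
      by (rule nn_integral_lborel_swap) (simp add: case_prod_unfold)
    also have "\<dots> = (\<integral>\<^sup>+p. ennreal (transition_kernel (fst p) (snd p) h') * indicator ({0..} \<times> {-1..1}) p * f p \<partial>(lborel \<Otimes>\<^sub>M lborel))"
      by (subst lborel.nn_integral_fst[symmetric]) (simp_all add: borel_prod)
    also have "\<dots> = emeasure (density lborel (\<lambda>(s, h). ennreal (transition_kernel s h h') * indicator ({0..} \<times> {-1..1}) (s, h))) X"
      using kern box by (subst emeasure_density) (auto simp: f_def case_prod_unfold lborel_prod borel_prod)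
    finally show "emeasure (distr mu borel (\<lambda>k. limit_map k h')) X =
      emeasure (density lborel (\<lambda>(s, h). ennreal (transition_kernel s h h') * indicator ({0..} \<times> {-1..1}) (s, h))) X" .
  qed simp
qed (rule transition_kernel_nonneg)

section \<open>The first obstacle hit\<close>

text \<open>If \<open>p = (q, a)\<close> is primitive and \<open>p' = (z, a')\<close> with \<open>q a' - a z = 1\<close>, \<open>0 < z < q\<close>, then a line avoids
  all lattice points with first coordinate strictly between \<open>0\<close> and \<open>q\<close> as soon as it avoids
  \<open>p'\<close> and \<open>p - p'\<close>: these are the two points next to the segment from \<open>0\<close> to \<open>p\<close>.\<close>

lemma lattice_point_coordinates:
  fixes q a z q1 a1 :: int and t \<kappa> h' h y c :: real
  assumes "\<kappa> > 0" "q > 0" "q dvd a * z + 1" "0 < q1" "q1 < q"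
  defines "h \<equiv> h' + (of_int q * t - of_int a) / \<kappa>" and "y \<equiv> of_int z / of_int q" and "c \<equiv> 1 / (\<kappa> * of_int q)"
  obtains v j :: int where "v \<noteq> 0" "of_int q1 / of_int q = of_int v * y - of_int j"
    "h' + (of_int q1 * t - of_int a1) / \<kappa> = h' - of_int v * c - (of_int v * y - of_int j) * (h' - h)"
proof -
  define v where "v = q * a1 - a * q1"
  have "q dvd q1 * (a * z + 1) - q * (a1 * z)" using assms(3) by simp
  hence "q dvd q1 - v * z" by (simp add: v_def algebra_simps)
  then obtain i where i: "q1 - v * z = q * i" by auto
  have "v \<noteq> 0"
  proof
    assume "v = 0"
    hence "q dvd q1" using i by simp
    thus False using assms(4,5) by (simp add: zdvd_not_zless)
  qed
  moreover have "q1 = v * z + q * i" using i by simp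
  hence "real_of_int q1 = of_int v * of_int z + of_int q * of_int i" by (metis of_int_add of_int_mult)
  hence q1: "real_of_int q1 / of_int q = of_int v * y - of_int (- i)"
    using \<open>q > 0\<close> by (simp add: y_def field_simps)
  moreover have "h' + (of_int q1 * t - of_int a1) / \<kappa> = h' - of_int v * c - (of_int v * y - of_int (- i)) * (h' - h)"
  proof -
    have v: "real_of_int v = of_int q * of_int a1 - of_int a * of_int q1" by (simp add: v_def)
    show ?thesis
      unfolding q1[symmetric] unfolding v c_def h_def using \<open>q > 0\<close> \<open>\<kappa> > 0\<close> by (simp add: field_simps)
  qed
  ultimately show ?thesis by (rule that)
qed

text \<open>In the basis p', p the point is v p' - j p, and 0 < q1 < q with 0 < y < 1 forces 0 <= j
  <= v - 1 when v > 0. Then v times the bound c > 1 + h' + y (h - h') puts the offset below -v + (v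
  - 1 - j) (-h') + j (-h) <= -1. For v < 0 the argument is repeated with the other neighbour p - p',
  that is with 1 - y in place of y.\<close>

lemma first_column_sufficient:
  fixes q a z q1 a1 :: int and t \<kappa> h' h y c :: real
  assumes \<kappa>: "\<kappa> > 0" and h': "\<bar>h'\<bar> \<le> 1" and q: "0 < z" "z < q" "q dvd a * z + 1" "0 < q1" "q1 < q"
  defines "h \<equiv> h' + (of_int q * t - of_int a) / \<kappa>" and "y \<equiv> of_int z / of_int q" and "c \<equiv> 1 / (\<kappa> * of_int q)"
  assumes h: "\<bar>h\<bar> \<le> 1" and c1: "c > 1 + h' + y * (h - h')" and c2: "c > 1 - h + y * (h - h')"
  shows "\<bar>h' + (of_int q1 * t - of_int a1) / \<kappa>\<bar> > 1"
proof -
  obtain v j :: int where v: "v \<noteq> 0" "of_int q1 / of_int q = of_int v * y - of_int j"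
    "h' + (of_int q1 * t - of_int a1) / \<kappa> = h' - of_int v * c - (of_int v * y - of_int j) * (h' - h)"
    using lattice_point_coordinates[OF \<kappa> _ q(3-5), where h' = h' and t = t and ?a1.0 = a1] q
    unfolding h_def y_def c_def by auto
  have y: "0 < y" "y < 1" using q by (auto simp: y_def)
  have frac: "0 < of_int v * y - real_of_int j" "of_int v * y - real_of_int j < 1"
    using q unfolding v(2)[symmetric] by auto
  show ?thesis
  proof (cases "v > 0")
    case True
    hence v1: "real_of_int v \<ge> 1" by simp
    have "of_int v * y < real_of_int v * 1" using True y by (intro mult_strict_left_mono) auto
    hence "real_of_int j < of_int v" using frac by linarith
    hence "j \<le> v - 1" by linarith
    hence j1: "real_of_int j \<le> of_int v - 1" by linarith
    have "0 < of_int v * y" using True y by simp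
    hence "real_of_int j > - 1" using frac by linarith
    hence "j \<ge> 0" by linarith
    hence j0: "real_of_int j \<ge> 0" by linarith
    have "of_int v * (1 + h' + y * (h - h')) < of_int v * c" using True c1 by (intro mult_strict_left_mono) auto
    hence "h' + (of_int q1 * t - of_int a1) / \<kappa> < h' - of_int v * (1 + h' + y * (h - h')) - (of_int v * y - of_int j) * (h' - h)"
      unfolding v(3) by linarith
    also have "\<dots> = - of_int v + (of_int v - 1 - of_int j) * (- h') + of_int j * (- h)" by (simp add: algebra_simps)
    also have "\<dots> \<le> - of_int v + (of_int v - 1 - of_int j) * 1 + of_int j * 1"
      using h' h j0 j1 by (intro add_mono mult_left_mono) auto
    finally show ?thesis by simp
  next
    case False
    define n i where "n = - v" and "i = n + j"
    have n: "n > 0" "v = - n" "j = i - n" using False v(1) by (auto simp: n_def i_def)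
    hence n1: "real_of_int n \<ge> 1" by simp
    have fr: "of_int v * y - real_of_int j = of_int n * (1 - y) - of_int i" by (simp add: n algebra_simps)
    have "of_int n * (1 - y) < real_of_int n * 1" using n y by (intro mult_strict_left_mono) auto
    hence "real_of_int i < of_int n" using frac unfolding fr by linarith
    hence "i \<le> n - 1" by linarith
    hence i1: "real_of_int i \<le> of_int n - 1" by linarith
    have "0 < of_int n * (1 - y)" using n y by simp
    hence "real_of_int i > - 1" using frac unfolding fr by linarith
    hence "i \<ge> 0" by linarith
    hence i0: "real_of_int i \<ge> 0" by linarith
    have c2': "c > 1 - h' + (1 - y) * (h' - h)" using c2 by (simp add: algebra_simps)
    have "of_int n * (1 - h' + (1 - y) * (h' - h)) < of_int n * c" using n c2' by (intro mult_strict_left_mono) auto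
    moreover have "of_int v * c = - (of_int n * c)" using n(2) by simp
    ultimately have "h' + (of_int q1 * t - of_int a1) / \<kappa> > h' + of_int n * (1 - h' + (1 - y) * (h' - h)) - (of_int n * (1 - y) - of_int i) * (h' - h)"
      unfolding v(3) fr by linarith
    also have "h' + of_int n * (1 - h' + (1 - y) * (h' - h)) - (of_int n * (1 - y) - of_int i) * (h' - h) =
      of_int n - ((of_int n - 1 - of_int i) * h' + of_int i * h)" by (simp add: algebra_simps)
    finally have "h' + (of_int q1 * t - of_int a1) / \<kappa> > of_int n - ((of_int n - 1 - of_int i) * h' + of_int i * h)" .
    moreover have "(of_int n - 1 - of_int i) * h' + of_int i * h \<le> (of_int n - 1 - of_int i) * 1 + of_int i * 1"
      using h' h i0 i1 by (intro add_mono mult_left_mono) auto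
    ultimately show ?thesis by simp
  qed
qed

text \<open>The offset of p' is a convex combination of h' and h minus c, hence less than 1; missing
  the strip can only mean being below -1. In the same way p - p' can miss it only by being above
  1.\<close>

lemma first_column_necessary:
  fixes q a z :: int and t \<kappa> h' h y c :: real
  assumes \<kappa>: "\<kappa> > 0" and h': "\<bar>h'\<bar> \<le> 1" and q: "0 < z" "z < q" "q dvd a * z + 1"
    and avoid: "\<And>q1 a1 :: int. 0 < q1 \<Longrightarrow> q1 < q \<Longrightarrow> \<bar>h' + (of_int q1 * t - of_int a1) / \<kappa>\<bar> > 1"
  defines "h \<equiv> h' + (of_int q * t - of_int a) / \<kappa>" and "y \<equiv> of_int z / of_int q" and "c \<equiv> 1 / (\<kappa> * of_int q)"
  assumes h: "\<bar>h\<bar> \<le> 1"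
  shows "c > 1 + h' + y * (h - h')" "c > 1 - h + y * (h - h')"
proof -
  obtain a' where a': "a * z + 1 = q * a'" using q(3) by auto
  have y: "0 < y" "y < 1" using q by (auto simp: y_def)
  have c: "c > 0" using \<kappa> q by (simp add: c_def)
  have a'r: "real_of_int a' = (of_int a * of_int z + 1) / of_int q"
  proof -
    have "real_of_int (a * z + 1) = of_int (q * a')" by (simp only: a')
    thus ?thesis using q by (simp add: field_simps)
  qed
  have "h' + (of_int z * t - of_int a') / \<kappa> = h' - c - y * (h' - h)"
    unfolding a'r c_def y_def h_def using \<kappa> q by (simp add: field_simps)
  hence "\<bar>h' - c - y * (h' - h)\<bar> > 1" using avoid[of z a'] q by simp
  moreover have "h' - y * (h' - h) \<le> 1"
  proof -
    have "h' - y * (h' - h) = (1 - y) * h' + y * h" by (simp add: algebra_simps)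
    also have "\<dots> \<le> (1 - y) * 1 + y * 1" using y h h' by (intro add_mono mult_left_mono) auto
    finally show ?thesis by simp
  qed
  ultimately have "h' - c - y * (h' - h) < - 1" using c by (auto simp: abs_if split: if_splits)
  thus "c > 1 + h' + y * (h - h')" by (simp add: algebra_simps)
  have "h' + (of_int (q - z) * t - of_int (a - a')) / \<kappa> = h + c + y * (h' - h)"
    unfolding of_int_diff a'r c_def y_def h_def using \<kappa> q by (simp add: field_simps)
  hence "\<bar>h + c + y * (h' - h)\<bar> > 1" using avoid[of "q - z" "a - a'"] q by simp
  moreover have "h + y * (h' - h) \<ge> - 1"
  proof -
    have "(1 - y) * (- 1) + y * (- 1) \<le> (1 - y) * h + y * h'" using y h h' by (intro add_mono mult_left_mono) auto
    thus ?thesis by (simp add: algebra_simps)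
  qed
  ultimately have "h + c + y * (h' - h) > 1" using c by (auto simp: abs_if split: if_splits)
  thus "c > 1 - h + y * (h - h')" by (simp add: algebra_simps)
qed

text \<open>With s = 2 \<kappa> q one has c = 2 / s, and the two bounds on c differ only by h' in
  place of -h; the maximum combines them.\<close>

definition column_cond :: "real \<Rightarrow> real \<Rightarrow> real \<Rightarrow> real \<Rightarrow> bool" where
  "column_cond h' s h y \<longleftrightarrow> s * (h - h') * y < 2 - s * (1 + max h' (- h))"

lemma column_cond_iff:
  assumes "\<kappa> > 0" "q > (0::real)"
  shows "column_cond h' (2 * \<kappa> * q) h y \<longleftrightarrow>
    1 / (\<kappa> * q) > 1 + h' + y * (h - h') \<and> 1 / (\<kappa> * q) > 1 - h + y * (h - h')"
proof -
  have *: "1 / (\<kappa> * q) > x \<longleftrightarrow> \<kappa> * q * x < 1" for x using assms by (simp add: less_divide_eq mult.commute)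
  have "max (\<kappa> * q * h') (\<kappa> * q * - h) = \<kappa> * q * max h' (- h)"
    using assms by (simp add: max_mult_distrib_left)
  hence "column_cond h' (2 * \<kappa> * q) h y \<longleftrightarrow>
      2 * (\<kappa> * q * (y * (h - h')) + \<kappa> * q + max (\<kappa> * q * h') (\<kappa> * q * - h)) < 2 * 1"
    unfolding column_cond_def by (simp add: algebra_simps)
  also have "\<dots> \<longleftrightarrow> \<kappa> * q * (y * (h - h')) + \<kappa> * q + max (\<kappa> * q * h') (\<kappa> * q * - h) < 1"
    by (rule mult_less_cancel_left_pos) simp
  also have "\<dots> \<longleftrightarrow> \<kappa> * q * (1 + h' + y * (h - h')) < 1 \<and> \<kappa> * q * (1 - h + y * (h - h')) < 1"
    by (auto simp: max_def algebra_simps)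
  finally show ?thesis unfolding * .
qed

section \<open>Trajectories of given slope\<close>

definition slope_direction :: "real \<Rightarrow> complex" where
  "slope_direction t = (1 / sqrt (1 + t\<^sup>2)) *\<^sub>R Complex 1 t"

lemma norm_slope_direction: "norm (slope_direction t) = 1"
proof -
  have "norm (Complex 1 t) = sqrt (1 + t\<^sup>2)" by (simp add: complex_norm)
  moreover have "sqrt (1 + t\<^sup>2) \<noteq> 0" by (simp add: add_nonneg_eq_0_iff)
  ultimately show ?thesis by (simp add: slope_direction_def)
qed

lemma sqrt_slope_bounds: "1 \<le> sqrt (1 + t\<^sup>2)" "sqrt (1 + t\<^sup>2) \<le> 1 + \<bar>t\<bar>" "\<bar>t\<bar> \<le> sqrt (1 + t\<^sup>2)"
proof -
  show "sqrt (1 + t\<^sup>2) \<le> 1 + \<bar>t\<bar>" by (rule real_le_lsqrt) (auto simp: power2_eq_square algebra_simps)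
  show "\<bar>t\<bar> \<le> sqrt (1 + t\<^sup>2)" by (rule real_le_rsqrt) auto
qed simp

text \<open>Smallness makes the column q decide the order of the hits: 2 r \<sigma> < 1 leaves at
  most one hit in a column, and 4 r |t| < 1 prevents hits in different columns from changing their
  order along the trajectory.\<close>

locale slope_flight =
  fixes r h' t :: real
  assumes r: "0 < r" and h': "\<bar>h'\<bar> \<le> 1" and small: "4 * r * (1 + \<bar>t\<bar>) < 1"
begin

abbreviation \<sigma> :: real where "\<sigma> \<equiv> sqrt (1 + t\<^sup>2)"

lemma r_small: "r < 1 / 2" "2 * r * \<sigma> < 1" "4 * r * \<bar>t\<bar> < 1"
proof -
  have "r * 1 \<le> r * (1 + \<bar>t\<bar>)" using r by (intro mult_left_mono) auto
  thus "r < 1 / 2" using small by linarith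
  have "r * \<sigma> \<le> r * (1 + \<bar>t\<bar>)" "r * \<bar>t\<bar> \<le> r * (1 + \<bar>t\<bar>)"
    using r sqrt_slope_bounds by (intro mult_left_mono; auto)+
  thus "2 * r * \<sigma> < 1" "4 * r * \<bar>t\<bar> < 1" using small r by (auto simp: algebra_simps)
qed

sublocale flight r h' "slope_direction t"
  by unfold_locales (use r r_small h' norm_slope_direction in auto)

lemma \<sigma>_pos: "\<sigma> > 0" "\<sigma> \<ge> 1"
proof -
  show "\<sigma> \<ge> 1" by (rule sqrt_slope_bounds(1))
  thus "\<sigma> > 0" by linarith
qed

lemma mult_cnj_slope_direction:
  "Re (Complex q a * cnj (slope_direction t)) = (q + a * t) / \<sigma>"
  "Im (Complex q a * cnj (slope_direction t)) = (a - q * t) / \<sigma>"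
  by (simp_all add: slope_direction_def add_divide_distrib diff_divide_distrib)

lemma offset_Complex: "offset (Complex q a) = h' + (q * t - a) / r / \<sigma>"
  unfolding offset_def mult_cnj_slope_direction by (simp add: diff_divide_distrib mult.commute)

lemma offset_Complex': "offset (Complex q a) = h' + (q * t - a) / (r * \<sigma>)"
  by (simp add: offset_Complex)

lemma along_Complex: "along (Complex q a) = q * \<sigma> + (a - q * t) * t / \<sigma>"
proof -
  have "along (Complex q a) = (q + a * t) / \<sigma>"
    unfolding along_def mult_cnj_slope_direction ..
  also have "q + a * t = q * (\<sigma> * \<sigma>) + (a - q * t) * t"
    by (simp add: power2_eq_square algebra_simps)
  also have "\<dots> / \<sigma> = q * \<sigma> + (a - q * t) * t / \<sigma>"
  proof -
    have "(q * (s * s) + b) / s = q * s + b / s" if "s \<noteq> 0" for s b :: real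
      using that by (simp add: add_divide_distrib)
    from this[of \<sigma> "(a - q * t) * t"] \<sigma>_pos(1) show ?thesis by (metis less_irrefl)
  qed
  finally show ?thesis .
qed

lemma offset_bound:
  assumes "\<bar>offset (Complex q a)\<bar> \<le> 1"
  shows "\<bar>a - q * t\<bar> \<le> 2 * r * \<sigma>" "\<bar>along (Complex q a) - q * \<sigma>\<bar> \<le> 2 * r * \<bar>t\<bar>"
proof -
  have "\<bar>(q * t - a) / (r * \<sigma>)\<bar> \<le> 2" using assms h' unfolding offset_Complex' by linarith
  thus 1: "\<bar>a - q * t\<bar> \<le> 2 * r * \<sigma>"
    using r \<sigma>_pos by (simp add: abs_divide abs_mult divide_le_eq abs_minus_commute mult_ac)
  have "\<bar>along (Complex q a) - q * \<sigma>\<bar> = \<bar>a - q * t\<bar> * (\<bar>t\<bar> / \<sigma>)"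
    using \<sigma>_pos by (simp add: along_Complex abs_mult)
  also have "\<dots> \<le> (2 * r * \<sigma>) * (\<bar>t\<bar> / \<sigma>)" using 1 \<sigma>_pos by (intro mult_right_mono) auto
  also have "\<dots> = 2 * r * \<bar>t\<bar>" using \<sigma>_pos by simp
  finally show "\<bar>along (Complex q a) - q * \<sigma>\<bar> \<le> 2 * r * \<bar>t\<bar>" .
qed

lemma hits_iff:
  fixes q a :: int
  shows "hits (Complex (of_int q) (of_int a)) \<longleftrightarrow> q \<ge> 1 \<and> \<bar>offset (Complex (of_int q) (of_int a))\<bar> \<le> 1" (is "_ \<longleftrightarrow> _ \<and> ?off")
proof -
  let ?p = "Complex (of_int q) (of_int a)"
  have "along ?p > 0 \<longleftrightarrow> q \<ge> 1" if off: ?off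
  proof (cases "q \<ge> 1")
    case True
    have "1 * 1 \<le> real_of_int q * \<sigma>" using True \<sigma>_pos by (intro mult_mono) auto
    thus ?thesis using True offset_bound(2)[OF off] r_small(3) by linarith
  next
    case False
    have "along ?p \<le> 0"
    proof (cases "q = 0")
      case True
      have "\<bar>real_of_int a\<bar> < 1" using offset_bound(1)[OF off] r_small(2) True by simp
      hence "a = 0" by linarith
      thus ?thesis using True by (simp add: along_Complex)
    next
      case nz: False
      have "1 * 1 \<le> (- real_of_int q) * \<sigma>" using False nz \<sigma>_pos by (intro mult_mono) auto
      thus ?thesis using offset_bound(2)[OF off] r_small(3) by linarith
    qed
    thus ?thesis using False by simp
  qed
  thus ?thesis by (auto simp: hits_def plane_lattice_def)
qed

lemma first_hit_iff:
  fixes q a :: int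
  shows "first_hit (Complex (of_int q) (of_int a)) \<longleftrightarrow> q \<ge> 1 \<and> \<bar>offset (Complex (of_int q) (of_int a))\<bar> \<le> 1 \<and>
    (\<forall>q1 a1 :: int. 0 < q1 \<and> q1 < q \<longrightarrow> \<bar>offset (Complex (of_int q1) (of_int a1))\<bar> > 1)"
    (is "?L \<longleftrightarrow> ?R")
proof -
  have less: "along (Complex (of_int q1) (of_int a1)) < along (Complex (of_int q2) (of_int a2))"
    if "q1 < q2" "\<bar>offset (Complex (of_int q1) (of_int a1))\<bar> \<le> 1" "\<bar>offset (Complex (of_int q2) (of_int a2))\<bar> \<le> 1" for q1 q2 a1 a2 :: int
  proof -
    have "1 * 1 \<le> real_of_int (q2 - q1) * \<sigma>" using that(1) \<sigma>_pos by (intro mult_mono) auto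
    hence "1 \<le> of_int q2 * \<sigma> - of_int q1 * \<sigma>" by (simp add: algebra_simps)
    thus ?thesis using offset_bound(2)[OF that(2)] offset_bound(2)[OF that(3)] r_small(3) by linarith
  qed
  show ?thesis
  proof
    assume L: ?L
    hence h: "hits (Complex (of_int q) (of_int a))" by (simp add: first_hit_def)
    show ?R
    proof (intro conjI allI impI)
      fix q1 a1 :: int assume q1: "0 < q1 \<and> q1 < q"
      show "\<bar>offset (Complex (of_int q1) (of_int a1))\<bar> > 1"
      proof (rule ccontr)
        assume off: "\<not> ?thesis"
        hence "hits (Complex (of_int q1) (of_int a1))" using q1 by (simp add: hits_iff)
        hence "along (Complex (of_int q) (of_int a)) \<le> along (Complex (of_int q1) (of_int a1))"
          using L by (simp add: first_hit_def)
        thus False using less[of q1 q a1 a] q1 off h by (simp add: hits_iff)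
      qed
    qed (use h in \<open>simp_all add: hits_iff\<close>)
  next
    assume R: ?R
    show ?L
      unfolding first_hit_def
    proof (intro conjI allI impI)
      show "hits (Complex (of_int q) (of_int a))" using R by (simp add: hits_iff)
      fix k assume k: "hits k"
      then obtain q1 a1 :: int where k_eq: "k = Complex (of_int q1) (of_int a1)"
        by (auto simp: hits_def elim: plane_latticeE)
      have k': "q1 \<ge> 1" "\<bar>offset (Complex (of_int q1) (of_int a1))\<bar> \<le> 1" using k by (simp_all add: k_eq hits_iff)
      show "along (Complex (of_int q) (of_int a)) \<le> along k"
      proof (cases "q1 = q")
        case True
        have "(of_int a1 - of_int a) / (r * \<sigma>) = offset (Complex (of_int q) (of_int a)) - offset (Complex (of_int q1) (of_int a1))"
          by (simp add: offset_Complex' True diff_divide_distrib)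
        hence "\<bar>(real_of_int a1 - of_int a) / (r * \<sigma>)\<bar> \<le> 2" using R k'(2) by linarith
        hence "\<bar>real_of_int a1 - of_int a\<bar> \<le> 2 * r * \<sigma>"
          using r \<sigma>_pos by (simp add: abs_divide abs_mult divide_le_eq mult_ac)
        hence "\<bar>real_of_int (a1 - a)\<bar> < 1" using r_small(2) by simp
        hence "a1 = a" by linarith
        thus ?thesis using True k_eq by simp
      next
        case False
        hence "q < q1" using R k' by (metis linorder_cases not_le zero_less_one_class.zero_less_one order_less_le_trans)
        thus ?thesis using less[of q q1 a a1] R k' by (simp add: k_eq)
      qed
    qed
  qed
qed

text \<open>The projection of a hit in column q is q \<sigma> up to 2 r |t|, and each half chord is
  at most r. Multiplied by 2 r this makes the rescaled time an explicit function of q up to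
  O(r^2).\<close>

lemma entry_time_estimate:
  assumes "\<bar>offset (Complex q a)\<bar> \<le> 1"
  shows "\<bar>2 * r * entry (Complex q a) - 2 * r * q * \<sigma>\<bar> \<le> r\<^sup>2 * (4 * \<bar>t\<bar> + 4)"
proof -
  have 1: "0 \<le> r * sqrt (1 - h'\<^sup>2)" "r * sqrt (1 - h'\<^sup>2) \<le> r"
    using r h' by (auto simp: abs_square_le_1 intro!: mult_left_le real_le_lsqrt)
  have 2: "0 \<le> r * sqrt (1 - (offset (Complex q a))\<^sup>2)" "r * sqrt (1 - (offset (Complex q a))\<^sup>2) \<le> r"
    using r assms by (auto simp: abs_square_le_1 intro!: mult_left_le real_le_lsqrt)
  have "\<bar>entry (Complex q a) - q * \<sigma>\<bar> \<le> 2 * r * \<bar>t\<bar> + 2 * r"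
    using offset_bound(2)[OF assms] 1 2 unfolding entry_def by linarith
  hence "2 * r * \<bar>entry (Complex q a) - q * \<sigma>\<bar> \<le> 2 * r * (2 * r * \<bar>t\<bar> + 2 * r)"
    using r by (intro mult_left_mono) auto
  also have "2 * r * (2 * r * \<bar>t\<bar> + 2 * r) = r\<^sup>2 * (4 * \<bar>t\<bar> + 4)" by (simp add: power2_eq_square algebra_simps)
  also have "2 * r * \<bar>entry (Complex q a) - q * \<sigma>\<bar> = \<bar>2 * r * entry (Complex q a) - 2 * r * q * \<sigma>\<bar>"
  proof -
    have "2 * r * \<bar>entry (Complex q a) - q * \<sigma>\<bar> = \<bar>2 * r * (entry (Complex q a) - q * \<sigma>)\<bar>"
      using r by (simp add: abs_mult)
    thus ?thesis by (simp add: right_diff_distrib mult.assoc)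
  qed
  finally show ?thesis .
qed

text \<open>If d > 1 divides p, the offset of p / d is the convex combination of h' and
  \<open>offset p\<close> with weights 1 - 1 / d and 1 / d, so p / d would be an earlier
  hit.\<close>

lemma first_hit_primitive:
  fixes q a :: int
  assumes "first_hit (Complex (of_int q) (of_int a))"
  shows "coprime q a"
proof (rule ccontr)
  assume "\<not> coprime q a"
  define d where "d = gcd q a"
  have fh: "q \<ge> 1" "\<bar>offset (Complex (of_int q) (of_int a))\<bar> \<le> 1"
    "\<And>q1 a1 :: int. 0 < q1 \<Longrightarrow> q1 < q \<Longrightarrow> \<bar>offset (Complex (of_int q1) (of_int a1))\<bar> > 1"
    using assms unfolding first_hit_iff by auto
  have d: "d > 1" using \<open>\<not> coprime q a\<close> fh(1) unfolding d_def coprime_iff_gcd_eq_1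
    by (metis gcd_ge_0_int gcd_pos_int int_one_le_iff_zero_less not_le order_antisym_conv linorder_not_less zero_less_one_class.zero_less_one less_le_trans order_less_irrefl)
  obtain q1 a1 where qa: "q = d * q1" "a = d * a1" unfolding d_def by (meson dvdE gcd_dvd1 gcd_dvd2)
  have q1: "0 < q1" "q1 < q"
  proof -
    have "0 < d * q1" using qa(1) fh(1) by simp
    thus "0 < q1" using d by (simp add: zero_less_mult_iff)
    thus "q1 < q" using qa(1) d by simp
  qed
  have dr: "real_of_int q = of_int d * of_int q1" "real_of_int a = of_int d * of_int a1" using qa by simp_all
  define X where "X = (of_int q1 * t - of_int a1) / (r * \<sigma>)"
  have off: "offset (Complex (of_int q) (of_int a)) = h' + of_int d * X"
    unfolding offset_Complex' dr X_def by (simp add: algebra_simps)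
  have "\<bar>h' + X\<bar> \<le> 1"
  proof -
    have "h' + X = (1 - 1 / of_int d) * h' + 1 / of_int d * (h' + of_int d * X)" using d by (simp add: field_simps)
    also have "\<bar>\<dots>\<bar> \<le> (1 - 1 / of_int d) * \<bar>h'\<bar> + 1 / of_int d * \<bar>h' + of_int d * X\<bar>"
      using d by (intro order.trans[OF abs_triangle_ineq]) (simp add: abs_mult)
    also have "\<dots> \<le> (1 - 1 / of_int d) * 1 + 1 / of_int d * 1"
      using d h' fh(2) off by (intro add_mono mult_left_mono) auto
    finally show ?thesis by simp
  qed
  thus False using fh(3)[OF q1, of a1] by (simp add: offset_Complex' X_def)
qed

lemma first_hit_iff_column_cond:
  fixes q a z :: int
  assumes q: "0 < z" "z < q" "q dvd a * z + 1"
  defines "h \<equiv> offset (Complex (of_int q) (of_int a))"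
  shows "first_hit (Complex (of_int q) (of_int a)) \<longleftrightarrow> \<bar>h\<bar> \<le> 1 \<and> column_cond h' (2 * (r * \<sigma>) * of_int q) h (of_int z / of_int q)"
proof -
  have \<kappa>: "r * \<sigma> > 0" using r \<sigma>_pos by simp
  show ?thesis
  proof
    assume fh: "first_hit (Complex (of_int q) (of_int a))"
    hence h: "\<bar>h\<bar> \<le> 1" unfolding first_hit_iff h_def by auto
    have "column_cond h' (2 * (r * \<sigma>) * of_int q) h (of_int z / of_int q)"
      using first_column_necessary[OF \<kappa> h' q, of t] fh h q
      unfolding first_hit_iff h_def offset_Complex' by (subst column_cond_iff) (use \<kappa> in auto)
    thus "\<bar>h\<bar> \<le> 1 \<and> column_cond h' (2 * (r * \<sigma>) * of_int q) h (of_int z / of_int q)" using h by simp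
  next
    assume *: "\<bar>h\<bar> \<le> 1 \<and> column_cond h' (2 * (r * \<sigma>) * of_int q) h (of_int z / of_int q)"
    have cc: "1 / (r * \<sigma> * of_int q) > 1 + h' + of_int z / of_int q * (h - h')"
      "1 / (r * \<sigma> * of_int q) > 1 - h + of_int z / of_int q * (h - h')"
      using * column_cond_iff[OF \<kappa>, of "of_int q" h' h "of_int z / of_int q"] q by auto
    show "first_hit (Complex (of_int q) (of_int a))"
      unfolding first_hit_iff
    proof (intro conjI allI impI)
      fix q1 a1 :: int assume "0 < q1 \<and> q1 < q"
      thus "\<bar>offset (Complex (of_int q1) (of_int a1))\<bar> > 1"
        unfolding offset_Complex' using first_column_sufficient[OF \<kappa> h' q, of q1 t a1] * cc
        unfolding h_def offset_Complex' by auto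
    qed (use * q in \<open>auto simp: h_def\<close>)
  qed
qed

end

section \<open>Weak convergence for continuous densities\<close>

lemma (in flight) first_hit_unique:
  assumes "first_hit p" "first_hit k"
  shows "p = k"
proof (rule ccontr)
  assume "p \<noteq> k"
  have "along p \<le> along k" "along k \<le> along p" using assms by (simp_all add: first_hit_def)
  hence eq: "along p = along k" by linarith
  have "along k - along p > r * sqrt (1 - (offset p)\<^sup>2) + r * sqrt (1 - (offset k)\<^sup>2)"
    using assms \<open>p \<noteq> k\<close> eq by (intro along_gap) (auto simp: first_hit_def hits_def)
  moreover have "r * sqrt (1 - (offset p)\<^sup>2) \<ge> 0" "r * sqrt (1 - (offset k)\<^sup>2) \<ge> 0"
    using assms r by (auto simp: first_hit_def hits_def abs_square_le_1)
  ultimately show False using eq by linarith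
qed

text \<open>Extension by zero can jump at h = 1 and h = -1. Clamping h to [-1, 1] and multiplying by
  a factor that falls to 0 for |h| between 1 and 2 gives a continuous function on the plane; the
  cutoffs later remove the values at |h| > 1. Positivity of \<open>s0\<close> is where the open
  half-line matters.\<close>

lemma Cc_extension:
  assumes "\<Phi> \<in> Cc ({0<..} \<times> {-1..1::real})"
  obtains F :: "real \<Rightarrow> real \<Rightarrow> real" and s0 S0 b where
    "continuous_on UNIV (\<lambda>(s, h). F s h)" "0 < s0" "s0 < S0"
    "\<And>s h. F s h \<noteq> 0 \<Longrightarrow> s \<in> {s0..S0} \<and> h \<in> {-2..2}"
    "\<And>s h. \<bar>h\<bar> \<le> 1 \<Longrightarrow> F s h = \<Phi> (s, h)" "\<And>s h. \<bar>F s h\<bar> \<le> b"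
proof -
  obtain C where \<Phi>: "continuous_on ({0<..} \<times> {-1..1}) \<Phi>" "compact C" "C \<subseteq> {0<..} \<times> {-1..1}"
    "\<And>x. x \<notin> C \<Longrightarrow> \<Phi> x = 0"
    using assms by (auto simp: Cc_def)
  \<comment> \<open>The point 1 keeps K nonempty if C is empty; similarly the added 1 in
    \<open>S0\<close> makes \<open>s0 < S0\<close> strict.\<close>
  define K where "K = insert 1 (fst ` C)"
  have "compact (fst ` C)" using \<Phi>(2) by (intro compact_continuous_image continuous_intros)
  hence K: "compact K" "K \<noteq> {}" "K \<subseteq> {0<..}" using \<Phi>(3) by (auto simp: K_def)
  obtain s0 where s0: "s0 \<in> K" "\<And>s. s \<in> K \<Longrightarrow> s0 \<le> s" using compact_attains_inf[OF K(1,2)] by auto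
  obtain S1 where S1: "S1 \<in> K" "\<And>s. s \<in> K \<Longrightarrow> s \<le> S1" using compact_attains_sup[OF K(1,2)] by auto
  define S0 where "S0 = S1 + 1"
  have pos: "0 < s0" "s0 < S0" using s0(1) K(3) S1(2)[OF s0(1)] by (auto simp: S0_def)
  have supp: "s \<in> {s0..S0}" if "\<Phi> (s, h) \<noteq> 0" for s h
  proof -
    have "(s, h) \<in> C" using that \<Phi>(4) by blast
    hence "s \<in> K" by (force simp: K_def)
    thus ?thesis using s0(2) S1(2) by (force simp: S0_def)
  qed
  define cl where "cl h = max (-1) (min 1 h)" for h :: real
  define F where "F s h = \<Phi> (s, cl h) * max 0 (min 1 (2 - \<bar>h\<bar>))" for s h
  have "continuous_on ({0<..} \<times> UNIV \<union> {..<s0} \<times> UNIV) (\<lambda>p. \<Phi> (fst p, cl (snd p)))"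
  proof (rule continuous_on_open_Un)
    show "continuous_on ({0<..} \<times> UNIV) (\<lambda>p. \<Phi> (fst p, cl (snd p)))"
      by (rule continuous_on_compose2[OF \<Phi>(1)]) (auto simp: cl_def intro!: continuous_intros)
    have "\<Phi> (s, cl h) = 0" if "s < s0" for s h using supp[of s "cl h"] that by force
    thus "continuous_on ({..<s0} \<times> UNIV) (\<lambda>p. \<Phi> (fst p, cl (snd p)))"
      by (subst continuous_on_cong[OF refl, of _ _ "\<lambda>_. 0"]) auto
  qed (auto intro!: open_Times)
  moreover have "{0<..} \<times> UNIV \<union> {..<s0} \<times> UNIV = (UNIV :: (real \<times> real) set)" using pos by auto
  ultimately have "continuous_on UNIV (\<lambda>p. \<Phi> (fst p, cl (snd p)))" by simp
  hence 1: "continuous_on UNIV (\<lambda>(s, h). F s h)"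
    unfolding F_def case_prod_unfold by (intro continuous_intros)
  have 2: "s \<in> {s0..S0} \<and> h \<in> {-2..2}" if "F s h \<noteq> 0" for s h
    using that supp[of s "cl h"] by (auto simp: F_def max_def min_def split: if_splits)
  have 3: "F s h = \<Phi> (s, h)" if "\<bar>h\<bar> \<le> 1" for s h
  proof -
    have "cl h = h" "max 0 (min 1 (2 - \<bar>h\<bar>)) = 1" using that by (auto simp: cl_def)
    thus ?thesis by (simp add: F_def)
  qed
  have "bounded (\<Phi> ` C)"
    using \<Phi> by (intro compact_imp_bounded compact_continuous_image continuous_on_subset[OF \<Phi>(1)]) auto
  then obtain b where b: "\<And>x. x \<in> C \<Longrightarrow> \<bar>\<Phi> x\<bar> \<le> b" by (auto simp: bounded_iff)
  have 4: "\<bar>F s h\<bar> \<le> \<bar>b\<bar>" for s h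
  proof -
    have "\<bar>\<Phi> (s, cl h)\<bar> \<le> \<bar>b\<bar>" using b[of "(s, cl h)"] \<Phi>(4)[of "(s, cl h)"] by force
    hence "\<bar>F s h\<bar> \<le> \<bar>b\<bar> * 1" unfolding F_def abs_mult by (intro mult_mono) auto
    thus ?thesis by simp
  qed
  show ?thesis by (rule that[OF 1 pos 2 3 4])
qed

text \<open>Continuous functions squeezing the indicator function of the conditions for a first hit:
  \<open>lower_cut\<close> tends to it, and \<open>error_cut\<close> dominates the difference. Both have the same value at
  \<open>y = 0\<close> and \<open>y = 1\<close>, as required for functions on the torus.\<close>

definition cut :: "nat \<Rightarrow> real \<Rightarrow> real" where
  "cut n y = max 0 (min 1 (real n * min y (1 - y)))"

definition margin :: "real \<Rightarrow> real \<Rightarrow> real \<Rightarrow> real \<Rightarrow> real" where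
  "margin h' s h y = min (1 - \<bar>h\<bar>) (2 - s * (1 + max h' (- h)) - s * (h - h') * y)"

definition lower_cut :: "nat \<Rightarrow> real \<Rightarrow> real \<Rightarrow> real \<Rightarrow> real \<Rightarrow> real" where
  "lower_cut n h' s h y = cut n y * max 0 (min 1 (real n * margin h' s h y))"

definition error_cut :: "nat \<Rightarrow> real \<Rightarrow> real \<Rightarrow> real \<Rightarrow> real \<Rightarrow> real" where
  "error_cut n h' s h y = (1 - cut n y) + cut n y * max 0 (1 - real n * \<bar>margin h' s h y\<bar>)"

lemma cut_bounds: "0 \<le> cut n y" "cut n y \<le> 1" by (auto simp: cut_def)

lemma cut_ends [simp]: "cut n 0 = 0" "cut n 1 = 0" by (auto simp: cut_def)

lemma lower_cut_bounds: "0 \<le> lower_cut n h' s h y" "lower_cut n h' s h y \<le> 1"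
  using cut_bounds[of n y] by (auto simp: lower_cut_def intro!: mult_le_one)

lemma error_cut_bounds: "0 \<le> error_cut n h' s h y" "error_cut n h' s h y \<le> 1"
proof -
  have "cut n y * max 0 (1 - real n * \<bar>margin h' s h y\<bar>) \<le> cut n y * 1"
    using cut_bounds[of n y] by (intro mult_left_mono) auto
  moreover have "0 \<le> cut n y * max 0 (1 - real n * \<bar>margin h' s h y\<bar>)" using cut_bounds[of n y] by auto
  ultimately show "0 \<le> error_cut n h' s h y" "error_cut n h' s h y \<le> 1"
    using cut_bounds[of n y] unfolding error_cut_def by linarith+
qed

lemma continuous_on_cuts [continuous_intros]:
  assumes "continuous_on A a1" "continuous_on A a2" "continuous_on A a3"
  shows "continuous_on A (\<lambda>x. lower_cut n h' (a1 x) (a2 x) (a3 x))"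
    and "continuous_on A (\<lambda>x. error_cut n h' (a1 x) (a2 x) (a3 x))"
  unfolding lower_cut_def error_cut_def margin_def cut_def by (intro continuous_intros assms)+

text \<open>Under the conditions the margin m is nonnegative, and 1 - min 1 (n m) is at most max 0
  (1 - n |m|). Otherwise \<open>lower_cut\<close> is 0. The range of y is that of z / q for a
  residue z; y = 0 occurs only for q = 1.\<close>

lemma lower_cut_error:
  assumes "0 \<le> y" "y < 1"
  shows "\<bar>(if 0 < y \<and> \<bar>h\<bar> \<le> 1 \<and> column_cond h' s h y then 1 else 0) - lower_cut n h' s h y\<bar> \<le> error_cut n h' s h y"
proof (cases "0 < y \<and> \<bar>h\<bar> \<le> 1 \<and> column_cond h' s h y")
  case True
  define m where "m = margin h' s h y"
  have m: "m \<ge> 0" using True by (simp add: m_def margin_def column_cond_def)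
  have "1 - max 0 (min 1 (real n * m)) \<le> max 0 (1 - real n * \<bar>m\<bar>)" using m by (auto simp: max_def min_def)
  from mult_left_mono[OF this cut_bounds(1)[of n y]]
  have "1 - lower_cut n h' s h y \<le> error_cut n h' s h y"
    by (simp add: lower_cut_def error_cut_def m_def algebra_simps)
  thus ?thesis using True lower_cut_bounds[of n h' s h y] by simp
next
  case False
  have "lower_cut n h' s h y = 0"
  proof (cases "y = 0")
    case True
    thus ?thesis by (simp add: lower_cut_def)
  next
    case y: False
    have "margin h' s h y \<le> 0" using False assms y unfolding margin_def column_cond_def by linarith
    hence "real n * margin h' s h y \<le> 0" by (simp add: mult_nonneg_nonpos)
    thus ?thesis by (simp add: lower_cut_def)
  qed
  thus ?thesis using False error_cut_bounds(1)[of n h' s h y] by auto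
qed

lemma cut_limits:
  assumes y: "0 < y" "y < 1" and m: "margin h' s h y \<noteq> 0"
  shows "(\<lambda>n. lower_cut n h' s h y) \<longlonglongrightarrow> (if margin h' s h y > 0 then 1 else 0)"
    and "(\<lambda>n. error_cut n h' s h y) \<longlonglongrightarrow> 0"
proof -
  define e where "e = min (min y (1 - y)) \<bar>margin h' s h y\<bar>"
  have e: "e > 0" using assms by (simp add: e_def)
  obtain N :: nat where N: "real N > 1 / e" using reals_Archimedean2 by blast
  have big: "real n * e \<ge> 1" if "n \<ge> N" for n
  proof -
    have "1 / e \<le> real n" using N that by simp
    thus ?thesis using e by (simp add: field_simps)
  qed
  have big': "real n * min y (1 - y) \<ge> 1" "real n * \<bar>margin h' s h y\<bar> \<ge> 1" if "n \<ge> N" for n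
  proof -
    have "real n * e \<le> real n * min y (1 - y)" "real n * e \<le> real n * \<bar>margin h' s h y\<bar>"
      unfolding e_def by (intro mult_left_mono min.cobounded1 min.cobounded2; simp)+
    thus "real n * min y (1 - y) \<ge> 1" "real n * \<bar>margin h' s h y\<bar> \<ge> 1" using big[OF that] by linarith+
  qed
  have "lower_cut n h' s h y = (if margin h' s h y > 0 then 1 else 0)" "error_cut n h' s h y = 0" if "n \<ge> N" for n
  proof -
    have c: "cut n y = 1" using big'(1)[OF that] by (simp add: cut_def)
    show "lower_cut n h' s h y = (if margin h' s h y > 0 then 1 else 0)"
      using big'(2)[OF that] by (auto simp: lower_cut_def c mult_nonneg_nonpos)
    show "error_cut n h' s h y = 0" using big'(2)[OF that] by (simp add: error_cut_def c)
  qed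
  thus "(\<lambda>n. lower_cut n h' s h y) \<longlonglongrightarrow> (if margin h' s h y > 0 then 1 else 0)" "(\<lambda>n. error_cut n h' s h y) \<longlonglongrightarrow> 0"
    by (auto intro!: tendsto_eventually eventually_sequentiallyI)
qed

text \<open>For h different from h' and |h| different from 1 the margin vanishes for at most one y,
  so both cutoffs converge almost everywhere and dominated convergence applies. For h = h' the
  margin would be constant in y, for |h| = 1 it could vanish on an interval.\<close>

lemma integral_cut_limits:
  assumes s: "s > 0" and h: "h \<noteq> h'" "\<bar>h\<bar> \<noteq> 1"
  shows "(\<lambda>n. integral {0..1} (lower_cut n h' s h)) \<longlonglongrightarrow> (if \<bar>h\<bar> < 1 then pi\<^sup>2 / 3 * transition_kernel s h h' else 0)"
    and "(\<lambda>n. integral {0..1} (error_cut n h' s h)) \<longlonglongrightarrow> 0"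
proof -
  define y0 where "y0 = (2 - s * (1 + max h' (- h))) / (s * (h - h'))"
  have y0: "y = y0" if "margin h' s h y = 0" for y
  proof -
    have "s * (h - h') * y = 2 - s * (1 + max h' (- h))" using that h(2) by (auto simp: margin_def min_def split: if_splits)
    thus ?thesis using s h(1) by (simp add: y0_def field_simps)
  qed
  have AE: "AE y in lborel. y \<noteq> 0 \<and> y \<noteq> 1 \<and> y \<noteq> y0"
    using AE_lborel_singleton[of 0] AE_lborel_singleton[of 1] AE_lborel_singleton[of y0] by eventually_elim auto
  have leb: "integral {0..1} f = (LINT y|lborel. indicator {0..1} y * f y)" if "continuous_on UNIV f" for f :: "real \<Rightarrow> real"
    using set_borel_integral_eq_integral(2)[of "{0..1}" f] borel_integrable_atLeastAtMost'[of 0 1 f] continuous_on_subset[OF that]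
    by (simp add: set_lebesgue_integral_def)
  have cont: "continuous_on UNIV (lower_cut n h' s h)" "continuous_on UNIV (error_cut n h' s h)" for n
    by (intro continuous_intros)+
  have meas: "(\<lambda>y. indicator {0..1} y * f y) \<in> borel_measurable lborel" if "continuous_on UNIV f" for f :: "real \<Rightarrow> real"
    using borel_measurable_continuous_onI[OF that] by measurable
  have int01: "integrable lborel (indicator {0..1 :: real} :: real \<Rightarrow> real)" by simp
  define G where "G = {y \<in> {0..1}. s * (h - h') * y < 2 - s * (1 + max h' (- h))}"
  have G [measurable]: "G \<in> sets borel" unfolding G_def by measurable
  have lim: "(\<lambda>n. LINT y|lborel. indicator {0..1} y * lower_cut n h' s h y) \<longlonglongrightarrow>
     (LINT y|lborel. (if \<bar>h\<bar> < 1 then indicator G y else 0))"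
  proof (rule integral_dominated_convergence[where w = "indicator {0..1}"])
    show "AE y in lborel. (\<lambda>n. indicator {0..1} y * lower_cut n h' s h y) \<longlonglongrightarrow> (if \<bar>h\<bar> < 1 then indicator G y else 0)"
      using AE
    proof eventually_elim
      case (elim y)
      show ?case
      proof (cases "y \<in> {0..1}")
        case True
        hence y: "0 < y" "y < 1" using elim by auto
        have mne: "margin h' s h y \<noteq> 0" using elim y0 by auto
        have "(if margin h' s h y > 0 then 1 else 0) = (if \<bar>h\<bar> < 1 then indicator G y else (0 :: real))"
          using True by (auto simp: margin_def G_def indicator_def)
        thus ?thesis using cut_limits(1)[OF y mne] True by simp
      qed (auto simp: G_def)
    qed
    show "AE y in lborel. norm (indicator {0..1} y * lower_cut n h' s h y) \<le> indicator {0..1} y" for n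
      using lower_cut_bounds by (auto simp: indicator_def)
  qed (use int01 cont meas in \<open>auto simp: case_prod_unfold\<close>)
  also have "(LINT y|lborel. (if \<bar>h\<bar> < 1 then indicator G y else 0)) = (if \<bar>h\<bar> < 1 then pi\<^sup>2 / 3 * transition_kernel s h h' else 0)"
    using measure_transition_kernel[OF s h(1)] by (simp add: G_def)
  finally show "(\<lambda>n. integral {0..1} (lower_cut n h' s h)) \<longlonglongrightarrow> (if \<bar>h\<bar> < 1 then pi\<^sup>2 / 3 * transition_kernel s h h' else 0)"
    unfolding leb[OF cont(1)] .
  have "(\<lambda>n. LINT y|lborel. indicator {0..1} y * error_cut n h' s h y) \<longlonglongrightarrow> (LINT y|(lborel :: real measure). (0 :: real))"
  proof (rule integral_dominated_convergence[where w = "indicator {0..1 :: real}" and f = "\<lambda>_. 0"])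
    show "AE y in lborel. (\<lambda>n. indicator {0..1} y * error_cut n h' s h y) \<longlonglongrightarrow> 0"
      using AE
    proof eventually_elim
      case (elim y)
      show ?case
      proof (cases "y \<in> {0..1}")
        case True
        hence y: "0 < y" "y < 1" using elim by auto
        have mne: "margin h' s h y \<noteq> 0" using elim y0 by auto
        show ?thesis using cut_limits(2)[OF y mne] True by simp
      qed auto
    qed
    show "AE y in lborel. norm (indicator {0..1} y * error_cut n h' s h y) \<le> indicator {0..1} y" for n
      using error_cut_bounds by (auto simp: indicator_def)
  qed (use int01 cont meas in auto)
  thus "(\<lambda>n. integral {0..1} (error_cut n h' s h)) \<longlonglongrightarrow> 0" unfolding leb[OF cont(2)] by simp
qed

text \<open>Dominated convergence in h and then in s; the 4 is the length of [-2, 2].\<close>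

lemma iterated_integral_tendsto:
  fixes f :: "nat \<Rightarrow> real \<Rightarrow> real \<Rightarrow> real" and g :: "real \<Rightarrow> real \<Rightarrow> real"
  assumes meas: "\<And>n. (\<lambda>(s, h). f n s h) \<in> borel_measurable (borel \<Otimes>\<^sub>M borel)" "(\<lambda>(s, h). g s h) \<in> borel_measurable (borel \<Otimes>\<^sub>M borel)"
    and bd: "\<And>n s h. \<bar>f n s h\<bar> \<le> b * indicator {s0..S0} s * indicator {-2..2} h"
    and lim: "\<And>s. AE h in lborel. (\<lambda>n. f n s h) \<longlonglongrightarrow> g s h"
  shows "(\<lambda>n. LINT s|lborel. LINT h|lborel. f n s h) \<longlonglongrightarrow> (LINT s|lborel. LINT h|lborel. g s h)"
proof -
  note [measurable] = meas
  have b: "b * indicator {s0..S0} s \<ge> 0" for s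
    using bd[of 0 s 0] by (auto simp: indicator_def split: if_splits)
  have mf [measurable]: "f n s \<in> borel_measurable borel" "g s \<in> borel_measurable borel" for n s
    using measurable_compose[OF measurable_Pair1' meas(1)[of n]] measurable_compose[OF measurable_Pair1' meas(2)]
    by (auto simp: space_borel)
  show ?thesis
  proof (rule integral_dominated_convergence[where w = "\<lambda>s. 4 * b * indicator {s0..S0} s"])
    show "AE s in lborel. (\<lambda>n. LINT h|lborel. f n s h) \<longlonglongrightarrow> (LINT h|lborel. g s h)"
    proof (rule AE_I2)
      fix s
      show "(\<lambda>n. LINT h|lborel. f n s h) \<longlonglongrightarrow> (LINT h|lborel. g s h)"
        by (rule integral_dominated_convergence[where w = "\<lambda>h. b * indicator {s0..S0} s * indicator {-2..2} h"])
           (use lim[of s] bd in auto)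
    qed
    show "AE s in lborel. norm (LINT h|lborel. f n s h) \<le> 4 * b * indicator {s0..S0} s" for n
    proof (rule AE_I2)
      fix s
      have "norm (LINT h|lborel. f n s h) \<le> (LINT h|lborel. b * indicator {s0..S0} s * indicator {-2..2 :: real} h)"
      proof (rule Bochner_Integration.integral_norm_bound_integral)
        show I: "integrable lborel (\<lambda>h. b * indicator {s0..S0} s * indicator {-2..2 :: real} h)" by simp
        show "integrable lborel (f n s)"
        proof (rule Bochner_Integration.integrable_bound[OF I])
          show "AE h in lborel. norm (f n s h) \<le> norm (b * indicator {s0..S0} s * indicator {-2..2} h)"
            using bd[of n s] by (intro AE_I2) (simp only: real_norm_def, meson abs_ge_self order.trans)
        qed simp
        show "norm (f n s h) \<le> b * indicator {s0..S0} s * indicator {-2..2} h" for h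
          using bd[of n s h] by simp
      qed
      also have "\<dots> = 4 * b * indicator {s0..S0} s" by simp
      finally show "norm (LINT h|lborel. f n s h) \<le> 4 * b * indicator {s0..S0} s" .
    qed
  qed (simp_all add: emeasure_lborel_Icc_eq)
qed

definition limit_integral :: "(real \<times> real \<Rightarrow> real) \<Rightarrow> real \<Rightarrow> real" where
  "limit_integral \<Phi> h' = (LINT s:{0<..}|lborel. (LINT h:{-1..1}|lborel. \<Phi> (s, h) * transition_kernel s h h'))"

text \<open>The factor 3 / pi^2 of the lattice limit cancels the pi^2 / 3 in the measure of the
  admissible y, which leaves the kernel itself.\<close>

lemma cut_integrals_tendsto:
  fixes F :: "real \<Rightarrow> real \<Rightarrow> real"
  assumes F: "continuous_on UNIV (\<lambda>(s, h). F s h)" "0 < s0"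
    "\<And>s h. F s h \<noteq> 0 \<Longrightarrow> s \<in> {s0..S0} \<and> h \<in> {-2..2}"
    "\<And>s h. \<bar>h\<bar> \<le> 1 \<Longrightarrow> F s h = \<Phi> (s, h)" "\<And>s h. \<bar>F s h\<bar> \<le> b"
  shows "(\<lambda>n. 3 / pi\<^sup>2 * (LINT s|lborel. LINT h|lborel. integral {0..1} (\<lambda>y. F s h * lower_cut n h' s h y))) \<longlonglongrightarrow> limit_integral \<Phi> h'"
    and "(\<lambda>n. LINT s|lborel. LINT h|lborel. integral {0..1} (\<lambda>y. \<bar>F s h\<bar> * error_cut n h' s h y)) \<longlonglongrightarrow> 0"
proof -
  have [measurable]: "(\<lambda>(s, h). F s h) \<in> borel_measurable (borel \<Otimes>\<^sub>M borel)"
    using borel_measurable_continuous_onI[OF F(1)] by (simp add: borel_prod)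
  have [measurable]: "(\<lambda>(s, h). transition_kernel s h h') \<in> borel_measurable (borel \<Otimes>\<^sub>M borel)"
    using transition_kernel_measurable[of h'] by (simp add: borel_prod)
  have mA: "(\<lambda>(s, h). integral {0..1} (lower_cut n h' s h)) \<in> borel_measurable (borel \<Otimes>\<^sub>M borel)"
    "(\<lambda>(s, h). integral {0..1} (error_cut n h' s h)) \<in> borel_measurable (borel \<Otimes>\<^sub>M borel)" for n
  proof -
    have "continuous_on UNIV (\<lambda>p. integral (cbox 0 1) (lower_cut n h' (fst p) (snd p)))"
      "continuous_on UNIV (\<lambda>p. integral (cbox 0 1) (error_cut n h' (fst p) (snd p)))"
      by (intro integral_continuous_on_param; auto simp: case_prod_unfold intro!: continuous_intros)+
    thus "(\<lambda>(s, h). integral {0..1} (lower_cut n h' s h)) \<in> borel_measurable (borel \<Otimes>\<^sub>M borel)"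
      "(\<lambda>(s, h). integral {0..1} (error_cut n h' s h)) \<in> borel_measurable (borel \<Otimes>\<^sub>M borel)"
      by (auto simp: borel_prod case_prod_unfold cbox_interval dest: borel_measurable_continuous_onI)
  qed
  note [measurable] = mA
  have int_bd: "\<bar>integral {0..1} (lower_cut n h' s h)\<bar> \<le> 1" "\<bar>integral {0..1} (error_cut n h' s h)\<bar> \<le> 1" for n s h
  proof -
    have "norm (integral {0..1} (lower_cut n h' s h)) \<le> 1 * (1 - 0)" "norm (integral {0..1} (error_cut n h' s h)) \<le> 1 * (1 - 0)"
      by (rule integral_bound; use lower_cut_bounds error_cut_bounds in \<open>auto intro!: continuous_intros\<close>)+
    thus "\<bar>integral {0..1} (lower_cut n h' s h)\<bar> \<le> 1" "\<bar>integral {0..1} (error_cut n h' s h)\<bar> \<le> 1" by auto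
  qed
  have F_bd: "\<bar>F s h\<bar> * \<bar>i\<bar> \<le> b * indicator {s0..S0} s * indicator {-2..2} h" if "\<bar>i\<bar> \<le> 1" for s h i
  proof (cases "F s h = 0")
    case True
    moreover have "b \<ge> 0" using F(5)[of 0 0] by linarith
    ultimately show ?thesis by simp
  next
    case False
    have "\<bar>F s h\<bar> * \<bar>i\<bar> \<le> b * 1" using F(5) that by (intro mult_mono) (auto intro: order.trans[OF _ F(5)])
    thus ?thesis using F(3)[OF False] by simp
  qed
  have AE: "AE h in lborel. h \<noteq> h' \<and> \<bar>h\<bar> \<noteq> 1"
    using AE_lborel_singleton[of h'] AE_lborel_singleton[of 1] AE_lborel_singleton[of "-1"] by eventually_elim auto
  have F0: "F s h = 0" if "s \<le> 0" for s h using F(2,3) that by force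
  have "(\<lambda>n. LINT s|lborel. LINT h|lborel. F s h * integral {0..1} (lower_cut n h' s h)) \<longlonglongrightarrow>
     (LINT s|lborel. LINT h|lborel. F s h * (if \<bar>h\<bar> < 1 then pi\<^sup>2 / 3 * transition_kernel s h h' else 0))"
  proof (rule iterated_integral_tendsto)
    show "AE h in lborel. (\<lambda>n. F s h * integral {0..1} (lower_cut n h' s h)) \<longlonglongrightarrow>
       F s h * (if \<bar>h\<bar> < 1 then pi\<^sup>2 / 3 * transition_kernel s h h' else 0)" for s
      using AE
    proof eventually_elim
      case (elim h)
      show ?case
      proof (cases "s > 0")
        case True
        thus ?thesis using elim by (intro tendsto_mult_left integral_cut_limits(1)) auto
      qed (simp add: F0)
    qed
    show "\<bar>F s h * integral {0..1} (lower_cut n h' s h)\<bar> \<le> b * indicator {s0..S0} s * indicator {-2..2} h" for n s h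
      unfolding abs_mult by (rule F_bd[OF int_bd(1)])
  qed measurable
  hence "(\<lambda>n. 3 / pi\<^sup>2 * (LINT s|lborel. LINT h|lborel. F s h * integral {0..1} (lower_cut n h' s h))) \<longlonglongrightarrow>
     3 / pi\<^sup>2 * (LINT s|lborel. LINT h|lborel. F s h * (if \<bar>h\<bar> < 1 then pi\<^sup>2 / 3 * transition_kernel s h h' else 0))"
    by (rule tendsto_mult_left)
  also have "3 / pi\<^sup>2 * (LINT s|lborel. LINT h|lborel. F s h * (if \<bar>h\<bar> < 1 then pi\<^sup>2 / 3 * transition_kernel s h h' else 0)) = limit_integral \<Phi> h'"
  proof -
    have "3 / pi\<^sup>2 * (LINT s|lborel. LINT h|lborel. F s h * (if \<bar>h\<bar> < 1 then pi\<^sup>2 / 3 * transition_kernel s h h' else 0)) =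
      (LINT s|lborel. LINT h|lborel. 3 / pi\<^sup>2 * (F s h * (if \<bar>h\<bar> < 1 then pi\<^sup>2 / 3 * transition_kernel s h h' else 0)))"
      by simp
    also have "\<dots> = (LINT s|lborel. indicator {0<..} s *\<^sub>R (LINT h|lborel. indicator {-1..1} h *\<^sub>R (\<Phi> (s, h) * transition_kernel s h h')))"
    proof (rule Bochner_Integration.integral_cong[OF refl])
      fix s :: real
      have "(LINT h|lborel. 3 / pi\<^sup>2 * (F s h * (if \<bar>h\<bar> < 1 then pi\<^sup>2 / 3 * transition_kernel s h h' else 0))) =
        (LINT h|lborel. indicator {0<..} s *\<^sub>R (indicator {-1..1} h *\<^sub>R (F s h * transition_kernel s h h')))"
      proof (rule integral_cong_AE)
        show "AE h in lborel. 3 / pi\<^sup>2 * (F s h * (if \<bar>h\<bar> < 1 then pi\<^sup>2 / 3 * transition_kernel s h h' else 0)) =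
          indicator {0<..} s *\<^sub>R (indicator {-1..1} h *\<^sub>R (F s h * transition_kernel s h h'))"
          using AE by eventually_elim (auto simp: indicator_def F0 abs_if split: if_splits)
      qed measurable
      also have "\<dots> = indicator {0<..} s *\<^sub>R (LINT h|lborel. indicator {-1..1} h *\<^sub>R (\<Phi> (s, h) * transition_kernel s h h'))"
        unfolding integral_scaleR_right[symmetric]
        by (simp, rule disjI2, rule Bochner_Integration.integral_cong[OF refl]) (auto simp: indicator_def F(4))
      finally show "(LINT h|lborel. 3 / pi\<^sup>2 * (F s h * (if \<bar>h\<bar> < 1 then pi\<^sup>2 / 3 * transition_kernel s h h' else 0))) =
        indicator {0<..} s *\<^sub>R (LINT h|lborel. indicator {-1..1} h *\<^sub>R (\<Phi> (s, h) * transition_kernel s h h'))" .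
    qed
    finally show ?thesis by (simp add: limit_integral_def set_lebesgue_integral_def)
  qed
  finally show "(\<lambda>n. 3 / pi\<^sup>2 * (LINT s|lborel. LINT h|lborel. integral {0..1} (\<lambda>y. F s h * lower_cut n h' s h y))) \<longlonglongrightarrow> limit_integral \<Phi> h'"
    by simp
  have "(\<lambda>n. LINT s|lborel. LINT h|lborel. \<bar>F s h\<bar> * integral {0..1} (error_cut n h' s h)) \<longlonglongrightarrow>
     (LINT s|(lborel :: real measure). LINT h|(lborel :: real measure). (0 :: real))"
  proof (rule iterated_integral_tendsto[where g = "\<lambda>s h. 0" and f = "\<lambda>n s h. \<bar>F s h\<bar> * integral {0..1} (error_cut n h' s h)"])
    show "AE h in lborel. (\<lambda>n. \<bar>F s h\<bar> * integral {0..1} (error_cut n h' s h)) \<longlonglongrightarrow> 0" for s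
      using AE
    proof eventually_elim
      case (elim h)
      show ?case
      proof (cases "s > 0")
        case True
        thus ?thesis using elim by (intro tendsto_mult_right_zero integral_cut_limits(2)) auto
      qed (simp add: F0)
    qed
    show "\<bar>\<bar>F s h\<bar> * integral {0..1} (error_cut n h' s h)\<bar> \<le> b * indicator {s0..S0} s * indicator {-2..2} h" for n s h
      unfolding abs_mult abs_abs by (rule F_bd[OF int_bd(2)])
  qed measurable
  thus "(\<lambda>n. LINT s|lborel. LINT h|lborel. integral {0..1} (\<lambda>y. \<bar>F s h\<bar> * error_cut n h' s h y)) \<longlonglongrightarrow> 0"
    by simp
qed

section \<open>The transfer map as a sum over candidate obstacles\<close>

lemma compact_support_unif_continuous:
  fixes F :: "real \<Rightarrow> real \<Rightarrow> real"
  assumes "continuous_on UNIV (\<lambda>(s, h). F s h)"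
    "\<And>s h. F s h \<noteq> 0 \<Longrightarrow> s \<in> {s0..S0} \<and> h \<in> {-2..2}" and "e > 0"
  shows "\<exists>d>0. \<forall>s s' h. \<bar>h\<bar> \<le> 1 \<longrightarrow> \<bar>s' - s\<bar> < d \<longrightarrow> \<bar>F s' h - F s h\<bar> \<le> e"
proof -
  \<comment> \<open>Widened by 1 so that s and s' both lie in K as soon as one of them belongs to
    the support and |s' - s| < 1.\<close>
  define K where "K = {s0 - 1..S0 + 1} \<times> {-1..1 :: real}"
  have "uniformly_continuous_on K (\<lambda>(s, h). F s h)"
    by (intro compact_uniformly_continuous continuous_on_subset[OF assms(1)]) (auto simp: K_def intro: compact_Times)
  then obtain d where d: "d > 0" "\<And>p p'. p \<in> K \<Longrightarrow> p' \<in> K \<Longrightarrow> dist p' p < d \<Longrightarrow>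
      dist ((\<lambda>(s, h). F s h) p') ((\<lambda>(s, h). F s h) p) < e"
    using \<open>e > 0\<close> by (metis uniformly_continuous_on_def)
  show ?thesis
  proof (intro exI[of _ "min d 1"] conjI allI impI)
    fix s s' h :: real assume h: "\<bar>h\<bar> \<le> 1" and s: "\<bar>s' - s\<bar> < min d 1"
    show "\<bar>F s' h - F s h\<bar> \<le> e"
    proof (cases "F s h = 0 \<and> F s' h = 0")
      case False
      hence "s \<in> {s0..S0} \<or> s' \<in> {s0..S0}" using assms(2) by blast
      hence "(s, h) \<in> K" "(s', h) \<in> K" using s h by (auto simp: K_def abs_le_iff)
      from d(2)[OF this] s show ?thesis by (simp add: dist_Pair_Pair dist_real_def)
    qed (use \<open>e > 0\<close> in simp)
  qed (use d in simp)
qed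

text \<open>The slope is t = \<tau> + k with k an integer. Shearing by k takes (q, x) to (q, x + k
  q) and keeps the residue x modulo q, so the same unit pairs serve every k; k enters only through
  \<sigma>.\<close>

definition hit_term :: "(real \<Rightarrow> real \<Rightarrow> real) \<Rightarrow> real \<Rightarrow> (real \<Rightarrow> real) \<Rightarrow> real \<Rightarrow> real \<Rightarrow> nat \<Rightarrow> int \<times> int \<Rightarrow> real" where
  "hit_term F h' \<sigma> r \<tau> q p =
    (let s = 2 * (r * real q) * \<sigma> \<tau>; h = h' + (real q * \<tau> - of_int (fst p)) / r / \<sigma> \<tau>; y = of_int (snd p) / real q
     in (if 0 < y \<and> \<bar>h\<bar> \<le> 1 \<and> column_cond h' s h y then 1 else 0) * F s h)"

lemma shifted_dvd:
  fixes k x z :: int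
  assumes "(x, z) \<in> unit_pairs q"
  shows "int q dvd (x + k * int q) * z + 1"
proof -
  have eq: "(x + k * int q) * z + 1 = (x * z + 1) + int q * (k * z)" by (simp add: algebra_simps)
  show ?thesis unfolding eq by (rule dvd_add) (use assms in \<open>auto simp: unit_pairs_def\<close>)
qed

text \<open>At most one term of the sum is nonzero, the one at the first hit, and its time differs
  from the true one by O(r^2). The point is that a first hit with a relevant time really is among
  the indices, that is q <= (S0 + 1) / r and 0 < x < q.\<close>

lemma transfer_map_hit_sum:
  fixes F :: "real \<Rightarrow> real \<Rightarrow> real" and k :: int
  assumes \<Phi>: "\<Phi> \<in> Cc ({0<..} \<times> {-1..1::real})"
    and F: "continuous_on UNIV (\<lambda>(s, h). F s h)" "0 < s0" "s0 < S0"
      "\<And>s h. F s h \<noteq> 0 \<Longrightarrow> s \<in> {s0..S0} \<and> h \<in> {-2..2}"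
      "\<And>s h. \<bar>h\<bar> \<le> 1 \<Longrightarrow> F s h = \<Phi> (s, h)"
    and h': "\<bar>h'\<bar> \<le> 1" and \<delta>: "0 < \<delta>" and e: "e > 0"
  defines "\<sigma> \<equiv> \<lambda>\<tau>. sqrt (1 + (\<tau> + of_int k)\<^sup>2)"
  shows "\<forall>\<^sub>F r in at_right 0. \<forall>\<tau>\<in>{\<delta>..1 - \<delta>}. (\<exists>p. flight.first_hit r h' (slope_direction (\<tau> + of_int k)) p) \<longrightarrow>
    \<bar>\<Phi> (transfer_map r h' (slope_direction (\<tau> + of_int k))) -
      (\<Sum>q=1..nat \<lfloor>(S0 + 1) / r\<rfloor>. \<Sum>p\<in>unit_pairs q. hit_term F h' \<sigma> r \<tau> q p)\<bar> \<le> e"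
proof -
  obtain d where d: "d > 0" "\<And>s s' h. \<bar>h\<bar> \<le> 1 \<Longrightarrow> \<bar>s' - s\<bar> < d \<Longrightarrow> \<bar>F s' h - F s h\<bar> \<le> e"
    using compact_support_unif_continuous[OF F(1,4) e] by blast
  define T where "T = 1 + \<bar>real_of_int k\<bar>"
  have T: "T \<ge> 1" by (simp add: T_def)
  have "((\<lambda>r::real. 4 * r * (1 + T)) \<longlongrightarrow> 4 * 0 * (1 + T)) (at_right 0)" by (intro tendsto_intros)
  \<comment> \<open>The 1 gives the smallness required by \<open>slope_flight\<close>. The s0
    \<delta> gives q \<delta> > 1 for hits with s > s0 / 2, because s <= 2 r q (1 + T).\<close>
  hence ev1: "\<forall>\<^sub>F r in at_right (0::real). 4 * r * (1 + T) < min 1 (s0 * \<delta>)"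
    using F(2) \<delta> by (intro order_tendstoD) auto
  have "((\<lambda>r::real. r\<^sup>2 * (4 * T + 4)) \<longlongrightarrow> 0\<^sup>2 * (4 * T + 4)) (at_right 0)" by (intro tendsto_intros)
  \<comment> \<open>The discrepancy in time stays below d for uniform continuity, below 1 for q <=
    (S0 + 1) / r, and below s0 / 2 for s > s0 / 2.\<close>
  hence ev2: "\<forall>\<^sub>F r in at_right (0::real). r\<^sup>2 * (4 * T + 4) < min (min d 1) (s0 / 2)"
    using F(2) d(1) by (intro order_tendstoD) auto
  show ?thesis
    using eventually_at_right_less[of "0::real"] ev1 ev2
  proof eventually_elim
    case (elim r)
    show ?case
    proof (intro ballI impI)
      fix \<tau> assume \<tau>: "\<tau> \<in> {\<delta>..1 - \<delta>}" and ex: "\<exists>p. flight.first_hit r h' (slope_direction (\<tau> + of_int k)) p"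
      define t where "t = \<tau> + of_int k"
      have tT: "\<bar>t\<bar> \<le> T" using \<tau> \<delta> by (auto simp: t_def T_def)
      have "4 * r * (1 + \<bar>t\<bar>) \<le> 4 * r * (1 + T)" using elim tT by (intro mult_left_mono) auto
      also have "\<dots> < 1" using elim by simp
      finally have "4 * r * (1 + \<bar>t\<bar>) < 1" .
      then interpret slope_flight r h' t using elim h' by unfold_locales auto
      have \<sigma>\<tau>: "\<sigma> \<tau> = sqrt (1 + t\<^sup>2)" by (simp add: \<sigma>_def t_def)
      have off: "offset (Complex (real_of_int (int q)) (of_int (x + k * int q))) = h' + (real q * \<tau> - of_int x) / r / \<sigma> \<tau>" for q :: nat and x
        unfolding \<sigma>\<tau> offset_Complex by (simp add: t_def algebra_simps)
      define J where "J = {(q, p). q \<in> {1..nat \<lfloor>(S0 + 1) / r\<rfloor>} \<and> p \<in> unit_pairs q \<and>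
         first_hit (Complex (real_of_int (int q)) (of_int (fst p + k * int q))) \<and> 0 < snd p}"
      have term_eq: "hit_term F h' \<sigma> r \<tau> q p = (if (q, p) \<in> J then F (2 * (r * real q) * \<sigma> \<tau>) (h' + (real q * \<tau> - of_int (fst p)) / r / \<sigma> \<tau>) else 0)"
        if q: "q \<in> {1..nat \<lfloor>(S0 + 1) / r\<rfloor>}" "p \<in> unit_pairs q" for q p
      proof (cases "0 < snd p")
        case True
        have z: "0 < snd p" "snd p < int q" "int q dvd (fst p + k * int q) * snd p + 1"
          using True q shifted_dvd[of "fst p" "snd p" q k] by (auto simp: unit_pairs_def)
        have s: "2 * (r * sqrt (1 + t\<^sup>2)) * real_of_int (int q) = 2 * (r * real q) * \<sigma> \<tau>" by (simp add: \<sigma>\<tau>)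
        show ?thesis
          using first_hit_iff_column_cond[OF z] q True
          unfolding off s by (simp add: hit_term_def J_def Let_def)
      qed (auto simp: hit_term_def J_def Let_def zero_less_divide_iff)
      have uniq: "x = x'" if "x \<in> J" "x' \<in> J" for x x'
      proof -
        obtain q p where x1: "x = (q, p)" by (cases x)
        obtain q' p' where x2: "x' = (q', p')" by (cases x')
        note x = x1 x2
        have "Complex (real_of_int (int q)) (of_int (fst p + k * int q)) = Complex (real_of_int (int q')) (of_int (fst p' + k * int q'))"
          using that first_hit_unique unfolding x J_def by blast
        hence "real_of_int (int q) = real_of_int (int q')" "real_of_int (fst p + k * int q) = of_int (fst p' + k * int q')"
          by (simp_all only: complex.inject)
        hence "int q = int q'" "fst p + k * int q = fst p' + k * int q'" by (simp_all only: of_int_eq_iff)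
        hence qq: "q = q'" and "fst p = fst p'" by auto
        moreover have "(fst p, snd p) \<in> unit_pairs q" "(fst p', snd p') \<in> unit_pairs q'" using that by (auto simp: x J_def)
        ultimately show ?thesis using unit_pairs_unique x by (metis prod.collapse)
      qed
      define S where "S = (\<Sum>q=1..nat \<lfloor>(S0 + 1) / r\<rfloor>. \<Sum>p\<in>unit_pairs q. hit_term F h' \<sigma> r \<tau> q p)"
      define I where "I = (SIGMA q:{1..nat \<lfloor>(S0 + 1) / r\<rfloor>}. unit_pairs q)"
      have finI: "finite I" unfolding I_def by auto
      have JI: "J \<subseteq> I" by (auto simp: J_def I_def)
      have "S = (\<Sum>(q, p)\<in>I. hit_term F h' \<sigma> r \<tau> q p)"
        unfolding S_def I_def by (rule sum.Sigma) auto
      also have "\<dots> = (\<Sum>(q, p)\<in>J. F (2 * (r * real q) * \<sigma> \<tau>) (h' + (real q * \<tau> - of_int (fst p)) / r / \<sigma> \<tau>))"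
        using finI JI term_eq by (intro sum.mono_neutral_cong_right) (auto simp: I_def)
      finally have S: "S = (\<Sum>(q, p)\<in>J. F (2 * (r * real q) * \<sigma> \<tau>) (h' + (real q * \<tau> - of_int (fst p)) / r / \<sigma> \<tau>))" .
      obtain p where fp: "first_hit p" using ex by (auto simp: t_def)
      then obtain q a :: int where p: "p = Complex (of_int q) (of_int a)"
        by (auto simp: first_hit_def hits_def elim: plane_latticeE)
      note fh = fp[unfolded p]
      have q1: "q \<ge> 1" "\<bar>offset (Complex (of_int q) (of_int a))\<bar> \<le> 1" using fh unfolding first_hit_iff by auto
      define x where "x = a - k * q"
      define n where "n = nat q"
      have qn: "q = int n" using q1 by (simp add: n_def)
      have a: "a = x + k * int n" by (simp add: x_def qn)
      define s where "s = 2 * (r * real n) * \<sigma> \<tau>"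
      define h where "h = h' + (real n * \<tau> - of_int x) / r / \<sigma> \<tau>"
      have offh: "offset (Complex (of_int q) (of_int a)) = h" unfolding qn a off h_def ..
      have tm: "transfer_map r h' (slope_direction t) = (2 * r * entry (Complex (of_int q) (of_int a)), h)"
        using transfer_map_first_hit[OF fh] offh by simp
      define s' where "s' = 2 * r * entry (Complex (of_int q) (of_int a))"
      have "\<bar>s' - s\<bar> \<le> r\<^sup>2 * (4 * \<bar>t\<bar> + 4)"
        using entry_time_estimate[OF q1(2)] unfolding s'_def s_def \<sigma>\<tau> by (simp add: qn mult_ac)
      also have "\<dots> \<le> r\<^sup>2 * (4 * T + 4)" using tT by (intro mult_left_mono) auto
      finally have ss: "\<bar>s' - s\<bar> < d" "\<bar>s' - s\<bar> < 1" "\<bar>s' - s\<bar> < s0 / 2" using elim by auto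
      have hle: "\<bar>h\<bar> \<le> 1" using q1(2) offh by simp
      have \<Phi>F: "\<Phi> (transfer_map r h' (slope_direction t)) = F s' h" using F(5)[OF hle] by (simp add: tm s'_def)
      have "\<bar>F s' h - S\<bar> \<le> e"
      proof (cases "F s' h = 0 \<and> J = {}")
        case True
        thus ?thesis using e S by simp
      next
        \<comment> \<open>Either nonzero side yields the index: a member of J is the given first hit
          by uniqueness, and F s' h \<noteq> 0 bounds the time, which places the first hit among the
          indices.\<close>
        case nontriv: False
        have "\<exists>y. (n, (x, y)) \<in> J"
        proof (cases "J = {}")
          case False
          then obtain q2 p2 where J2: "(q2, p2) \<in> J" by auto
          have "Complex (real_of_int (int q2)) (of_int (fst p2 + k * int q2)) = Complex (of_int q) (of_int a)"
            using J2 fh first_hit_unique unfolding J_def by blast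
          hence "real_of_int (int q2) = of_int q" "real_of_int (fst p2 + k * int q2) = of_int a"
            by (simp_all only: complex.inject)
          hence "int q2 = q" "fst p2 + k * int q2 = a" by (simp_all only: of_int_eq_iff)
          hence "q2 = n" "fst p2 = x" using qn by (auto simp: x_def)
          thus ?thesis using J2 by (metis prod.collapse)
        next
          case True
          hence "F s' h \<noteq> 0" using nontriv by simp
          hence s'_in: "s0 \<le> s'" "s' \<le> S0" using F(4) by auto
          have sl: "s0 / 2 < s" "s < S0 + 1" using ss s'_in by linarith+
          have \<sigma>1: "1 \<le> \<sigma> \<tau>" "\<sigma> \<tau> \<le> 1 + T" "0 < \<sigma> \<tau>"
            using sqrt_slope_bounds[of t] tT unfolding \<sigma>\<tau> by linarith+
          have rn: "r * real n * 1 \<le> r * real n * \<sigma> \<tau>" using \<sigma>1 elim by (intro mult_left_mono) auto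
          have "s = 2 * (r * real n * \<sigma> \<tau>)" by (simp add: s_def)
          moreover have "0 \<le> r * real n" using elim by simp
          ultimately have "r * real n \<le> S0 + 1" using rn sl(2) by linarith
          hence "real n \<le> (S0 + 1) / r" using elim by (simp add: field_simps)
          hence nle: "n \<le> nat \<lfloor>(S0 + 1) / r\<rfloor>" by (simp add: le_nat_floor)
          have "s0 / 2 < 2 * (r * real n) * (1 + T)"
          proof -
            have "2 * (r * real n) * \<sigma> \<tau> \<le> 2 * (r * real n) * (1 + T)" using \<sigma>1 elim by (intro mult_left_mono) auto
            thus ?thesis using sl(1) by (simp add: s_def)
          qed
          hence "s0 < 4 * r * (1 + T) * real n" by (simp add: algebra_simps)
          hence "s0 * \<delta> < (4 * r * (1 + T) * real n) * \<delta>" using \<delta> by (rule mult_strict_right_mono)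
          also have "\<dots> = (4 * r * (1 + T)) * (real n * \<delta>)" by simp
          also have "\<dots> \<le> (s0 * \<delta>) * (real n * \<delta>)" using elim \<delta> by (intro mult_right_mono) auto
          finally have n\<delta>: "1 < real n * \<delta>" using F(2) \<delta> by simp
          have "\<bar>(real n * \<tau> - of_int x) / r / \<sigma> \<tau>\<bar> \<le> 2" using hle h' unfolding h_def by linarith
          hence "\<bar>real n * \<tau> - of_int x\<bar> \<le> 2 * r * \<sigma> \<tau>"
            using elim \<sigma>1 by (simp add: abs_divide divide_le_eq mult_ac)
          \<comment> \<open>As n \<delta> > 1 and \<tau> keeps distance \<delta> from 0 and 1, an
            integer within 1 of n \<tau> lies strictly between 0 and n.\<close>
          hence close: "\<bar>real n * \<tau> - of_int x\<bar> < 1" using r_small(2) unfolding \<sigma>\<tau> by linarith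
          have "real n * \<delta> \<le> real n * \<tau>" "real n * \<tau> \<le> real n * (1 - \<delta>)" using \<tau> by (intro mult_left_mono; simp)+
          hence "0 < real_of_int x" "real_of_int x < real n"
            using close n\<delta> by (auto simp: algebra_simps abs_less_iff)
          hence x: "0 < x" "x < int n" by linarith+
          have "coprime q a" by (rule first_hit_primitive[OF fh])
          hence "coprime (int n) x"
            unfolding a qn by (simp add: coprime_iff_gcd_eq_1 add.commute[of x] gcd_add_mult)
          then obtain y0 where y0: "[x * y0 = 1] (mod int n)" using cong_solve_coprime_int[of x "int n"] by (auto simp: coprime_commute)
          define y where "y = (- y0) mod int n"
          have "[x * y + 1 = x * (- y0) + 1] (mod int n)"
            unfolding y_def by (intro cong_add cong_mult cong_refl) (simp add: cong_def)
          also have "x * (- y0) + 1 = 1 - x * y0" by simp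
          also have "[1 - x * y0 = 1 - 1] (mod int n)" by (intro cong_diff cong_refl y0)
          finally have ydvd: "int n dvd x * y + 1" by (simp add: cong_0_iff)
          have yU: "(x, y) \<in> unit_pairs n" using ydvd x by (auto simp: unit_pairs_def y_def)
          have "y \<noteq> 0"
          proof
            assume "y = 0"
            hence "int n dvd 1" using ydvd by simp
            thus False using x by simp
          qed
          hence "0 < y" using yU by (auto simp: unit_pairs_def)
          moreover have "first_hit (Complex (real_of_int (int n)) (of_int (x + k * int n)))" using fh unfolding qn a .
          ultimately have "(n, (x, y)) \<in> J" using yU nle x by (auto simp: J_def)
          thus ?thesis ..
        qed
        then obtain y where "(n, (x, y)) \<in> J" ..
        hence "J = {(n, (x, y))}" using uniq by blast
        hence "S = F s h" by (simp add: S s_def h_def)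
        thus ?thesis using d(2)[OF hle ss(1)] by simp
      qed
      thus "\<bar>\<Phi> (transfer_map r h' (slope_direction (\<tau> + of_int k))) -
        (\<Sum>q=1..nat \<lfloor>(S0 + 1) / r\<rfloor>. \<Sum>p\<in>unit_pairs q. hit_term F h' \<sigma> r \<tau> q p)\<bar> \<le> e"
        unfolding S_def[symmetric] t_def[symmetric] \<Phi>F .
    qed
  qed
qed

section \<open>Exceptional directions and measurability\<close>

text \<open>The hits up to p lie in a bounded piece of the strip, so there are finitely many and one
  is nearest.\<close>

lemma (in flight) first_hit_exists:
  assumes "hits p"
  shows "\<exists>p. first_hit p"
proof -
  define S where "S = {k. hits k \<and> along k \<le> along p}"
  define N where "N = nat \<lceil>along p + 1\<rceil>"
  have N: "along p + 1 \<le> real N" unfolding N_def by (rule real_nat_ceiling_ge)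
  have "S \<subseteq> (\<lambda>(m, n). Complex (of_int m) (of_int n)) ` ({- int N..int N} \<times> {- int N..int N})"
  proof
    fix k assume k: "k \<in> S"
    then obtain m n :: int where mn: "k = Complex (of_int m) (of_int n)"
      by (auto simp: S_def hits_def elim: plane_latticeE)
    have "norm k = norm (k * cnj \<omega>)" by (simp add: norm_mult_cnj_\<omega>)
    also have "\<dots> \<le> \<bar>Re (k * cnj \<omega>)\<bar> + \<bar>Im (k * cnj \<omega>)\<bar>" by (rule cmod_le)
    also have "\<bar>Re (k * cnj \<omega>)\<bar> \<le> along p" using k by (auto simp: S_def hits_def along_def)
    also have "\<bar>Im (k * cnj \<omega>)\<bar> \<le> 1"
    proof -
      have "Im (k * cnj \<omega>) = r * (h' - offset k)" unfolding right_diff_distrib r_offset by simp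
      also have "\<bar>\<dots>\<bar> \<le> r * 2"
        unfolding abs_mult using r h' k by (intro mult_mono) (auto simp: S_def hits_def)
      finally show ?thesis using r by simp
    qed
    finally have "norm k \<le> real N" using N by simp
    hence "\<bar>real_of_int m\<bar> \<le> real N" "\<bar>real_of_int n\<bar> \<le> real N"
      using abs_Re_le_cmod[of k] abs_Im_le_cmod[of k] by (auto simp: mn)
    hence "m \<in> {- int N..int N}" "n \<in> {- int N..int N}" by (auto simp: abs_le_iff)
    thus "k \<in> (\<lambda>(m, n). Complex (of_int m) (of_int n)) ` ({- int N..int N} \<times> {- int N..int N})"
      unfolding mn by auto
  qed
  hence fin: "finite S" by (rule finite_subset) auto
  have "p \<in> S" using assms by (simp add: S_def)
  define q where "q = arg_min_on along S"
  have q: "q \<in> S" "\<And>k. k \<in> S \<Longrightarrow> along q \<le> along k"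
    unfolding q_def using fin \<open>p \<in> S\<close> by (auto intro: arg_min_if_finite arg_min_least)
  have "first_hit q"
    unfolding first_hit_def
  proof (intro conjI allI impI)
    fix k assume "hits k"
    show "along q \<le> along k"
    proof (cases "k \<in> S")
      case False
      hence "along p \<le> along k" using \<open>hits k\<close> by (simp add: S_def)
      thus ?thesis using q(1) by (simp add: S_def)
    qed (rule q(2))
  qed (use q in \<open>simp add: S_def\<close>)
  thus ?thesis ..
qed

text \<open>The multiples of an irrational slope are dense modulo 1, so some lattice point comes
  within r / \<rho> of the centre \<beta> of the strip, measured along its column.\<close>

lemma (in flight) hit_exists_irrational:
  assumes "Re \<omega> \<noteq> 0" "Im \<omega> / Re \<omega> \<notin> \<rat>"
  shows "\<exists>p. first_hit p"
proof -
  define \<rho> t where "\<rho> = \<bar>Re \<omega>\<bar>" and "t = Im \<omega> / Re \<omega>"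
  \<comment> \<open>Multiplying the lattice point by the sign of Re \<omega> makes it lie ahead of
    the particle for leftward directions as well.\<close>
  define sg :: int where "sg = (if Re \<omega> > 0 then 1 else -1)"
  have sg: "real_of_int sg * Re \<omega> = \<rho>" "real_of_int sg * Im \<omega> = \<rho> * t" "\<rho> > 0"
    using assms(1) by (auto simp: sg_def \<rho>_def t_def field_simps)
  \<comment> \<open>Density is applied to M t instead of t, so the column m is a positive multiple
    of M; with |X t| < M this makes \<open>along\<close> positive.\<close>
  define M where "M = nat \<lceil>2 * r * \<bar>t\<bar> / \<rho>\<rceil> + 1"
  have M: "real M > 2 * r * \<bar>t\<bar> / \<rho>" "M > 0" unfolding M_def by linarith+
  have irr: "real M * t \<notin> \<rat>"
  proof
    assume "real M * t \<in> \<rat>"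
    hence "real M * t / real M \<in> \<rat>" by (intro Rats_divide) auto
    thus False using M(2) assms(2) by (simp add: t_def)
  qed
  define \<beta> where "\<beta> = h' * r / \<rho>"
  have "r / \<rho> > 0" using r sg(3) by simp
  then obtain a k :: int where ak: "k > 0" "\<bar>of_int k * (real M * t) - of_int a - (- \<beta>)\<bar> < r / \<rho>"
    using sequence_of_fractional_parts_is_dense[OF irr] by metis
  define m where "m = k * int M"
  have m: "m \<ge> int M" using ak(1) M(2) by (simp add: m_def)
  have mr: "real_of_int m \<ge> real M" using m by linarith
  define X where "X = of_int a - of_int m * t"
  have X: "\<bar>X - \<beta>\<bar> < r / \<rho>" using ak(2) by (simp add: X_def m_def abs_minus_commute algebra_simps)
  define p where "p = Complex (of_int (sg * m)) (of_int (sg * a))"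
  have im: "Im (p * cnj \<omega>) = \<rho> * X"
  proof -
    have "Im (p * cnj \<omega>) = of_int a * (of_int sg * Re \<omega>) - of_int m * (of_int sg * Im \<omega>)"
      by (simp add: p_def algebra_simps)
    thus ?thesis unfolding sg by (simp add: X_def algebra_simps)
  qed
  have re: "Re (p * cnj \<omega>) = \<rho> * (of_int m * (1 + t * t) + X * t)"
  proof -
    have "Re (p * cnj \<omega>) = of_int m * (of_int sg * Re \<omega>) + of_int a * (of_int sg * Im \<omega>)"
      by (simp add: p_def algebra_simps)
    thus ?thesis unfolding sg by (simp add: X_def algebra_simps)
  qed
  have "offset p = - (\<rho> / r) * (X - \<beta>)" unfolding offset_def im \<beta>_def using r sg(3) by (simp add: field_simps)
  hence "\<bar>offset p\<bar> = \<rho> / r * \<bar>X - \<beta>\<bar>" using r sg(3) by (simp add: abs_mult)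
  also have "\<dots> \<le> \<rho> / r * (r / \<rho>)" using X r sg(3) by (intro mult_left_mono) auto
  finally have off: "\<bar>offset p\<bar> \<le> 1" using r sg(3) by simp
  have "\<bar>\<beta>\<bar> \<le> r / \<rho>"
    using h' r sg(3) by (simp add: \<beta>_def abs_mult divide_right_mono mult_left_le_one_le)
  hence "\<bar>X\<bar> \<le> 2 * r / \<rho>" using X by linarith
  hence "\<bar>X\<bar> * \<bar>t\<bar> \<le> (2 * r / \<rho>) * \<bar>t\<bar>" by (intro mult_right_mono) auto
  hence "\<bar>X * t\<bar> < real M" using M(1) by (simp add: abs_mult)
  moreover have "real M * 1 \<le> of_int m * (1 + t * t)" using mr by (intro mult_mono) auto
  ultimately have "of_int m * (1 + t * t) + X * t > 0" by linarith
  hence "along p > 0" unfolding along_def re using sg(3) by simp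
  moreover have "p \<in> plane_lattice" by (simp add: p_def plane_lattice_def)
  ultimately have "hits p" using off by (simp add: hits_def)
  thus ?thesis by (rule first_hit_exists)
qed

lemma Re_Im_slope_direction: "Re (slope_direction t) = 1 / sqrt (1 + t\<^sup>2)" "Im (slope_direction t) = t / sqrt (1 + t\<^sup>2)"
  by (simp_all add: slope_direction_def)

lemma unit_vector_slope:
  assumes "norm \<omega> = 1" "Re \<omega> \<noteq> 0"
  shows "\<omega> = slope_direction (Im \<omega> / Re \<omega>) \<or> \<omega> = - slope_direction (Im \<omega> / Re \<omega>)"
proof -
  define t where "t = Im \<omega> / Re \<omega>"
  have "(Re \<omega>)\<^sup>2 + (Im \<omega>)\<^sup>2 = 1" using assms(1) by (metis cmod_power2 power_one)
  hence "(Re \<omega>)\<^sup>2 * (1 + t\<^sup>2) = 1" using assms(2) by (simp add: t_def field_simps power2_eq_square)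
  hence "(Re \<omega> * sqrt (1 + t\<^sup>2))\<^sup>2 = 1" by (simp add: power_mult_distrib)
  hence "Re \<omega> * sqrt (1 + t\<^sup>2) = 1 \<or> Re \<omega> * sqrt (1 + t\<^sup>2) = -1" by (simp add: power2_eq_1_iff)
  moreover have "sqrt (1 + t\<^sup>2) > 0" using sqrt_slope_bounds(1)[of t] by linarith
  moreover have "Im \<omega> = t * Re \<omega>" using assms(2) by (simp add: t_def)
  ultimately have "\<omega> = slope_direction t \<or> \<omega> = - slope_direction t"
    by (auto simp: complex_eq_iff Re_Im_slope_direction field_simps)
  thus ?thesis by (simp add: t_def)
qed

definition exceptional_directions :: "complex set" where
  "exceptional_directions = {\<omega>. norm \<omega> = 1 \<and> (Re \<omega> = 0 \<or> Im \<omega> / Re \<omega> \<in> \<rat>)}"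

lemma countable_exceptional_directions: "countable exceptional_directions"
proof (rule countable_subset)
  show "exceptional_directions \<subseteq> {\<i>, - \<i>} \<union> (slope_direction ` \<rat> \<union> (\<lambda>t. - slope_direction t) ` \<rat>)"
  proof
    fix \<omega> assume w: "\<omega> \<in> exceptional_directions"
    show "\<omega> \<in> {\<i>, - \<i>} \<union> (slope_direction ` \<rat> \<union> (\<lambda>t. - slope_direction t) ` \<rat>)"
    proof (cases "Re \<omega> = 0")
      case True
      hence "\<bar>Im \<omega>\<bar> = 1" using w by (auto simp: exceptional_directions_def cmod_def power2_eq_1_iff)
      thus ?thesis using True by (auto simp: complex_eq_iff abs_if split: if_splits)
    next
      case False
      thus ?thesis using unit_vector_slope[of \<omega>] w by (auto simp: exceptional_directions_def)
    qed
  qed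
qed (auto intro: countable_rat)

lemma first_hit_exists_direction:
  assumes "0 < r" "r < 1 / 2" "\<bar>h'\<bar> \<le> 1" "norm \<omega> = 1" "\<omega> \<notin> exceptional_directions"
  shows "\<exists>p. flight.first_hit r h' \<omega> p"
proof -
  interpret flight r h' \<omega> by unfold_locales (use assms in auto)
  show ?thesis using assms by (intro hit_exists_irrational) (auto simp: exceptional_directions_def)
qed

text \<open>Central symmetry of the lattice, p to -p. Up to countably many directions the transfer
  map thus depends on the slope only.\<close>

lemma transfer_map_minus:
  assumes "0 < r" "r < 1 / 2" "\<bar>h'\<bar> \<le> 1" "norm \<omega> = 1" "\<omega> \<notin> exceptional_directions"
  shows "transfer_map r h' (- \<omega>) = transfer_map r h' \<omega>"
proof -
  interpret A: flight r h' \<omega> by unfold_locales (use assms in auto)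
  interpret B: flight r h' "- \<omega>" by unfold_locales (use assms in auto)
  obtain p where p: "A.first_hit p" using first_hit_exists_direction[OF assms] by blast
  have al: "B.along (- k) = A.along k" "B.offset (- k) = A.offset k" for k
    by (simp_all add: A.along_def B.along_def A.offset_def B.offset_def)
  have lat: "- k \<in> plane_lattice \<longleftrightarrow> k \<in> plane_lattice" for k by (auto simp: plane_lattice_def)
  have hits: "B.hits (- k) = A.hits k" for k by (simp add: A.hits_def B.hits_def al lat)
  have "B.first_hit (- p)"
    unfolding B.first_hit_def
  proof (intro conjI allI impI)
    show "B.hits (- p)" using p by (simp add: hits A.first_hit_def)
    fix k assume "B.hits k"
    hence "A.hits (- k)" using hits[of "- k"] by simp
    hence "A.along p \<le> A.along (- k)" using p by (simp add: A.first_hit_def)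
    thus "B.along (- p) \<le> B.along k" using al(1)[of p] al(1)[of "- k"] by simp
  qed
  moreover have "B.entry (- p) = A.entry p" by (simp add: A.entry_def B.entry_def al)
  ultimately show ?thesis
    using A.transfer_map_first_hit[OF p] B.transfer_map_first_hit[of "- p"] by (simp add: al)
qed

text \<open>Directions whose first hit is a given lattice point form a Borel set, described by
  countably many inequalities, and on it the transfer map is explicit. These sets cover the circle
  up to countably many points.\<close>

lemma transfer_map_measurable:
  assumes \<Phi>: "\<Phi> \<in> Cc ({0<..} \<times> {-1..1::real})" and r: "0 < r" "r < 1 / 2" and h': "\<bar>h'\<bar> \<le> 1"
  shows "(\<lambda>\<omega>. \<Phi> (transfer_map r h' \<omega>)) \<in> borel_measurable (restrict_space borel (sphere 0 1))"
proof -
  obtain F :: "real \<Rightarrow> real \<Rightarrow> real" and s0 S0 b where F: "continuous_on UNIV (\<lambda>(s, h). F s h)"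
    "\<And>s h. \<bar>h\<bar> \<le> 1 \<Longrightarrow> F s h = \<Phi> (s, h)"
    using Cc_extension[OF \<Phi>] by metis
  have [measurable]: "(\<lambda>(s, h). F s h) \<in> borel_measurable (borel \<Otimes>\<^sub>M borel)"
    using borel_measurable_continuous_onI[OF F(1)] by (simp add: borel_prod)
  define al where "al p \<omega> = Re p * Re \<omega> + Im p * Im \<omega>" for p \<omega>
  define off where "off p \<omega> = h' - (Im p * Re \<omega> - Re p * Im \<omega>) / r" for p \<omega>
  define hit where "hit p \<omega> \<longleftrightarrow> al p \<omega> > 0 \<and> \<bar>off p \<omega>\<bar> \<le> 1" for p \<omega>
  define L where "L = (\<lambda>(m :: int, n :: int). Complex (of_int m) (of_int n))"
  define fst_hit where "fst_hit p \<omega> \<longleftrightarrow> hit p \<omega> \<and> (\<forall>k. hit (L k) \<omega> \<longrightarrow> al p \<omega> \<le> al (L k) \<omega>)" for p \<omega>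
  define W where "W k = {\<omega>. fst_hit (L k) \<omega>}" for k
  have [measurable]: "al p \<in> borel_measurable borel" "off p \<in> borel_measurable borel" for p
    unfolding al_def off_def by measurable
  have [measurable]: "Measurable.pred borel (hit p)" for p unfolding hit_def by measurable
  have [measurable]: "Measurable.pred borel (fst_hit p)" for p unfolding fst_hit_def by measurable
  have W [measurable]: "W k \<in> sets borel" for k unfolding W_def by measurable
  have L_lat: "plane_lattice = range L"
    by (auto simp: L_def plane_lattice_def image_iff elim: plane_latticeE)
       (metis complex_surj Ints_cases)
  have fh: "flight.first_hit r h' \<omega> p \<longleftrightarrow> p \<in> plane_lattice \<and> fst_hit p \<omega>" if "norm \<omega> = 1" for p \<omega>
  proof -
    interpret flight r h' \<omega> by unfold_locales (use r h' that in auto)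
    have "along k = al k \<omega>" "offset k = off k \<omega>" for k
      by (simp_all add: along_def al_def offset_def off_def algebra_simps)
    thus ?thesis
      by (auto simp: first_hit_def hits_def fst_hit_def hit_def L_lat)
  qed
  define E where "E = exceptional_directions"
  \<comment> \<open>Directions without a first hit get the value 0; they are exceptional, and
    altering a function on a countable set keeps it measurable.\<close>
  define f where "f \<omega> = (if \<exists>k. \<omega> \<in> W k then \<Phi> (transfer_map r h' \<omega>) else 0)" for \<omega>
  define M where "M = restrict_space borel (sphere (0 :: complex) 1)"
  have spM: "space M = sphere 0 1" by (simp add: M_def space_restrict_space)
  define U where "U = (\<Union>k. W k)"
  have U [measurable]: "U \<in> sets borel" unfolding U_def by measurable
  have "f \<in> borel_measurable M"
  proof (rule measurable_piecewise_restrict[where C = "insert (- U) (range W)"])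
    show "countable (insert (- U) (range W))" by simp
    show "space M \<subseteq> \<Union> (insert (- U) (range W))" by (auto simp: U_def)
    fix V assume V: "V \<in> insert (- U) (range W)"
    have "V \<in> sets borel" using V U W by auto
    thus "V \<inter> space M \<in> sets M" unfolding M_def sets_restrict_space space_restrict_space by auto
    show "f \<in> borel_measurable (restrict_space M V)"
    proof (cases "V = - U")
      case True
      have "f \<omega> = 0" if "\<omega> \<in> space (restrict_space M V)" for \<omega>
        using that True by (auto simp: space_restrict_space f_def U_def)
      thus ?thesis by (subst measurable_cong[of _ _ "\<lambda>_. 0"]) auto
    next
      case False
      then obtain k where k: "V = W k" using V by auto
      define p where "p = L k"
      define g where "g \<omega> = F (2 * r * (al p \<omega> - r * sqrt (1 - h'\<^sup>2) - r * sqrt (1 - (off p \<omega>)\<^sup>2))) (off p \<omega>)" for \<omega>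
      have "f \<omega> = g \<omega>" if "\<omega> \<in> space (restrict_space M V)" for \<omega>
      proof -
        have w: "norm \<omega> = 1" "\<omega> \<in> W k" using that by (auto simp: space_restrict_space spM k)
        interpret flight r h' \<omega> by unfold_locales (use r h' w in auto)
        have p: "first_hit p" using fh[OF w(1)] w(2) by (auto simp: W_def p_def L_lat)
        have ao: "along p = al p \<omega>" "offset p = off p \<omega>"
          by (simp_all add: along_def al_def offset_def off_def algebra_simps)
        have "\<bar>off p \<omega>\<bar> \<le> 1" using p by (simp add: first_hit_def hits_def ao)
        moreover have "f \<omega> = \<Phi> (transfer_map r h' \<omega>)" unfolding f_def using w(2) by (intro if_P exI)
        ultimately show ?thesis using transfer_map_first_hit[OF p] F(2) by (simp add: g_def entry_def ao)
      qed
      moreover have "g \<in> borel_measurable borel" unfolding g_def by measurable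
      hence "g \<in> borel_measurable (restrict_space M V)"
        unfolding M_def by (intro measurable_restrict_space1)
      ultimately show ?thesis by (subst measurable_cong[of _ _ g]) auto
    qed
  qed
  hence "(\<lambda>\<omega>. \<Phi> (transfer_map r h' \<omega>)) \<in> borel_measurable M"
  proof (rule measurable_discrete_difference)
    show "countable (E \<inter> sphere 0 1)" using countable_exceptional_directions by (simp add: E_def countable_Int1)
    show "{\<omega>} \<in> sets M" if "\<omega> \<in> E \<inter> sphere 0 1" for \<omega>
      using that unfolding M_def sets_restrict_space by (auto intro!: image_eqI[of _ _ "{\<omega>}"])
    fix \<omega> assume w: "\<omega> \<in> space M" "\<omega> \<notin> E \<inter> sphere 0 1"
    hence n: "norm \<omega> = 1" "\<omega> \<notin> exceptional_directions" by (auto simp: spM E_def)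
    obtain p where "flight.first_hit r h' \<omega> p" using first_hit_exists_direction[OF r h' n] by blast
    hence "p \<in> plane_lattice" "fst_hit p \<omega>" using fh[OF n(1)] by auto
    hence "\<exists>k. \<omega> \<in> W k" by (auto simp: L_lat W_def)
    thus "f \<omega> = \<Phi> (transfer_map r h' \<omega>)" by (simp add: f_def)
  qed simp
  thus ?thesis by (simp add: M_def)
qed

section \<open>The transfer map as a function of the slope\<close>

lemma slope_direction_measurable: "slope_direction \<in> measurable borel (restrict_space borel (sphere 0 1))"
proof (rule measurable_restrict_space2)
  have "continuous_on UNIV slope_direction"
    unfolding slope_direction_def
    by (intro continuous_intros continuous_on_Complex) (auto simp: add_nonneg_eq_0_iff)
  thus "slope_direction \<in> borel_measurable borel" by (rule borel_measurable_continuous_onI)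
qed (auto simp: norm_slope_direction)

lemma transfer_map_slope_measurable:
  assumes "\<Phi> \<in> Cc ({0<..} \<times> {-1..1::real})" "0 < r" "r < 1 / 2" "\<bar>h'\<bar> \<le> 1"
  shows "(\<lambda>t. \<Phi> (transfer_map r h' (slope_direction t))) \<in> borel_measurable borel"
  using measurable_compose[OF slope_direction_measurable transfer_map_measurable[OF assms]] .

lemma slope_direction_exceptional: "t \<notin> \<rat> \<Longrightarrow> slope_direction t \<notin> exceptional_directions"
proof -
  have "sqrt (1 + t\<^sup>2) > 0" using sqrt_slope_bounds(1)[of t] by linarith
  thus "t \<notin> \<rat> \<Longrightarrow> slope_direction t \<notin> exceptional_directions"
    by (auto simp: exceptional_directions_def Re_Im_slope_direction)
qed

section \<open>Weak-star convergence on the circle\<close>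

locale averaging =
  fixes f :: "real \<Rightarrow> real \<Rightarrow> real" and c b :: real
  assumes eventually_measurable: "\<forall>\<^sub>F r in at_right 0. f r \<in> borel_measurable borel"
    and f_bound: "\<bar>f r x\<bar> \<le> b"
begin

text \<open>The integrable test functions on which the weak limit is already known. Starting from
  continuous functions supported between consecutive integers, this class is enlarged step by step
  to all of L^1.\<close>

definition averages :: "(real \<Rightarrow> real) \<Rightarrow> bool" where
  "averages g \<longleftrightarrow> integrable lborel g \<and>
     ((\<lambda>r. LINT x|lborel. f r x * g x) \<longlongrightarrow> c * (LINT x|lborel. g x)) (at_right 0)"

lemma b_nonneg: "0 \<le> b" using f_bound[of 0 0] by linarith

lemma integrable_f_mult:
  assumes "integrable lborel g" "f r \<in> borel_measurable borel"
  shows "integrable lborel (\<lambda>x. f r x * g x)"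
proof (rule Bochner_Integration.integrable_bound)
  show "integrable lborel (\<lambda>x. b * g x)" using assms by simp
  show "(\<lambda>x. f r x * g x) \<in> borel_measurable lborel" using assms by auto
  show "AE x in lborel. norm (f r x * g x) \<le> norm (b * g x)"
    using f_bound b_nonneg by (auto simp: abs_mult intro!: mult_right_mono)
qed

lemma averages_integrable: "averages g \<Longrightarrow> integrable lborel g"
  by (simp add: averages_def)

lemma averages_add:
  assumes "averages g1" "averages g2"
  shows "averages (\<lambda>x. g1 x + g2 x)"
proof -
  have "((\<lambda>r. (LINT x|lborel. f r x * g1 x) + (LINT x|lborel. f r x * g2 x)) \<longlongrightarrow>
      c * (LINT x|lborel. g1 x) + c * (LINT x|lborel. g2 x)) (at_right 0)"
    using assms by (intro tendsto_add) (auto simp: averages_def)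
  also have "c * (LINT x|lborel. g1 x) + c * (LINT x|lborel. g2 x) = c * (LINT x|lborel. g1 x + g2 x)"
    using assms by (simp add: averages_def distrib_left)
  finally have "((\<lambda>r. LINT x|lborel. f r x * (g1 x + g2 x)) \<longlongrightarrow> c * (LINT x|lborel. g1 x + g2 x)) (at_right 0)"
  proof (rule Lim_transform_eventually)
    show "\<forall>\<^sub>F r in at_right 0. (LINT x|lborel. f r x * g1 x) + (LINT x|lborel. f r x * g2 x) = (LINT x|lborel. f r x * (g1 x + g2 x))"
      using eventually_measurable
      by eventually_elim (use assms in \<open>simp add: averages_def distrib_left integrable_f_mult\<close>)
  qed
  thus ?thesis using assms by (simp add: averages_def)
qed

lemma averages_scale:
  assumes "averages g"
  shows "averages (\<lambda>x. a * g x)"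
proof -
  have "((\<lambda>r. a * (LINT x|lborel. f r x * g x)) \<longlongrightarrow> a * (c * (LINT x|lborel. g x))) (at_right 0)"
    using assms by (intro tendsto_intros) (auto simp: averages_def)
  thus ?thesis using assms by (simp add: averages_def mult.left_commute)
qed

text \<open>Since f is bounded by b, replacing G by g n changes the integrals for all r at once by
  at most b times the L^1 distance, and the limit by at most |c| times it.\<close>

lemma averages_dominated:
  assumes g: "\<And>n::nat. averages (g n)" and w: "integrable lborel w" and G: "G \<in> borel_measurable borel"
    and lim: "AE x in lborel. (\<lambda>n. g n x) \<longlonglongrightarrow> G x" and dom: "\<And>n. AE x in lborel. \<bar>g n x\<bar> \<le> w x"
  shows "averages G"
proof -
  have gi: "integrable lborel (g n)" for n using g by (rule averages_integrable)
  have [measurable]: "g n \<in> borel_measurable borel" for n using gi[of n] by auto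
  have [measurable]: "w \<in> borel_measurable borel" "G \<in> borel_measurable borel" using w G by auto
  have Gi: "integrable lborel G"
    by (rule integrable_dominated_convergence[OF _ _ w lim]) (use dom in auto)
  have Gw: "AE x in lborel. \<bar>G x\<bar> \<le> w x"
  proof -
    have "AE x in lborel. \<forall>n. \<bar>g n x\<bar> \<le> w x" using dom by (simp add: AE_all_countable)
    with lim show ?thesis
    proof eventually_elim
      case (elim x)
      have "(\<lambda>n. \<bar>g n x\<bar>) \<longlonglongrightarrow> \<bar>G x\<bar>" using elim by (intro tendsto_intros)
      thus ?case using elim by (intro LIMSEQ_le_const2) auto
    qed
  qed
  have "(\<lambda>n. LINT x|lborel. \<bar>G x - g n x\<bar>) \<longlonglongrightarrow> (LINT x|(lborel :: real measure). (0 :: real))"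
  proof (rule integral_dominated_convergence[where w = "\<lambda>x. 2 * w x" and f = "\<lambda>_. 0"])
    show "AE x in lborel. (\<lambda>n. \<bar>G x - g n x\<bar>) \<longlonglongrightarrow> 0"
      using lim
    proof eventually_elim
      case (elim x)
      have "(\<lambda>n. \<bar>G x - g n x\<bar>) \<longlonglongrightarrow> \<bar>G x - G x\<bar>" using elim by (intro tendsto_intros)
      thus ?case by simp
    qed
    show "AE x in lborel. norm \<bar>G x - g n x\<bar> \<le> 2 * w x" for n
      using dom[of n] Gw by eventually_elim auto
  qed (use w in auto)
  hence dist0: "(\<lambda>n. (b + \<bar>c\<bar>) * (LINT x|lborel. \<bar>G x - g n x\<bar>)) \<longlonglongrightarrow> 0"
    by (intro tendsto_mult_right_zero) simp
  have "((\<lambda>r. LINT x|lborel. f r x * G x) \<longlongrightarrow> c * (LINT x|lborel. G x)) (at_right 0)"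
  proof (rule tendsto_approxI)
    fix e :: real assume "e > 0"
    hence "\<forall>\<^sub>F n in sequentially. (b + \<bar>c\<bar>) * (LINT x|lborel. \<bar>G x - g n x\<bar>) < e"
      using dist0 by (rule order_tendstoD(2)[rotated])
    then obtain n where n: "(b + \<bar>c\<bar>) * (LINT x|lborel. \<bar>G x - g n x\<bar>) < e"
      by (auto simp: eventually_sequentially)
    define d where "d = (LINT x|lborel. \<bar>G x - g n x\<bar>)"
    have d0: "d \<ge> 0" unfolding d_def by (intro integral_nonneg_AE) auto
    have "b * d \<le> (b + \<bar>c\<bar>) * d" "\<bar>c\<bar> * d \<le> (b + \<bar>c\<bar>) * d"
      using d0 b_nonneg by (auto intro!: mult_right_mono)
    hence bd: "b * d \<le> e" "\<bar>c\<bar> * d \<le> e" using n unfolding d_def by linarith+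
    show "\<exists>h l. (h \<longlongrightarrow> l) (at_right 0) \<and> (\<forall>\<^sub>F r in at_right 0. norm ((LINT x|lborel. f r x * G x) - h r) \<le> e) \<and>
        norm (c * (LINT x|lborel. G x) - l) \<le> e"
    proof (intro exI conjI)
      show "((\<lambda>r. LINT x|lborel. f r x * g n x) \<longlongrightarrow> c * (LINT x|lborel. g n x)) (at_right 0)"
        using g[of n] by (simp add: averages_def)
      show "\<forall>\<^sub>F r in at_right 0. norm ((LINT x|lborel. f r x * G x) - (LINT x|lborel. f r x * g n x)) \<le> e"
        using eventually_measurable
      proof eventually_elim
        case (elim r)
        have "(LINT x|lborel. f r x * G x) - (LINT x|lborel. f r x * g n x) = (LINT x|lborel. f r x * (G x - g n x))"
          using integrable_f_mult[OF Gi elim] integrable_f_mult[OF gi elim] by (simp add: right_diff_distrib)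
        also have "norm \<dots> \<le> (LINT x|lborel. b * \<bar>G x - g n x\<bar>)"
        proof (rule Bochner_Integration.integral_norm_bound_integral)
          show "integrable lborel (\<lambda>x. f r x * (G x - g n x))" using Gi gi by (intro integrable_f_mult elim) auto
        qed (use Gi gi f_bound in \<open>auto simp: abs_mult intro!: mult_right_mono\<close>)
        also have "\<dots> = b * d" by (simp add: d_def)
        finally show ?case using bd by simp
      qed
      have "c * (LINT x|lborel. G x) - c * (LINT x|lborel. g n x) = c * (LINT x|lborel. G x - g n x)"
        using Gi gi by (simp add: right_diff_distrib)
      also have "norm \<dots> \<le> \<bar>c\<bar> * d"
        unfolding real_norm_def abs_mult d_def by (intro mult_left_mono integral_abs_bound) auto
      finally show "norm (c * (LINT x|lborel. G x) - c * (LINT x|lborel. g n x)) \<le> e" using bd by simp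
    qed
  qed
  thus ?thesis using Gi by (simp add: averages_def)
qed

lemma averages_indicator_interval:
  assumes cont: "\<And>g \<delta>. continuous_on UNIV g \<Longrightarrow> 0 < \<delta> \<Longrightarrow>
      (\<And>x. g x \<noteq> 0 \<Longrightarrow> x \<in> {k + \<delta>..k + 1 - \<delta>}) \<Longrightarrow> averages g"
    and u: "k \<le> u" "u \<le> k + 1"
  shows "averages (indicator {k..u})"
proof (rule averages_dominated[where w = "indicator {k..u}"])
  \<comment> \<open>Trapezoids supported inside [k, u] at distance 1 / (n + 1) from its ends, as the
    assumption on continuous functions demands, with slopes n + 1.\<close>
  define g :: "nat \<Rightarrow> real \<Rightarrow> real" where
    "g n x = max 0 (min 1 (real (Suc n) * min (x - k - 1 / real (Suc n)) (u - 1 / real (Suc n) - x)))" for n x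
  have g0: "g n x = 0" if "x \<notin> {k + 1 / real (Suc n)..u - 1 / real (Suc n)}" for n x
  proof -
    have "min (x - k - 1 / real (Suc n)) (u - 1 / real (Suc n) - x) \<le> 0" using that by auto
    hence "real (Suc n) * min (x - k - 1 / real (Suc n)) (u - 1 / real (Suc n) - x) \<le> 0"
      by (intro mult_nonneg_nonpos) auto
    thus ?thesis by (simp add: g_def)
  qed
  show "averages (g n)" for n
  proof (rule cont)
    show "continuous_on UNIV (g n)" unfolding g_def by (intro continuous_intros)
    show "0 < 1 / real (Suc n)" by simp
    fix x assume "g n x \<noteq> 0"
    hence "x \<in> {k + 1 / real (Suc n)..u - 1 / real (Suc n)}" using g0 by blast
    thus "x \<in> {k + 1 / real (Suc n)..k + 1 - 1 / real (Suc n)}" using u by auto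
  qed
  show "integrable lborel (indicator {k..u} :: real \<Rightarrow> real)"
    by (intro integrable_real_indicator) (auto simp: emeasure_lborel_Icc_eq)
  have g_outside: "g n x = 0" if "x \<notin> {k..u}" for n x
  proof (rule g0)
    have "k \<le> k + 1 / real (Suc n)" "u - 1 / real (Suc n) \<le> u" by simp_all
    hence "{k + 1 / real (Suc n)..u - 1 / real (Suc n)} \<subseteq> {k..u}"
      by (intro iffD2[OF atLeastatMost_subset_iff] disjI2 conjI)
    thus "x \<notin> {k + 1 / real (Suc n)..u - 1 / real (Suc n)}" using that by blast
  qed
  have "g n x \<le> indicator {k..u} x \<and> 0 \<le> g n x" for n x
  proof (cases "x \<in> {k..u}")
    case False
    thus ?thesis by (simp add: g_outside)
  qed (auto simp: g_def)
  thus "AE x in lborel. \<bar>g n x\<bar> \<le> indicator {k..u} x" for n by (simp add: abs_of_nonneg)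
  have pt: "(\<lambda>n. g n x) \<longlonglongrightarrow> indicator {k..u} x" if "x \<noteq> k" "x \<noteq> u" for x
  proof (cases "x \<in> {k..u}")
    case True
    define m where "m = min (x - k) (u - x)"
    have m: "m > 0" using True that by (auto simp: m_def)
    obtain N where N: "real N * m \<ge> 2" using real_arch_simple[of "2 / m"] m by (auto simp: field_simps)
    have "g n x = 1" if "n \<ge> N" for n
    proof -
      have eq: "min (x - k - 1 / real (Suc n)) (u - 1 / real (Suc n) - x) = m - 1 / real (Suc n)"
        by (auto simp: m_def min_def)
      have "real N * m \<le> real (Suc n) * m" using that m by (intro mult_right_mono) auto
      moreover have "real (Suc n) * (m - 1 / real (Suc n)) = real (Suc n) * m - 1"
        by (simp add: right_diff_distrib del: of_nat_Suc)
      ultimately have "real (Suc n) * (m - 1 / real (Suc n)) \<ge> 1" using N by linarith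
      thus ?thesis unfolding g_def eq by (simp del: of_nat_Suc)
    qed
    hence "\<forall>\<^sub>F n in sequentially. g n x = indicator {k..u} x"
      using True by (auto simp: eventually_sequentially)
    thus ?thesis by (rule tendsto_eventually)
  next
    case False
    thus ?thesis by (simp add: g_outside)
  qed
  have "AE x in lborel. x \<noteq> k" "AE x in lborel. x \<noteq> u" by (rule AE_lborel_singleton)+
  thus "AE x in lborel. (\<lambda>n. g n x) \<longlonglongrightarrow> indicator {k..u} x"
    by eventually_elim (rule pt)
qed (auto simp: borel_measurable_indicator)

text \<open>Half-lines form an intersection-stable generator, so indicators of all Borel subsets of
  the interval follow by complements and disjoint unions; integrable functions follow by linearity
  and dominated limits.\<close>

lemma averages_unit_interval:
  assumes cont: "\<And>g \<delta>. continuous_on UNIV g \<Longrightarrow> 0 < \<delta> \<Longrightarrow>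
      (\<And>x. g x \<noteq> 0 \<Longrightarrow> x \<in> {k + \<delta>..k + 1 - \<delta>}) \<Longrightarrow> averages g"
    and g: "integrable lborel g"
  shows "averages (\<lambda>x. indicator {k..k + 1} x * g x)"
proof -
  have set: "averages (indicator (A \<inter> {k..k + 1}))" if "A \<in> sets borel" for A
  proof -
    have int: "integrable lborel (indicator {k..k + 1} :: real \<Rightarrow> real)"
      by (intro integrable_real_indicator) (auto simp: emeasure_lborel_Icc_eq)
    have whole: "averages (indicator {k..k + 1})" by (rule averages_indicator_interval[OF cont]) auto
    have zero: "averages (\<lambda>x. 0)" using averages_scale[OF whole, of 0] by simp
    have gen: "Int_stable (range (atMost :: real \<Rightarrow> real set))" "range (atMost :: real \<Rightarrow> real set) \<subseteq> Pow UNIV"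
      "A \<in> sigma_sets UNIV (range atMost)"
      using that by (auto simp: Int_stable_def borel_eq_atMost)
    show ?thesis
      using gen
    proof (induction rule: sigma_sets_induct_disjoint[where G = "range atMost" and \<Omega> = UNIV])
      case (basic A)
      then obtain u where A: "A = {..u}" by auto
      consider "u < k" | "k \<le> u" "u \<le> k + 1" | "u > k + 1" by linarith
      thus ?case
      proof cases
        case 1
        hence "A \<inter> {k..k + 1} = {}" by (auto simp: A)
        thus ?thesis using zero by (simp add: indicator_def)
      next
        case 2
        hence "A \<inter> {k..k + 1} = {k..u}" by (auto simp: A)
        thus ?thesis using averages_indicator_interval[OF cont] 2 by simp
      next
        case 3
        hence "A \<inter> {k..k + 1} = {k..k + 1}" by (auto simp: A)
        thus ?thesis using whole by simp
      qed
    next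
      case empty
      show ?case using zero by (simp add: indicator_def)
    next
      case (compl A)
      have "averages (\<lambda>x. indicator {k..k + 1} x + (- 1) * indicator (A \<inter> {k..k + 1}) x)"
        by (intro averages_add averages_scale whole compl)
      also have "(\<lambda>x. indicator {k..k + 1} x + (- 1) * indicator (A \<inter> {k..k + 1}) x) = (indicator ((UNIV - A) \<inter> {k..k + 1}) :: real \<Rightarrow> real)"
        by (auto simp: fun_eq_iff indicator_def)
      finally show ?case .
    next
      case (union A)
      have A: "A i \<in> sets borel" for i using union(2) by (auto simp: borel_eq_atMost)
      show ?case
      proof (rule averages_dominated[OF _ int])
        show "averages (\<lambda>x. \<Sum>i<n. indicator (A i \<inter> {k..k + 1}) x)" for n
        proof (induction n)
          case (Suc n)
          show ?case using averages_add[OF Suc union(3)[of n]] by simp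
        qed (simp add: zero)
        show "indicator (\<Union> (range A) \<inter> {k..k + 1}) \<in> borel_measurable borel"
          using A by (intro borel_measurable_indicator) auto
        have disj: "disjoint_family (\<lambda>i. A i \<inter> {k..k + 1})"
          using union(1) by (auto simp: disjoint_family_on_def)
        have un: "(\<Union>i. A i \<inter> {k..k + 1}) = \<Union> (range A) \<inter> {k..k + 1}" by auto
        have "(\<lambda>i. indicator (A i \<inter> {k..k + 1}) x :: real) sums indicator (\<Union> (range A) \<inter> {k..k + 1}) x" for x
          using indicator_sums[of "\<lambda>i. A i \<inter> {k..k + 1}" x] disj unfolding un by (auto simp: disjoint_family_on_def)
        thus "AE x in lborel. (\<lambda>n. \<Sum>i<n. indicator (A i \<inter> {k..k + 1}) x :: real) \<longlonglongrightarrow> indicator (\<Union> (range A) \<inter> {k..k + 1}) x"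
          by (simp add: sums_def)
        have "(\<Sum>i<n. indicator (A i \<inter> {k..k + 1}) x :: real) = indicator (\<Union>i<n. A i \<inter> {k..k + 1}) x" for n x
          using disj by (intro indicator_UN_disjoint[symmetric]) (auto simp: disjoint_family_on_def)
        thus "AE x in lborel. \<bar>\<Sum>i<n. indicator (A i \<inter> {k..k + 1}) x\<bar> \<le> (indicator {k..k + 1} x :: real)" for n
          by (auto simp: indicator_def)
      qed
    qed
  qed
  show ?thesis
    using g
  proof (induction rule: integrable_induct)
    case (base A a)
    have "averages (\<lambda>x. a * indicator (A \<inter> {k..k + 1}) x)" using set[of A] base by (intro averages_scale) auto
    thus ?case by (simp add: indicator_inter_arith mult_ac)
  next
    case (add g1 g2)
    thus ?case using averages_add[OF add(3,4)] by (simp add: distrib_left)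
  next
    case (lim g s)
    have [measurable]: "g \<in> borel_measurable borel" using lim(4) by auto
    show ?case
    proof (rule averages_dominated[OF lim(5)])
      show "integrable lborel (\<lambda>x. 2 * \<bar>g x\<bar>)" using lim(4) by simp
      show "(\<lambda>x. indicator {k..k + 1} x * g x) \<in> borel_measurable borel" by measurable
      show "AE x in lborel. (\<lambda>n. indicator {k..k + 1} x * s n x) \<longlonglongrightarrow> indicator {k..k + 1} x * g x"
        using lim(2) by (auto intro!: tendsto_intros)
      show "AE x in lborel. \<bar>indicator {k..k + 1} x * s n x\<bar> \<le> 2 * \<bar>g x\<bar>" for n
        using lim(3)[of _ n] by (auto simp: indicator_def)
    qed
  qed
qed

text \<open>Unit intervals with integer ends exhaust the line, and overlap only in the integers, a
  null set; the partial sums are dominated by |g|.\<close>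

theorem averages_all:
  assumes cont: "\<And>g \<delta> k. continuous_on UNIV g \<Longrightarrow> 0 < \<delta> \<Longrightarrow>
      (\<And>x. g x \<noteq> 0 \<Longrightarrow> x \<in> {of_int k + \<delta>..of_int k + 1 - \<delta>}) \<Longrightarrow> averages g"
    and g: "integrable lborel g"
  shows "averages g"
proof -
  have [measurable]: "g \<in> borel_measurable borel" using g by auto
  define S where "S k x = indicator {real_of_int k..real_of_int k + 1} x * g x" for k x
  have S: "averages (S k)" for k unfolding S_def by (rule averages_unit_interval[OF cont g])
  have part: "averages (\<lambda>x. \<Sum>k\<in>{- int n..<int n}. S k x)" for n
  proof (induction n)
    case 0
    show ?case using averages_scale[OF S, of 0] by simp
  next
    case (Suc n)
    have "{- int (Suc n)..<int (Suc n)} = insert (- int n - 1) (insert (int n) {- int n..<int n})" by auto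
    hence "(\<lambda>x. \<Sum>k\<in>{- int (Suc n)..<int (Suc n)}. S k x) = (\<lambda>x. S (- int n - 1) x + (S (int n) x + (\<Sum>k\<in>{- int n..<int n}. S k x)))"
      by (simp add: fun_eq_iff)
    thus ?case using S Suc.IH by (simp only: averages_add)
  qed
  have eq: "(\<Sum>k\<in>{- int n..<int n}. S k x) = (if \<lfloor>x\<rfloor> \<in> {- int n..<int n} then g x else 0)" if "x \<notin> \<int>" for n x
  proof -
    have "S k x = (if \<lfloor>x\<rfloor> = k then g x else 0)" for k
    proof -
      have "x \<noteq> of_int (k + 1)" "x \<noteq> of_int k" using that Ints_of_int by metis+
      hence "x \<noteq> of_int k + 1" "x \<noteq> of_int k" by simp_all
      hence "x \<in> {of_int k..of_int k + 1} \<longleftrightarrow> \<lfloor>x\<rfloor> = k" unfolding floor_eq_iff by auto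
      thus ?thesis by (simp add: S_def indicator_def)
    qed
    thus ?thesis by simp
  qed
  have nonint: "AE x in lborel. x \<notin> (\<int> :: real set)"
  proof (rule AE_not_in)
    have "countable (\<int> :: real set)" unfolding Ints_def by simp
    thus "(\<int> :: real set) \<in> null_sets lborel" by (rule countable_imp_null_set_lborel)
  qed
  show ?thesis
  proof (rule averages_dominated[OF part])
    show "integrable lborel (\<lambda>x. \<bar>g x\<bar>)" using g by simp
    show "AE x in lborel. (\<lambda>n. \<Sum>k\<in>{- int n..<int n}. S k x) \<longlonglongrightarrow> g x"
      using nonint
    proof eventually_elim
      case (elim x)
      have "\<forall>\<^sub>F n in sequentially. (\<Sum>k\<in>{- int n..<int n}. S k x) = g x"
        using eventually_gt_at_top[of "nat \<bar>\<lfloor>x\<rfloor>\<bar>"]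
        by eventually_elim (auto simp: eq[OF elim])
      thus ?case by (rule tendsto_eventually)
    qed
    show "AE x in lborel. \<bar>\<Sum>k\<in>{- int n..<int n}. S k x\<bar> \<le> \<bar>g x\<bar>" for n
      using nonint by eventually_elim (auto simp: eq)
  qed simp
qed

end

lemma Cc_bounded:
  assumes "\<Phi> \<in> Cc S"
  obtains b where "\<And>x. \<bar>\<Phi> x\<bar> \<le> b"
proof -
  obtain C where C: "continuous_on S \<Phi>" "compact C" "C \<subseteq> S" "\<And>x. x \<notin> C \<Longrightarrow> \<Phi> x = 0"
    using assms by (auto simp: Cc_def)
  have "bounded (\<Phi> ` C)"
    by (intro compact_imp_bounded compact_continuous_image continuous_on_subset[OF C(1)] C)
  then obtain b where b: "\<And>x. x \<in> C \<Longrightarrow> \<bar>\<Phi> x\<bar> \<le> b" by (auto simp: bounded_iff)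
  have "\<bar>\<Phi> x\<bar> \<le> max b 0" for x using b[of x] C(4)[of x] by (cases "x \<in> C") auto
  thus ?thesis using that by blast
qed

text \<open>The cutoff index n is fixed first, so that the limits for the cutoffs are good, and only
  then r is made small. For a given r the comparison is pointwise: transfer map with hit sum, then
  hit sum with lower cutoff, the latter at the cost of the error cutoff.\<close>

lemma slope_averages_continuous:
  fixes g :: "real \<Rightarrow> real" and k :: int
  assumes \<Phi>: "\<Phi> \<in> Cc ({0<..} \<times> {-1..1::real})" and h': "\<bar>h'\<bar> \<le> 1" and \<delta>: "0 < \<delta>"
    and g: "continuous_on UNIV g" "\<And>x. g x \<noteq> 0 \<Longrightarrow> x \<in> {of_int k + \<delta>..of_int k + 1 - \<delta>}"
  shows "((\<lambda>r. LINT t|lborel. \<Phi> (transfer_map r h' (slope_direction t)) * g t) \<longlongrightarrow>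
    limit_integral \<Phi> h' * (LINT t|lborel. g t)) (at_right 0)"
proof -
  obtain F s0 S0 b where F: "continuous_on UNIV (\<lambda>(s, h). F s h)" "0 < s0" "s0 < S0"
    "\<And>s h. F s h \<noteq> 0 \<Longrightarrow> s \<in> {s0..S0} \<and> h \<in> {-2..2}"
    "\<And>s h. \<bar>h\<bar> \<le> 1 \<Longrightarrow> F s h = \<Phi> (s, h)" "\<And>s h. \<bar>F s h\<bar> \<le> b"
    using Cc_extension[OF \<Phi>] by blast
  obtain b' where b': "\<And>x. \<bar>\<Phi> x\<bar> \<le> b'" using Cc_bounded[OF \<Phi>] by blast
  define \<gamma> where "\<gamma> \<tau> = g (of_int k + \<tau>)" for \<tau>
  define f where "f r \<tau> = \<Phi> (transfer_map r h' (slope_direction (\<tau> + of_int k)))" for r \<tau>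
  define \<sigma> where "\<sigma> \<tau> = sqrt (1 + (\<tau> + of_int k)\<^sup>2)" for \<tau> :: real
  have \<gamma>: "continuous_on UNIV \<gamma>" "\<And>x. \<gamma> x \<noteq> 0 \<Longrightarrow> x \<in> {\<delta>..1 - \<delta>}"
  proof -
    show "continuous_on UNIV \<gamma>"
      unfolding \<gamma>_def by (intro continuous_on_compose2[OF g(1)] continuous_intros) auto
    show "x \<in> {\<delta>..1 - \<delta>}" if "\<gamma> x \<noteq> 0" for x
      using g(2)[of "of_int k + x"] that by (auto simp: \<gamma>_def)
  qed
  have \<gamma>i: "integrable lborel \<gamma>" by (rule lborel_integral_compact_support(1)[OF \<gamma>])
  have \<sigma>: "continuous_on UNIV \<sigma>" "\<And>x. \<sigma> x \<ge> 1" "\<And>x. x \<in> {0..1} \<Longrightarrow> \<sigma> x \<le> sqrt (1 + (1 + \<bar>of_int k\<bar>)\<^sup>2)"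
  proof -
    show "continuous_on UNIV \<sigma>" unfolding \<sigma>_def by (intro continuous_intros)
    show "\<sigma> x \<ge> 1" for x by (simp add: \<sigma>_def)
    show "\<sigma> x \<le> sqrt (1 + (1 + \<bar>of_int k\<bar>)\<^sup>2)" if "x \<in> {0..1}" for x
    proof -
      have "\<bar>x + of_int k\<bar> \<le> 1 + \<bar>real_of_int k\<bar>" using that by auto
      hence "(x + of_int k)\<^sup>2 \<le> (1 + \<bar>real_of_int k\<bar>)\<^sup>2" by (simp add: abs_le_square_iff[symmetric])
      thus ?thesis by (simp add: \<sigma>_def)
    qed
  qed
  have \<sigma>0: "\<sigma> x \<noteq> 0" for x using \<sigma>(2)[of x] by auto
  define I where "I = (LINT x|lborel. \<bar>\<gamma> x\<bar>)"
  have I0: "I \<ge> 0" unfolding I_def by (rule integral_nonneg_AE) simp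
  have shift: "(LINT t|lborel. G t) = (LINT \<tau>|lborel. G (of_int k + \<tau>))" for G :: "real \<Rightarrow> real"
    using lborel_integral_real_affine[of 1 G "of_int k"] by simp
  have gI: "(LINT t|lborel. g t) = (LINT \<tau>|lborel. \<gamma> \<tau>)" unfolding \<gamma>_def by (rule shift)
  have fI: "(LINT t|lborel. \<Phi> (transfer_map r h' (slope_direction t)) * g t) = (LINT \<tau>|lborel. f r \<tau> * \<gamma> \<tau>)" for r
    unfolding \<gamma>_def f_def by (subst shift) (simp add: add.commute)
  define A where "A n s h y = F s h * lower_cut n h' s h y" for n s h y
  define B where "B n s h y = \<bar>F s h\<bar> * error_cut n h' s h y" for n s h y
  define KA where "KA n = (LINT s|lborel. LINT h|lborel. integral {0..1} (A n s h))" for n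
  define KB where "KB n = (LINT s|lborel. LINT h|lborel. integral {0..1} (B n s h))" for n
  have KA: "(\<lambda>n. 3 / pi\<^sup>2 * KA n) \<longlonglongrightarrow> limit_integral \<Phi> h'"
    using cut_integrals_tendsto(1)[where h' = h', OF F(1,2,4,5,6)] unfolding KA_def A_def .
  have KB: "KB \<longlonglongrightarrow> 0"
    using cut_integrals_tendsto(2)[where h' = h', OF F(1,2,4,5,6)] unfolding KB_def B_def .
  have contF: "continuous_on X (\<lambda>x. F (a1 x) (a2 x))" if "continuous_on X a1" "continuous_on X a2"
    for X :: "'z::topological_space set" and a1 a2
    using continuous_on_compose2[OF F(1) continuous_on_Pair[OF that]] by simp
  have contAB: "continuous_on X (\<lambda>x. A n (a1 x) (a2 x) (a3 x))" "continuous_on X (\<lambda>x. B n (a1 x) (a2 x) (a3 x))"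
    if "continuous_on X a1" "continuous_on X a2" "continuous_on X a3"
    for X :: "'z::topological_space set" and a1 a2 a3 n
    unfolding A_def B_def by (intro continuous_intros contF that)+
  define arg where "arg D r \<tau> q p = D (2 * (r * real q) * \<sigma> \<tau>) (h' + (real q * \<tau> - of_int (fst p)) / r / \<sigma> \<tau>) (of_int (snd p) / real q)"
    for D :: "real \<Rightarrow> real \<Rightarrow> real \<Rightarrow> real" and r \<tau> q and p :: "int \<times> int"
  define SS where "SS D r \<tau> = (\<Sum>q=1..nat \<lfloor>(S0 + 1) / r\<rfloor>. \<Sum>p\<in>unit_pairs q. arg D r \<tau> q p)" for D r \<tau>
  have sumint: "(\<Sum>q=1..nat \<lfloor>(S0 + 1) / r\<rfloor>. \<Sum>p\<in>unit_pairs q. LINT t|lborel. G t * arg D r t q p) = (LINT t|lborel. G t * SS D r t)"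
    "integrable lborel (\<lambda>t. G t * SS D r t)"
    if G: "continuous_on UNIV G" "\<And>x. G x \<noteq> 0 \<Longrightarrow> x \<in> {\<delta>..1 - \<delta>}" and D: "\<And>a1 a2 a3 :: real \<Rightarrow> real. continuous_on UNIV a1 \<Longrightarrow> continuous_on UNIV a2 \<Longrightarrow> continuous_on UNIV a3 \<Longrightarrow> continuous_on UNIV (\<lambda>x. D (a1 x) (a2 x) (a3 x))"
      and r: "r > 0" for G D r
  proof -
    have "continuous_on UNIV (\<lambda>t. G t * arg D r t q p)" for q p
      unfolding arg_def by (intro continuous_intros G D \<sigma>) (use r \<sigma>0 in auto)
    hence int: "integrable lborel (\<lambda>t. G t * arg D r t q p)" for q p
      by (rule lborel_integral_compact_support(1)) (use G(2) in auto)
    show "(\<Sum>q=1..nat \<lfloor>(S0 + 1) / r\<rfloor>. \<Sum>p\<in>unit_pairs q. LINT t|lborel. G t * arg D r t q p) = (LINT t|lborel. G t * SS D r t)"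
      unfolding SS_def by (simp add: int sum_distrib_left)
    show "integrable lborel (\<lambda>t. G t * SS D r t)"
      unfolding SS_def sum_distrib_left by (intro Bochner_Integration.integrable_sum int)
  qed
  have lim: "((\<lambda>r. \<Sum>q=1..nat \<lfloor>(S0 + 1) / r\<rfloor>. \<Sum>p\<in>unit_pairs q. LINT t|lborel. G t * arg D r t q p) \<longlongrightarrow>
      3 / pi\<^sup>2 * (LINT x|lborel. G x) * (LINT s|lborel. LINT h|lborel. integral {0..1} (D s h))) (at_right 0)"
    if "continuous_on UNIV G" "\<And>x. G x \<noteq> 0 \<Longrightarrow> x \<in> {\<delta>..1 - \<delta>}" "continuous_on UNIV (\<lambda>(s, h, y). D s h y)"
      "\<And>s h y. D s h y \<noteq> 0 \<Longrightarrow> F s h \<noteq> 0" "\<And>s h. D s h 0 = D s h 1" for G D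
    unfolding arg_def
  proof (rule lattice_integral_sum_scaled_tendsto[OF that(3) _ F(2,3) that(5,1,2) \<delta> \<sigma> h'])
    note nz = that(4)
    show "s \<in> {s0..S0} \<and> h \<in> {-2..2}" if "D s h y \<noteq> 0" for s h y
      by (rule F(4), rule nz, rule that)
    show "S0 \<le> S0 + 1" by linarith
  qed
  have "((\<lambda>r. LINT \<tau>|lborel. f r \<tau> * \<gamma> \<tau>) \<longlongrightarrow> limit_integral \<Phi> h' * (LINT \<tau>|lborel. \<gamma> \<tau>)) (at_right 0)"
  proof (rule tendsto_approxI)
    fix e :: real assume e: "e > 0"
    \<comment> \<open>Half of e is spent on the hit sum, integrated against |\<gamma>|, and half on
      the error cutoff. I + 1 in place of I keeps the denominator positive when \<gamma>
      vanishes.\<close>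
    define e1 where "e1 = e / (2 * (I + 1))"
    have e1: "e1 > 0" using e I0 by (simp add: e1_def)
    have e1I: "e1 * I \<le> e / 2"
    proof -
      have "e1 * I \<le> e1 * (I + 1)" using e1 by (intro mult_left_mono) auto
      also have "\<dots> = e / 2" using I0 by (simp add: e1_def add_nonneg_eq_0_iff divide_simps)
      finally show ?thesis .
    qed
    have "(\<lambda>n. 3 / pi\<^sup>2 * I * KB n) \<longlonglongrightarrow> 3 / pi\<^sup>2 * I * 0" by (intro tendsto_intros KB)
    hence "\<forall>\<^sub>F n in sequentially. 3 / pi\<^sup>2 * I * KB n < e / 2"
      by (rule order_tendstoD(2)) (use e in simp)
    moreover have "\<forall>\<^sub>F n in sequentially. dist (3 / pi\<^sup>2 * KA n) (limit_integral \<Phi> h') < e / (I + 1)"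
      using e I0 by (intro tendstoD[OF KA]) auto
    ultimately have "\<forall>\<^sub>F n in sequentially. 3 / pi\<^sup>2 * I * KB n < e / 2 \<and> dist (3 / pi\<^sup>2 * KA n) (limit_integral \<Phi> h') < e / (I + 1)"
      by (rule eventually_conj)
    then obtain n where n: "3 / pi\<^sup>2 * I * KB n < e / 2" "dist (3 / pi\<^sup>2 * KA n) (limit_integral \<Phi> h') < e / (I + 1)"
      by (auto simp: eventually_sequentially)
    have contA: "continuous_on UNIV (\<lambda>(s, h, y). A n s h y)" "continuous_on UNIV (\<lambda>(s, h, y). B n s h y)"
      unfolding split_beta by (intro contAB continuous_intros)+
    have ends: "A n s h 0 = A n s h 1" for s h
      by (simp add: A_def lower_cut_def)
    have endsB: "B n s h 0 = B n s h 1" for s h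
      by (simp add: B_def error_cut_def)
    have \<gamma>': "continuous_on UNIV (\<lambda>x. \<bar>\<gamma> x\<bar>)" "\<And>x. \<bar>\<gamma> x\<bar> \<noteq> 0 \<Longrightarrow> x \<in> {\<delta>..1 - \<delta>}"
      using \<gamma> by (auto intro!: continuous_intros)
    have limA: "((\<lambda>r. \<Sum>q=1..nat \<lfloor>(S0 + 1) / r\<rfloor>. \<Sum>p\<in>unit_pairs q. LINT t|lborel. \<gamma> t * arg (A n) r t q p) \<longlongrightarrow>
      3 / pi\<^sup>2 * (LINT x|lborel. \<gamma> x) * KA n) (at_right 0)"
      unfolding KA_def by (rule lim[OF \<gamma> contA(1) _ ends]) (auto simp: A_def)
    have limB: "((\<lambda>r. \<Sum>q=1..nat \<lfloor>(S0 + 1) / r\<rfloor>. \<Sum>p\<in>unit_pairs q. LINT t|lborel. \<bar>\<gamma> t\<bar> * arg (B n) r t q p) \<longlongrightarrow>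
      3 / pi\<^sup>2 * I * KB n) (at_right 0)"
      unfolding KB_def I_def by (rule lim[OF \<gamma>' contA(2) _ endsB]) (auto simp: B_def)
    have evB: "\<forall>\<^sub>F r in at_right 0. (\<Sum>q=1..nat \<lfloor>(S0 + 1) / r\<rfloor>. \<Sum>p\<in>unit_pairs q. LINT t|lborel. \<bar>\<gamma> t\<bar> * arg (B n) r t q p) < e / 2"
      by (rule order_tendstoD(2)[OF limB n(1)])
    have ev1: "\<forall>\<^sub>F r in at_right 0. \<forall>\<tau>\<in>{\<delta>..1 - \<delta>}. (\<exists>p. flight.first_hit r h' (slope_direction (\<tau> + of_int k)) p) \<longrightarrow>
      \<bar>f r \<tau> - (\<Sum>q=1..nat \<lfloor>(S0 + 1) / r\<rfloor>. \<Sum>p\<in>unit_pairs q. hit_term F h' \<sigma> r \<tau> q p)\<bar> \<le> e1"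
      using transfer_map_hit_sum[OF \<Phi> F(1-5) h' \<delta> e1, of k] unfolding f_def \<sigma>_def .
    have evr: "\<forall>\<^sub>F r in at_right (0::real). r < 1 / 2"
      using eventually_at_right_real[of 0 "1 / 2 :: real"] by (auto elim: eventually_mono)
    show "\<exists>h l. (h \<longlongrightarrow> l) (at_right 0) \<and> (\<forall>\<^sub>F r in at_right 0. norm ((LINT \<tau>|lborel. f r \<tau> * \<gamma> \<tau>) - h r) \<le> e) \<and>
        norm (limit_integral \<Phi> h' * (LINT \<tau>|lborel. \<gamma> \<tau>) - l) \<le> e"
    proof (intro exI conjI)
      show "((\<lambda>r. \<Sum>q=1..nat \<lfloor>(S0 + 1) / r\<rfloor>. \<Sum>p\<in>unit_pairs q. LINT t|lborel. \<gamma> t * arg (A n) r t q p) \<longlongrightarrow>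
        3 / pi\<^sup>2 * (LINT x|lborel. \<gamma> x) * KA n) (at_right 0)" by (rule limA)
      have "limit_integral \<Phi> h' * (LINT \<tau>|lborel. \<gamma> \<tau>) - 3 / pi\<^sup>2 * (LINT x|lborel. \<gamma> x) * KA n =
          - ((LINT \<tau>|lborel. \<gamma> \<tau>) * (3 / pi\<^sup>2 * KA n - limit_integral \<Phi> h'))"
        by (simp add: algebra_simps)
      also have "norm \<dots> = \<bar>LINT \<tau>|lborel. \<gamma> \<tau>\<bar> * dist (3 / pi\<^sup>2 * KA n) (limit_integral \<Phi> h')"
        by (simp only: real_norm_def dist_real_def abs_minus_cancel abs_mult)
      also have "\<dots> \<le> (I + 1) * (e / (I + 1))"
      proof (rule mult_mono)
        show "\<bar>LINT \<tau>|lborel. \<gamma> \<tau>\<bar> \<le> I + 1" using integral_abs_bound[of lborel \<gamma>] unfolding I_def by linarith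
      qed (use n(2) I0 in auto)
      also have "\<dots> = e" using I0 by simp
      finally show "norm (limit_integral \<Phi> h' * (LINT \<tau>|lborel. \<gamma> \<tau>) - 3 / pi\<^sup>2 * (LINT x|lborel. \<gamma> x) * KA n) \<le> e" .
      show "\<forall>\<^sub>F r in at_right 0. norm ((LINT \<tau>|lborel. f r \<tau> * \<gamma> \<tau>) -
          (\<Sum>q=1..nat \<lfloor>(S0 + 1) / r\<rfloor>. \<Sum>p\<in>unit_pairs q. LINT t|lborel. \<gamma> t * arg (A n) r t q p)) \<le> e"
        using eventually_at_right_less[of "0::real"] evr ev1 evB
      proof eventually_elim
        case (elim r)
        have r: "r > 0" "r < 1 / 2" using elim by auto
        have sA: "integrable lborel (\<lambda>t. \<gamma> t * SS (A n) r t)" by (rule sumint(2)[OF \<gamma> contAB(1) r(1)])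
        have sB: "integrable lborel (\<lambda>t. \<bar>\<gamma> t\<bar> * SS (B n) r t)" by (rule sumint(2)[OF \<gamma>' contAB(2) r(1)])
        have sumA: "(\<Sum>q=1..nat \<lfloor>(S0 + 1) / r\<rfloor>. \<Sum>p\<in>unit_pairs q. LINT t|lborel. \<gamma> t * arg (A n) r t q p) = (LINT t|lborel. \<gamma> t * SS (A n) r t)"
          by (rule sumint(1)[OF \<gamma> contAB(1) r(1)])
        have sumB: "(\<Sum>q=1..nat \<lfloor>(S0 + 1) / r\<rfloor>. \<Sum>p\<in>unit_pairs q. LINT t|lborel. \<bar>\<gamma> t\<bar> * arg (B n) r t q p) = (LINT t|lborel. \<bar>\<gamma> t\<bar> * SS (B n) r t)"
          by (rule sumint(1)[OF \<gamma>' contAB(2) r(1)])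
        have mf: "f r \<in> borel_measurable borel"
          unfolding f_def by (rule measurable_compose[OF _ transfer_map_slope_measurable[OF \<Phi> r h']]) measurable
        have fi: "integrable lborel (\<lambda>t. f r t * \<gamma> t)"
        proof (rule Bochner_Integration.integrable_bound)
          show "integrable lborel (\<lambda>x. b' * \<gamma> x)" using \<gamma>i by simp
          show "(\<lambda>t. f r t * \<gamma> t) \<in> borel_measurable lborel" using mf \<gamma>i by auto
          have "\<bar>f r x\<bar> \<le> \<bar>b'\<bar>" for x unfolding f_def by (rule order_trans[OF b' abs_ge_self])
          thus "AE x in lborel. norm (f r x * \<gamma> x) \<le> norm (b' * \<gamma> x)"
            by (auto simp: abs_mult intro!: mult_right_mono)
        qed
        \<comment> \<open>Irrationality of the slope guarantees a first hit; the excluded t form a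
          null set.\<close>
        have pt: "\<bar>f r t * \<gamma> t - \<gamma> t * SS (A n) r t\<bar> \<le> e1 * \<bar>\<gamma> t\<bar> + \<bar>\<gamma> t\<bar> * SS (B n) r t" if t: "t \<notin> \<rat>" for t
        proof (cases "\<gamma> t = 0")
          case False
          hence td: "t \<in> {\<delta>..1 - \<delta>}" using \<gamma>(2) by blast
          have "t + of_int k \<notin> \<rat>"
          proof
            assume "t + of_int k \<in> \<rat>"
            hence "(t + of_int k) - of_int k \<in> \<rat>" by (intro Rats_diff) auto
            thus False using t by simp
          qed
          hence "\<exists>p. flight.first_hit r h' (slope_direction (t + of_int k)) p"
            by (intro first_hit_exists_direction r h' norm_slope_direction slope_direction_exceptional)
          hence 1: "\<bar>f r t - (\<Sum>q=1..nat \<lfloor>(S0 + 1) / r\<rfloor>. \<Sum>p\<in>unit_pairs q. hit_term F h' \<sigma> r t q p)\<bar> \<le> e1"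
            using elim td by blast
          have "\<bar>hit_term F h' \<sigma> r t q p - arg (A n) r t q p\<bar> \<le> arg (B n) r t q p"
            if q: "q \<in> {1..nat \<lfloor>(S0 + 1) / r\<rfloor>}" "p \<in> unit_pairs q" for q p
          proof -
            define s h y where "s = 2 * (r * real q) * \<sigma> t" and "h = h' + (real q * t - of_int (fst p)) / r / \<sigma> t"
              and "y = of_int (snd p) / real q"
            have z: "0 \<le> snd p" "snd p < int q" using q(2) by (auto simp: unit_pairs_def)
            hence "real_of_int (snd p) < real q" by linarith
            hence y: "0 \<le> y" "y < 1" using z by (auto simp: y_def)
            define c where "c = (if 0 < y \<and> \<bar>h\<bar> \<le> 1 \<and> column_cond h' s h y then 1 else 0 :: real)"
            have "hit_term F h' \<sigma> r t q p - arg (A n) r t q p = F s h * (c - lower_cut n h' s h y)"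
              unfolding hit_term_def arg_def A_def Let_def s_def[symmetric] h_def[symmetric] y_def[symmetric] c_def[symmetric]
              by (simp add: algebra_simps)
            also have "\<bar>\<dots>\<bar> \<le> \<bar>F s h\<bar> * error_cut n h' s h y"
              unfolding abs_mult c_def by (intro mult_left_mono lower_cut_error y) auto
            also have "\<dots> = arg (B n) r t q p" by (simp add: arg_def B_def s_def h_def y_def)
            finally show ?thesis .
          qed
          hence "\<bar>(\<Sum>q=1..nat \<lfloor>(S0 + 1) / r\<rfloor>. \<Sum>p\<in>unit_pairs q. hit_term F h' \<sigma> r t q p) - SS (A n) r t\<bar> \<le> SS (B n) r t"
            unfolding SS_def sum_subtractf[symmetric]
            by (intro order_trans[OF sum_abs] sum_mono order_trans[OF sum_abs])
          with 1 have "\<bar>f r t - SS (A n) r t\<bar> \<le> e1 + SS (B n) r t" by linarith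
          hence "\<bar>\<gamma> t\<bar> * \<bar>f r t - SS (A n) r t\<bar> \<le> \<bar>\<gamma> t\<bar> * (e1 + SS (B n) r t)" by (intro mult_left_mono) auto
          moreover have "\<bar>f r t * \<gamma> t - \<gamma> t * SS (A n) r t\<bar> = \<bar>\<gamma> t\<bar> * \<bar>f r t - SS (A n) r t\<bar>"
            unfolding abs_mult[symmetric] by (simp add: right_diff_distrib mult.commute)
          moreover have "\<bar>\<gamma> t\<bar> * (e1 + SS (B n) r t) = e1 * \<bar>\<gamma> t\<bar> + \<bar>\<gamma> t\<bar> * SS (B n) r t"
            by (simp add: distrib_left)
          ultimately show ?thesis by linarith
        qed simp
        have irr: "AE t in lborel. t \<notin> (\<rat> :: real set)"
          by (intro AE_not_in countable_imp_null_set_lborel countable_rat)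
        have diff: "(LINT \<tau>|lborel. f r \<tau> * \<gamma> \<tau>) - (\<Sum>q=1..nat \<lfloor>(S0 + 1) / r\<rfloor>. \<Sum>p\<in>unit_pairs q. LINT t|lborel. \<gamma> t * arg (A n) r t q p)
            = (LINT t|lborel. f r t * \<gamma> t - \<gamma> t * SS (A n) r t)"
          unfolding sumA using fi sA by simp
        have "\<bar>LINT t|lborel. f r t * \<gamma> t - \<gamma> t * SS (A n) r t\<bar> \<le> (LINT t|lborel. \<bar>f r t * \<gamma> t - \<gamma> t * SS (A n) r t\<bar>)" by (rule integral_abs_bound)
        also have "\<dots> \<le> (LINT t|lborel. e1 * \<bar>\<gamma> t\<bar> + \<bar>\<gamma> t\<bar> * SS (B n) r t)"
        proof (rule integral_mono_AE)
          show "AE t in lborel. \<bar>f r t * \<gamma> t - \<gamma> t * SS (A n) r t\<bar> \<le> e1 * \<bar>\<gamma> t\<bar> + \<bar>\<gamma> t\<bar> * SS (B n) r t"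
            using irr by eventually_elim (rule pt)
        qed (use fi sA sB \<gamma>i in auto)
        also have "\<dots> = e1 * I + (LINT t|lborel. \<bar>\<gamma> t\<bar> * SS (B n) r t)" using sB \<gamma>i by (simp add: I_def)
        also have "\<dots> \<le> e" using e1I elim(4) unfolding sumB by linarith
        finally show ?case unfolding diff real_norm_def .
      qed
    qed
  qed
  thus ?thesis unfolding fI gI .
qed

text \<open>The angle is \<theta> = a + arctan t with Jacobian 1 / (1 + t^2). The change of
  variables is made for Lebesgue measure and carried back to Borel functions.\<close>

lemma integral_arctan_substitution:
  fixes H :: "real \<Rightarrow> real"
  assumes H: "integrable lborel H"
  shows "integrable lborel (\<lambda>t. H (a + arctan t) / (1 + t\<^sup>2))"
    and "(LINT t|lborel. H (a + arctan t) / (1 + t\<^sup>2)) = (LINT \<theta>:{a - pi / 2<..<a + pi / 2}|lborel. H \<theta>)"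
proof -
  have [measurable]: "H \<in> borel_measurable borel" using H by auto
  define g where "g t = a + arctan t" for t
  have rg: "range g = {a - pi / 2<..<a + pi / 2}"
  proof (rule subset_antisym)
    show "range g \<subseteq> {a - pi / 2<..<a + pi / 2}"
    proof (rule image_subsetI)
      fix x show "g x \<in> {a - pi / 2<..<a + pi / 2}"
        using arctan_lbound[of x] arctan_ubound[of x] by (simp add: g_def)
    qed
    show "{a - pi / 2<..<a + pi / 2} \<subseteq> range g"
    proof
      fix y assume y: "y \<in> {a - pi / 2<..<a + pi / 2}"
      have "y = g (tan (y - a))" using arctan_tan[of "y - a"] y by (simp add: g_def)
      thus "y \<in> range g" by blast
    qed
  qed
  have SH: "set_integrable lborel (range g) H"
    unfolding rg set_integrable_def using H by (intro integrable_mult_indicator) auto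
  hence "set_integrable lebesgue (range g) H"
    unfolding set_integrable_def rg by (subst integrable_completion) auto
  moreover have "((\<lambda>t. \<bar>inverse (1 + t\<^sup>2)\<bar> * H (g t)) absolutely_integrable_on UNIV \<and>
      integral UNIV (\<lambda>t. \<bar>inverse (1 + t\<^sup>2)\<bar> * H (g t)) = integral (range g) H) \<longleftrightarrow>
      (H absolutely_integrable_on range g \<and> integral (range g) H = integral (range g) H)"
  proof (rule has_absolute_integral_change_of_variables_1')
    show "(g has_field_derivative inverse (1 + x\<^sup>2)) (at x within UNIV)" for x
      unfolding g_def by (auto intro!: derivative_eq_intros)
    show "inj_on g UNIV" by (auto simp: g_def inj_on_def arctan_eq_iff)
  qed simp
  ultimately have sub: "(\<lambda>t. \<bar>inverse (1 + t\<^sup>2)\<bar> * H (g t)) absolutely_integrable_on UNIV"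
    "integral UNIV (\<lambda>t. \<bar>inverse (1 + t\<^sup>2)\<bar> * H (g t)) = integral (range g) H" by auto
  have eq: "(\<lambda>t. \<bar>inverse (1 + t\<^sup>2)\<bar> * H (g t)) = (\<lambda>t. H (a + arctan t) / (1 + t\<^sup>2))"
    by (auto simp: g_def fun_eq_iff divide_inverse abs_of_nonneg)
  have "integrable lebesgue (\<lambda>t. H (a + arctan t) / (1 + t\<^sup>2))"
    using sub(1) unfolding eq set_integrable_def by simp
  thus int: "integrable lborel (\<lambda>t. H (a + arctan t) / (1 + t\<^sup>2))"
    by (subst (asm) integrable_completion) auto
  show "(LINT t|lborel. H (a + arctan t) / (1 + t\<^sup>2)) = (LINT \<theta>:{a - pi / 2<..<a + pi / 2}|lborel. H \<theta>)"
    using sub(2) set_borel_integral_eq_integral(2)[OF SH] integral_lborel[OF int] unfolding eq rg by simp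
qed

lemma cis_measurable_circle:
  "cis \<in> measurable (restrict_space lborel {0..<2 * pi}) (restrict_space borel (sphere 0 1))"
proof (rule measurable_restrict_space1, rule measurable_restrict_space2)
  have "continuous_on UNIV cis" by (intro continuous_intros)
  thus "cis \<in> borel_measurable lborel" using borel_measurable_continuous_onI by auto
qed auto

lemma borel_measurable_arc_length_measure:
  "borel_measurable arc_length_measure = borel_measurable (restrict_space borel (sphere (0 :: complex) 1))"
  by (rule measurable_cong_sets) (simp_all add: arc_length_measure_def)

lemma arc_length_integral:
  fixes v :: "complex \<Rightarrow> real"
  assumes v: "integrable arc_length_measure v"
  shows "integrable lborel (\<lambda>\<theta>. indicator {0..<2 * pi} \<theta> * v (cis \<theta>))"
    and "(LINT \<omega>|arc_length_measure. v \<omega>) = (LINT \<theta>|lborel. indicator {0..<2 * pi} \<theta> * v (cis \<theta>))"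
proof -
  have m: "v \<in> borel_measurable (restrict_space borel (sphere 0 1))"
    using v borel_measurable_integrable borel_measurable_arc_length_measure by blast
  have "integrable (restrict_space lborel {0..<2 * pi}) (\<lambda>\<theta>. v (cis \<theta>))"
    using v unfolding arc_length_measure_def integrable_distr_eq[OF cis_measurable_circle m] .
  thus "integrable lborel (\<lambda>\<theta>. indicator {0..<2 * pi} \<theta> * v (cis \<theta>))"
    by (subst (asm) integrable_restrict_space) auto
  show "(LINT \<omega>|arc_length_measure. v \<omega>) = (LINT \<theta>|lborel. indicator {0..<2 * pi} \<theta> * v (cis \<theta>))"
    unfolding arc_length_measure_def integral_distr[OF cis_measurable_circle m]
    by (subst integral_restrict_space) auto
qed

lemma cis_pi_arctan:
  "cis (real j * pi + arctan t) = slope_direction t \<or> cis (real j * pi + arctan t) = - slope_direction t"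
proof -
  have "cis (arctan t) = slope_direction t"
    by (simp add: complex_eq_iff Re_Im_slope_direction cos_arctan sin_arctan)
  moreover have "cis (real j * pi + arctan t) = cis (real j * pi) * cis (arctan t)" by (simp add: cis_mult)
  moreover have "cis (real j * pi) = (- 1) ^ j"
  proof (induction j)
    case (Suc j)
    have "real (Suc j) * pi = pi + real j * pi" by (simp add: distrib_right)
    hence "cis (real (Suc j) * pi) = cis pi * cis (real j * pi)" by (simp only: cis_mult)
    thus ?case using Suc by simp
  qed simp
  ultimately show ?thesis by (cases "even j") auto
qed

text \<open>The slope parametrises half turns centred at multiples of pi. Those around 0, pi and 2
  pi cover [0, 2 pi) except for two points; the indicator discards the outer halves of the first and
  the last.\<close>

lemma arc_length_integral_slopes:
  fixes v :: "complex \<Rightarrow> real"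
  assumes v: "integrable arc_length_measure v"
  shows "integrable lborel (\<lambda>t. indicator {0..<2 * pi} (real j * pi + arctan t) / (1 + t\<^sup>2) * v (cis (real j * pi + arctan t)))"
    and "(LINT \<omega>|arc_length_measure. v \<omega>) =
      (\<Sum>j<3. LINT t|lborel. indicator {0..<2 * pi} (real j * pi + arctan t) / (1 + t\<^sup>2) * v (cis (real j * pi + arctan t)))"
proof -
  define H where "H \<theta> = indicator {0..<2 * pi} \<theta> * v (cis \<theta>)" for \<theta>
  have H: "integrable lborel H" unfolding H_def by (rule arc_length_integral[OF v])
  have eq: "indicator {0..<2 * pi} (real j * pi + arctan t) / (1 + t\<^sup>2) * v (cis (real j * pi + arctan t)) = H (real j * pi + arctan t) / (1 + t\<^sup>2)"
    for j t by (simp add: H_def)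
  show "integrable lborel (\<lambda>t. indicator {0..<2 * pi} (real j * pi + arctan t) / (1 + t\<^sup>2) * v (cis (real j * pi + arctan t)))"
    unfolding eq by (rule integral_arctan_substitution(1)[OF H])
  define S where "S j = {real j * pi - pi / 2<..<real j * pi + pi / 2}" for j
  have int: "integrable lborel (\<lambda>\<theta>. indicator (S j) \<theta> * H \<theta>)" for j
    using integrable_mult_indicator[OF _ H, of "S j"] by (simp add: S_def)
  have "(LINT \<omega>|arc_length_measure. v \<omega>) = (LINT \<theta>|lborel. H \<theta>)"
    unfolding H_def by (rule arc_length_integral(2)[OF v])
  also have "\<dots> = (LINT \<theta>|lborel. (\<Sum>j<3. indicator (S j) \<theta> * H \<theta>))"
  proof (rule integral_cong_AE)
    show "H \<in> borel_measurable lborel" using H by (rule borel_measurable_integrable)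
    show "(\<lambda>\<theta>. \<Sum>j<3. indicator (S j) \<theta> * H \<theta>) \<in> borel_measurable lborel"
      by (intro borel_measurable_sum borel_measurable_integrable int)
    have "AE \<theta> in lborel. \<theta> \<noteq> pi / 2" "AE \<theta> in lborel. \<theta> \<noteq> 3 * pi / 2"
      by (rule AE_lborel_singleton)+
    thus "AE \<theta> in lborel. H \<theta> = (\<Sum>j<3. indicator (S j) \<theta> * H \<theta>)"
    proof eventually_elim
      case (elim \<theta>)
      show ?case
      proof (cases "\<theta> \<in> {0..<2 * pi}")
        case True
        have "(\<Sum>j<3. indicator (S j) \<theta> :: real) = indicator (S 0) \<theta> + indicator (S 1) \<theta> + indicator (S 2) \<theta>"
          by (simp add: numeral_3_eq_3 numeral_2_eq_2)
        also have "\<dots> = 1" using True elim pi_gt_zero by (auto simp: S_def indicator_def)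
        finally show ?thesis by (simp flip: sum_distrib_right)
      qed (simp add: H_def)
    qed
  qed
  also have "\<dots> = (\<Sum>j<3. LINT \<theta>|lborel. indicator (S j) \<theta> * H \<theta>)"
    by (rule Bochner_Integration.integral_sum) (rule int)
  also have "\<dots> = (\<Sum>j<3. LINT t|lborel. H (real j * pi + arctan t) / (1 + t\<^sup>2))"
    unfolding integral_arctan_substitution(2)[OF H] by (simp add: set_lebesgue_integral_def S_def)
  finally show "(LINT \<omega>|arc_length_measure. v \<omega>) =
      (\<Sum>j<3. LINT t|lborel. indicator {0..<2 * pi} (real j * pi + arctan t) / (1 + t\<^sup>2) * v (cis (real j * pi + arctan t)))"
    unfolding eq .
qed

text \<open>A density on the circle becomes three integrable functions of the slope. On each of the
  three arcs the transfer map is the same function of the slope for irrational slopes, by central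
  symmetry, so one averaging statement covers them all.\<close>

lemma transfer_map_circle_averages:
  assumes \<Phi>: "\<Phi> \<in> Cc ({0<..} \<times> {-1..1::real})" and h': "\<bar>h'\<bar> \<le> 1" and g: "integrable arc_length_measure g"
  shows "((\<lambda>r. LINT \<omega>|arc_length_measure. \<Phi> (transfer_map r h' \<omega>) * g \<omega>) \<longlongrightarrow>
    limit_integral \<Phi> h' * (LINT \<omega>|arc_length_measure. g \<omega>)) (at_right 0)"
proof -
  obtain b where b: "\<And>x. \<bar>\<Phi> x\<bar> \<le> b" using Cc_bounded[OF \<Phi>] by blast
  have evr: "\<forall>\<^sub>F r in at_right (0::real). 0 < r \<and> r < 1 / 2"
    using eventually_at_right_real[of 0 "1 / 2 :: real"] by (auto elim: eventually_mono)
  interpret averaging "\<lambda>r t. \<Phi> (transfer_map r h' (slope_direction t))" "limit_integral \<Phi> h'" b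
  proof
    show "\<forall>\<^sub>F r in at_right 0. (\<lambda>t. \<Phi> (transfer_map r h' (slope_direction t))) \<in> borel_measurable borel"
      using evr by eventually_elim (auto intro: transfer_map_slope_measurable[OF \<Phi> _ _ h'])
  qed (rule b)
  define G where "G j t = indicator {0..<2 * pi} (real j * pi + arctan t) / (1 + t\<^sup>2) * g (cis (real j * pi + arctan t))" for j t
  have Gi: "integrable lborel (G j)" for j unfolding G_def by (rule arc_length_integral_slopes[OF g])
  have "averages (G j)" for j
  proof (rule averages_all[OF _ Gi])
    fix u :: "real \<Rightarrow> real" and \<delta> :: real and k :: int
    assume u: "continuous_on UNIV u" "0 < \<delta>" "\<And>x. u x \<noteq> 0 \<Longrightarrow> x \<in> {of_int k + \<delta>..of_int k + 1 - \<delta>}"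
    show "averages u"
      unfolding averages_def
      using lborel_integral_compact_support(1)[OF u(1,3)] slope_averages_continuous[OF \<Phi> h' u(2,1,3)] by blast
  qed
  hence "((\<lambda>r. \<Sum>j<3. LINT t|lborel. \<Phi> (transfer_map r h' (slope_direction t)) * G j t) \<longlongrightarrow>
      (\<Sum>j<3. limit_integral \<Phi> h' * (LINT t|lborel. G j t))) (at_right 0)"
    by (intro tendsto_sum) (auto simp: averages_def)
  also have "(\<Sum>j<3. limit_integral \<Phi> h' * (LINT t|lborel. G j t)) = limit_integral \<Phi> h' * (LINT \<omega>|arc_length_measure. g \<omega>)"
    unfolding arc_length_integral_slopes(2)[OF g] G_def sum_distrib_left ..
  finally show ?thesis
  proof (rule Lim_transform_eventually)
    show "\<forall>\<^sub>F r in at_right 0. (\<Sum>j<3. LINT t|lborel. \<Phi> (transfer_map r h' (slope_direction t)) * G j t) =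
        (LINT \<omega>|arc_length_measure. \<Phi> (transfer_map r h' \<omega>) * g \<omega>)"
      using evr
    proof eventually_elim
      case (elim r)
      hence r: "0 < r" "r < 1 / 2" by auto
      have mF: "(\<lambda>\<omega>. \<Phi> (transfer_map r h' \<omega>)) \<in> borel_measurable arc_length_measure"
        unfolding borel_measurable_arc_length_measure by (rule transfer_map_measurable[OF \<Phi> r h'])
      have v: "integrable arc_length_measure (\<lambda>\<omega>. \<Phi> (transfer_map r h' \<omega>) * g \<omega>)"
      proof (rule Bochner_Integration.integrable_bound)
        show "integrable arc_length_measure (\<lambda>\<omega>. b * g \<omega>)" using g by simp
        show "(\<lambda>\<omega>. \<Phi> (transfer_map r h' \<omega>) * g \<omega>) \<in> borel_measurable arc_length_measure"
          using mF g by auto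
        show "AE \<omega> in arc_length_measure. norm (\<Phi> (transfer_map r h' \<omega>) * g \<omega>) \<le> norm (b * g \<omega>)"
          unfolding real_norm_def abs_mult abs_of_nonneg[OF b_nonneg] by (intro AE_I2 mult_right_mono b abs_ge_zero)
      qed
      have irr: "AE t in lborel. t \<notin> (\<rat> :: real set)"
        by (intro AE_not_in countable_imp_null_set_lborel countable_rat)
      show ?case
        unfolding arc_length_integral_slopes(2)[OF v]
      proof (rule sum.cong[OF refl], rule integral_cong_AE)
        fix j :: nat
        show "(\<lambda>t. \<Phi> (transfer_map r h' (slope_direction t)) * G j t) \<in> borel_measurable lborel"
          using transfer_map_slope_measurable[OF \<Phi> r h'] Gi[of j] by auto
        show "(\<lambda>t. indicator {0..<2 * pi} (real j * pi + arctan t) / (1 + t\<^sup>2) *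
            (\<Phi> (transfer_map r h' (cis (real j * pi + arctan t))) * g (cis (real j * pi + arctan t)))) \<in> borel_measurable lborel"
          using arc_length_integral_slopes(1)[OF v, of j] by (rule borel_measurable_integrable)
        show "AE t in lborel. \<Phi> (transfer_map r h' (slope_direction t)) * G j t =
            indicator {0..<2 * pi} (real j * pi + arctan t) / (1 + t\<^sup>2) *
            (\<Phi> (transfer_map r h' (cis (real j * pi + arctan t))) * g (cis (real j * pi + arctan t)))"
          using irr
        proof eventually_elim
          case (elim t)
          have "transfer_map r h' (- slope_direction t) = transfer_map r h' (slope_direction t)"
            using elim by (intro transfer_map_minus r h' norm_slope_direction slope_direction_exceptional)
          hence "transfer_map r h' (cis (real j * pi + arctan t)) = transfer_map r h' (slope_direction t)"
            using cis_pi_arctan[of j t] by auto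
          thus ?case by (simp add: G_def)
        qed
      qed
    qed
  qed
qed

theorem theorem3p1:
  shows "\<exists>P :: real \<Rightarrow> real \<Rightarrow> real \<Rightarrow> real.
    transition_density P \<and>
    (\<forall>\<Phi>\<in>Cc ({0<..} \<times> {-1..1}). \<forall>h'\<in>{-1..1}.
       weak_star_tendsto arc_length_measure
         (\<lambda>r \<omega>. \<Phi> (transfer_map r h' \<omega>))
         (\<lambda>\<omega>. LINT s:{0<..}|lborel. (LINT h:{-1..1}|lborel. \<Phi> (s, h) * P s h h'))
         (at_right 0)) \<and>
    piecewise_continuous_on ({0..} \<times> {-1..1} \<times> {-1..1}) (\<lambda>(s, h, h'). (1 + s) * P s h h') \<and>
    bounded ((\<lambda>(s, h, h'). (1 + s) * P s h h') ` ({0..} \<times> {-1..1} \<times> {-1..1})) \<and>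
    (\<forall>s\<ge>0. \<forall>h\<in>{-1..1}. \<forall>h'\<in>{-1..1}. P s h h' = P s (- h) (- h'))"
proof (intro exI conjI)
  show "transition_density transition_kernel" by (rule transition_density_transition_kernel)
  show "\<forall>\<Phi>\<in>Cc ({0<..} \<times> {-1..1}). \<forall>h'\<in>{-1..1}.
       weak_star_tendsto arc_length_measure
         (\<lambda>r \<omega>. \<Phi> (transfer_map r h' \<omega>))
         (\<lambda>\<omega>. LINT s:{0<..}|lborel. (LINT h:{-1..1}|lborel. \<Phi> (s, h) * transition_kernel s h h'))
         (at_right 0)"
  proof (intro ballI)
    fix \<Phi> :: "real \<times> real \<Rightarrow> real" and h' :: real
    assume \<Phi>: "\<Phi> \<in> Cc ({0<..} \<times> {-1..1})" and "h' \<in> {-1..1}"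
    hence h': "\<bar>h'\<bar> \<le> 1" by auto
    obtain b where b: "\<And>x. \<bar>\<Phi> x\<bar> \<le> b" using Cc_bounded[OF \<Phi>] by blast
    have evr: "\<forall>\<^sub>F r in at_right (0::real). 0 < r \<and> r < 1 / 2"
      using eventually_at_right_real[of 0 "1 / 2 :: real"] by (auto elim: eventually_mono)
    show "weak_star_tendsto arc_length_measure
         (\<lambda>r \<omega>. \<Phi> (transfer_map r h' \<omega>))
         (\<lambda>\<omega>. LINT s:{0<..}|lborel. (LINT h:{-1..1}|lborel. \<Phi> (s, h) * transition_kernel s h h'))
         (at_right 0)"
      unfolding weak_star_tendsto_def limit_integral_def[symmetric]
    proof (intro conjI allI impI)
      show "\<forall>\<^sub>F r in at_right 0. (\<lambda>\<omega>. \<Phi> (transfer_map r h' \<omega>)) \<in> Linfty arc_length_measure"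
        using evr
      proof eventually_elim
        case (elim r)
        have "(\<lambda>\<omega>. \<Phi> (transfer_map r h' \<omega>)) \<in> borel_measurable arc_length_measure"
          unfolding borel_measurable_arc_length_measure by (rule transfer_map_measurable[OF \<Phi> _ _ h']) (use elim in auto)
        moreover have "AE \<omega> in arc_length_measure. \<bar>\<Phi> (transfer_map r h' \<omega>)\<bar> \<le> b" by (intro AE_I2 b)
        ultimately show ?case unfolding Linfty_def by blast
      qed
      show "(\<lambda>\<omega>. limit_integral \<Phi> h') \<in> Linfty arc_length_measure" by (auto simp: Linfty_def)
      fix g :: "complex \<Rightarrow> real" assume "integrable arc_length_measure g"
      thus "((\<lambda>r. LINT \<omega>|arc_length_measure. \<Phi> (transfer_map r h' \<omega>) * g \<omega>) \<longlongrightarrow>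
          (LINT \<omega>|arc_length_measure. limit_integral \<Phi> h' * g \<omega>)) (at_right 0)"
        using transfer_map_circle_averages[OF \<Phi> h'] by simp
    qed
  qed
  show "piecewise_continuous_on ({0..} \<times> {-1..1} \<times> {-1..1}) (\<lambda>(s, h, h'). (1 + s) * transition_kernel s h h')"
    by (rule transition_kernel_piecewise_continuous)
  show "bounded ((\<lambda>(s, h, h'). (1 + s) * transition_kernel s h h') ` ({0..} \<times> {-1..1} \<times> {-1..1}))"
    by (rule transition_kernel_bounded)
  show "\<forall>s\<ge>0. \<forall>h\<in>{-1..1}. \<forall>h'\<in>{-1..1}. transition_kernel s h h' = transition_kernel s (- h) (- h')"
    by (intro allI ballI impI) (rule transition_kernel_minus)
qed

end
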